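(* If there is an algorithm solving $\mathsf{MAX}\text{-}\mathsf{SAT}$ on $n$ variables and $m$ clauses in time $2^{n-\Omega(n/\log m)}$, then $\mathsf{E}^{\mathsf{NP}}$ does not have $2^{o(\sqrt{n})}$-size $\mathsf{SYM}\circ\mathsf{AND}$ circuits.
   Context: $\mathsf{MAX}\text{-}\mathsf{SAT}$: given a CNF formula, find the maximum number of simultaneously satisfiable clauses. A $\mathsf{SYM}\circ\mathsf{AND}$ circuit has a symmetric output gate (computing $f(\sum_i z_i)$ for arbitrary $f$) over unbounded fan-in AND gates of input literals. $\mathsf{E}^{\mathsf{NP}}$: languages decidable in time $2^{O(n)}$ with an $\mathsf{NP}$ oracle; "$\mathsf{E}^{\mathsf{NP}}$ does not have $s(n)$-size $\mathcal{C}$ circuits" means some $f\in\mathsf{E}^{\mathsf{NP}}$ has, for infinitely many $n$, no $\mathcal{C}$ circuit of size $s(n)$ on inputs of length $n$. *)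

theory Defs
  imports Complex_Main "HOL-Library.Landau_Symbols" "HOL-Library.Log_Nat"
begin

section \<open>Random access machines with logarithmic cost and an oracle\<close>

text \<open>
  Registers are indexed by natural numbers, hold natural numbers and are initially 0. The input is
  a read-only bit string with random access. \<open>Append\<close> extends the pending query string by one bit;
  \<open>Query\<close> submits it to the oracle and resets it. A run ends when the program counter leaves the
  program, and its result is the content of register 0.
\<close>

datatype instr =
    Const nat nat
  | Add nat nat nat
  | Sub nat nat nat
  | Load nat nat
  | Store nat nat
  | Read nat nat
  | Append nat
  | Query nat
  | JumpZero nat nat

type_synonym ram = "instr list"

type_synonym bits = "bool list"

type_synonym config = "nat \<times> (nat \<Rightarrow> nat) \<times> bits"

fun step_instr :: "bits set \<Rightarrow> bits \<Rightarrow> instr \<Rightarrow> config \<Rightarrow> config" where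
  "step_instr A x (Const r k) (pc, M, q) = (Suc pc, M(r := k), q)"
| "step_instr A x (Add r s t) (pc, M, q) = (Suc pc, M(r := M s + M t), q)"
| "step_instr A x (Sub r s t) (pc, M, q) = (Suc pc, M(r := M s - M t), q)"
| "step_instr A x (Load r s) (pc, M, q) = (Suc pc, M(r := M (M s)), q)"
| "step_instr A x (Store r s) (pc, M, q) = (Suc pc, M(M r := M s), q)"
| "step_instr A x (Read r s) (pc, M, q) =
     (Suc pc, M(r := (if M s < length x then of_bool (x ! M s) else 2)), q)"
| "step_instr A x (Append s) (pc, M, q) = (Suc pc, M, q @ [M s \<noteq> 0])"
| "step_instr A x (Query r) (pc, M, q) = (Suc pc, M(r := of_bool (q \<in> A)), [])"
| "step_instr A x (JumpZero r l) (pc, M, q) = (if M r = 0 then l else Suc pc, M, q)"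

definition bit_cost :: "nat \<Rightarrow> nat" where
  "bit_cost n = max 1 (floorlog 2 n)"

fun cost_instr :: "instr \<Rightarrow> (nat \<Rightarrow> nat) \<Rightarrow> nat" where
  "cost_instr (Const r k) M = bit_cost k"
| "cost_instr (Add r s t) M = bit_cost (M s) + bit_cost (M t)"
| "cost_instr (Sub r s t) M = bit_cost (M s) + bit_cost (M t)"
| "cost_instr (Load r s) M = bit_cost (M s) + bit_cost (M (M s))"
| "cost_instr (Store r s) M = bit_cost (M r) + bit_cost (M s)"
| "cost_instr (Read r s) M = bit_cost (M s)"
| "cost_instr (Append s) M = bit_cost (M s)"
| "cost_instr (Query r) M = 1"
| "cost_instr (JumpZero r l) M = bit_cost (M r)"

text \<open>\<open>exec P A x c v t\<close>: with oracle \<open>A\<close> and input \<open>x\<close>, program \<open>P\<close> started in configuration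
  \<open>c\<close> halts with result \<open>v\<close> after total cost \<open>t\<close>.\<close>

inductive exec :: "ram \<Rightarrow> bits set \<Rightarrow> bits \<Rightarrow> config \<Rightarrow> nat \<Rightarrow> nat \<Rightarrow> bool"
  for P :: ram and A :: "bits set" and x :: bits where
  halt: "length P \<le> pc \<Longrightarrow> exec P A x (pc, M, q) (M 0) 0"
| step: "pc < length P \<Longrightarrow> exec P A x (step_instr A x (P ! pc) (pc, M, q)) v t \<Longrightarrow>
    exec P A x (pc, M, q) v (cost_instr (P ! pc) M + t)"

definition computes_in :: "ram \<Rightarrow> bits set \<Rightarrow> bits \<Rightarrow> nat \<Rightarrow> nat \<Rightarrow> bool" where
  "computes_in P A x v t \<longleftrightarrow> exec P A x (0, (\<lambda>_. 0), []) v t"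


section \<open>The classes P, NP and E with an NP oracle\<close>

definition decides_in_time :: "ram \<Rightarrow> bits set \<Rightarrow> bits set \<Rightarrow> (nat \<Rightarrow> real) \<Rightarrow> bool" where
  "decides_in_time P A L T \<longleftrightarrow>
     (\<forall>x. \<exists>t. computes_in P A x (of_bool (x \<in> L)) t \<and> real t \<le> T (length x))"

definition class_P :: "bits set set" where
  "class_P = {L. \<exists>P k. decides_in_time P {} L (\<lambda>n. real (n ^ k + k))}"

definition pair_code :: "bits \<Rightarrow> bits \<Rightarrow> bits" where
  "pair_code x w = concat (map (\<lambda>b. [b, b]) x) @ [False, True] @ w"

definition class_NP :: "bits set set" where
  "class_NP = {L. \<exists>R\<in>class_P. \<exists>k.
     L = {x. \<exists>w. length w \<le> length x ^ k + k \<and> pair_code x w \<in> R}}"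

definition class_E_NP :: "bits set set" where
  "class_E_NP = {L. \<exists>A\<in>class_NP. \<exists>P. \<exists>g\<in>O(\<lambda>n. real n).
     decides_in_time P A L (\<lambda>n. 2 powr g n)}"


section \<open>MAX-SAT\<close>

text \<open>The literal \<open>(i, b)\<close> is variable \<open>i\<close> if \<open>b\<close> holds, and its negation otherwise.\<close>

type_synonym literal = "nat \<times> bool"

type_synonym cnf = "literal list list"

definition clause_true :: "(nat \<Rightarrow> bool) \<Rightarrow> literal list \<Rightarrow> bool" where
  "clause_true \<alpha> C \<longleftrightarrow> (\<exists>(i, b)\<in>set C. \<alpha> i = b)"

definition max_sat :: "cnf \<Rightarrow> nat" where
  "max_sat F = Max (range (\<lambda>\<alpha>. length (filter (clause_true \<alpha>) F)))"

definition cnf_on :: "nat \<Rightarrow> cnf \<Rightarrow> bool" where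
  "cnf_on n F \<longleftrightarrow> (\<forall>C\<in>set F. \<forall>(i, b)\<in>set C. i < n)"

text \<open>Data bits are doubled; the pair 01 ends a number and the pair 10 ends a clause.\<close>

definition nat_code :: "nat \<Rightarrow> bits" where
  "nat_code n = concat (map (\<lambda>j. [bit n j, bit n j]) [0..<floorlog 2 n]) @ [False, True]"

definition clause_code :: "literal list \<Rightarrow> bits" where
  "clause_code C = concat (map (\<lambda>(i, b). [b, b] @ nat_code i) C) @ [True, False]"

definition cnf_code :: "nat \<Rightarrow> cnf \<Rightarrow> bits" where
  "cnf_code n F = nat_code n @ concat (map clause_code F)"

text \<open>
  As usual for exponential-time algorithms, the bound \<open>T n m\<close>, for \<open>n\<close> variables and \<open>m\<close> clauses,
  is understood up to a factor polynomial in the length of the input. Without it, a bound below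
  \<open>2 ^ n\<close> could not hold for formulas with \<open>m \<ge> 2 ^ n\<close> clauses, which take longer to read.
\<close>

definition solves_MAX_SAT_in_time :: "ram \<Rightarrow> (nat \<Rightarrow> nat \<Rightarrow> real) \<Rightarrow> bool" where
  "solves_MAX_SAT_in_time P T \<longleftrightarrow>
     (\<exists>k. \<forall>n F. cnf_on n F \<longrightarrow>
        (\<exists>t. computes_in P {} (cnf_code n F) (max_sat F) t \<and>
             real t \<le> real (length (cnf_code n F) ^ k + k) * T n (length F)))"


section \<open>Circuits with a symmetric gate over AND gates\<close>

text \<open>\<open>SymAnd f Gs\<close> has the AND gates \<open>Gs\<close>, each given by its input literals, and the output gate
  applying \<open>f\<close> to the number of true AND gates. Repeated AND gates are counted repeatedly.\<close>

datatype sym_and = SymAnd "nat \<Rightarrow> bool" "literal list list"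

fun circuit_on :: "nat \<Rightarrow> sym_and \<Rightarrow> bool" where
  "circuit_on n (SymAnd f Gs) \<longleftrightarrow> (\<forall>G\<in>set Gs. \<forall>(i, b)\<in>set G. i < n)"

fun circuit_size :: "sym_and \<Rightarrow> nat" where
  "circuit_size (SymAnd f Gs) = length Gs + 1"

fun circuit_eval :: "sym_and \<Rightarrow> bits \<Rightarrow> bool" where
  "circuit_eval (SymAnd f Gs) x = f (\<Sum>G\<leftarrow>Gs. of_bool (\<forall>(i, b)\<in>set G. x ! i = b))"

definition has_sym_and_circuit :: "bits set \<Rightarrow> nat \<Rightarrow> real \<Rightarrow> bool" where
  "has_sym_and_circuit L n s \<longleftrightarrow>
     (\<exists>C. circuit_on n C \<and> real (circuit_size C) \<le> s \<and>
          (\<forall>x. length x = n \<longrightarrow> circuit_eval C x = (x \<in> L)))"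

definition E_NP_lacks_sym_and_circuits :: "(nat \<Rightarrow> real) \<Rightarrow> bool" where
  "E_NP_lacks_sym_and_circuits s \<longleftrightarrow>
     (\<exists>L\<in>class_E_NP. \<exists>\<^sub>\<infinity>n. \<not> has_sym_and_circuit L n (s n))"

end

theory Submission
  imports Defs
begin

text \<open>
  Williams' algorithmic method. Suppose that every language in E with an NP oracle had such circuits,
  and consider a machine \<open>V\<close> that, on a word \<open>w\<close> of length \<open>K\<close>, guesses bits and runs for less than
  \<open>2 ^ K\<close> steps. Whether \<open>V\<close> has an accepting run is expressed by a constraint system over a table with
  \<open>2 ^ K\<close> rows; rows that access the same memory cell are brought together by a Benes network, so every
  constraint compares at most five entries and is described by a pattern in \<open>K\<close> free bits. The
  lexicographically first satisfying table lies in E with an NP oracle, hence is given by a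
  SYM-AND circuit of size \<open>2 ^ o(sqrt K)\<close>, which can be guessed and verified: a violated
  constraint is an assignment of the \<open>K\<close> bits under which a few counts of true AND gates take
  prescribed values, and this is a MAX-SAT question with \<open>2 ^ o(sqrt K)\<close> clauses, since
  \<open>c\<^sup>2 + 2 * a * (s - c)\<close> is minimal exactly for \<open>c = a\<close>. The assumed algorithm saves a factor
  \<open>2 ^ \<omega>(sqrt K)\<close> over exhaustive search, and the verification takes less than \<open>2 ^ K\<close> steps.

  Diagonalisation follows Fortnow and Santhanam. \<open>V\<close> knows its own code. On \<open>w\<close> it guesses circuits
  for the systems of \<open>w0\<close> and \<open>w1\<close> and accepts if both are correct, until \<open>w\<close> is the start word followed by a
  full description of a circuit \<open>D\<close>; then it accepts iff \<open>D\<close> fails for the system of the start word.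
  So \<open>V\<close> accepts the start word iff all circuits fail for its system, that is, iff it does not accept it.
\<close>

section \<open>A tree machine and a structured language for it\<close>

text \<open>The saving is only a factor 2 to the power c K / log m, so the verifier may lose no more
  than a polynomial in the number of gates. Hence the simulation of the given random access machine
  on trees has constant overhead per unit of cost, and the patterns of the constraints vary in
  \<open>K\<close> positions only. In the opposite direction, from trees back to random access
  machines, a quadratic loss is harmless, since it only concerns membership in P and in E with an NP
  oracle.

  The function g of the statement may be uncomputable. The verifier works with 2 ^ floor(sqrt K / q)
  gates instead; the constant q depends on the exponents of the polynomial bounds but not on g, and
  any g in o(sqrt n) is eventually small enough.

  A nondeterministic machine cannot negate its own acceptance. The negation is therefore postponed
  to the leaves of a binary tree of words, where it concerns one explicit circuit. At an inner word
  of length K the guessed circuits belong to length K + 1, so the estimate has to beat 2 ^ K with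
  formulas in K + 1 variables.\<close>

datatype tree = Lf | Nd tree tree

primrec thd :: "tree => tree" where
 "thd Lf = Lf"
| "thd (Nd a b) = a"

primrec ttl :: "tree => tree" where
 "ttl Lf = Lf"
| "ttl (Nd a b) = b"

definition tbool :: "bool => tree" where
 "tbool b = (if b then Nd Lf Lf else Lf)"

definition tnext :: "bits => tree" where
 "tnext i = tbool (i \<noteq> [] \<and> hd i)"

datatype tinstr =
  TNil nat
 | TCons nat nat nat
 | THd nat nat
 | TTl nat nat
 | TJnil nat nat
 | TNext nat
 | TEof nat
 | TEmit nat
 | TAsk nat

type_synonym tconf = "nat \<times> (nat => tree) \<times> bits \<times> bits"

fun tinstr_step :: "bits set => tinstr => tconf => tconf" where
 "tinstr_step A (TNil r) (pc, R, i, q) = (Suc pc, R(r := Lf), i, q)"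
| "tinstr_step A (TCons r s t) (pc, R, i, q) = (Suc pc, R(r := Nd (R s) (R t)), i, q)"
| "tinstr_step A (THd r s) (pc, R, i, q) = (Suc pc, R(r := thd (R s)), i, q)"
| "tinstr_step A (TTl r s) (pc, R, i, q) = (Suc pc, R(r := ttl (R s)), i, q)"
| "tinstr_step A (TJnil r l) (pc, R, i, q) = (if R r = Lf then l else Suc pc, R, i, q)"
| "tinstr_step A (TNext r) (pc, R, i, q) = (Suc pc, R(r := tnext i), tl i, q)"
| "tinstr_step A (TEof r) (pc, R, i, q) = (Suc pc, R(r := tbool (i = [])), i, q)"
| "tinstr_step A (TEmit r) (pc, R, i, q) = (Suc pc, R, i, q @ [R r \<noteq> Lf])"
| "tinstr_step A (TAsk r) (pc, R, i, q) = (Suc pc, R(r := tbool (q \<in> A)), i, [])"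

definition tstep :: "bits set => tinstr list => tconf => tconf" where
 "tstep A P c = (if fst c < length P then tinstr_step A (P ! fst c) c else c)"

definition trun :: "bits set => tinstr list => nat => tconf => tconf" where
 "trun A P n = tstep A P ^^ n"

lemma trun_0 [simp]: "trun A P 0 c = c"
 by (simp add: trun_def)

lemma trun_add: "trun A P (m + n) c = trun A P n (trun A P m c)"
 unfolding trun_def by (metis add.commute comp_apply funpow_add)

lemma trun_Suc: "trun A P (Suc n) c = trun A P n (tstep A P c)"
 by (simp add: trun_def funpow_swap1)

section \<open>A structured language and its compilation\<close>

datatype fn =
  FId
 | FNil
 | FHd
 | FTl
 | FPair fn fn
 | FComp fn fn
 | FIf fn fn fn
 | FWhile fn
 | FNext
 | FEof
 | FEmit
 | FAsk

type_synonym fstate = "tree \<times> bits \<times> bits"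

text \<open>The constants count the instructions that \<open>fcode\<close> adds: 1 + 5 + 3 for a
  pair, 1 + 3 + 2 and 1 + 3 for the two branches, 2 + 2 for an iteration of a loop and 2 for its
  exit. This makes \<open>trun_code\<close> exact in time.\<close>

inductive ev :: "bits set => fn => fstate => fstate => nat => bool" for A where
 ev_Id: "ev A FId s s 0"
| ev_Nil: "ev A FNil (x, i, q) (Lf, i, q) 1"
| ev_Hd: "ev A FHd (x, i, q) (thd x, i, q) 1"
| ev_Tl: "ev A FTl (x, i, q) (ttl x, i, q) 1"
| ev_Pair: "ev A F (x, i, q) (y, i', q') t ==> ev A G (x, i', q') (z, i'', q'') u ==>
  ev A (FPair F G) (x, i, q) (Nd y z, i'', q'') (t + u + 9)"
| ev_Comp: "ev A F s s' t ==> ev A G s' s'' u ==> ev A (FComp F G) s s'' (t + u)"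
| ev_If_True: "ev A B (x, i, q) (y, i', q') t ==> y \<noteq> Lf ==> ev A F (x, i', q') s u ==>
  ev A (FIf B F G) (x, i, q) s (t + u + 6)"
| ev_If_False: "ev A B (x, i, q) (Lf, i', q') t ==> ev A G (x, i', q') s u ==>
  ev A (FIf B F G) (x, i, q) s (t + u + 4)"
| ev_While_end: "thd x = Lf ==> ev A (FWhile F) (x, i, q) (x, i, q) 2"
| ev_While: "thd x \<noteq> Lf ==> ev A F (x, i, q) s t ==> ev A (FWhile F) s s' u ==>
  ev A (FWhile F) (x, i, q) s' (t + u + 4)"
| ev_Next: "ev A FNext (x, i, q) (tnext i, tl i, q) 1"
| ev_Eof: "ev A FEof (x, i, q) (tbool (i = []), i, q) 1"
| ev_Emit: "ev A FEmit (x, i, q) (x, i, q @ [x \<noteq> Lf]) 1"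
| ev_Ask: "ev A FAsk (x, i, q) (tbool (q \<in> A), i, []) 1"

primrec flen :: "fn => nat" where
 "flen FId = 0"
| "flen FNil = 1"
| "flen FHd = 1"
| "flen FTl = 1"
| "flen (FPair F G) = flen F + flen G + 9"
| "flen (FComp F G) = flen F + flen G"
| "flen (FIf B F G) = flen B + flen F + flen G + 8"
| "flen (FWhile F) = flen F + 4"
| "flen FNext = 1"
| "flen FEof = 1"
| "flen FEmit = 1"
| "flen FAsk = 1"

text \<open>Register 0 is the accumulator, register 1 a stack of saved values (itself a tree), register 2
 a scratch register.\<close>

primrec fcode :: "nat => fn => tinstr list" where
 "fcode a FId = []"
| "fcode a FNil = [TNil 0]"
| "fcode a FHd = [THd 0 0]"
| "fcode a FTl = [TTl 0 0]"
| "fcode a (FPair F G) = [TCons 1 0 1] @ fcode (a + 1) F @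
   [THd 2 1, TTl 1 1, TCons 1 0 1, TCons 0 2 2, THd 0 0] @ fcode (a + flen F + 6) G @
   [THd 2 1, TTl 1 1, TCons 0 2 0]"
| "fcode a (FComp F G) = fcode a F @ fcode (a + flen F) G"
| "fcode a (FIf B F G) = [TCons 1 0 1] @ fcode (a + 1) B @
   [TJnil 0 (a + flen B + flen F + 6), THd 0 1, TTl 1 1] @ fcode (a + flen B + 4) F @
   [TNil 2, TJnil 2 (a + flen B + flen F + flen G + 8)] @
   [THd 0 1, TTl 1 1] @ fcode (a + flen B + flen F + 8) G"
| "fcode a (FWhile F) = [THd 2 0, TJnil 2 (a + flen F + 4)] @ fcode (a + 2) F @
   [TNil 2, TJnil 2 a]"
| "fcode a FNext = [TNext 0]"
| "fcode a FEof = [TEof 0]"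
| "fcode a FEmit = [TEmit 0]"
| "fcode a FAsk = [TAsk 0]"

lemma length_fcode [simp]: "length (fcode a F) = flen F"
 by (induction F arbitrary: a) auto

definition code_at :: "tinstr list => nat => tinstr list => bool" where
 "code_at P a cs \<longleftrightarrow> (\<exists>pre post. P = pre @ cs @ post \<and> length pre = a)"

lemma code_at_append: "code_at P a (cs @ ds) \<longleftrightarrow> code_at P a cs \<and> code_at P (a + length cs) ds"
proof
 assume "code_at P a (cs @ ds)"
 then obtain pre post where "P = pre @ (cs @ ds) @ post" "length pre = a"
  by (auto simp: code_at_def)
 then show "code_at P a cs \<and> code_at P (a + length cs) ds"
  unfolding code_at_def
  by (metis append.assoc length_append)
next
 assume a: "code_at P a cs \<and> code_at P (a + length cs) ds"
 then obtain pre post pre' post' where *: "P = pre @ cs @ post" "length pre = a"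
  "P = pre' @ ds @ post'" "length pre' = a + length cs"
  unfolding code_at_def by blast
 then have "(pre @ cs) @ post = pre' @ ds @ post'" "length (pre @ cs) = length pre'"
  by simp_all
 then have "post = ds @ post'"
  by (meson append_eq_append_conv)
 then show "code_at P a (cs @ ds)"
  unfolding code_at_def using * by auto
qed

lemma code_at_Cons: "code_at P a (c # ds) \<longleftrightarrow> a < length P \<and> P ! a = c \<and> code_at P (Suc a) ds"
proof -
 have "code_at P a [c] \<longleftrightarrow> a < length P \<and> P ! a = c"
  unfolding code_at_def
  by (auto simp: nth_append) (metis append_Cons append_Nil id_take_nth_drop length_take
   less_imp_le min.absorb2)
 then show ?thesis
  using code_at_append[of P a "[c]" ds] by simp
qed

lemma tstep_code_at:
 "code_at P a (c # ds) ==> tstep A P (a, R, i, q) = tinstr_step A c (a, R, i, q)"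
 by (simp add: code_at_Cons tstep_def)

text \<open>Preservation of register 1 is the invariant that carries the induction: every construct
  pops exactly what it has pushed, so a saved value is still on top after a subprogram has run.
  Register 2 is scratch, hence the final registers are only asserted to exist.\<close>

lemma trun_code:
 assumes "ev A F s s' t" "code_at P a (fcode a F)" "R 0 = fst s"
 shows "\<exists>R'. trun A P t (a, R, snd s) = (a + flen F, R', snd s') \<and> R' 0 = fst s' \<and> R' 1 = R 1"
 using assms
proof (induction arbitrary: a R rule: ev.induct)
 case (ev_Pair F x i q y i' q' t G z i'' q'' u)
 let ?R1 = "R(1 := Nd x (R 1))"
 note c = ev_Pair.prems(1)[simplified, unfolded code_at_Cons code_at_append, simplified, unfolded code_at_Cons, simplified]
 have c1: "code_at P (a + 1) (fcode (a + 1) F)" using c by simp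
 have e1: "?R1 0 = fst (x, i, q)" using ev_Pair.prems(2) by simp
 obtain R2 where R2: "trun A P t (a + 1, ?R1, i, q) = (a + 1 + flen F, R2, i', q')"
  "R2 0 = y" "R2 1 = ?R1 1"
  using ev_Pair.IH(1)[of "a + 1" ?R1, OF c1 e1] unfolding fst_conv snd_conv by blast
 let ?R3 = "R2(2 := x, 1 := Nd y (R 1), 0 := x)"
 have cG: "code_at P (a + flen F + 6) (fcode (a + flen F + 6) G)"
  using c by (simp add: eval_nat_numeral)
 have e3: "?R3 0 = fst (x, i', q')" by simp
 obtain R4 where R4: "trun A P u (a + flen F + 6, ?R3, i', q') = (a + flen F + 6 + flen G, R4, i'', q'')"
  "R4 0 = z" "R4 1 = ?R3 1"
  using ev_Pair.IH(2)[of "a + flen F + 6" ?R3, OF cG e3] unfolding fst_conv snd_conv by blast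
 have 1: "trun A P 1 (a, R, i, q) = (a + 1, ?R1, i, q)"
  using c ev_Pair.prems(2) by (simp add: trun_def tstep_def)
 have 2: "trun A P 5 (a + 1 + flen F, R2, i', q') = (a + flen F + 6, ?R3, i', q')"
  using c R2(2,3)
  by (simp add: trun_def tstep_def eval_nat_numeral fun_eq_iff)
 have 3: "\<exists>R'. trun A P 3 (a + flen F + 6 + flen G, R4, i'', q'') = (a + flen (FPair F G), R', i'', q'')
   \<and> R' 0 = Nd y z \<and> R' 1 = R 1"
  using c R4(2,3)
  by (simp add: trun_def tstep_def eval_nat_numeral add.assoc)
 have "t + u + 9 = 1 + (t + (5 + (u + 3)))" by simp
 then have "trun A P (t + u + 9) (a, R, i, q) = trun A P 3 (a + flen F + 6 + flen G, R4, i'', q'')"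
  by (simp only: trun_add 1 R2(1) 2 R4(1))
 then show ?case using 3 by simp
next
 case (ev_Comp F s s' t G s'' u)
 note c = ev_Comp.prems(1)[simplified, unfolded code_at_append]
 obtain R2 where R2: "trun A P t (a, R, snd s) = (a + flen F, R2, snd s')" "R2 0 = fst s'" "R2 1 = R 1"
  using ev_Comp.IH(1)[of a R] c ev_Comp.prems(2) by auto
 then show ?case
  using ev_Comp.IH(2)[of "a + flen F" R2] c by (auto simp: trun_add add.assoc)
next
 case (ev_If_True B x i q y i' q' t F s u G)
 let ?R1 = "R(1 := Nd x (R 1))"
 note c = ev_If_True.prems(1)[simplified, unfolded code_at_Cons code_at_append, simplified, unfolded code_at_Cons, simplified]
 have c1: "code_at P (a + 1) (fcode (a + 1) B)" using c by simp
 have e1: "?R1 0 = fst (x, i, q)" using ev_If_True.prems(2) by simp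
 obtain R2 where R2: "trun A P t (a + 1, ?R1, i, q) = (a + 1 + flen B, R2, i', q')"
  "R2 0 = y" "R2 1 = ?R1 1"
  using ev_If_True.IH(1)[of "a + 1" ?R1, OF c1 e1] unfolding fst_conv snd_conv by blast
 let ?R3 = "R2(0 := x, 1 := R 1)"
 have cF: "code_at P (a + flen B + 4) (fcode (a + flen B + 4) F)"
  using c by (simp add: eval_nat_numeral)
 have e3: "?R3 0 = fst (x, i', q')" by simp
 obtain R4 where R4: "trun A P u (a + flen B + 4, ?R3, i', q') = (a + flen B + 4 + flen F, R4, snd s)"
  "R4 0 = fst s" "R4 1 = ?R3 1"
  using ev_If_True.IH(2)[of "a + flen B + 4" ?R3, OF cF e3] unfolding fst_conv snd_conv by blast
 have 1: "trun A P 1 (a, R, i, q) = (a + 1, ?R1, i, q)"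
  using c ev_If_True.prems(2) by (simp add: trun_def tstep_def)
 have 2: "trun A P 3 (a + 1 + flen B, R2, i', q') = (a + flen B + 4, ?R3, i', q')"
  using c R2(2,3) ev_If_True.hyps(2)
  by (simp add: trun_def tstep_def eval_nat_numeral fun_eq_iff)
 have 3: "\<exists>R'. trun A P 2 (a + flen B + 4 + flen F, R4, snd s) = (a + flen (FIf B F G), R', snd s)
   \<and> R' 0 = fst s \<and> R' 1 = R 1"
  using c R4(2,3)
  by (cases "snd s") (simp add: trun_def tstep_def eval_nat_numeral add.assoc)
 have "t + u + 6 = 1 + (t + (3 + (u + 2)))" by simp
 then have "trun A P (t + u + 6) (a, R, i, q) = trun A P 2 (a + flen B + 4 + flen F, R4, snd s)"
  by (simp only: trun_add 1 R2(1) 2 R4(1))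
 then show ?case using 3 by simp
next
 case (ev_If_False B x i q i' q' t G s u F)
 let ?R1 = "R(1 := Nd x (R 1))"
 note c = ev_If_False.prems(1)[simplified, unfolded code_at_Cons code_at_append, simplified, unfolded code_at_Cons, simplified]
 have c1: "code_at P (a + 1) (fcode (a + 1) B)" using c by simp
 have e1: "?R1 0 = fst (x, i, q)" using ev_If_False.prems(2) by simp
 obtain R2 where R2: "trun A P t (a + 1, ?R1, i, q) = (a + 1 + flen B, R2, i', q')"
  "R2 0 = Lf" "R2 1 = ?R1 1"
  using ev_If_False.IH(1)[of "a + 1" ?R1, OF c1 e1] unfolding fst_conv snd_conv by blast
 let ?R3 = "R2(0 := x, 1 := R 1)"
 have cF: "code_at P (a + flen B + flen F + 8) (fcode (a + flen B + flen F + 8) G)"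
  using c by (simp add: eval_nat_numeral)
 have e3: "?R3 0 = fst (x, i', q')" by simp
 obtain R4 where R4: "trun A P u (a + flen B + flen F + 8, ?R3, i', q') =
   (a + flen B + flen F + 8 + flen G, R4, snd s)" "R4 0 = fst s" "R4 1 = ?R3 1"
  using ev_If_False.IH(2)[of "a + flen B + flen F + 8" ?R3, OF cF e3] unfolding fst_conv snd_conv by blast
 have 1: "trun A P 1 (a, R, i, q) = (a + 1, ?R1, i, q)"
  using c ev_If_False.prems(2) by (simp add: trun_def tstep_def)
 have 2: "trun A P 3 (a + 1 + flen B, R2, i', q') = (a + flen B + flen F + 8, ?R3, i', q')"
  using c R2(2,3)
  by (simp add: trun_def tstep_def eval_nat_numeral fun_eq_iff)
 have "t + u + 4 = 1 + (t + (3 + u))" by simp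
 then have "trun A P (t + u + 4) (a, R, i, q) = (a + flen B + flen F + 8 + flen G, R4, snd s)"
  by (simp only: trun_add 1 R2(1) 2 R4(1))
 then show ?case using R4 by simp
next
 case (ev_While_end x F i q)
 note c = ev_While_end.prems(1)[simplified, unfolded code_at_Cons code_at_append, simplified, unfolded code_at_Cons, simplified]
 show ?case using c ev_While_end.hyps ev_While_end.prems(2)
  by (simp add: trun_def tstep_def eval_nat_numeral)
next
 case (ev_While x F i q s t s' u)
 note c = ev_While.prems(1)[simplified, unfolded code_at_Cons code_at_append, simplified, unfolded code_at_Cons, simplified]
 let ?R1 = "R(2 := thd x)"
 have cF: "code_at P (a + 2) (fcode (a + 2) F)"
  using c by (simp add: eval_nat_numeral)
 have e1: "?R1 0 = fst (x, i, q)" using ev_While.prems(2) by simp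
 obtain R2 where R2: "trun A P t (a + 2, ?R1, i, q) = (a + 2 + flen F, R2, snd s)"
  "R2 0 = fst s" "R2 1 = ?R1 1"
  using ev_While.IH(1)[of "a + 2" ?R1, OF cF e1] unfolding fst_conv snd_conv by blast
 let ?R3 = "R2(2 := Lf)"
 have e3: "?R3 0 = fst s" using R2 by simp
 obtain R4 where R4: "trun A P u (a, ?R3, snd s) = (a + flen (FWhile F), R4, snd s')"
  "R4 0 = fst s'" "R4 1 = ?R3 1"
  using ev_While.IH(2)[of a ?R3, OF ev_While.prems(1) e3] by blast
 have 1: "trun A P 2 (a, R, i, q) = (a + 2, ?R1, i, q)"
  using c ev_While.prems(2) ev_While.hyps(1) by (simp add: trun_def tstep_def eval_nat_numeral)
 have 2: "trun A P 2 (a + 2 + flen F, R2, snd s) = (a, ?R3, snd s)"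
  using c by (cases "snd s") (simp add: trun_def tstep_def eval_nat_numeral)
 have "t + u + 4 = 2 + (t + (2 + u))" by simp
 then have "trun A P (t + u + 4) (a, R, i, q) = (a + flen (FWhile F), R4, snd s')"
  by (simp only: trun_add 1 R2(1) 2 R4(1))
 then show ?case using R4 R2 by simp
qed (simp_all add: trun_def tstep_def code_at_Cons)

section \<open>Time-bounded and polynomial-time functions\<close>

class enc =
 fixes enc :: "'a => tree"

instantiation tree :: enc
begin
definition enc_tree :: "tree => tree" where "enc_tree t = t"
instance ..
end

instantiation bool :: enc
begin
definition enc_bool :: "bool => tree" where "enc_bool = tbool"
instance ..
end

text \<open>Numbers are unary, so that arithmetic reduces to lists of units; polynomial bounds below
  are therefore polynomial in the value of a number. Binary numbers will be bit lists.\<close>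

instantiation nat :: enc
begin
primrec enc_nat :: "nat => tree" where
 "enc_nat 0 = Lf"
| "enc_nat (Suc n) = Nd Lf (enc_nat n)"
instance ..
end

instantiation list :: (enc) enc
begin
primrec enc_list :: "'a list => tree" where
 "enc_list [] = Lf"
| "enc_list (x # xs) = Nd (enc x) (enc_list xs)"
instance ..
end

instantiation prod :: (enc, enc) enc
begin
definition enc_prod :: "'a \<times> 'b => tree" where "enc_prod p = Nd (enc (fst p)) (enc (snd p))"
instance ..
end

lemma enc_Pair [simp]: "enc (a, b) = Nd (enc a) (enc b)"
 by (simp add: enc_prod_def)

lemma enc_True [simp]: "enc True = Nd Lf Lf" and enc_False [simp]: "enc False = Lf"
 by (simp_all add: enc_bool_def tbool_def)

lemma enc_tree [simp]: "enc (t :: tree) = t"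
 by (simp add: enc_tree_def)

lemma enc_bool_Lf_iff [simp]: "enc b = Lf \<longleftrightarrow> \<not> b"
 by (cases b) auto

lemma enc_list_Lf_iff [simp]: "enc l = Lf \<longleftrightarrow> l = []" for l :: "'a::enc list"
 by (cases l) auto

lemma enc_nat_Lf_iff [simp]: "enc n = Lf \<longleftrightarrow> n = (0 :: nat)"
 by (cases n) auto

lemma enc_replicate_Lf: "enc (replicate n Lf) = enc n"
 by (induction n) auto

primrec sz :: "tree => nat" where
 "sz Lf = 1"
| "sz (Nd a b) = Suc (sz a + sz b)"

definition es :: "'a::enc => nat" where "es x = sz (enc x)"

lemma sz_pos: "sz t \<ge> 1"
 by (cases t) auto

lemma es_pos: "es x \<ge> 1"
 unfolding es_def by (rule sz_pos)

lemma es_simps [simp]: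
 "es (a, b) = Suc (es a + es b)"
 "es ([] :: 'a::enc list) = 1"
 "es (x # xs) = Suc (es x + es xs)"
 "es (n :: nat) = 2 * n + 1"
proof -
 show "es (n :: nat) = 2 * n + 1" by (induction n) (auto simp: es_def)
qed (auto simp: es_def)

lemma es_bool: "es (b :: bool) \<le> 3"
 by (cases b) (auto simp: es_def)

lemma es_append: "es (xs @ ys) + 1 = es xs + es ys"
 by (induction xs) auto

lemma es_rev [simp]: "es (rev xs) = es xs"
proof (induction xs)
 case (Cons x xs)
 then show ?case using es_append[of "rev xs" "[x]"] by simp
qed simp

lemma length_le_es: "length xs \<le> es xs"
 by (induction xs) auto

lemma es_mem: "x \<in> set xs ==> es x \<le> es xs"
 by (induction xs) auto

lemma es_list_le: "(\<And>x. x \<in> set xs ==> es x \<le> b) ==> es xs \<le> length xs * (b + 1) + 1"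
proof (induction xs)
 case (Cons x xs)
 have "es x \<le> b" "es xs \<le> length xs * (b + 1) + 1" using Cons by auto
 then show ?case by simp
qed simp

text \<open>The end-of-input test is excluded together with the oracle: a program that reads guesses
  must not notice where they end, so that its run depends only on the bits it has consumed.\<close>

primrec noask :: "fn => bool" where
 "noask FId = True"
| "noask FNil = True"
| "noask FHd = True"
| "noask FTl = True"
| "noask (FPair F G) = (noask F \<and> noask G)"
| "noask (FComp F G) = (noask F \<and> noask G)"
| "noask (FIf B F G) = (noask B \<and> noask F \<and> noask G)"
| "noask (FWhile F) = noask F"
| "noask FNext = True"
| "noask FEof = False"
| "noask FEmit = False"
| "noask FAsk = False"

text \<open>Valid for every oracle and every content of the two streams, which are left untouched;
  such programs can be used inside verifiers that read guesses as well as inside oracle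
  machines.\<close>

definition rn :: "fn => tree => tree => nat => bool" where
 "rn F x y t \<longleftrightarrow> (\<forall>A i q. \<exists>t'\<le>t. ev A F (x, i, q) (y, i, q) t')"

lemma rn_mono: "rn F x y t ==> t \<le> u ==> rn F x y u"
 unfolding rn_def by (meson le_trans)

lemma rn_Id: "rn FId x x 0"
 unfolding rn_def by (auto intro: ev_Id)

lemma rn_Nil: "rn FNil x Lf 1"
 unfolding rn_def using ev_Nil by blast

lemma rn_Hd: "rn FHd x (thd x) 1"
 unfolding rn_def using ev_Hd by blast

lemma rn_Tl: "rn FTl x (ttl x) 1"
 unfolding rn_def using ev_Tl by blast

lemma rn_Pair: "rn F x y t ==> rn G x z u ==> rn (FPair F G) x (Nd y z) (t + u + 9)"
 unfolding rn_def by (meson add_le_mono ev_Pair le_refl)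

lemma rn_Comp: "rn F x y t ==> rn G y z u ==> rn (FComp F G) x z (t + u)"
 unfolding rn_def by (meson add_le_mono ev_Comp)

lemma rn_If_True: "rn B x y t ==> y \<noteq> Lf ==> rn F x z u ==> rn (FIf B F G) x z (t + u + 6)"
 unfolding rn_def by (meson add_le_mono ev_If_True le_refl)

lemma rn_If_False: "rn B x Lf t ==> rn G x z u ==> rn (FIf B F G) x z (t + u + 6)"
 unfolding rn_def
proof (intro allI)
 fix A i q
 assume "\<forall>A i q. \<exists>t'\<le>t. ev A B (x, i, q) (Lf, i, q) t'" "\<forall>A i q. \<exists>t'\<le>u. ev A G (x, i, q) (z, i, q) t'"
 then obtain t' u' where "t' \<le> t" "ev A B (x, i, q) (Lf, i, q) t'" "u' \<le> u" "ev A G (x, i, q) (z, i, q) u'"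
  by meson
 then show "\<exists>t'\<le>t + u + 6. ev A (FIf B F G) (x, i, q) (z, i, q) t'"
  using ev_If_False[of A B x i q i q t' G "(z, i, q)" u' F]
  by (intro exI[of _ "t' + u' + 4"]) auto
qed

lemma rn_If: "rn B x y t ==> (y \<noteq> Lf ==> rn F x z u) ==> (y = Lf ==> rn G x z u) ==>
  rn (FIf B F G) x z (t + u + 6)"
 by (cases "y = Lf") (auto intro: rn_If_True rn_If_False)

lemma rn_While_end: "thd x = Lf ==> rn (FWhile F) x x 2"
 unfolding rn_def using ev_While_end by blast

lemma rn_While: "thd x \<noteq> Lf ==> rn F x y t ==> rn (FWhile F) y z u ==> rn (FWhile F) x z (t + u + 4)"
 unfolding rn_def by (meson add_le_mono ev_While le_refl)

text \<open>Constant factors are hidden but nothing more, because the simulation of a random access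
  machine has to be linear in its cost. The summand 1 lets the bound 0 stand for constant
  time.\<close>

definition ctime :: "('a::enc => 'b::enc) => ('a => nat) => bool" where
 "ctime f \<tau> \<longleftrightarrow> (\<exists>F C. noask F \<and> (\<forall>x. rn F (enc x) (enc (f x)) (C * (\<tau> x + 1))))"

lemma ctimeI: "noask F ==> (\<And>x. rn F (enc x) (enc (f x)) (C * (\<tau> x + 1))) ==> ctime f \<tau>"
 unfolding ctime_def by blast

lemma ctime_le:
 assumes "ctime f \<sigma>" "\<And>x. \<sigma> x \<le> D * (\<tau> x + 1)"
 shows "ctime f \<tau>"
proof -
 obtain F C where F: "noask F" "\<And>x. rn F (enc x) (enc (f x)) (C * (\<sigma> x + 1))"
  using assms(1) unfolding ctime_def by blast
 have "C * (\<sigma> x + 1) \<le> (C * D + C) * (\<tau> x + 1)" for x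
 proof -
  have "C * (\<sigma> x + 1) \<le> C * (D * (\<tau> x + 1) + 1)" using assms(2)[of x] by simp
  also have "\<dots> \<le> (C * D + C) * (\<tau> x + 1)" by (simp add: algebra_simps)
  finally show ?thesis .
 qed
 then show ?thesis using F by (meson ctimeI rn_mono)
qed

lemma ctime_mono: "ctime f \<sigma> ==> (\<And>x. \<sigma> x \<le> \<tau> x) ==> ctime f \<tau>"
 by (rule ctime_le[where D = 1]) (auto intro: le_SucI)

lemma ctime_cast: "ctime f \<tau> ==> (\<And>x. enc (g x) = enc (f x)) ==> ctime g \<tau>"
 unfolding ctime_def by simp

lemma ctime_id: "ctime (%x. x) \<tau>"
 by (rule ctimeI[of FId _ 0]) (auto intro: rn_Id)

lemma ctime_const: "ctime (%x. c) \<tau>"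
proof -
 have "\<exists>F C. noask F \<and> (\<forall>x. rn F x t C)" for t
 proof (induction t)
  case Lf
  then show ?case by (intro exI[of _ FNil] exI[of _ 1]) (auto intro: rn_Nil[simplified])
 next
  case (Nd a b)
  then obtain F C G D where "noask F" "\<forall>x. rn F x a C" "noask G" "\<forall>x. rn G x b D"
   by blast
  then show ?case by (intro exI[of _ "FPair F G"] exI[of _ "C + D + 9"]) (auto intro: rn_Pair)
 qed
 then obtain F C where F: "noask F" "\<And>x. rn F x (enc c) C" by blast
 have "rn F (enc x) (enc c) (C * (\<tau> x + 1))" for x by (rule rn_mono[OF F(2)]) simp
 then show ?thesis by (rule ctimeI[OF F(1)])
qed

lemma ctime_pair:
 assumes "ctime f \<tau>" "ctime g \<tau>"
 shows "ctime (%x. (f x, g x)) \<tau>"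
proof -
 obtain F C G D where F: "noask F" "\<And>x. rn F (enc x) (enc (f x)) (C * (\<tau> x + 1))"
  "noask G" "\<And>x. rn G (enc x) (enc (g x)) (D * (\<tau> x + 1))"
  using assms unfolding ctime_def by metis
 have "rn (FPair F G) (enc x) (enc (f x, g x)) ((C + D + 9) * (\<tau> x + 1))" for x
  unfolding enc_Pair by (rule rn_mono[OF rn_Pair[OF F(2) F(4)]]) (simp add: algebra_simps)
 then show ?thesis by (rule ctimeI[rotated]) (simp add: F)
qed

lemma ctime_comp:
 assumes "ctime g \<tau>" "ctime f \<sigma>" "\<And>x. \<sigma> (g x) \<le> D * (\<tau> x + 1)"
 shows "ctime (%x. f (g x)) \<tau>"
proof -
 obtain F C G E where F: "noask F" "\<And>x. rn F (enc x) (enc (f x)) (C * (\<sigma> x + 1))"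
  "noask G" "\<And>x. rn G (enc x) (enc (g x)) (E * (\<tau> x + 1))"
  using assms unfolding ctime_def by metis
 have "rn (FComp G F) (enc x) (enc (f (g x))) ((E + C * D + C) * (\<tau> x + 1))" for x
 proof (rule rn_mono[OF rn_Comp[OF F(4) F(2)]])
  have "C * (\<sigma> (g x) + 1) \<le> C * (D * (\<tau> x + 1) + 1)" using assms(3)[of x] by simp
  then show "E * (\<tau> x + 1) + C * (\<sigma> (g x) + 1) \<le> (E + C * D + C) * (\<tau> x + 1)"
   by (simp add: algebra_simps)
 qed
 then show ?thesis by (rule ctimeI[rotated]) (simp add: F)
qed

lemma ctime_comp0: "ctime g \<tau> ==> ctime f (%_. 0) ==> ctime (%x. f (g x)) \<tau>"
 by (rule ctime_comp[where D = 0 and \<sigma> = "%_. 0"]) auto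

lemma ctime_if:
 assumes "ctime b \<tau>" "ctime f \<tau>" "ctime g \<tau>"
 shows "ctime (%x. if b x then f x else g x) \<tau>"
proof -
 obtain F C G D B E where F: "noask F" "\<And>x. rn F (enc x) (enc (f x)) (C * (\<tau> x + 1))"
  "noask G" "\<And>x. rn G (enc x) (enc (g x)) (D * (\<tau> x + 1))"
  "noask B" "\<And>x. rn B (enc x) (enc (b x)) (E * (\<tau> x + 1))"
  using assms unfolding ctime_def by metis
 have "rn (FIf B F G) (enc x) (enc (if b x then f x else g x)) ((E + (C + D) + 6) * (\<tau> x + 1))" for x
 proof (rule rn_mono[OF rn_If[OF F(6)]])
  show "rn F (enc x) (enc (if b x then f x else g x)) ((C + D) * (\<tau> x + 1))" if "enc (b x) \<noteq> Lf"
   using that by (auto intro!: rn_mono[OF F(2)[of x]] simp: algebra_simps)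
  show "rn G (enc x) (enc (if b x then f x else g x)) ((C + D) * (\<tau> x + 1))" if "enc (b x) = Lf"
   using that by (auto intro!: rn_mono[OF F(4)[of x]] simp: algebra_simps)
 qed (simp add: algebra_simps)
 then show ?thesis by (rule ctimeI[rotated]) (simp add: F)
qed

lemma ctime_thd: "ctime thd \<tau>"
 by (rule ctimeI[of FHd _ 1]) (auto intro: rn_mono[OF rn_Hd])

lemma ctime_ttl: "ctime ttl \<tau>"
 by (rule ctimeI[of FTl _ 1]) (auto intro: rn_mono[OF rn_Tl])

lemma ctime_fst: "ctime f \<tau> ==> ctime (%x. fst (f x)) \<tau>"
proof (erule ctime_comp0)
 have "rn FHd (enc x) (enc (fst x)) (1 * (0 + 1))" for x :: "'b \<times> 'c"
  using rn_Hd[of "enc x"] by (simp add: enc_prod_def)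
 then show "ctime (fst :: 'b \<times> 'c => 'b) (%_. 0)"
  by (intro ctimeI[of FHd]) auto
qed

lemma ctime_snd: "ctime f \<tau> ==> ctime (%x. snd (f x)) \<tau>"
proof (erule ctime_comp0)
 have "rn FTl (enc x) (enc (snd x)) (1 * (0 + 1))" for x :: "'b \<times> 'c"
  using rn_Tl[of "enc x"] by (simp add: enc_prod_def)
 then show "ctime (snd :: 'b \<times> 'c => 'c) (%_. 0)"
  by (intro ctimeI[of FTl]) auto
qed

lemma ctime_Cons: "ctime f \<tau> ==> ctime g \<tau> ==> ctime (%x. f x # g x) \<tau>"
 by (rule ctime_cast[OF ctime_pair]) auto

lemma ctime_tl: "ctime f \<tau> ==> ctime (%x. tl (f x)) \<tau>"
proof (erule ctime_comp0)
 have "rn FTl (enc x) (enc (tl x)) (1 * (0 + 1))" for x :: "'b list"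
  using rn_Tl[of "enc x"] by (cases x) auto
 then show "ctime (tl :: 'b list => 'b list) (%_. 0)"
  by (intro ctimeI[of FTl]) auto
qed

lemma ctime_null: "ctime f \<tau> ==> ctime (%x. f x = []) \<tau>"
proof (erule ctime_comp0)
 have "rn (FIf FId FNil (FPair FNil FNil)) (enc x) (enc (x = [])) (17 * (0 + 1))" for x :: "'b list"
  by (rule rn_mono[OF rn_If[OF rn_Id, where u = 11]])
   (auto intro: rn_mono[OF rn_Nil] rn_mono[OF rn_Pair[OF rn_Nil rn_Nil]])
 then show "ctime (%x :: 'b list. x = []) (%_. 0)"
  by (intro ctimeI[of "FIf FId FNil (FPair FNil FNil)"]) auto
qed

lemma ctime_case_list:
 assumes "ctime l \<tau>" "ctime n \<tau>" "ctime (%p. c (fst p) (fst (snd p)) (snd (snd p))) \<sigma>"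
  "\<And>x y ys. l x = y # ys ==> \<sigma> (x, (y, ys)) \<le> D * (\<tau> x + 1)"
 shows "ctime (%x. case l x of [] => n x | y # ys => c x y ys) \<tau>"
proof -
 obtain F C G E L H where F: "noask F" "\<And>x. rn F (enc x) (enc (l x)) (C * (\<tau> x + 1))"
  "noask G" "\<And>x. rn G (enc x) (enc (n x)) (E * (\<tau> x + 1))"
  "noask L" "\<And>p. rn L (enc p) (enc (c (fst p) (fst (snd p)) (snd (snd p)))) (H * (\<sigma> p + 1))"
  using assms unfolding ctime_def by metis
 let ?P = "FIf F (FComp (FPair FId F) L) G"
 have "rn ?P (enc x) (enc (case l x of [] => n x | y # ys => c x y ys))
   ((C + (E + C + H * D + H + 9) + 6) * (\<tau> x + 1))" for x
 proof (rule rn_mono[OF rn_If[OF F(2)]])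
  show "rn (FComp (FPair FId F) L) (enc x) (enc (case l x of [] => n x | y # ys => c x y ys))
    ((E + C + H * D + H + 9) * (\<tau> x + 1))" if ne: "enc (l x) \<noteq> Lf"
  proof -
   obtain y ys where l: "l x = y # ys" using ne by (cases "l x") auto
   have 1: "rn (FPair FId F) (enc x) (enc (x, (y, ys))) (C * (\<tau> x + 1) + 9)"
    using rn_Pair[OF rn_Id F(2)[of x]] l by simp
   have "H * (\<sigma> (x, (y, ys)) + 1) \<le> H * (D * (\<tau> x + 1) + 1)" using assms(4)[OF l] by simp
   then have 2: "C * (\<tau> x + 1) + 9 + H * (\<sigma> (x, (y, ys)) + 1) \<le> (E + C + H * D + H + 9) * (\<tau> x + 1)"
    by (simp add: algebra_simps)
   show ?thesis using rn_mono[OF rn_Comp[OF 1 F(6)] 2] l by simp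
  qed
  show "rn G (enc x) (enc (case l x of [] => n x | y # ys => c x y ys))
    ((E + C + H * D + H + 9) * (\<tau> x + 1))" if "enc (l x) = Lf"
   using that by (auto intro!: rn_mono[OF F(4)[of x]] simp: algebra_simps)
 qed (simp add: algebra_simps)
 then show ?thesis by (rule ctimeI[rotated]) (simp add: F)
qed

text \<open>The loop keeps the remaining list in front, where its emptiness ends the
  \<open>FWhile\<close>, followed by the fixed parameter \<open>x\<close>, on which the folded
  function may depend, and the accumulator.\<close>

lemma rn_foldl:
 assumes "\<And>ys y zs. l = ys @ y # zs ==> rn F (enc ((x, foldl f a ys), y)) (enc (f (foldl f a ys) y)) d"
 shows "rn (FWhile (FPair (FComp FHd FTl) (FPair (FComp FTl FHd) (FComp (FPair FTl (FComp FHd FHd)) F))))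
  (Nd (enc l) (enc (x, a))) (Nd Lf (enc (x, foldl f a l))) (length l * (d + 40) + 2)"
 using assms
proof (induction l arbitrary: a)
 case Nil
 then show ?case using rn_While_end[of "Nd Lf (enc (x, a))"] by (simp add: numeral_2_eq_2)
next
 case (Cons y l)
 let ?B = "FPair (FComp FHd FTl) (FPair (FComp FTl FHd) (FComp (FPair FTl (FComp FHd FHd)) F))"
 let ?s = "Nd (enc (y # l)) (enc (x, a))"
 have r: "rn F (enc ((x, a), y)) (enc (f a y)) d"
  using Cons.prems[of "[]" y l] by simp
 have 1: "rn (FComp FHd FTl) ?s (enc l) 2"
  using rn_Comp[OF rn_Hd[of ?s] rn_Tl] by (simp add: numeral_2_eq_2)
 have 2: "rn (FComp FTl FHd) ?s (enc x) 2"
  using rn_Comp[OF rn_Tl[of ?s] rn_Hd] by (simp add: numeral_2_eq_2)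
 have 3: "rn (FPair FTl (FComp FHd FHd)) ?s (enc ((x, a), y)) 12"
  using rn_Pair[OF rn_Tl[of ?s] rn_Comp[OF rn_Hd[of ?s] rn_Hd]] by simp
 have b: "rn ?B ?s (Nd (enc l) (enc (x, f a y))) (d + 34)"
  using rn_Pair[OF 1 rn_Pair[OF 2 rn_Comp[OF 3 r]]] by (auto elim: rn_mono)
 have "rn (FWhile ?B) (Nd (enc l) (enc (x, f a y))) (Nd Lf (enc (x, foldl f (f a y) l)))
   (length l * (d + 40) + 2)"
 proof (rule Cons.IH)
  fix ys z zs assume "l = ys @ z # zs"
  then show "rn F (enc ((x, foldl f (f a y) ys), z)) (enc (f (foldl f (f a y) ys) z)) d"
   using Cons.prems[of "y # ys" z zs] by simp
 qed
 from rn_While[OF _ b this] show ?case by (auto elim: rn_mono)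
qed

text \<open>The cost of one step depends on the accumulator, so it is bounded by \<open>D x\<close>
  only for the accumulators that really occur.\<close>

lemma ctime_foldl:
 assumes l: "ctime l \<tau>" and a: "ctime a \<tau>"
  and f: "ctime (%p. f (fst (fst p)) (snd (fst p)) (snd p)) \<sigma>"
  and b: "\<And>x ys y zs. l x = ys @ y # zs ==> \<sigma> ((x, foldl (f x) (a x) ys), y) \<le> D x"
  and D: "\<And>x. length (l x) * (D x + 1) \<le> B * (\<tau> x + 1)"
 shows "ctime (%x. foldl (f x) (a x) (l x)) \<tau>"
proof -
 obtain L c1 where L: "noask L" "\<And>x. rn L (enc x) (enc (l x)) (c1 * (\<tau> x + 1))"
  using l unfolding ctime_def by blast
 obtain I c2 where I: "noask I" "\<And>x. rn I (enc x) (enc (a x)) (c2 * (\<tau> x + 1))"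
  using a unfolding ctime_def by blast
 obtain F c3 where F: "noask F"
  "\<And>p. rn F (enc p) (enc (f (fst (fst p)) (snd (fst p)) (snd p))) (c3 * (\<sigma> p + 1))"
  using f unfolding ctime_def by blast
 let ?W = "FWhile (FPair (FComp FHd FTl) (FPair (FComp FTl FHd) (FComp (FPair FTl (FComp FHd FHd)) F)))"
 let ?P = "FComp (FPair L (FPair FId I)) (FComp ?W (FComp FTl FTl))"
 have "rn ?P (enc x) (enc (foldl (f x) (a x) (l x))) ((c1 + c2 + c3 * B + 40 * B + 22) * (\<tau> x + 1))" for x
 proof -
  have 1: "rn (FPair L (FPair FId I)) (enc x) (Nd (enc (l x)) (enc (x, a x)))
    (c1 * (\<tau> x + 1) + (c2 * (\<tau> x + 1) + 9) + 9)"
   using rn_Pair[OF L(2) rn_Pair[OF rn_Id I(2)]] by simp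
  have 2: "rn ?W (Nd (enc (l x)) (enc (x, a x))) (Nd Lf (enc (x, foldl (f x) (a x) (l x))))
    (length (l x) * (c3 * (D x + 1) + 40) + 2)"
  proof (rule rn_foldl)
   fix ys y zs assume l: "l x = ys @ y # zs"
   show "rn F (enc ((x, foldl (f x) (a x) ys), y)) (enc (f x (foldl (f x) (a x) ys) y)) (c3 * (D x + 1))"
    using F(2)[of "((x, foldl (f x) (a x) ys), y)"] b[OF l] by (auto elim: rn_mono)
  qed
  have 3: "rn (FComp FTl FTl) (Nd Lf (enc (x, foldl (f x) (a x) (l x)))) (enc (foldl (f x) (a x) (l x))) 2"
   using rn_Comp[OF rn_Tl[of "Nd Lf (enc (x, foldl (f x) (a x) (l x)))"] rn_Tl] by (simp add: numeral_2_eq_2)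
  have "length (l x) * (c3 * (D x + 1) + 40) \<le> (c3 + 40) * (length (l x) * (D x + 1))"
   by (simp add: algebra_simps)
  also have "\<dots> \<le> (c3 + 40) * (B * (\<tau> x + 1))"
   using D by (intro mult_le_mono2)
  finally have 4: "length (l x) * (c3 * (D x + 1) + 40) \<le> (c3 * B + 40 * B) * (\<tau> x + 1)"
   by (simp add: algebra_simps)
  have "(c1 + c2 + c3 * B + 40 * B + 22) * (\<tau> x + 1) = c1 * (\<tau> x + 1) + c2 * (\<tau> x + 1) +
    (c3 * B + 40 * B) * (\<tau> x + 1) + 22 * (\<tau> x + 1)" by (simp add: algebra_simps)
  moreover have "22 * (\<tau> x + 1) \<ge> 22" by simp
  ultimately have 5: "(c1 * (\<tau> x + 1) + (c2 * (\<tau> x + 1) + 9) + 9) + (length (l x) * (c3 * (D x + 1) + 40) + 2 + 2)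
    \<le> (c1 + c2 + c3 * B + 40 * B + 22) * (\<tau> x + 1)"
   using 4 by linarith
  show ?thesis by (rule rn_mono[OF rn_Comp[OF 1 rn_Comp[OF 2 3]] 5])
 qed
 then show ?thesis by (rule ctimeI[rotated]) (simp add: L I F)
qed

lemma ctime_foldl0:
 assumes "ctime l \<tau>" "ctime a \<tau>" "ctime (%p. f (fst (fst p)) (snd (fst p)) (snd p)) (%_. 0)"
  and "\<And>x. length (l x) \<le> B * (\<tau> x + 1)"
 shows "ctime (%x. foldl (f x) (a x) (l x)) \<tau>"
 by (rule ctime_foldl[OF assms(1-3), where D = "%_. 0" and B = B]) (use assms(4) in auto)

section \<open>Closure properties of polynomial time\<close>

definition pbound :: "('a::enc => nat) => bool" where
 "pbound h \<longleftrightarrow> (\<exists>k. \<forall>x. h x \<le> (es x + 1) ^ k)"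

lemma pbound_mono: "pbound h ==> (\<And>x. g x \<le> h x) ==> pbound g"
 unfolding pbound_def by (meson le_trans)

lemma es_power_mono: "k \<le> l ==> (es x + 1) ^ k \<le> (es x + 1) ^ l"
 by (rule power_increasing) auto

lemma pbound_const: "pbound (%_. c)"
proof -
 have "c \<le> (es x + 1) ^ c" for x :: "'a"
 proof -
  have "c \<le> 2 ^ c" by (simp add: less_imp_le)
  also have "\<dots> \<le> (es x + 1) ^ c" using es_pos[of x] by (intro power_mono) auto
  finally show ?thesis .
 qed
 then show ?thesis unfolding pbound_def by blast
qed

lemma pbound_es: "pbound es"
 unfolding pbound_def by (intro exI[of _ 1]) auto

lemma pbound_add:
 assumes "pbound g" "pbound h"
 shows "pbound (%x. g x + h x)"
proof -
 obtain k l where kl: "\<And>x. g x \<le> (es x + 1) ^ k" "\<And>x. h x \<le> (es x + 1) ^ l"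
  using assms unfolding pbound_def by blast
 have "g x + h x \<le> (es x + 1) ^ Suc (k + l)" for x
 proof -
  have "g x \<le> (es x + 1) ^ (k + l)" "h x \<le> (es x + 1) ^ (k + l)"
   using kl es_power_mono[of k "k + l" x] es_power_mono[of l "k + l" x] by (meson le_add1 le_add2 le_trans)+
  then have "g x + h x \<le> 2 * (es x + 1) ^ (k + l)" by linarith
  also have "\<dots> \<le> (es x + 1) ^ Suc (k + l)" using es_pos[of x] by simp
  finally show ?thesis .
 qed
 then show ?thesis unfolding pbound_def by blast
qed

lemma pbound_mult: "pbound g ==> pbound h ==> pbound (%x. g x * h x)"
 unfolding pbound_def by (metis mult_le_mono power_add)

lemma pbound_Suc: "pbound g ==> pbound (%x. Suc (g x))"
 using pbound_add[of g "%_. 1"] pbound_const[of 1] by simp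

lemma pbound_power: "pbound g ==> pbound (%x. g x ^ n)"
 by (induction n) (auto intro: pbound_mult pbound_const)

lemma pbound_comp:
 assumes "pbound h" "pbound (%x. es (f x))"
 shows "pbound (%x. h (f x))"
proof -
 obtain k where k: "\<And>x. h x \<le> (es x + 1) ^ k" using assms(1) unfolding pbound_def by blast
 have "pbound (%x. (es (f x) + 1) ^ k)"
  by (intro pbound_power pbound_add pbound_const assms)
 then show ?thesis by (rule pbound_mono) (rule k)
qed

lemmas pbound_intros = pbound_add pbound_mult pbound_Suc pbound_power pbound_const

text \<open>The size of the result is bounded separately: trees share subtrees, so a single
  instruction can double the size of the accumulator, and a time bound does not yield a polynomial
  bound on \<open>es\<close>. Composition uses both bounds.\<close>

definition poly :: "('a::enc => 'b::enc) => bool" where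
 "poly f \<longleftrightarrow> (\<exists>\<tau>. pbound \<tau> \<and> ctime f \<tau>) \<and> pbound (%x. es (f x))"

lemma polyI: "pbound \<tau> ==> ctime f \<tau> ==> pbound (%x. es (f x)) ==> poly f"
 unfolding poly_def by blast

lemma poly_es: "poly f ==> pbound (%x. es (f x))"
 unfolding poly_def by blast

lemma pbound_length: "poly l ==> pbound (%x. length (l x))"
 by (rule pbound_mono[OF poly_es]) (auto intro: length_le_es)

lemma poly_cast: "poly f ==> (\<And>x. enc (g x) = enc (f x)) ==> poly g"
 unfolding poly_def es_def using ctime_cast[of f _ g] by auto

lemma poly_const: "poly (%x. c)"
 by (rule polyI[OF pbound_const[of 0] ctime_const pbound_const])

lemma poly_id: "poly (%x. x)"
 by (rule polyI[OF pbound_const[of 0] ctime_id pbound_es])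

lemma poly_pair:
 assumes "poly f" "poly g"
 shows "poly (%x. (f x, g x))"
proof -
 obtain \<sigma> \<tau> where st: "pbound \<sigma>" "ctime f \<sigma>" "pbound \<tau>" "ctime g \<tau>"
  using assms unfolding poly_def by blast
 show ?thesis
 proof (rule polyI[OF pbound_add[OF st(1,3)]])
  show "ctime (%x. (f x, g x)) (%x. \<sigma> x + \<tau> x)"
   by (intro ctime_pair ctime_mono[OF st(2)] ctime_mono[OF st(4)]) auto
 qed (simp add: pbound_intros poly_es assms)
qed

lemma poly_comp:
 assumes "poly f" "poly g"
 shows "poly (%x. f (g x))"
proof -
 obtain \<sigma> \<tau> where st: "pbound \<sigma>" "ctime f \<sigma>" "pbound \<tau>" "ctime g \<tau>"
  using assms unfolding poly_def by blast
 have "pbound (%x. \<sigma> (g x))" by (rule pbound_comp[OF st(1) poly_es[OF assms(2)]])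
 from pbound_add[OF st(3) this] show ?thesis
 proof (rule polyI)
  show "ctime (%x. f (g x)) (%x. \<tau> x + \<sigma> (g x))"
   by (rule ctime_comp[OF ctime_mono[OF st(4)] st(2), where D = 1]) auto
 qed (rule pbound_comp[OF poly_es poly_es]; fact)
qed

lemma poly_if:
 assumes "poly b" "poly f" "poly g"
 shows "poly (%x. if b x then f x else g x)"
proof -
 obtain \<rho> \<sigma> \<tau> where st: "pbound \<sigma>" "ctime f \<sigma>" "pbound \<tau>" "ctime g \<tau>" "pbound \<rho>" "ctime b \<rho>"
  using assms unfolding poly_def by blast
 show ?thesis
 proof (rule polyI[OF pbound_add[OF st(5) pbound_add[OF st(1,3)]]])
  show "ctime (%x. if b x then f x else g x) (%x. \<rho> x + (\<sigma> x + \<tau> x))"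
   by (intro ctime_if ctime_mono[OF st(2)] ctime_mono[OF st(4)] ctime_mono[OF st(6)]) auto
  show "pbound (%x. es (if b x then f x else g x))"
   by (rule pbound_mono[OF pbound_add[OF poly_es[OF assms(2)] poly_es[OF assms(3)]]]) auto
 qed
qed

lemma poly_fst: "poly f ==> poly (%x. fst (f x))"
proof (rule poly_comp[where f = fst])
 show "poly (fst :: 'b \<times> 'c => 'b)"
  by (rule polyI[OF pbound_const[of 0] ctime_fst[OF ctime_id]])
   (rule pbound_mono[OF pbound_es], auto simp: es_def enc_prod_def)
qed

lemma poly_snd: "poly f ==> poly (%x. snd (f x))"
proof (rule poly_comp[where f = snd])
 show "poly (snd :: 'b \<times> 'c => 'c)"
  by (rule polyI[OF pbound_const[of 0] ctime_snd[OF ctime_id]])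
   (rule pbound_mono[OF pbound_es], auto simp: es_def enc_prod_def)
qed

lemma poly_Cons: "poly f ==> poly g ==> poly (%x. f x # g x)"
 by (rule poly_cast[OF poly_pair]) auto

lemma poly_Suc: "poly f ==> poly (%x. Suc (f x))"
 by (rule poly_cast[OF poly_pair[OF poly_const[of Lf]]]) auto

lemma poly_tl: "poly f ==> poly (%x. tl (f x))"
proof (rule poly_comp[where f = tl])
 have "es (tl x) \<le> es x" for x :: "'b list" by (cases x) auto
 then show "poly (tl :: 'b list => 'b list)"
  by (intro polyI[OF pbound_const[of 0] ctime_tl[OF ctime_id]] pbound_mono[OF pbound_es])
qed

lemma poly_null: "poly f ==> poly (%x. f x = [])"
proof (rule poly_comp[where f = "%x. x = []"])
 show "poly (%x :: 'b list. x = [])"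
  by (rule polyI[OF pbound_const[of 0] ctime_null[OF ctime_id]])
   (rule pbound_mono[OF pbound_const[of 3]], rule es_bool)
qed

lemma poly_case_list:
 assumes "poly l" "poly n" "poly (%p. c (fst p) (fst (snd p)) (snd (snd p)))"
 shows "poly (%x. case l x of [] => n x | y # ys => c x y ys)"
proof -
 obtain \<rho> \<sigma> \<tau> where st: "pbound \<rho>" "ctime l \<rho>" "pbound \<tau>" "ctime n \<tau>"
  "pbound \<sigma>" "ctime (%p. c (fst p) (fst (snd p)) (snd (snd p))) \<sigma>"
  using assms unfolding poly_def by blast
 obtain k where k: "\<And>x. \<sigma> x \<le> (es x + 1) ^ k" using st(5) unfolding pbound_def by blast
 define \<sigma>' where "\<sigma>' = (%x. (es x + es (l x) + 2) ^ k)"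
 have 1: "\<sigma> (x, (y, ys)) \<le> \<sigma>' x" if "l x = y # ys" for x y ys
  using le_trans[OF k, of "(x, (y, ys))"] that unfolding \<sigma>'_def
  by (simp add: power_mono)
 obtain k2 where k2: "\<And>p. es (c (fst p) (fst (snd p)) (snd (snd p))) \<le> (es p + 1) ^ k2"
  using poly_es[OF assms(3)] unfolding pbound_def by blast
 have 2: "es (c x y ys) \<le> (es x + es (l x) + 2) ^ k2" if "l x = y # ys" for x y ys
  using le_trans[OF k2, of "(x, (y, ys))"] that by (simp add: power_mono)
 have 3: "pbound \<sigma>'" unfolding \<sigma>'_def by (intro pbound_intros pbound_es poly_es assms)
 show ?thesis
 proof (rule polyI[OF pbound_add[OF st(1) pbound_add[OF st(3) 3]]])
  show "ctime (%x. case l x of [] => n x | y # ys => c x y ys) (%x. \<rho> x + (\<tau> x + \<sigma>' x))"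
  proof (rule ctime_case_list[OF ctime_mono[OF st(2)] ctime_mono[OF st(4)] st(6), where D = 1])
   fix x y ys assume "l x = y # ys"
   then show "\<sigma> (x, y, ys) \<le> 1 * (\<rho> x + (\<tau> x + \<sigma>' x) + 1)" using 1 by fastforce
  qed auto
  have "pbound (%x. es (n x) + (es x + es (l x) + 2) ^ k2)"
   by (intro pbound_intros pbound_es poly_es assms)
  then show "pbound (%x. es (case l x of [] => n x | y # ys => c x y ys))"
  proof (rule pbound_mono)
   fix x
   show "es (case l x of [] => n x | y # ys => c x y ys) \<le> es (n x) + (es x + es (l x) + 2) ^ k2"
    using 2[of x] by (cases "l x") (auto simp del: es_simps intro: trans_le_add2)
  qed
 qed
qed

text \<open>Iteration is where sizes could explode; hence a common polynomial bound \<open>B\<close>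
  on all intermediate accumulators is part of the hypotheses.\<close>

lemma poly_foldl:
 assumes l: "poly l" and a: "poly a"
  and f: "poly (%p. f (fst (fst p)) (snd (fst p)) (snd p))"
  and B: "pbound B" "\<And>x ys zs. l x = ys @ zs ==> es (foldl (f x) (a x) ys) \<le> B x"
 shows "poly (%x. foldl (f x) (a x) (l x))"
proof -
 obtain \<rho> \<sigma> \<tau> where st: "pbound \<rho>" "ctime l \<rho>" "pbound \<tau>" "ctime a \<tau>"
  "pbound \<sigma>" "ctime (%p. f (fst (fst p)) (snd (fst p)) (snd p)) \<sigma>"
  using assms unfolding poly_def by blast
 obtain k where k: "\<And>x. \<sigma> x \<le> (es x + 1) ^ k" using st(5) unfolding pbound_def by blast
 define D where "D = (%x. (es x + B x + es (l x) + 3) ^ k)"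
 have 1: "\<sigma> ((x, foldl (f x) (a x) ys), y) \<le> D x" if "l x = ys @ y # zs" for x ys y zs
 proof -
  have "es (foldl (f x) (a x) ys) \<le> B x" using B(2) that by blast
  moreover have "es y \<le> es (l x)" by (rule es_mem) (use that in simp)
  ultimately have "(es ((x, foldl (f x) (a x) ys), y) + 1) ^ k \<le> D x"
   unfolding D_def by (intro power_mono) auto
  then show ?thesis using k le_trans by blast
 qed
 have 3: "pbound D" unfolding D_def by (intro pbound_intros pbound_es poly_es assms)
 have "pbound (%x. \<rho> x + (\<tau> x + length (l x) * (D x + 1)))"
  by (intro pbound_intros pbound_length l st 3)
 then show ?thesis
 proof (rule polyI)
  show "ctime (%x. foldl (f x) (a x) (l x)) (%x. \<rho> x + (\<tau> x + length (l x) * (D x + 1)))"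
   by (rule ctime_foldl[OF ctime_mono[OF st(2)] ctime_mono[OF st(4)] st(6) 1, where B = 1]) auto
  show "pbound (%x. es (foldl (f x) (a x) (l x)))"
   by (rule pbound_mono[OF B(1)]) (use B(2)[where zs = "[]"] in auto)
 qed
qed

named_theorems poly_intros

lemmas [poly_intros] = poly_const poly_id poly_pair poly_fst poly_snd poly_if poly_Cons poly_Suc
 poly_tl poly_null poly_case_list

lemma poly2: "poly (%p. h (fst p) (snd p)) ==> poly f ==> poly g ==> poly (%x. h (f x) (g x))"
 using poly_comp[of "%p. h (fst p) (snd p)" "%x. (f x, g x)"] by (simp add: poly_pair)

lemma poly3: "poly (%p. h (fst p) (fst (snd p)) (snd (snd p))) ==> poly f ==> poly g ==> poly k ==>
  poly (%x. h (f x) (g x) (k x))"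
 using poly_comp[of "%p. h (fst p) (fst (snd p)) (snd (snd p))" "%x. (f x, g x, k x)"]
 by (simp add: poly_pair)

lemma poly_case_prod [poly_intros]:
 "poly (%x. f x (fst (g x)) (snd (g x))) ==> poly (%x. case g x of (a, b) => f x a b)"
 by (simp add: case_prod_beta)

lemma poly_not [poly_intros]: "poly f ==> poly (%x. \<not> f x)"
 by (rule poly_cast[OF poly_if[of f "%_. False" "%_. True"]]) (auto intro: poly_const)

lemma poly_conj [poly_intros]: "poly f ==> poly g ==> poly (%x. f x \<and> g x)"
 by (rule poly_cast[OF poly_if[of f g "%_. False"]]) (auto intro: poly_const)

lemma poly_disj [poly_intros]: "poly f ==> poly g ==> poly (%x. f x \<or> g x)"
 by (rule poly_cast[OF poly_if[of f "%_. True" g]]) (auto intro: poly_const)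

lemma poly_eq_bool [poly_intros]: "poly f ==> poly g ==> poly (%x. f x = (g x :: bool))"
 by (rule poly_cast[OF poly_if[of f g "%x. \<not> g x"]]) (auto intro: poly_not)

lemma foldl_rev_append: "foldl (%acc y. y # acc) a ys = rev ys @ a"
 by (induction ys arbitrary: a) auto

lemma poly_rev [poly_intros]:
 assumes "poly f"
 shows "poly (%x. rev (f x))"
proof -
 have "poly (%x. foldl (%acc y. y # acc) [] (f x))"
 proof (rule poly_foldl[where B = "%x. es (f x)"])
  fix x ys zs assume "f x = ys @ zs"
  then show "es (foldl (%acc y. y # acc) [] ys) \<le> es (f x)"
   using es_append[of ys zs] es_pos[of zs] by (simp add: foldl_rev_append)
 qed (intro poly_intros poly_es assms)+
 then show ?thesis by (simp add: foldl_rev_append)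
qed

lemma poly_append [poly_intros]:
 assumes "poly f" "poly g"
 shows "poly (%x. f x @ g x)"
proof -
 have "poly (%x. foldl (%acc y. y # acc) (g x) (rev (f x)))"
 proof (rule poly_foldl[where B = "%x. es (f x) + es (g x)"])
  fix x ys zs assume *: "rev (f x) = ys @ zs"
  have "es (rev (f x)) + 1 = es ys + es zs" unfolding * by (rule es_append)
  then have "es (f x) + 1 = es ys + es zs" by simp
  then show "es (foldl (%acc y. y # acc) (g x) ys) \<le> es (f x) + es (g x)"
   using es_append[of "rev ys" "g x"] es_pos[of zs] by (simp add: foldl_rev_append)
 qed (intro poly_intros poly_es assms pbound_intros)+
 then show ?thesis by (simp add: foldl_rev_append)
qed

lemma foldl_rev_map: "foldl (%acc y. f y # acc) a ys = rev (map f ys) @ a"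
 by (induction ys arbitrary: a) auto

lemma poly_map [poly_intros]:
 assumes l: "poly l" and f: "poly (%p. f (fst p) (snd p))"
 shows "poly (%x. map (%y. f x y) (l x))"
proof -
 obtain k where k: "\<And>p. es (f (fst p) (snd p)) \<le> (es p + 1) ^ k"
  using poly_es[OF f] unfolding pbound_def by blast
 define B where "B = (%x. (es x + es (l x) + 2) ^ k)"
 have B: "es (f x y) \<le> B x" if "y \<in> set (l x)" for x y
 proof -
  have "(es (x, y) + 1) ^ k \<le> B x"
   unfolding B_def using es_mem[OF that] by (intro power_mono) auto
  then show ?thesis using k[of "(x, y)"] by simp
 qed
 have 1: "pbound (%x. es (l x) * (B x + 1) + 1)"
  unfolding B_def by (intro pbound_intros poly_es l pbound_es)
 have f': "poly (%p. f (fst (fst p)) (snd p))"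
  using poly2[OF f poly_fst[OF poly_fst[OF poly_id]] poly_snd[OF poly_id]] .
 have "poly (%x. foldl (%acc y. f x y # acc) [] (l x))"
 proof (rule poly_foldl[OF l poly_const _ 1])
  show "poly (%p. f (fst (fst p)) (snd p) # snd (fst p))"
   using f' by (intro poly_intros)
  fix x ys zs assume l: "l x = ys @ zs"
  then have "es (map (f x) ys) \<le> length ys * (B x + 1) + 1"
   by (intro le_trans[OF es_list_le[where b = "B x"]]) (auto intro: B)
  also have "length ys * (B x + 1) \<le> es (l x) * (B x + 1)"
   using length_le_es[of "l x"] l by (intro mult_le_mono1) auto
  finally show "es (foldl (%acc y. f x y # acc) [] ys) \<le> es (l x) * (B x + 1) + 1"
   by (simp add: foldl_rev_map)
 qed
 then have "poly (%x. rev (foldl (%acc y. f x y # acc) [] (l x)))" by (rule poly_rev)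
 then show ?thesis by (simp add: foldl_rev_map)
qed

lemma foldl_append_concat: "foldl (%acc y. acc @ y) a ys = a @ concat ys"
 by (induction ys arbitrary: a) auto

lemma es_concat: "es (concat l) \<le> es l"
proof (induction l)
 case (Cons a l)
 then show ?case using es_append[of a "concat l"] by simp
qed simp

lemma poly_concat [poly_intros]:
 assumes "poly l"
 shows "poly (%x. concat (l x))"
proof -
 have "poly (%x. foldl (%acc y. acc @ y) [] (l x))"
 proof (rule poly_foldl[where B = "%x. es (l x)"])
  fix x ys zs assume *: "l x = ys @ zs"
  show "es (foldl (%acc y. acc @ y) [] ys) \<le> es (l x)"
   using es_concat[of ys] es_append[of ys zs] es_pos[of zs] * by (simp add: foldl_append_concat)
 qed (intro poly_intros poly_es assms)+
 then show ?thesis by (simp add: foldl_append_concat)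
qed

lemma poly_filter [poly_intros]:
 assumes l: "poly l" and f: "poly (%p. P (fst p) (snd p))"
 shows "poly (%x. filter (%y. P x y) (l x))"
proof -
 have "poly (%x. concat (map (%y. if P x y then [y] else []) (l x)))"
  by (intro poly_intros l f)
 moreover have "concat (map (%y. if Q y then [y] else []) ys) = filter Q ys" for Q and ys :: "'b list"
  by (induction ys) auto
 ultimately show ?thesis by simp
qed

lemma poly_ex [poly_intros]:
 assumes "poly l" "poly (%p. P (fst p) (snd p))"
 shows "poly (%x. \<exists>y\<in>set (l x). P x y)"
proof -
 have "poly (%x. \<not> (filter (%y. P x y) (l x) = []))" by (intro poly_intros assms)
 then show ?thesis by (simp add: filter_empty_conv Bex_def)
qed

lemma poly_all [poly_intros]:
 assumes "poly l" "poly (%p. P (fst p) (snd p))"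
 shows "poly (%x. \<forall>y\<in>set (l x). P x y)"
proof -
 have "poly (%x. \<not> (\<exists>y\<in>set (l x). \<not> P x y))" by (intro poly_intros assms)
 then show ?thesis by simp
qed

lemma poly_units: "poly f ==> poly (%x. replicate (f x) Lf)"
 by (rule poly_cast) (auto simp: enc_replicate_Lf)

lemma poly_replicate [poly_intros]:
 assumes "poly f" "poly g"
 shows "poly (%x. replicate (f x) (g x))"
proof -
 have "poly (%x. map (%_. g x) (replicate (f x) Lf))"
  by (intro poly_map poly_units assms poly_comp[OF assms(2)] poly_intros)
 then show ?thesis by (simp add: map_replicate)
qed

lemma poly_length [poly_intros]:
 assumes "poly f"
 shows "poly (%x. length (f x))"
proof (rule poly_cast)
 show "poly (%x. map (%_. Lf) (f x))" by (intro poly_intros assms)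
 show "enc (length (f x)) = enc (map (%_. Lf) (f x))" for x
  by (induction "f x" arbitrary: x) (auto simp flip: enc_replicate_Lf simp: map_replicate_const)
qed

lemma poly_plus [poly_intros]:
 assumes "poly f" "poly g"
 shows "poly (%x. f x + g x :: nat)"
proof -
 have "poly (%x. length (replicate (f x) Lf @ replicate (g x) Lf))"
  by (intro poly_intros assms)
 then show ?thesis by simp
qed

lemma poly_times [poly_intros]:
 assumes "poly f" "poly g"
 shows "poly (%x. f x * g x :: nat)"
proof -
 have "poly (%x. length (concat (replicate (f x) (replicate (g x) Lf))))"
  by (intro poly_intros assms)
 moreover have "length (concat (replicate m (replicate n Lf))) = m * n" for m n
  by (induction m) auto
 ultimately show ?thesis by simp
qed

lemma foldl_tl: "foldl (%acc y. tl acc) a ys = drop (length ys) a"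
 by (induction ys arbitrary: a) (auto simp: drop_Suc)

lemma es_drop: "es (drop n l) \<le> es l"
proof (induction l arbitrary: n)
 case (Cons a l)
 then show ?case by (cases n) (auto simp: trans_le_add2 le_SucI)
qed simp

lemma poly_drop [poly_intros]:
 assumes "poly f" "poly g"
 shows "poly (%x. drop (f x) (g x))"
proof -
 have "poly (%x. foldl (%acc y. tl acc) (g x) (replicate (f x) Lf))"
 proof (rule poly_foldl[where B = "%x. es (g x)"])
  show "es (foldl (%acc y. tl acc) (g x) ys) \<le> es (g x)" for x ys
   by (simp add: foldl_tl es_drop)
 qed (intro poly_intros poly_es assms)+
 then show ?thesis by (simp add: foldl_tl)
qed

lemma poly_minus [poly_intros]:
 assumes "poly f" "poly g"
 shows "poly (%x. f x - g x :: nat)"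
proof -
 have "poly (%x. length (drop (g x) (replicate (f x) Lf)))"
  by (intro poly_intros assms)
 then show ?thesis by simp
qed

lemma poly_take [poly_intros]:
 assumes "poly f" "poly g"
 shows "poly (%x. take (f x) (g x))"
proof -
 have "poly (%x. rev (drop (length (g x) - f x) (rev (g x))))"
  by (intro poly_intros assms)
 moreover have "rev (drop (length l - n) (rev l)) = take n l" for n and l :: "'b list"
  by (cases "n \<le> length l") (auto simp: rev_drop)
 ultimately show ?thesis by simp
qed

lemma poly_le [poly_intros]:
 assumes "poly f" "poly g"
 shows "poly (%x. f x \<le> (g x :: nat))"
proof -
 have "poly (%x. drop (g x) (replicate (f x) Lf) = [])"
  by (intro poly_intros assms)
 then show ?thesis by simp
qed

lemma poly_less [poly_intros]:
 assumes "poly f" "poly g"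
 shows "poly (%x. f x < (g x :: nat))"
 using poly_le[OF poly_Suc[OF assms(1)] assms(2)] by (simp add: Suc_le_eq)

lemma poly_eq_nat [poly_intros]:
 assumes "poly f" "poly g"
 shows "poly (%x. f x = (g x :: nat))"
proof -
 have "poly (%x. f x \<le> g x \<and> g x \<le> f x)"
  by (intro poly_intros assms)
 then show ?thesis by (simp add: order.eq_iff)
qed

lemma es_upt: "es [0..<n] \<le> n * (2 * n + 2) + 1"
 using es_list_le[of "[0..<n]" "2 * n + 1"] by auto

lemma poly_upt [poly_intros]:
 assumes "poly f"
 shows "poly (%x. [0..<f x])"
proof -
 have 1: "foldl (%acc y. acc @ [length acc]) [] ys = [0..<length ys]" for ys :: "tree list"
  by (induction ys rule: rev_induct) auto
 have "poly (%x. foldl (%acc y. acc @ [length acc]) [] (replicate (f x) Lf))"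
 proof (rule poly_foldl[where B = "%x. f x * (2 * f x + 2) + 1"])
  have "pbound (%x. f x)"
   by (rule pbound_mono[OF poly_es[OF assms]]) simp
  then show "pbound (%x. f x * (2 * f x + 2) + 1)" by (intro pbound_intros)
  fix x and ys zs :: "tree list" assume "replicate (f x) Lf = ys @ zs"
  then have "length (replicate (f x) Lf) = length (ys @ zs)" by (rule arg_cong)
  then have "length ys \<le> f x" by simp
  then have "length ys * (2 * length ys + 2) + 1 \<le> f x * (2 * f x + 2) + 1"
   by (intro add_mono mult_mono) auto
  then show "es (foldl (%acc y. acc @ [length acc]) [] ys) \<le> f x * (2 * f x + 2) + 1"
   using es_upt[of "length ys"] unfolding 1 by linarith
 qed (intro poly_intros assms)+
 then show ?thesis by (simp add: 1)
qed

lemma es_take: "es (take n l) \<le> es l"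
proof (induction l arbitrary: n)
 case (Cons a l)
 then show ?case by (cases n) (auto simp: trans_le_add2 le_SucI)
qed simp

lemma foldl_zip: "length xs \<le> length ys ==> foldl (%acc y. case fst acc of [] => acc | z # zs => (zs, (y, z) # snd acc))
  (ys, a) xs = (drop (length xs) ys, rev (zip xs ys) @ a)"
proof (induction xs arbitrary: ys a)
 case (Cons x xs)
 then show ?case by (cases ys) auto
qed simp

lemma es_zip: "es (zip xs ys) \<le> 2 * (es xs + es ys)"
proof (induction xs arbitrary: ys)
 case (Cons x xs)
 show ?case
 proof (cases ys)
  case (Cons y ys')
  then show ?thesis using Cons.IH[of ys'] by auto
 qed simp
qed simp

lemma poly_zip [poly_intros]:
 assumes "poly f" "poly g"
 shows "poly (%x. zip (f x) (g x))"
proof -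
 let ?f = "%acc y. case fst acc of [] => acc | z # zs => (zs, (y, z) # snd acc)"
 have "poly (%x. foldl ?f (g x, []) (take (length (g x)) (f x)))"
 proof (rule poly_foldl[where B = "%x. es (g x) + 2 * (es (f x) + es (g x)) + 1"])
  fix x ys zs assume *: "take (length (g x)) (f x) = ys @ zs"
  have "length (take (length (g x)) (f x)) = length ys + length zs" unfolding * by simp
  then have 1: "length ys \<le> length (g x)" by simp
  have "es (take (length (g x)) (f x)) + 1 = es ys + es zs" unfolding * by (rule es_append)
  then have "es ys \<le> es (f x)"
   using es_take[of "length (g x)" "f x"] es_pos[of zs] by linarith
  then show "es (foldl ?f (g x, []) ys) \<le> es (g x) + 2 * (es (f x) + es (g x)) + 1"
   using es_zip[of ys "g x"] es_drop[of "length ys" "g x"] by (simp add: foldl_zip[OF 1])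
 qed (intro poly_intros poly_es assms pbound_intros)+
 then have "poly (%x. rev (snd (foldl ?f (g x, []) (take (length (g x)) (f x)))))"
  by (intro poly_intros)
 moreover have "zip (take (length b) a) b = zip a b" for a :: "'b list" and b :: "'c list"
 proof (induction a arbitrary: b)
  case (Cons x a)
  then show ?case by (cases b) auto
 qed simp
 ultimately show ?thesis by (simp add: foldl_zip)
qed

lemma list_eq_iff_zip: "xs = ys \<longleftrightarrow> length xs = length ys \<and> (\<forall>p\<in>set (zip xs ys). fst p = snd p)"
proof (induction xs arbitrary: ys)
 case (Cons a xs)
 then show ?case by (cases ys) auto
qed auto

lemma poly_eq_bits [poly_intros]:
 fixes f g :: "'a::enc => bool list"
 assumes "poly f" "poly g"
 shows "poly (%x. f x = g x)"
 unfolding list_eq_iff_zip by (intro poly_intros assms)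

lemma poly_Let [poly_intros]:
 assumes "poly g" "poly (%p. f (fst p) (snd p))"
 shows "poly (%x. let y = g x in f x y)"
 using poly2[OF assms(2) poly_id assms(1)] by simp

lemma poly_thd [poly_intros]: "poly f ==> poly (%x. thd (f x))"
proof (rule poly_comp[where f = thd])
 have "es (thd x) \<le> es x" for x by (cases x) (auto simp: es_def)
 then show "poly thd"
  by (intro polyI[OF pbound_const[of 0] ctime_thd] pbound_mono[OF pbound_es])
qed

lemma poly_ttl [poly_intros]: "poly f ==> poly (%x. ttl (f x))"
proof (rule poly_comp[where f = ttl])
 have "es (ttl x) \<le> es x" for x by (cases x) (auto simp: es_def)
 then show "poly ttl"
  by (intro polyI[OF pbound_const[of 0] ctime_ttl] pbound_mono[OF pbound_es])
qed

lemma poly_Nd [poly_intros]: "poly f ==> poly g ==> poly (%x. Nd (f x) (g x))"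
 by (rule poly_cast[OF poly_pair[of f g]]) auto

section \<open>Simulating a random access machine on trees\<close>

text \<open>Least significant bit first and without leading zeros: 0 is the empty list, equality of
  numbers is equality of lists, and \<open>nb a\<close> can serve as the path to cell
  \<open>a\<close> in a trie.\<close>

fun nb :: "nat => bits" where
 "nb n = (if n = 0 then [] else odd n # nb (n div 2))"

declare nb.simps [simp del]

primrec bval :: "bits => nat" where
 "bval [] = 0"
| "bval (b # bs) = of_bool b + 2 * bval bs"

lemma nb_0 [simp]: "nb 0 = []"
 by (simp add: nb.simps)

lemma bval_nb [simp]: "bval (nb n) = n"
proof (induction n rule: nb.induct)
 case (1 n)
 then show ?case by (subst nb.simps) auto
qed

lemma nb_inj [simp]: "nb m = nb n \<longleftrightarrow> m = n"
 by (metis bval_nb)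

lemma nb_Nil_iff [simp]: "nb n = [] \<longleftrightarrow> n = 0"
 using nb_inj[of n 0] by simp

lemma nb_double: "m \<noteq> 0 \<or> b ==> nb (of_bool b + 2 * m) = b # nb m"
 by (subst nb.simps) auto

lemma length_nb: "length (nb n) = floorlog 2 n"
proof (induction n rule: nb.induct)
 case (1 n)
 then show ?case by (subst nb.simps) (simp add: compute_floorlog)
qed

lemma length_nb_le: "length (nb n) \<le> bit_cost n"
 by (simp add: length_nb bit_cost_def)

lemma bit_cost_pos: "bit_cost n \<ge> 1"
 by (simp add: bit_cost_def)

lemma bval_less: "bval bs < 2 ^ length bs"
 by (induction bs) (auto simp: of_bool_def)

lemma bval_append: "bval (as @ bs) = bval as + 2 ^ length as * bval bs"
 by (induction as) (auto simp: algebra_simps)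

lemma nb_canonical: "nb n = [] \<or> last (nb n)"
proof (induction n rule: nb.induct)
 case (1 n)
 then show ?case by (subst (1 2) nb.simps) (auto simp: odd_pos)
qed

text \<open>Numbers are produced most significant bit first, then reversed and stripped.\<close>

definition strip :: "bits => bits" where
 "strip ds = foldl (%acc b. if acc = [] \<and> \<not> b then [] else b # acc) [] ds"

lemma strip_eq: "strip ds = nb (bval (rev ds))"
proof -
 have "foldl (%acc b. if acc = [] \<and> \<not> b then [] else b # acc) (nb n) ds = nb (bval (rev ds) + 2 ^ length ds * n)" for n
 proof (induction ds arbitrary: n)
  case (Cons b ds)
  have "(if nb n = [] \<and> \<not> b then [] else b # nb n) = nb (of_bool b + 2 * n)"
   by (auto simp: nb_double[symmetric])
  then show ?case using Cons by (simp add: bval_append algebra_simps del: nb_Nil_iff)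
 qed simp
 from this[of 0] show ?thesis by (simp add: strip_def)
qed

text \<open>A state consists of the rest of the second operand, the carry, and the digits found so
  far, the latest in front.\<close>

definition add1 :: "bits \<times> bool \<times> bits => bool => bits \<times> bool \<times> bits" where
 "add1 st x = (case fst st of
    [] => ([], x \<and> fst (snd st), (x \<noteq> fst (snd st)) # snd (snd st))
   | y # ys => (ys, (x \<and> y) \<or> (x \<and> fst (snd st)) \<or> (y \<and> fst (snd st)), (x \<noteq> (y \<noteq> fst (snd st))) # snd (snd st)))"

lemma add1_foldl:
 "foldl add1 (b, c, ds) a = (b', c', ds') ==> \<exists>d. ds' = rev d @ ds \<and> length d = length a \<and> b' = drop (length a) b \<and>
   bval a + bval (take (length a) b) + of_bool c = bval d + 2 ^ length a * of_bool c'"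
proof (induction a arbitrary: b c ds)
 case (Cons x a)
 obtain b1 c1 d1 where s: "add1 (b, c, ds) x = (b1, c1, d1 # ds)" "b1 = tl b"
  "of_bool x + of_bool (b \<noteq> [] \<and> hd b) + of_bool c = of_bool d1 + (2::nat) * of_bool c1"
  by (cases b) (auto simp: add1_def)
 then obtain d where d: "ds' = rev d @ d1 # ds" "length d = length a" "b' = drop (length a) b1"
   "bval a + bval (take (length a) b1) + of_bool c1 = bval d + 2 ^ length a * of_bool c'"
  using Cons by fastforce
 have "bval (take (length (x # a)) b) = of_bool (b \<noteq> [] \<and> hd b) + 2 * bval (take (length a) b1)"
  using s(2) by (cases b) auto
 then have "bval (x # a) + bval (take (length (x # a)) b) + of_bool c = bval (d1 # d) + 2 ^ length (x # a) * of_bool c'"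
  using d(4) s(3) by (simp add: algebra_simps)
 then show ?case using d s(2) by (intro exI[of _ "d1 # d"]) (auto simp: drop_Suc)
qed simp

text \<open>The first pass runs along \<open>a\<close>; the second runs along what is left of
  \<open>b\<close>, with an exhausted partner, to propagate the carry. The digits arrive most
  significant first, as \<open>strip\<close> expects them.\<close>

definition badd :: "bits => bits => bits" where
 "badd a b = (let s = foldl add1 (b, False, []) a; s' = foldl add1 ([], snd s) (fst s)
   in strip (if fst (snd s') then True # snd (snd s') else snd (snd s')))"

lemma badd_eq: "badd a b = nb (bval a + bval b)"
proof -
 obtain b' c d where s: "foldl add1 (b, False, []) a = (b', c, d)" by (metis prod_cases3)
 obtain b'' c' d' where s': "foldl add1 ([], c, d) b' = (b'', c', d')" by (metis prod_cases3)
 have 1: "length d = length a" "b' = drop (length a) b"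
   "bval a + bval (take (length a) b) = bval (rev d) + 2 ^ length a * of_bool c"
  using add1_foldl[OF s] by auto
 obtain e where 2: "d' = rev e @ d" "length e = length b'"
  "bval b' + of_bool c = bval e + 2 ^ length b' * of_bool c'"
  using add1_foldl[OF s'] by auto
 have "bval b = bval (take (length a) b @ b')" using 1(2) by simp
 also have "\<dots> = bval (take (length a) b) + 2 ^ length a * bval b'"
  unfolding bval_append using 1(2) by (cases "length a \<le> length b") (auto simp: min_def)
 finally have "bval a + bval b = bval (rev d) + 2 ^ length a * of_bool c + 2 ^ length a * bval b'"
  using 1(3) by linarith
 also have "\<dots> = bval (rev d) + 2 ^ length a * (bval b' + of_bool c)" by (simp only: distrib_left add_ac)
 finally have "bval a + bval b = bval (rev d) + 2 ^ length a * (bval e + 2 ^ length b' * of_bool c')"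
  unfolding 2(3) .
 then have "bval (rev (if c' then True # d' else d')) = bval a + bval b"
  using 1(1) 2 by (simp add: bval_append)
 then show ?thesis by (auto simp: badd_def s s' strip_eq Let_def)
qed

definition sub1 :: "bits \<times> bool \<times> bits => bool => bits \<times> bool \<times> bits" where
 "sub1 st x = (case fst st of
    [] => ([], \<not> x \<and> fst (snd st), (x \<noteq> fst (snd st)) # snd (snd st))
   | y # ys => (ys, (\<not> x \<and> y) \<or> (\<not> x \<and> fst (snd st)) \<or> (y \<and> fst (snd st)), (x \<noteq> (y \<noteq> fst (snd st))) # snd (snd st)))"

lemma sub1_foldl:
 "foldl sub1 (b, c, ds) a = (b', c', ds') ==> \<exists>d. ds' = rev d @ ds \<and> length d = length a \<and> b' = drop (length a) b \<and>
   bval a + 2 ^ length a * of_bool c' = bval d + bval (take (length a) b) + of_bool c"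
proof (induction a arbitrary: b c ds)
 case (Cons x a)
 obtain b1 c1 d1 where s: "sub1 (b, c, ds) x = (b1, c1, d1 # ds)" "b1 = tl b"
  "of_bool x + (2::nat) * of_bool c1 = of_bool d1 + of_bool (b \<noteq> [] \<and> hd b) + of_bool c"
  by (cases b) (auto simp: sub1_def)
 then obtain d where d: "ds' = rev d @ d1 # ds" "length d = length a" "b' = drop (length a) b1"
   "bval a + 2 ^ length a * of_bool c' = bval d + bval (take (length a) b1) + of_bool c1"
  using Cons by fastforce
 have "bval (take (length (x # a)) b) = of_bool (b \<noteq> [] \<and> hd b) + 2 * bval (take (length a) b1)"
  using s(2) by (cases b) auto
 then have "bval (x # a) + 2 ^ length (x # a) * of_bool c' = bval (d1 # d) + bval (take (length (x # a)) b) + of_bool c"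
  using d(4) s(3) by (simp add: algebra_simps)
 then show ?case using d s(2) by (intro exI[of _ "d1 # d"]) (auto simp: drop_Suc)
qed simp

definition bsub :: "bits => bits => bits" where
 "bsub a b = (let s = foldl sub1 (b, False, []) a
   in if fst s = [] \<and> \<not> fst (snd s) then strip (snd (snd s)) else [])"

lemma bval_pos: "bs \<noteq> [] ==> last bs ==> bval bs \<ge> 1"
 by (induction bs) (auto split: if_splits)

text \<open>A difference is truncated to 0 when digits of \<open>b\<close> remain or a borrow is
  left over. Leading zeros of \<open>b\<close> would also remain and be mistaken for an excess,
  hence the canonical form.\<close>

lemma bsub_eq:
 assumes "b = [] \<or> last b"
 shows "bsub a b = nb (bval a - bval b)"
proof -
 obtain b' c d where s: "foldl sub1 (b, False, []) a = (b', c, d)" by (metis prod_cases3)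
 have 1: "length d = length a" "b' = drop (length a) b"
   "bval a + 2 ^ length a * of_bool c = bval (rev d) + bval (take (length a) b)"
  using sub1_foldl[OF s] by auto
 have "bval b = bval (take (length a) b @ b')" using 1(2) by simp
 also have "\<dots> = bval (take (length a) b) + 2 ^ length a * bval b'"
  unfolding bval_append using 1(2) by (cases "length a \<le> length b") (auto simp: min_def)
 finally have b: "bval b = bval (take (length a) b) + 2 ^ length a * bval b'" .
 show ?thesis
 proof (cases "b' = [] \<and> \<not> c")
  case True
  have "bval b = bval (take (length a) b)" by (subst b) (simp add: True)
  moreover have "bval a = bval (rev d) + bval (take (length a) b)" using 1(3) True by simp
  ultimately have "bval (rev d) = bval a - bval b" by linarith
  then show ?thesis using True by (simp add: bsub_def s strip_eq)
 next
  case False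
  \<comment> \<open>Either a borrow is left, or \<open>b\<close> has more digits than
    \<open>a\<close> and, its top digit being 1, is at least \<open>2 ^ length a\<close>.\<close>
  have "bval a \<le> bval b"
  proof (cases "b' = []")
   case True
   then have c using False by simp
   have "bval b = bval (take (length a) b)" by (subst b) (simp add: True)
   moreover have "bval a + 2 ^ length a = bval (rev d) + bval (take (length a) b)" using 1(3) \<open>c\<close> by simp
   moreover have "bval (rev d) < 2 ^ length a" using bval_less[of "rev d"] 1(1) by simp
   ultimately show ?thesis by linarith
  next
   case False
   then have "length a < length b" using 1(2) by simp
   then have "last b'" using assms 1(2) by auto
   then have "bval b' \<ge> 1" using bval_pos False by blast
   then have "bval b \<ge> 2 ^ length a" using b by (metis le_add2 mult_le_mono2 mult_numeral_1_right numeral_One order_trans)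
   then show ?thesis using bval_less[of a] by simp
  qed
  then show ?thesis using False by (auto simp: bsub_def s)
 qed
qed

lemmas ctime_basic = ctime_const ctime_id ctime_pair ctime_fst ctime_snd ctime_if ctime_Cons ctime_tl ctime_null

lemma ctime_not: "ctime f \<tau> ==> ctime (%x. \<not> f x) \<tau>"
 by (rule ctime_cast[OF ctime_if[of f _ "%_. False" "%_. True"]]) (auto intro: ctime_const)

lemma ctime_conj: "ctime f \<tau> ==> ctime g \<tau> ==> ctime (%x. f x \<and> g x) \<tau>"
 by (rule ctime_cast[OF ctime_if[of f _ g "%_. False"]]) (auto intro: ctime_const)

lemma ctime_disj: "ctime f \<tau> ==> ctime g \<tau> ==> ctime (%x. f x \<or> g x) \<tau>"
 by (rule ctime_cast[OF ctime_if[of f _ "%_. True" g]]) (auto intro: ctime_const)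

lemma ctime_eq_bool: "ctime f \<tau> ==> ctime g \<tau> ==> ctime (%x. f x = (g x :: bool)) \<tau>"
 by (rule ctime_cast[OF ctime_if[of f _ g "%x. \<not> g x"]]) (auto intro: ctime_not)

lemma ctime_case_list0:
 "ctime l (%_. 0) ==> ctime n (%_. 0) ==> ctime (%p. c (fst p) (fst (snd p)) (snd (snd p))) (%_. 0) ==>
  ctime (%x. case l x of [] => n x | y # ys => c x y ys) (%_. 0)"
 by (rule ctime_case_list[where D = 0]) auto

lemmas ctime_intros = ctime_basic ctime_not ctime_conj ctime_disj ctime_eq_bool ctime_case_list0

lemma ctime_add1: "ctime (%p. add1 (fst p) (snd p)) (%_. 0)"
 unfolding add1_def by (intro ctime_intros)

lemma ctime_sub1: "ctime (%p. sub1 (fst p) (snd p)) (%_. 0)"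
 unfolding sub1_def by (intro ctime_intros)

lemma ctime_fold_add1:
 "ctime (%p. foldl add1 (fst p) (snd p)) (%p. length (snd p))"
 using ctime_comp0[OF _ ctime_add1, of "%p. (snd (fst p), snd p)" "%_. 0"]
 by (intro ctime_foldl0[where B = 1] ctime_intros) (simp_all add: ctime_intros)

lemma ctime_fold_sub1:
 "ctime (%p. foldl sub1 (fst p) (snd p)) (%p. length (snd p))"
 using ctime_comp0[OF _ ctime_sub1, of "%p. (snd (fst p), snd p)" "%_. 0"]
 by (intro ctime_foldl0[where B = 1] ctime_intros) (simp_all add: ctime_intros)

lemma ctime_strip: "ctime strip length"
 unfolding strip_def by (rule ctime_foldl0[where B = 1]) (intro ctime_intros | simp)+

lemma add1_length: "foldl add1 s a = (b', c', ds') ==> length b' \<le> length (fst s) \<and> length ds' = length a + length (snd (snd s))"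
 using add1_foldl[of "fst s" "fst (snd s)" "snd (snd s)" a] by auto

lemma ctime_badd: "ctime (%p. badd (fst p) (snd p)) (%p. length (fst p) + length (snd p))"
proof -
 let ?t = "%p :: bits \<times> bits. length (fst p) + length (snd p)"
 let ?s = "%p. foldl add1 (snd p, False, []) (fst p)"
 have s: "ctime ?s ?t"
  using ctime_comp[of "%p :: bits \<times> bits. ((snd p, False, [] :: bits), fst p)" ?t, OF _ ctime_fold_add1, where D = 1]
  by (simp add: ctime_intros)
 let ?s2 = "%p. foldl add1 ([], snd (?s p)) (fst (?s p))"
 have l: "length (fst (?s p)) \<le> length (snd p)" "length (snd (snd (?s p))) = length (fst p)" for p
  using add1_length[of "(snd p, False, [])" "fst p"] by (metis fst_conv snd_conv prod.collapse list.size(3) add.right_neutral)+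
 have s2: "ctime ?s2 ?t"
  using ctime_comp[of "%p. (([] :: bits, snd (?s p)), fst (?s p))" ?t, OF _ ctime_fold_add1, where D = 1] l
  by (simp add: ctime_intros s le_SucI trans_le_add2)
 have l2: "length (snd (snd (?s2 p))) \<le> length (fst p) + length (snd p)" for p
  using add1_length[of "([], snd (?s p))" "fst (?s p)"] l[of p] by (metis fst_conv snd_conv prod.collapse add.commute add_le_mono order_refl)
 have "ctime (%p. strip (if fst (snd (?s2 p)) then True # snd (snd (?s2 p)) else snd (snd (?s2 p)))) ?t"
 proof (rule ctime_comp[OF _ ctime_strip, where D = 1])
  show "ctime (%p. if fst (snd (?s2 p)) then True # snd (snd (?s2 p)) else snd (snd (?s2 p))) ?t"
   by (intro ctime_intros s2)
  show "length (if fst (snd (?s2 p)) then True # snd (snd (?s2 p)) else snd (snd (?s2 p))) \<le> 1 * (?t p + 1)" for p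
   using l2[of p] by (auto simp: le_SucI)
 qed
 then show ?thesis by (simp add: badd_def Let_def)
qed

lemma sub1_length: "foldl sub1 s a = (b', c', ds') ==> length ds' = length a + length (snd (snd s))"
 using sub1_foldl[of "fst s" "fst (snd s)" "snd (snd s)" a] by auto

lemma ctime_bsub: "ctime (%p. bsub (fst p) (snd p)) (%p. length (fst p) + length (snd p))"
proof -
 let ?t = "%p :: bits \<times> bits. length (fst p) + length (snd p)"
 let ?s = "%p. foldl sub1 (snd p, False, []) (fst p)"
 have s: "ctime ?s ?t"
  using ctime_comp[of "%p :: bits \<times> bits. ((snd p, False, [] :: bits), fst p)" ?t, OF _ ctime_fold_sub1, where D = 1]
  by (simp add: ctime_intros)
 have l: "length (snd (snd (?s p))) = length (fst p)" for p
  using sub1_length[of "(snd p, False, [])" "fst p"] by (metis snd_conv prod.collapse list.size(3) add.right_neutral)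
 have "ctime (%p. strip (snd (snd (?s p)))) ?t"
  by (rule ctime_comp[OF _ ctime_strip, where D = 1]) (auto intro!: ctime_intros s simp: l)
 then have "ctime (%p. if fst (?s p) = [] \<and> \<not> fst (snd (?s p)) then strip (snd (snd (?s p))) else []) ?t"
  by (intro ctime_intros s)
 then show ?thesis by (simp add: bsub_def Let_def)
qed

section \<open>Memory as a binary trie\<close>

datatype trie = TE | TN bits trie trie

instantiation trie :: enc
begin
primrec enc_trie :: "trie => tree" where
 "enc_trie TE = Lf"
| "enc_trie (TN v l r) = Nd (enc v) (Nd (enc_trie l) (enc_trie r))"
instance ..
end

primrec tval :: "trie => bits" where
 "tval TE = []"
| "tval (TN v l r) = v"

primrec tchild :: "bool => trie => trie" where
 "tchild b TE = TE"
| "tchild b (TN v l r) = (if b then r else l)"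

definition tget :: "bits => trie => bits" where
 "tget bs t = tval (foldl (%t b. tchild b t) t bs)"

definition tupd :: "bool => trie => trie => trie" where
 "tupd b new old = TN (tval old) (if b then tchild False old else new) (if b then new else tchild True old)"

definition tput :: "bits => trie => trie" where
 "tput v t = TN v (tchild False t) (tchild True t)"

text \<open>The descent records the visited nodes, so that an update can be rebuilt by a second loop
  going up; both are folds, the form of recursion for which time bounds are available.\<close>

definition tdown :: "bits => trie => trie \<times> (bool \<times> trie) list" where
 "tdown bs t = foldl (%s b. (tchild b (fst s), (b, fst s) # snd s)) (t, []) bs"

definition tset :: "bits => bits => trie => trie" where
 "tset bs v t = foldl (%new p. tupd (fst p) new (snd p)) (tput v (fst (tdown bs t))) (snd (tdown bs t))"

lemma tdown_gen: "foldl (%s b. (tchild b (fst s), (b, fst s) # snd s)) (t, ps) bs =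
  (fst (tdown bs t), snd (tdown bs t) @ ps)"
proof (induction bs arbitrary: t ps)
 case (Cons b bs)
 show ?case unfolding tdown_def by (simp add: Cons)
qed (simp add: tdown_def)

lemma tset_simps [simp]:
 "tset [] v t = tput v t"
 "tset (b # bs) v t = tupd b (tset bs v (tchild b t)) t"
proof -
 have "tdown (b # bs) t = (fst (tdown bs (tchild b t)), snd (tdown bs (tchild b t)) @ [(b, t)])"
  using tdown_gen[of "tchild b t" "[(b, t)]" bs] by (simp add: tdown_def)
 then show "tset (b # bs) v t = tupd b (tset bs v (tchild b t)) t"
  by (simp add: tset_def)
qed (simp add: tset_def tdown_def)

lemma tget_simps [simp]:
 "tget [] t = tval t"
 "tget (b # bs) t = tget bs (tchild b t)"
 by (simp_all add: tget_def)

lemma tget_tset: "tget bs' (tset bs v t) = (if bs' = bs then v else tget bs' t)"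
proof (induction bs arbitrary: bs' t)
 case Nil
 then show ?case by (cases bs') (auto simp: tput_def)
next
 case (Cons b bs)
 then show ?case by (cases bs') (auto simp: tupd_def)
qed

lemma tget_TE [simp]: "tget bs TE = []"
 by (induction bs) auto

lemma ctime_TN:
 assumes "ctime f \<tau>" "ctime g \<tau>" "ctime h \<tau>"
 shows "ctime (%x. TN (f x) (g x) (h x)) \<tau>"
 by (rule ctime_cast[OF ctime_pair[OF assms(1) ctime_pair[OF assms(2,3)]]]) simp

lemma ctime_tval: "ctime f \<tau> ==> ctime (%x. tval (f x)) \<tau>"
proof (erule ctime_comp0)
 have "rn FHd (enc x) (enc (tval x)) (1 * (0 + 1))" for x
  using rn_Hd[of "enc x"] by (cases x) simp_all
 then show "ctime tval (%_. 0)"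
  by (intro ctimeI[of FHd]) auto
qed

lemma ctime_tchild_const: "ctime f \<tau> ==> ctime (%x. tchild b (f x)) \<tau>"
proof (erule ctime_comp0)
 show "ctime (tchild b) (%_. 0)"
 proof (cases b)
  case True
  have "rn (FComp FTl FTl) (enc x) (enc (tchild b x)) (2 * (0 + 1))" for x
   using rn_Comp[OF rn_Tl[of "enc x"] rn_Tl] True by (cases x) (simp_all add: numeral_2_eq_2)
  then show ?thesis by (rule ctimeI[rotated]) simp
 next
  case False
  have "rn (FComp FTl FHd) (enc x) (enc (tchild b x)) (2 * (0 + 1))" for x
   using rn_Comp[OF rn_Tl[of "enc x"] rn_Hd] False by (cases x) (simp_all add: numeral_2_eq_2)
  then show ?thesis by (rule ctimeI[rotated]) simp
 qed
qed

lemma ctime_tchild: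
 assumes "ctime f \<tau>" "ctime g \<tau>"
 shows "ctime (%x. tchild (g x) (f x)) \<tau>"
 by (rule ctime_cast[OF ctime_if[OF assms(2) ctime_tchild_const[OF assms(1), of True] ctime_tchild_const[OF assms(1), of False]]])
  auto

lemmas trie_intros = ctime_intros ctime_TN ctime_tval ctime_tchild

lemma ctime_tget: "ctime (%p. tget (fst p) (snd p)) (%p. length (fst p))"
 unfolding tget_def
 by (intro ctime_tval ctime_foldl0[where B = 1] trie_intros) simp

lemma ctime_tdown: "ctime (%p. tdown (fst p) (snd p)) (%p. length (fst p))"
 unfolding tdown_def
 by (intro ctime_foldl0[where B = 1] trie_intros) simp

lemma length_tdown: "length (snd (tdown bs t)) = length bs"
proof (induction bs arbitrary: t)
 case (Cons b bs)
 have "tdown (b # bs) t = (fst (tdown bs (tchild b t)), snd (tdown bs (tchild b t)) @ [(b, t)])"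
  using tdown_gen[of "tchild b t" "[(b, t)]" bs] by (simp add: tdown_def)
 then show ?case using Cons by simp
qed (simp add: tdown_def)

lemma ctime_tset: "ctime (%p. tset (fst p) (fst (snd p)) (snd (snd p))) (%p. length (fst p))"
proof -
 have d: "ctime (%p :: bits \<times> bits \<times> trie. tdown (fst p) (snd (snd p))) (%p. length (fst p))"
  using ctime_comp[of "%p :: bits \<times> bits \<times> trie. (fst p, snd (snd p))" "%p. length (fst p)", OF _ ctime_tdown, where D = 1]
  by (simp add: ctime_intros)
 show ?thesis
  unfolding tset_def tupd_def tput_def
  by (intro ctime_foldl0[where B = 1] trie_intros d) (simp add: length_tdown)
qed

text \<open>Each branch has its own bound, compared with the total only under its condition. A
  dispatch over instructions is thus charged just for the instruction that is executed.\<close>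

lemma ctime_if2:
 assumes "ctime b \<tau>" "ctime f \<sigma>" "ctime g \<rho>"
  "\<And>x. b x ==> \<sigma> x \<le> D * (\<tau> x + 1)" "\<And>x. \<not> b x ==> \<rho> x \<le> D * (\<tau> x + 1)"
 shows "ctime (%x. if b x then f x else g x) \<tau>"
proof -
 obtain F C G H B E where F: "noask F" "\<And>x. rn F (enc x) (enc (f x)) (C * (\<sigma> x + 1))"
  "noask G" "\<And>x. rn G (enc x) (enc (g x)) (H * (\<rho> x + 1))"
  "noask B" "\<And>x. rn B (enc x) (enc (b x)) (E * (\<tau> x + 1))"
  using assms unfolding ctime_def by metis
 have "rn (FIf B F G) (enc x) (enc (if b x then f x else g x)) ((E + (C + H) * (D + 1) + 6) * (\<tau> x + 1))" for x
 proof (rule rn_mono[OF rn_If[OF F(6)]])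
  have 1: "(C + H) * (D * (\<tau> x + 1) + 1) \<le> (C + H) * (D + 1) * (\<tau> x + 1)"
   by (simp add: algebra_simps)
  show "rn F (enc x) (enc (if b x then f x else g x)) ((C + H) * (D + 1) * (\<tau> x + 1))" if "enc (b x) \<noteq> Lf"
  proof -
   have b: "b x" using that by simp
   have "C * (\<sigma> x + 1) \<le> (C + H) * (D * (\<tau> x + 1) + 1)"
    using assms(4)[OF b] by (intro mult_le_mono) auto
   then show ?thesis using b 1 by (auto intro!: rn_mono[OF F(2)[of x]] elim: le_trans)
  qed
  show "rn G (enc x) (enc (if b x then f x else g x)) ((C + H) * (D + 1) * (\<tau> x + 1))" if "enc (b x) = Lf"
  proof -
   have b: "\<not> b x" using that by simp
   have "H * (\<rho> x + 1) \<le> (C + H) * (D * (\<tau> x + 1) + 1)"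
    using assms(5)[OF b] by (intro mult_le_mono) auto
   then show ?thesis using b 1 by (auto intro!: rn_mono[OF F(4)[of x]] elim: le_trans)
  qed
 qed (simp add: algebra_simps)
 then show ?thesis by (rule ctimeI[rotated]) (simp add: F)
qed

lemma ctime_eq_const: "ctime f \<tau> ==> ctime (%x. f x = (c :: nat)) \<tau>"
proof (erule ctime_comp0)
 show "ctime (%n. n = c) (%_. 0)"
 proof (induction c)
  case 0
  have "ctime (%n. replicate n Lf = []) (%_. 0)"
   by (intro ctime_null ctime_cast[OF ctime_id]) (rule enc_replicate_Lf)
  then show ?case by simp
 next
  case (Suc c)
  have 0: "ctime (%n. replicate n Lf = []) (%_. 0)"
   by (intro ctime_null ctime_cast[OF ctime_id]) (rule enc_replicate_Lf)
  have p: "ctime (%n. n - 1 :: nat) (%_. 0)"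
  proof -
   have "rn FTl (enc n) (enc (n - 1)) (1 * (0 + 1))" for n :: nat
    using rn_Tl[of "enc n"] by (cases n) auto
   then show ?thesis by (rule ctimeI[rotated]) simp
  qed
  have "ctime (%n. if replicate n Lf = [] then False else n - 1 = c) (%_. 0)"
   by (intro ctime_intros 0 ctime_comp0[OF p Suc])
  moreover have "enc (n = Suc c) = enc (if replicate n Lf = [] then False else n - 1 = c)" for n
   by (cases n) auto
  ultimately show ?case by (rule ctime_cast)
 qed
qed

text \<open>The program counter is shifted by one: 0 means that the machine has halted.\<close>

type_synonym rstate = "nat \<times> trie \<times> trie"

definition pcode :: "ram => nat => nat" where
 "pcode P pc = (if pc < length P then Suc pc else 0)"

text \<open>A query is answered by 0, which is right for the empty oracle. An empty entry of the
  input trie means a position beyond the end, where \<open>Read\<close> returns 2, in binary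
  \<open>[False, True]\<close>.\<close>

fun iput :: "instr => trie \<times> trie => trie" where
 "iput (Const r k) (it, m) = tset (nb r) (nb k) m"
| "iput (Add r s t) (it, m) = tset (nb r) (badd (tget (nb s) m) (tget (nb t) m)) m"
| "iput (Sub r s t) (it, m) = tset (nb r) (bsub (tget (nb s) m) (tget (nb t) m)) m"
| "iput (Load r s) (it, m) = tset (nb r) (tget (tget (nb s) m) m) m"
| "iput (Store r s) (it, m) = tset (tget (nb r) m) (tget (nb s) m) m"
| "iput (Read r s) (it, m) = tset (nb r)
   (case tget (tget (nb s) m) it of [] => [False, True] | b # _ => if b then [True] else []) m"
| "iput (Append s) (it, m) = m"
| "iput (Query r) (it, m) = tset (nb r) [] m"
| "iput (JumpZero r l) (it, m) = m"

lemma iput_eqs: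
 "iput (Const r k) p = tset (nb r) (nb k) (snd p)"
 "iput (Add r s t) p = tset (nb r) (badd (tget (nb s) (snd p)) (tget (nb t) (snd p))) (snd p)"
 "iput (Sub r s t) p = tset (nb r) (bsub (tget (nb s) (snd p)) (tget (nb t) (snd p))) (snd p)"
 "iput (Load r s) p = tset (nb r) (tget (tget (nb s) (snd p)) (snd p)) (snd p)"
 "iput (Store r s) p = tset (tget (nb r) (snd p)) (tget (nb s) (snd p)) (snd p)"
 "iput (Read r s) p = tset (nb r)
   (case tget (tget (nb s) (snd p)) (fst p) of [] => [False, True] | b # _ => if b then [True] else []) (snd p)"
 "iput (Append s) p = snd p"
 "iput (Query r) p = tset (nb r) [] (snd p)"
 "iput (JumpZero r l) p = snd p"
 by (cases p; simp)+

fun ijump :: "ram => instr => nat => trie => nat" where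
 "ijump P (JumpZero r l) pc m = (if tget (nb r) m = [] then pcode P l else pcode P (Suc pc))"
| "ijump P _ pc m = pcode P (Suc pc)"

fun icost :: "instr => trie => nat" where
 "icost (Add r s t) m = length (tget (nb s) m) + length (tget (nb t) m)"
| "icost (Sub r s t) m = length (tget (nb s) m) + length (tget (nb t) m)"
| "icost (Load r s) m = length (tget (nb s) m)"
| "icost (Store r s) m = length (tget (nb r) m)"
| "icost (Read r s) m = length (tget (nb s) m)"
| "icost _ m = 0"

lemma ctime_tget_const: "ctime f \<tau> ==> ctime (%x. tget bs (f x)) \<tau>"
 using ctime_comp[of "%x. (bs, f x)" \<tau>, OF _ ctime_tget, where D = "length bs"]
 by (simp add: ctime_intros)

lemma ctime_tset_const:
 assumes "ctime f \<tau>" "ctime g \<tau>"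
 shows "ctime (%x. tset bs (g x) (f x)) \<tau>"
 using ctime_comp[of "%x. (bs, g x, f x)" \<tau>, OF _ ctime_tset, where D = "length bs"] assms
 by (simp add: ctime_intros)

lemma ctime_iput: "ctime (%p. iput ins p) (%p. icost ins (snd p))"
proof (cases ins)
 case (Const r k)
 have "ctime (%p :: trie \<times> trie. tset (nb r) (nb k) (snd p)) (%_. 0)"
  by (intro ctime_tset_const ctime_intros)
 then show ?thesis unfolding Const by (simp add: iput_eqs)
next
 case (Add r s t)
 let ?t = "%p :: trie \<times> trie. length (tget (nb s) (snd p)) + length (tget (nb t) (snd p))"
 have "ctime (%p :: trie \<times> trie. badd (tget (nb s) (snd p)) (tget (nb t) (snd p))) ?t"
  using ctime_comp[of "%p. (tget (nb s) (snd p), tget (nb t) (snd p))" ?t, OF _ ctime_badd, where D = 1]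
  by (simp add: ctime_intros ctime_tget_const)
 then have "ctime (%p :: trie \<times> trie. tset (nb r) (badd (tget (nb s) (snd p)) (tget (nb t) (snd p))) (snd p)) ?t"
  by (intro ctime_tset_const ctime_intros)
 then show ?thesis unfolding Add by (simp add: iput_eqs)
next
 case (Sub r s t)
 let ?t = "%p :: trie \<times> trie. length (tget (nb s) (snd p)) + length (tget (nb t) (snd p))"
 have "ctime (%p :: trie \<times> trie. bsub (tget (nb s) (snd p)) (tget (nb t) (snd p))) ?t"
  using ctime_comp[of "%p. (tget (nb s) (snd p), tget (nb t) (snd p))" ?t, OF _ ctime_bsub, where D = 1]
  by (simp add: ctime_intros ctime_tget_const)
 then have "ctime (%p :: trie \<times> trie. tset (nb r) (bsub (tget (nb s) (snd p)) (tget (nb t) (snd p))) (snd p)) ?t"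
  by (intro ctime_tset_const ctime_intros)
 then show ?thesis unfolding Sub by (simp add: iput_eqs)
next
 case (Load r s)
 let ?t = "%p :: trie \<times> trie. length (tget (nb s) (snd p))"
 have "ctime (%p :: trie \<times> trie. tget (tget (nb s) (snd p)) (snd p)) ?t"
  using ctime_comp[of "%p. (tget (nb s) (snd p), snd p)" ?t, OF _ ctime_tget, where D = 1]
  by (simp add: ctime_intros ctime_tget_const)
 then have "ctime (%p :: trie \<times> trie. tset (nb r) (tget (tget (nb s) (snd p)) (snd p)) (snd p)) ?t"
  by (intro ctime_tset_const ctime_intros)
 then show ?thesis unfolding Load by (simp add: iput_eqs)
next
 case (Store r s)
 let ?t = "%p :: trie \<times> trie. length (tget (nb r) (snd p))"
 have "ctime (%p :: trie \<times> trie. tset (tget (nb r) (snd p)) (tget (nb s) (snd p)) (snd p)) ?t"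
  using ctime_comp[of "%p. (tget (nb r) (snd p), tget (nb s) (snd p), snd p)" ?t, OF _ ctime_tset, where D = 1]
  by (simp add: ctime_intros ctime_tget_const)
 then show ?thesis unfolding Store by (simp add: iput_eqs)
next
 case (Read r s)
 let ?t = "%p :: trie \<times> trie. length (tget (nb s) (snd p))"
 have 1: "ctime (%p :: trie \<times> trie. tget (tget (nb s) (snd p)) (fst p)) ?t"
  using ctime_comp[of "%p. (tget (nb s) (snd p), fst p)" ?t, OF _ ctime_tget, where D = 1]
  by (simp add: ctime_intros ctime_tget_const)
 have "ctime (%v. case v of [] => [False, True] | b # _ => if b then [True] else []) (%_. 0)"
  by (intro ctime_intros)
 from ctime_comp0[OF 1 this]
 have "ctime (%p :: trie \<times> trie. tset (nb r) (case tget (tget (nb s) (snd p)) (fst p) of [] => [False, True]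
   | b # _ => if b then [True] else []) (snd p)) ?t"
  by (intro ctime_tset_const ctime_intros)
 then show ?thesis unfolding Read by (simp add: iput_eqs)
next
 case (Query r)
 have "ctime (%p :: trie \<times> trie. tset (nb r) [] (snd p)) (%_. 0)"
  by (intro ctime_tset_const ctime_intros)
 then show ?thesis unfolding Query by (simp add: iput_eqs)
next
 case (Append s)
 have "ctime (%p :: trie \<times> trie. snd p) (%_. 0)"
  by (intro ctime_intros)
 then show ?thesis unfolding Append by (simp add: iput_eqs)
next
 case (JumpZero r l)
 have "ctime (%p :: trie \<times> trie. snd p) (%_. 0)"
  by (intro ctime_intros)
 then show ?thesis unfolding JumpZero by (simp add: iput_eqs)
qed

lemma ctime_ijump: "ctime (%p. ijump P ins pc (snd p)) \<tau>"
proof (cases ins)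
 case (JumpZero r l)
 then show ?thesis by (auto intro!: ctime_intros ctime_tget_const)
qed (auto intro: ctime_const)

definition rcost :: "ram => rstate => nat" where
 "rcost P s = (if fst s = 0 \<or> length P < fst s then 0 else icost (P ! (fst s - 1)) (snd (snd s)))"

definition rstep :: "ram => rstate => rstate" where
 "rstep P s = (if fst s = 0 \<or> length P < fst s then s
   else (let ins = P ! (fst s - 1) in
    (ijump P ins (fst s - 1) (snd (snd s)), fst (snd s), iput ins (snd s))))"

text \<open>The program is fixed, so fetching an instruction is a chain of comparisons with
  constants. The induction adds one program position at a time to this chain.\<close>

lemma ctime_rstep: "ctime (rstep P) (rcost P)"
proof -
 define T where "T = (%n (s :: rstate). if fst s = 0 \<or> n < fst s then 0 else icost (P ! (fst s - 1)) (snd (snd s)))"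
 define R where "R = (%n s. if fst s = 0 \<or> n < fst s then s
   else (let ins = P ! (fst s - 1) in
    (ijump P ins (fst s - 1) (snd (snd s)), fst (snd s), iput ins (snd s))))"
 have "ctime (R n) (T n)" for n
 proof (induction n)
  case 0
  have "R 0 = (%s. s)" by (auto simp: R_def)
  then show ?case by (simp add: ctime_id)
 next
  case (Suc n)
  let ?f = "%s :: rstate. (ijump P (P ! n) n (snd (snd s)), fst (snd s), iput (P ! n) (snd s))"
  have f: "ctime ?f (%s. icost (P ! n) (snd (snd s)))"
  proof (intro ctime_intros)
   show "ctime (%s :: rstate. ijump P (P ! n) n (snd (snd s))) (%s. icost (P ! n) (snd (snd s)))"
    using ctime_comp0[OF ctime_snd[OF ctime_id] ctime_ijump] .
   show "ctime (%s :: rstate. iput (P ! n) (snd s)) (%s. icost (P ! n) (snd (snd s)))"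
    by (rule ctime_comp[OF ctime_snd[OF ctime_id] ctime_iput, where D = 1]) simp
  qed
  have "ctime (%s. if fst s = Suc n then ?f s else R n s) (T (Suc n))"
   by (rule ctime_if2[OF ctime_eq_const[OF ctime_fst[OF ctime_id]] f Suc, where D = 1])
    (auto simp: T_def)
  moreover have "R (Suc n) = (%s. if fst s = Suc n then ?f s else R n s)"
   by (auto simp: R_def Let_def fun_eq_iff)
  ultimately show ?case by simp
 qed
 moreover have "R (length P) = rstep P" "T (length P) = rcost P"
  by (auto simp: R_def rstep_def T_def rcost_def fun_eq_iff)
 ultimately show ?thesis by metis
qed

text \<open>An absent path reads as the empty list, that is, as 0; so the empty trie represents the
  initial memory.\<close>

definition mrel :: "(nat => nat) => trie => bool" where
 "mrel M m \<longleftrightarrow> (\<forall>a. tget (nb a) m = nb (M a))"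

definition irel :: "bits => trie => bool" where
 "irel x it \<longleftrightarrow> (\<forall>a. tget (nb a) it = (if a < length x then [x ! a] else []))"

lemma mrel_tset: "mrel M m ==> mrel (M(r := k)) (tset (nb r) (nb k) m)"
 by (auto simp: mrel_def tget_tset)

lemma nb_small: "nb (Suc 0) = [True]" "nb 2 = [False, True]"
 by (simp_all add: nb.simps)

lemma iput_step:
 assumes m: "mrel M m" and i: "irel x it" and s: "step_instr {} x ins (pc, M, q) = (pc', M', q')"
 shows "mrel M' (iput ins (it, m)) \<and> ijump P ins pc m = pcode P pc' \<and> icost ins m \<le> cost_instr ins M"
proof -
 have g: "tget (nb a) m = nb (M a)" for a using m by (simp add: mrel_def)
 note l = length_nb_le
 show ?thesis
 proof (cases ins)
  case (Const r k)
  then show ?thesis using s mrel_tset[OF m] by auto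
 next
  case (Add r s t)
  then show ?thesis using assms(3) mrel_tset[OF m] l add_mono[OF l[of "M s"] l[of "M t"]] by (auto simp: g badd_eq)
 next
  case (Sub r s t)
  then show ?thesis using assms(3) mrel_tset[OF m] l add_mono[OF l[of "M s"] l[of "M t"]] nb_canonical[of "M t"]
   by (auto simp: g bsub_eq simp del: nb_Nil_iff)
 next
  case (Load r s)
  then show ?thesis using assms(3) mrel_tset[OF m] l[of "M s"] by (auto simp: g)
 next
  case (Store r s)
  then show ?thesis using assms(3) mrel_tset[OF m] l[of "M r"] by (auto simp: g)
 next
  case (Read r s)
  have 1: "tget (nb (M s)) it = (if M s < length x then [x ! M s] else [])"
   using i by (simp add: irel_def)
  have "(case tget (nb (M s)) it of [] => [False, True] | b # _ => if b then [True] else []) =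
   nb (if M s < length x then of_bool (x ! M s) else 2)"
   unfolding 1 by (auto simp: nb_small)
  moreover have "M' = M(r := if M s < length x then of_bool (x ! M s) else 2)" "pc' = Suc pc"
   using Read assms(3) by auto
  ultimately show ?thesis using Read mrel_tset[OF m] l[of "M s"] by (simp add: g)
 next
  case (Append s)
  then show ?thesis using assms by auto
 next
  case (Query r)
  then show ?thesis using assms(3) mrel_tset[OF m, of r 0] by auto
 next
  case (JumpZero r l)
  then show ?thesis using assms by (auto simp: g)
 qed
qed

lemma cost_instr_pos: "cost_instr ins M \<ge> 1"
 using bit_cost_pos by (cases ins) (auto intro: trans_le_add1)

text \<open>The overhead is a constant factor: walking along an address or adding digits takes time
  linear in their number, and this number is what the logarithmic cost measure charges. The constant
  part of a step is paid by the minimal cost 1.\<close>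

lemma exec_sim:
 assumes F: "\<And>s. rn F (enc s) (enc (rstep P s)) (C * (rcost P s + 1))"
  and i: "irel x it"
 shows "exec P {} x c v t ==> c = (pc, M, q) ==> mrel M m ==>
  \<exists>m'. rn (FWhile F) (enc (pcode P pc, it, m)) (enc (0 :: nat, it, m')) ((2 * C + 4) * t + 2) \<and> tget [] m' = nb v"
proof (induction arbitrary: pc M q m rule: exec.induct)
 case (halt pc' M' q')
 then have h: "pcode P pc = 0" "mrel M m" "M' 0 = M 0" by (auto simp: pcode_def)
 have "tget (nb 0) m = nb (M 0)" using h(2) unfolding mrel_def by blast
 then have "tget [] m = nb (M' 0)" using h(3) by simp
 moreover have "rn (FWhile F) (enc (0 :: nat, it, m)) (enc (0 :: nat, it, m)) 2"
  by (rule rn_While_end) simp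
 then have "rn (FWhile F) (enc (pcode P pc, it, m)) (enc (0 :: nat, it, m)) ((2 * C + 4) * 0 + 2)"
  unfolding h(1) by (rule rn_mono) simp
 ultimately show ?case by blast
next
 case (step pc0 M0 q0 v t)
 then have eq: "pc0 = pc" "M0 = M" "q0 = q" by auto
 let ?ins = "P ! pc"
 obtain pc' M' q' where s: "step_instr {} x ?ins (pc, M, q) = (pc', M', q')" by (metis prod_cases3)
 note ist = iput_step[OF step.prems(2) i s, of P]
 let ?m = "iput ?ins (it, m)"
 obtain m' where m': "rn (FWhile F) (enc (pcode P pc', it, ?m)) (enc (0 :: nat, it, m')) ((2 * C + 4) * t + 2)"
  "tget [] m' = nb v"
  using step.IH[of pc' M' q' ?m] s ist eq by auto
 have pc: "pc < length P" using step.hyps eq by simp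
 then have 1: "rstep P (pcode P pc, it, m) = (pcode P pc', it, ?m)" "rcost P (pcode P pc, it, m) = icost ?ins m"
  using ist by (auto simp: rstep_def rcost_def pcode_def Let_def)
 have "rn F (enc (pcode P pc, it, m)) (enc (pcode P pc', it, ?m)) (C * (icost ?ins m + 1))"
  using F[of "(pcode P pc, it, m)"] unfolding 1 .
 moreover have "thd (enc (pcode P pc, it, m)) \<noteq> Lf" using pc by (simp add: pcode_def)
 ultimately have 2: "rn (FWhile F) (enc (pcode P pc, it, m)) (enc (0 :: nat, it, m'))
   (C * (icost ?ins m + 1) + ((2 * C + 4) * t + 2) + 4)"
  using m'(1) rn_While by blast
 have "icost ?ins m + 1 \<le> 2 * cost_instr ?ins M" using ist cost_instr_pos[of ?ins M] by simp
 then have "C * (icost ?ins m + 1) \<le> C * (2 * cost_instr ?ins M)" by (rule mult_le_mono2)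
 moreover have "4 \<le> 4 * cost_instr ?ins M" using cost_instr_pos[of ?ins M] by simp
 ultimately have "C * (icost ?ins m + 1) + ((2 * C + 4) * t + 2) + 4 \<le> (2 * C + 4) * (cost_instr ?ins M + t) + 2"
  by (simp add: algebra_simps)
 from rn_mono[OF 2 this] show ?case using m'(2) eq by blast
qed

section \<open>Binary numbers and tries within polynomial time\<close>

lemma poly_bits_binary:
 assumes "ctime (%p. h (fst p) (snd p)) (%p. length (fst p) + length (snd p))"
  "\<And>a b. length (h a b) \<le> length a + length b + 1"
 shows "poly (%p :: bits \<times> bits. h (fst p) (snd p) :: bits)"
proof (rule polyI[OF _ assms(1)])
 show "pbound (%p :: bits \<times> bits. length (fst p) + length (snd p))"
  by (intro pbound_intros pbound_length poly_intros)
 have "pbound (%p :: bits \<times> bits. (length (fst p) + length (snd p) + 1) * 4 + 1)"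
  by (intro pbound_intros pbound_length poly_intros)
 then show "pbound (%p :: bits \<times> bits. es (h (fst p) (snd p)))"
 proof (rule pbound_mono)
  fix p :: "bits \<times> bits"
  have "es (h (fst p) (snd p)) \<le> length (h (fst p) (snd p)) * (3 + 1) + 1"
   by (rule es_list_le) (rule es_bool)
  also have "\<dots> \<le> (length (fst p) + length (snd p) + 1) * 4 + 1"
   using assms(2)[of "fst p" "snd p"] by simp
  finally show "es (h (fst p) (snd p)) \<le> (length (fst p) + length (snd p) + 1) * 4 + 1" .
 qed
qed

lemma length_nb_bound: "n < 2 ^ k ==> length (nb n) \<le> k"
proof (induction k arbitrary: n)
 case (Suc k)
 then have "n div 2 < 2 ^ k" by simp
 then show ?case using Suc.IH[of "n div 2"] by (subst nb.simps) auto
qed simp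

lemma poly_badd [poly_intros]: "poly f ==> poly g ==> poly (%x. badd (f x) (g x))"
proof (rule poly2[OF poly_bits_binary[OF ctime_badd]])
 fix a b
 have "bval a < 2 ^ (length a + length b)" "bval b < 2 ^ (length a + length b)"
  using bval_less[of a] bval_less[of b]
  by (meson le_add1 le_add2 less_le_trans one_le_numeral power_increasing)+
 then have "bval a + bval b < 2 ^ (length a + length b + 1)" by simp
 then show "length (badd a b) \<le> length a + length b + 1"
  unfolding badd_eq by (rule length_nb_bound)
qed

lemma length_nb_le_self: "length (nb n) \<le> n"
 by (rule length_nb_bound) simp

lemma es_nb: "es (nb n) \<le> 4 * n + 1"
 using es_list_le[of "nb n" 3] es_bool length_nb_le_self[of n] by fastforce

lemma poly_nb [poly_intros]:
 assumes "poly f"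
 shows "poly (%x. nb (f x))"
proof -
 have 1: "foldl (%acc y. badd [True] acc) [] ys = nb (length ys)" for ys :: "tree list"
  by (induction ys rule: rev_induct) (auto simp: badd_eq)
 have "poly (%x. foldl (%acc y. badd [True] acc) [] (replicate (f x) Lf))"
 proof (rule poly_foldl[where B = "%x. 4 * f x + 1"])
  have "pbound (%x. f x)"
   by (rule pbound_mono[OF poly_es[OF assms]]) simp
  then show "pbound (%x. 4 * f x + 1)" by (intro pbound_intros)
  fix x and ys zs :: "tree list" assume "replicate (f x) Lf = ys @ zs"
  then have "length (replicate (f x) Lf) = length (ys @ zs)" by (rule arg_cong)
  then show "es (foldl (%acc y. badd [True] acc) [] ys) \<le> 4 * f x + 1"
   using es_nb[of "length ys"] by (simp add: 1)
 qed (intro poly_intros assms)+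
 then show ?thesis by (simp add: 1)
qed

lemma es_trie_simps [simp]: "es TE = 1" "es (TN v l r) = 2 + es v + es l + es r"
 by (simp_all add: es_def)

lemma es_tset: "es (tset bs v t) \<le> es t + es v + 5 * length bs + 5"
proof (induction bs arbitrary: t)
 case Nil
 then show ?case by (cases t) (auto simp: tput_def)
next
 case (Cons b bs)
 show ?case using Cons[of "tchild b t"] by (cases t; cases b) (auto simp: tupd_def)
qed

definition itrie :: "bits => nat \<times> trie" where
 "itrie x = foldl (%s b. (Suc (fst s), tset (nb (fst s)) [b] (snd s))) (0, TE) x"

lemma itrie_snoc: "itrie (x @ [b]) = (Suc (fst (itrie x)), tset (nb (fst (itrie x))) [b] (snd (itrie x)))"
 by (simp add: itrie_def)

lemma irel_itrie: "fst (itrie x) = length x \<and> irel x (snd (itrie x))"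
proof (induction x rule: rev_induct)
 case Nil
 then show ?case by (simp add: itrie_def irel_def)
next
 case (snoc b x)
 then show ?case by (auto simp: itrie_snoc irel_def tget_tset nth_append)
qed

lemma es_itrie: "es (itrie x) \<le> (length x + 1) * (5 * length x + 20)"
proof -
 have "es (snd (itrie x)) \<le> length x * (5 * length x + 10) + 1"
 proof (induction x rule: rev_induct)
  case Nil
  then show ?case by (simp add: itrie_def)
 next
  case (snoc b x)
  have "es (snd (itrie (x @ [b]))) \<le> es (snd (itrie x)) + es [b] + 5 * length (nb (length x)) + 5"
   using es_tset[of "nb (length x)" "[b]" "snd (itrie x)"] irel_itrie[of x] by (simp add: itrie_snoc)
  also have "\<dots> \<le> length x * (5 * length x + 10) + 1 + 5 + 5 * length x + 5"
   using snoc length_nb_le_self[of "length x"] es_bool[of b] by simp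
  also have "\<dots> \<le> length (x @ [b]) * (5 * length (x @ [b]) + 10) + 1" by (simp add: algebra_simps)
  finally show ?case .
 qed
 then have "es (itrie x) \<le> 2 * length x + 2 + (length x * (5 * length x + 10) + 1)"
  using irel_itrie[of x] by (cases "itrie x") auto
 also have "\<dots> \<le> (length x + 1) * (5 * length x + 20)" by (simp add: algebra_simps)
 finally show ?thesis .
qed

lemma poly_tset [poly_intros]: "poly f ==> poly g ==> poly h ==> poly (%x. tset (f x) (g x) (h x))"
proof (rule poly3, rule polyI[OF _ ctime_tset])
 show "pbound (%p :: bits \<times> bits \<times> trie. length (fst p))"
  by (intro pbound_length poly_intros)
 have "pbound (%p :: bits \<times> bits \<times> trie. 11 * es p)" by (intro pbound_intros pbound_es)
 then show "pbound (%p. es (tset (fst p) (fst (snd p)) (snd (snd p))))"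
 proof (rule pbound_mono)
  fix p :: "bits \<times> bits \<times> trie"
  obtain a b c where p: "p = (a, b, c)" by (metis prod_cases3)
  show "es (tset (fst p) (fst (snd p)) (snd (snd p))) \<le> 11 * es p"
   using es_tset[of a b c] length_le_es[of a] by (simp add: p)
 qed
qed

lemma poly_itrie: "poly itrie"
 unfolding itrie_def
proof (rule poly_foldl[where B = "%x. (length x + 1) * (5 * length x + 20)"])
 show "pbound (%x :: bits. (length x + 1) * (5 * length x + 20))"
  by (intro pbound_intros pbound_length poly_id)
 fix x ys zs :: bits assume *: "x = ys @ zs"
 have "es (itrie ys) \<le> (length ys + 1) * (5 * length ys + 20)" by (rule es_itrie)
 also have "\<dots> \<le> (length x + 1) * (5 * length x + 20)" using * by (intro mult_le_mono) auto
 finally show "es (foldl (%s b. (Suc (fst s), tset (nb (fst s)) [b] (snd s))) (0, TE) ys)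
  \<le> (length x + 1) * (5 * length x + 20)" by (simp add: itrie_def)
qed (intro poly_intros)+

text \<open>Linear in the cost \<open>t\<close>; the polynomial in the input size pays for storing
  the input in a trie. A quadratic dependence on \<open>t\<close> would consume the saving of the
  MAX-SAT algorithm.\<close>

lemma ram_simulation:
 "\<exists>F C k. noask F \<and> (\<forall>x v t. computes_in P {} x v t --> rn F (enc x) (enc (nb v)) (C * (t + (es x + 1) ^ k)))"
proof -
 obtain F C where F: "noask F" "\<And>s. rn F (enc s) (enc (rstep P s)) (C * (rcost P s + 1))"
  using ctime_rstep[of P] unfolding ctime_def by blast
 have "poly (%x. (pcode P 0, snd (itrie x), TE))"
  by (intro poly_intros poly_itrie)
 then obtain \<tau> where "ctime (%x. (pcode P 0, snd (itrie x), TE)) \<tau>" "pbound \<tau>"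
  unfolding poly_def by blast
 then obtain G D k where G: "noask G" "\<And>x. rn G (enc x) (enc (pcode P 0, snd (itrie x), TE)) (D * (\<tau> x + 1))"
  "\<And>x. \<tau> x \<le> (es x + 1) ^ k"
  unfolding ctime_def pbound_def by blast
 let ?H = "FComp G (FComp (FWhile F) (FComp FTl (FComp FTl FHd)))"
 have "rn ?H (enc x) (enc (nb v)) ((2 * C + 4 + 2 * D + 6) * (t + (es x + 1) ^ k))" if e: "computes_in P {} x v t" for x v t
 proof -
  have "irel x (snd (itrie x))" using irel_itrie by blast
  moreover have "mrel (%_. 0) TE" by (simp add: mrel_def)
  ultimately obtain m where m: "rn (FWhile F) (enc (pcode P 0, snd (itrie x), TE)) (enc (0 :: nat, snd (itrie x), m))
    ((2 * C + 4) * t + 2)" "tget [] m = nb v"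
   using exec_sim[OF F(2), of x "snd (itrie x)"] e unfolding computes_in_def by blast
  have "thd (enc m) = enc (nb v)" using m(2) by (cases m) auto
  then have 3: "rn (FComp FTl (FComp FTl FHd)) (enc (0 :: nat, snd (itrie x), m)) (enc (nb v)) (1 + (1 + 1))"
   using rn_Comp[OF rn_Tl[of "enc (0 :: nat, snd (itrie x), m)"] rn_Comp[OF rn_Tl rn_Hd]] by simp
  have "(es x + 1) ^ k \<ge> 1" by simp
  then have t: "\<tau> x + 1 \<le> 2 * (es x + 1) ^ k" using G(3)[of x] by linarith
  have "D * (\<tau> x + 1) \<le> D * (2 * (es x + 1) ^ k)" using t by (rule mult_le_mono2)
  moreover have "5 \<le> 6 * (es x + 1) ^ k" using \<open>(es x + 1) ^ k \<ge> 1\<close> by linarith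
  moreover have "(2 * C + 4 + 2 * D + 6) * (t + (es x + 1) ^ k) = (2 * C + 4) * t + (2 * C + 4) * (es x + 1) ^ k +
    (2 * D + 6) * t + (D * (2 * (es x + 1) ^ k) + 6 * (es x + 1) ^ k)" by (simp only: distrib_left distrib_right mult_ac add_ac)
  ultimately have "D * (\<tau> x + 1) + (((2 * C + 4) * t + 2) + (1 + (1 + 1))) \<le> (2 * C + 4 + 2 * D + 6) * (t + (es x + 1) ^ k)"
   by linarith
  then show ?thesis by (rule rn_mono[OF rn_Comp[OF G(2) rn_Comp[OF m(1) 3]]])
 qed
 moreover have "noask ?H" using F G by simp
 ultimately show ?thesis by blast
qed

section \<open>The pointer machine\<close>

text \<open>Trees are stored in cells; the cell created in step \<open>i\<close> has address \<open>i\<close>, so that no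
 allocation counter is needed besides the clock. Address 0 is the empty tree.\<close>

type_synonym pconf = "nat \<times> (nat => nat) \<times> (nat => nat) \<times> (nat => nat) \<times> bits \<times> bits"

text \<open>True is the tree \<open>Nd Lf Lf\<close>. It is represented by the current address
  \<open>i\<close>, whose cell has not been written and so has two nil components.\<close>

fun pinstr_step :: "bits set => nat => tinstr => pconf => pconf" where
 "pinstr_step A i (TNil r) (pc, R, h, t, x, q) = (Suc pc, R(r := 0), h, t, x, q)"
| "pinstr_step A i (TCons r s u) (pc, R, h, t, x, q) = (Suc pc, R(r := i), h(i := R s), t(i := R u), x, q)"
| "pinstr_step A i (THd r s) (pc, R, h, t, x, q) = (Suc pc, R(r := h (R s)), h, t, x, q)"
| "pinstr_step A i (TTl r s) (pc, R, h, t, x, q) = (Suc pc, R(r := t (R s)), h, t, x, q)"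
| "pinstr_step A i (TJnil r l) (pc, R, h, t, x, q) = (if R r = 0 then l else Suc pc, R, h, t, x, q)"
| "pinstr_step A i (TNext r) (pc, R, h, t, x, q) =
   (Suc pc, R(r := if x \<noteq> [] \<and> hd x then i else 0), h, t, tl x, q)"
| "pinstr_step A i (TEof r) (pc, R, h, t, x, q) = (Suc pc, R(r := if x = [] then i else 0), h, t, x, q)"
| "pinstr_step A i (TEmit r) (pc, R, h, t, x, q) = (Suc pc, R, h, t, x, q @ [R r \<noteq> 0])"
| "pinstr_step A i (TAsk r) (pc, R, h, t, x, q) = (Suc pc, R(r := if q \<in> A then i else 0), h, t, x, [])"

definition pstep :: "bits set => tinstr list => nat => pconf => pconf" where
 "pstep A P i c = (if fst c < length P then pinstr_step A i (P ! fst c) c else c)"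

primrec prun :: "bits set => tinstr list => nat => nat => pconf => pconf" where
 "prun A P 0 i c = c"
| "prun A P (Suc n) i c = pstep A P (i + n) (prun A P n i c)"

text \<open>All addresses used are below the clock \<open>i\<close>, hence the representation
  survives whatever is written to cell \<open>i\<close> next.\<close>

inductive prep :: "(nat => nat) => (nat => nat) => nat => nat => tree => bool" for h t i where
 prep_Lf: "prep h t i 0 Lf"
| prep_Nd: "0 < p ==> p < i ==> prep h t i (h p) a ==> prep h t i (t p) b ==> prep h t i p (Nd a b)"

lemma prep_mono:
 assumes "prep h t i p a"
 shows "prep h t (Suc i) p a" "prep (h(i := x)) (t(i := y)) (Suc i) p a"
 using assms by (induction) (auto intro: prep.intros)

lemma prep_0: "prep h t i p a ==> p = 0 \<longleftrightarrow> a = Lf"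
 by (cases rule: prep.cases) auto

lemma prep_hd: "prep h t i p a ==> h 0 = 0 ==> prep h t i (h p) (thd a)"
 by (cases rule: prep.cases) (auto intro: prep.intros)

lemma prep_tl: "prep h t i p a ==> t 0 = 0 ==> prep h t i (t p) (ttl a)"
 by (cases rule: prep.cases) (auto intro: prep.intros)

fun pinv :: "nat => pconf => bool" where
 "pinv i (pc, R, h, t, x, q) \<longleftrightarrow> 1 \<le> i \<and> (\<forall>r. R r < i) \<and> (\<forall>p. h p < i \<and> t p < i) \<and>
   (\<forall>p\<ge>i. h p = 0 \<and> t p = 0) \<and> h 0 = 0 \<and> t 0 = 0"

fun psim :: "nat => pconf => tconf => bool" where
 "psim i (pc, R, h, t, x, q) (pc', T, x', q') \<longleftrightarrow> pc = pc' \<and> x = x' \<and> q = q' \<and>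
   (\<forall>r. prep h t i (R r) (T r))"

lemma pinv_step: "pinv i c ==> pinv (Suc i) (pstep A P i c)"
proof -
 assume a: "pinv i c"
 obtain pc R h t x q where c: "c = (pc, R, h, t, x, q)" by (metis prod_cases6)
 have less: "R r < Suc i" "h p < Suc i" "t p < Suc i" for r p using a c by (auto intro: less_SucI)
 show ?thesis
  using a less unfolding c pstep_def by (cases "P ! pc") (auto simp: Suc_le_eq)
qed

lemma psim_step:
 assumes "pinv i c" "psim i c d"
 shows "psim (Suc i) (pstep A P i c) (tstep A P d)"
proof -
 obtain pc R h t x q where c: "c = (pc, R, h, t, x, q)" by (metis prod_cases6)
 obtain T where d: "d = (pc, T, x, q)" using assms(2) unfolding c by (cases d) auto
 have p: "prep h t i (R r) (T r)" for r using assms(2) unfolding c d by auto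
 have 0: "h 0 = 0" "t 0 = 0" "1 \<le> i" "h i = 0" "t i = 0" using assms(1) unfolding c by auto
 have 1: "prep h t (Suc i) (R r) (T r)" "prep (h(i := y)) (t(i := z)) (Suc i) (R r) (T r)" for r y z
  using prep_mono[OF p] by auto
 have b: "prep h t (Suc i) (if v then i else 0) (tbool v)" for v
  using 0 by (auto simp: tbool_def intro!: prep.intros)
 have bT: "prep h t (Suc i) i (tbool True)" and bF: "prep h t (Suc i) 0 (tbool False)"
  using b[of True] b[of False] by auto
 have cons: "prep (h(i := R r)) (t(i := R s)) (Suc i) i (Nd (T r) (T s))" for r s
  using 1(2) 0 by (intro prep_Nd) auto
 have hd: "prep h t (Suc i) (h (R s)) (thd (T s))" "prep h t (Suc i) (t (R s)) (ttl (T s))" for s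
  using prep_hd[OF 1(1)] prep_tl[OF 1(1)] 0 by auto
 have z: "R r = 0 \<longleftrightarrow> T r = Lf" for r using prep_0[OF p] .
 have zz: "prep h t (Suc i) 0 Lf" by (rule prep_Lf)
 show ?thesis
  unfolding c d pstep_def tstep_def
  using 1 bT bF cons hd z zz by (cases "P ! pc") (auto simp: tnext_def simp del: fun_upd_apply simp add: fun_upd_def)
qed

definition pinit :: "bits => pconf" where
 "pinit x = (0, %_. 0, %_. 0, %_. 0, x, [])"

lemma pinv_prun: "pinv i c ==> pinv (i + n) (prun A P n i c)"
 by (induction n) (use pinv_step in auto)

lemma psim_prun: "pinv i c ==> psim i c d ==> psim (i + n) (prun A P n i c) (trun A P n d)"
proof (induction n)
 case (Suc n)
 then show ?case using psim_step[OF pinv_prun[OF Suc.prems(1)] Suc.IH[OF Suc.prems], of A P]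
  by (simp add: trun_def)
qed simp

lemma pinit_inv: "pinv 1 (pinit x)" and pinit_sim: "psim 1 (pinit x) (0, %_. Lf, x, [])"
 by (auto simp: pinit_def intro: prep.intros)

section \<open>Compiling the pointer machine to a random access machine\<close>

text \<open>Register \<open>r < 4\<close> is kept in RAM register \<open>r + 1\<close>; RAM register 0 stays 0 until the end, 5 is the clock,
 6 and 7 hold the constants 1 and 20, 8 and 9 are scratch, 10 is the input position. Cell \<open>p\<close> occupies
 the RAM registers \<open>2 p + 20\<close> and \<open>2 p + 21\<close>.\<close>

fun tbody :: "tinstr => instr list" where
 "tbody (TNil r) = [Const (r + 1) 0]"
| "tbody (TCons r s u) = [Add 8 5 5, Add 8 8 7, Store 8 (s + 1), Add 8 8 6, Store 8 (u + 1), Add (r + 1) 5 0]"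
| "tbody (THd r s) = [Add 8 (s + 1) (s + 1), Add 8 8 7, Load (r + 1) 8]"
| "tbody (TTl r s) = [Add 8 (s + 1) (s + 1), Add 8 8 7, Add 8 8 6, Load (r + 1) 8]"
| "tbody (TJnil r l) = []"
| "tbody (TNext r) = [Read 8 10, Sub 9 8 6, Sub 8 8 9, Sub 8 8 9, Add 10 10 6, Const (r + 1) 0]"
| "tbody (TEof r) = [Read 8 10, Sub 8 8 6, Const (r + 1) 0]"
| "tbody (TEmit r) = [Append (r + 1)]"
| "tbody (TAsk r) = [Query 8, Const (r + 1) 0]"

fun ttail :: "(nat => nat) => nat => tinstr => instr list" where
 "ttail J e (TJnil r l) = [JumpZero (r + 1) (J l)]"
| "ttail J e (TNext r) = [JumpZero 8 e, Add (r + 1) 5 0]"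
| "ttail J e (TEof r) = [JumpZero 8 e, Add (r + 1) 5 0]"
| "ttail J e (TAsk r) = [JumpZero 8 e, Add (r + 1) 5 0]"
| "ttail J e _ = []"

text \<open>Padding every block to ten instructions makes block addresses an affine function of the
  instruction number. The padding precedes the conditional jump, so that falling through leads into
  the next block.\<close>

definition tblock :: "(nat => nat) => nat => tinstr => instr list" where
 "tblock J e c = (let p = Add 5 5 6 # tbody c; s = ttail J e c in
   p @ replicate (10 - length p - length s) (Const 9 0) @ s)"

lemma length_tblock [simp]: "length (tblock J e c) = 10"
 by (cases c) (auto simp: tblock_def)

definition taddr :: "tinstr list => nat => nat" where
 "taddr P l = 2 + 10 * min l (length P)"

definition ram_of :: "tinstr list => ram" where
 "ram_of P = [Const 6 1, Const 7 20] @ concat (map (%k. tblock (taddr P) (taddr P (Suc k)) (P ! k)) [0..<length P]) @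
   [JumpZero 1 (taddr P (length P) + 2), Const 0 1]"

text \<open>Stated backwards: a halting run from \<open>c'\<close> extends to one from
  \<open>c\<close> at additional cost at most \<open>b\<close>. In this form fragments compose
  without any mention of the final result.\<close>

definition exb :: "ram => bits set => bits => config => config => nat => bool" where
 "exb Q A x c c' b \<longleftrightarrow> (\<forall>v t. exec Q A x c' v t --> (\<exists>t'. exec Q A x c v t' \<and> t' \<le> b + t))"

lemma exb_refl: "exb Q A x c c 0"
 by (auto simp: exb_def)

lemma exb_trans:
 assumes "exb Q A x c c' b" "exb Q A x c' c'' b'"
 shows "exb Q A x c c'' (b + b')"
 unfolding exb_def
proof (intro allI impI)
 fix v t assume "exec Q A x c'' v t"
 then obtain t1 where t1: "exec Q A x c' v t1" "t1 \<le> b' + t" using assms(2) unfolding exb_def by blast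
 then obtain t2 where "exec Q A x c v t2" "t2 \<le> b + t1" using assms(1) unfolding exb_def by blast
 then show "\<exists>t'. exec Q A x c v t' \<and> t' \<le> b + b' + t" using t1(2) by (intro exI[of _ t2]) auto
qed

lemma exb_mono: "exb Q A x c c' b ==> b \<le> b' ==> exb Q A x c c' b'"
 unfolding exb_def by (meson add_le_mono le_trans order_refl)

lemma exb_step:
 assumes "pc < length Q" "cost_instr (Q ! pc) M \<le> b"
 shows "exb Q A x (pc, M, q) (step_instr A x (Q ! pc) (pc, M, q)) b"
 unfolding exb_def using exec.step[OF assms(1)] assms(2) by (meson add_le_mono order_refl)

definition straight :: "instr => bool" where
 "straight c \<longleftrightarrow> (\<forall>r l. c \<noteq> JumpZero r l)"

definition sl1 :: "bits set => bits => instr => (nat => nat) \<times> bits => (nat => nat) \<times> bits" where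
 "sl1 A x c s = snd (step_instr A x c (0, s))"

primrec sl :: "bits set => bits => instr list => (nat => nat) \<times> bits => (nat => nat) \<times> bits" where
 "sl A x [] s = s"
| "sl A x (c # cs) s = sl A x cs (sl1 A x c s)"

primrec slb :: "bits set => bits => nat => instr list => (nat => nat) \<times> bits => bool" where
 "slb A x b [] s = True"
| "slb A x b (c # cs) s = (cost_instr c (fst s) \<le> b \<and> slb A x b cs (sl1 A x c s))"

lemma sl_append: "sl A x (cs @ ds) s = sl A x ds (sl A x cs s)"
 by (induction cs arbitrary: s) auto

lemma slb_append: "slb A x b (cs @ ds) s \<longleftrightarrow> slb A x b cs s \<and> slb A x b ds (sl A x cs s)"
 by (induction cs arbitrary: s) auto

lemma step_straight: "straight c ==> step_instr A x c (pc, s) = (Suc pc, sl1 A x c s)"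
 by (cases c; cases s) (auto simp: straight_def sl1_def)

lemma exb_sl:
 assumes "\<And>j. j < length cs ==> a + j < length Q \<and> Q ! (a + j) = cs ! j" "\<forall>c\<in>set cs. straight c" "slb A x b cs s"
 shows "exb Q A x (a, s) (a + length cs, sl A x cs s) (length cs * b)"
 using assms
proof (induction cs arbitrary: a s)
 case Nil
 then show ?case by (simp add: exb_refl)
next
 case (Cons c cs)
 have 0: "a < length Q" "Q ! a = c" using Cons.prems(1)[of 0] by auto
 have "exb Q A x (a, s) (Suc a, sl1 A x c s) b"
  using exb_step[OF 0(1), of "fst s" b A x "snd s"] Cons.prems(2,3) 0 step_straight[of c A x a s] by simp
 moreover have "exb Q A x (Suc a, sl1 A x c s) (Suc a + length cs, sl A x cs (sl1 A x c s)) (length cs * b)"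
 proof (rule Cons.IH)
  fix j assume "j < length cs"
  then show "Suc a + j < length Q \<and> Q ! (Suc a + j) = cs ! j" using Cons.prems(1)[of "Suc j"] by simp
 qed (use Cons.prems in auto)
 ultimately show ?case using exb_trans by fastforce
qed

lemma concat_nth: "(\<And>ys. ys \<in> set xss ==> length ys = n) ==> i < length xss ==> j < n ==>
  concat xss ! (n * i + j) = xss ! i ! j"
proof (induction xss arbitrary: i)
 case (Cons ys xss)
 show ?case
 proof (cases i)
  case 0
  then show ?thesis using Cons by (simp add: nth_append)
 next
  case (Suc i')
  then have "concat xss ! (n * i' + j) = xss ! i' ! j" using Cons by simp
  moreover have "concat (ys # xss) ! (n * i + j) = concat xss ! (n * i' + j)"
   using Cons.prems(1)[of ys] Suc by (simp add: nth_append)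
  ultimately show ?thesis using Suc by simp
 qed
qed simp

lemma length_concat_uniform: "(\<And>ys. ys \<in> set xss ==> length ys = n) ==> length (concat xss) = n * length xss"
 by (induction xss) auto

lemma length_ram_of: "length (ram_of P) = 10 * length P + 4"
proof -
 have "length (concat (map (%k. tblock (taddr P) (taddr P (Suc k)) (P ! k)) [0..<length P])) = 10 * length P"
  by (subst length_concat_uniform[where n = 10]) auto
 then show ?thesis by (simp add: ram_of_def)
qed

lemma ram_of_nth:
 assumes "k < length P" "j < 10"
 shows "ram_of P ! (taddr P k + j) = tblock (taddr P) (taddr P (Suc k)) (P ! k) ! j"
proof -
 let ?X = "map (%k. tblock (taddr P) (taddr P (Suc k)) (P ! k)) [0..<length P]"
 have l: "length (concat ?X) = 10 * length P"
  by (subst length_concat_uniform[where n = 10]) auto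
 have "concat ?X ! (10 * k + j) = ?X ! k ! j"
  by (rule concat_nth) (use assms in auto)
 moreover have "10 * k + j < length (concat ?X)" using assms l by simp
 ultimately show ?thesis using assms by (simp add: ram_of_def taddr_def nth_append)
qed

lemma bit_cost_le: "bit_cost n \<le> n + 1"
 using length_nb_le_self[of n] by (simp add: bit_cost_def length_nb)

definition regs4 :: "tinstr => bool" where
 "regs4 c = (case c of TNil r => r < 4 | TCons r s u => r < 4 \<and> s < 4 \<and> u < 4 | THd r s => r < 4 \<and> s < 4
   | TTl r s => r < 4 \<and> s < 4 | TJnil r l => r < 4 | TNext r => r < 4 | TEof r => r < 4 | TEmit r => r < 4 | TAsk r => r < 4)"

text \<open>The clock register shows \<open>i - 1\<close> because every block starts by incrementing
  it. The bound on the input position in register 10 limits the cost of a read.\<close>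

fun mem_rel :: "bits => nat => pconf => (nat => nat) => bool" where
 "mem_rel x0 i (pc, R, h, t, x, q) M \<longleftrightarrow> M 0 = 0 \<and> (\<forall>r<4. M (Suc r) = R r) \<and> M 5 = i - 1 \<and> M 6 = 1 \<and> M 7 = 20 \<and>
   (\<forall>p. M (2 * p + 20) = h p \<and> M (2 * p + 21) = t p) \<and> x = drop (M 10) x0 \<and> M 10 < i"

lemma mem_rel_body:
 assumes m: "mem_rel x0 i (pc, R, h, t, x, q) M" and inv: "pinv i (pc, R, h, t, x, q)"
  and r: "regs4 c" and b: "b = 4 * i + 100"
 shows "slb A x0 b (Add 5 5 6 # tbody c) (M, q)"
  "\<exists>M' q'. sl A x0 (Add 5 5 6 # tbody c) (M, q) = (M', q') \<and>
   (case c of TJnil r l => mem_rel x0 (Suc i) (pc, R, h, t, x, q) M' \<and> q' = q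
    | TNext r => mem_rel x0 (Suc i) (pc, R(r := 0), h, t, tl x, q) M' \<and> q' = q \<and> M' 8 = of_bool (x \<noteq> [] \<and> hd x)
    | TEof r => mem_rel x0 (Suc i) (pc, R(r := 0), h, t, x, q) M' \<and> q' = q \<and> M' 8 = of_bool (x = [])
    | TAsk r => mem_rel x0 (Suc i) (pc, R(r := 0), h, t, x, []) M' \<and> q' = [] \<and> M' 8 = of_bool (q \<in> A)
    | _ => (let (pc', R', h', t', x', q'') = pinstr_step A i c (pc, R, h, t, x, q)
      in q' = q'' \<and> mem_rel x0 (Suc i) (pc', R', h', t', x', q'') M'))"
proof -
 have M: "M 0 = 0" "M 5 = i - 1" "M 6 = 1" "M 7 = 20" "x = drop (M 10) x0" "M 10 < i" "i \<ge> 1"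
  and MR: "\<And>r. r < 4 ==> M (Suc r) = R r"
  and MH: "\<And>p. M (2 * p + 20) = h p" "\<And>p. M (2 * p + 21) = t p"
  and RB: "\<And>r. R r < i" "\<And>p. h p < i" "\<And>p. t p < i"
  using m inv by auto
 have lt: "n < 4 ==> n \<noteq> 4 \<and> n \<noteq> 5 \<and> n \<noteq> 6 \<and> n \<noteq> 7 \<and> n \<noteq> 8 \<and> n \<noteq> 9" for n :: nat by auto
 have bc: "bit_cost n \<le> 2 * i + 50" if "n \<le> 2 * i + 49" for n
  using bit_cost_le[of n] that by linarith
 have bc2: "bit_cost m + bit_cost n \<le> b" if "m \<le> 2 * i + 49" "n \<le> 2 * i + 49" for m n
  using bc[OF that(1)] bc[OF that(2)] b by linarith
 have bc1: "bit_cost m \<le> b" if "m \<le> 2 * i + 49" for m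
  using bc[OF that(1)] b by linarith
 have RB': "R r \<le> 2 * i + 49" "h p \<le> 2 * i + 49" "t p \<le> 2 * i + 49" "R r + R r \<le> 2 * i + 49"
   "2 * R r \<le> 29 + 2 * i" "2 * R r \<le> 28 + 2 * i" for r p
  using RB(1)[of r] RB(2,3)[of p] by linarith+
 have MH1: "M (R s + R s + 20) = h (R s)" "M (R s + R s + 21) = t (R s)" "M (Suc (R s + R s + 20)) = t (R s)" for s
  using MH[of "R s"] by (simp_all add: mult_2 eval_nat_numeral)
 have b1: "Suc 0 \<le> b" by (simp add: b)
 note S = sl1_def fun_upd_def Let_def
 show "slb A x0 b (Add 5 5 6 # tbody c) (M, q)"
  using r lt MR M RB' MH1 by (cases c) (auto simp: S regs4_def intro!: bc1 bc2 b1)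
 show "\<exists>M' q'. sl A x0 (Add 5 5 6 # tbody c) (M, q) = (M', q') \<and>
   (case c of TJnil r l => mem_rel x0 (Suc i) (pc, R, h, t, x, q) M' \<and> q' = q
    | TNext r => mem_rel x0 (Suc i) (pc, R(r := 0), h, t, tl x, q) M' \<and> q' = q \<and> M' 8 = of_bool (x \<noteq> [] \<and> hd x)
    | TEof r => mem_rel x0 (Suc i) (pc, R(r := 0), h, t, x, q) M' \<and> q' = q \<and> M' 8 = of_bool (x = [])
    | TAsk r => mem_rel x0 (Suc i) (pc, R(r := 0), h, t, x, []) M' \<and> q' = [] \<and> M' 8 = of_bool (q \<in> A)
    | _ => (let (pc', R', h', t', x', q'') = pinstr_step A i c (pc, R, h, t, x, q)
      in q' = q'' \<and> mem_rel x0 (Suc i) (pc', R', h', t', x', q'') M'))"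
 proof (cases c)
  case (TNil r)
  then show ?thesis using r lt MR M MH by (auto simp: S regs4_def)
 next
  case (TCons r s u)
  then show ?thesis using r lt MR M MH by (auto simp: S regs4_def)
 next
  case (THd r s)
  then show ?thesis using r lt MR M MH MH1 by (auto simp: S regs4_def)
 next
  case (TTl r s)
  then show ?thesis using r lt MR M MH MH1 by (auto simp: S regs4_def)
 next
  case (TJnil r l)
  then show ?thesis using r lt MR M MH by (auto simp: S regs4_def)
 next
  \<comment> \<open>\<open>Read\<close> answers 2 beyond the end. Register 9 is then 1, otherwise 0,
    and subtracting it twice turns the 2 into 0 while it leaves proper bits alone.\<close>
  case (TNext r)
  then show ?thesis using r lt MR M MH by (auto simp: S regs4_def drop_Suc tl_drop hd_drop_conv_nth)
 next
  \<comment> \<open>Subtracting 1 leaves something only of the answer 2 that signals the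
    end.\<close>
  case (TEof r)
  then show ?thesis using r lt MR M MH by (auto simp: S regs4_def)
 next
  case (TEmit r)
  then show ?thesis using r lt MR M MH by (auto simp: S regs4_def)
 next
  case (TAsk r)
  then show ?thesis using r lt MR M MH by (auto simp: S regs4_def)
 qed
qed

declare mem_rel.simps [simp del]

lemma mem_rel_9: "mem_rel x0 i c M ==> mem_rel x0 i c (M(9 := k))"
 by (cases c) (auto simp: mem_rel.simps)

lemma sl_pad: "\<exists>M'. sl A x (replicate n (Const 9 0)) (M, q) = (M', q) \<and> (M' = M \<or> M' = M(9 := 0))"
proof (induction n arbitrary: M)
 case (Suc n)
 obtain M' where "sl A x (replicate n (Const 9 0)) (M(9 := 0), q) = (M', q)" "M' = M(9 := 0)"
  using Suc[of "M(9 := 0)"] by fastforce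
 then have "sl A x (replicate (Suc n) (Const 9 0)) (M, q) = (M(9 := 0), q)" by (simp add: sl1_def)
 then show ?case by blast
qed simp

lemma slb_pad: "b \<ge> 1 ==> slb A x b (replicate n (Const 9 0)) (M, q)"
 by (induction n arbitrary: M) (auto simp: sl1_def bit_cost_def floorlog_def)

lemma straight_tbody: "c' \<in> set (Add 5 5 6 # tbody c) ==> straight c'"
 by (cases c) (auto simp: straight_def)

lemma mem_rel_setreg: "mem_rel x0 i (pc, R, h, t, x, q) M ==> r < 4 ==>
  mem_rel x0 i (pc, R(r := k), h, t, x, q) (M(Suc r := k))"
 by (auto simp: mem_rel.simps)

lemma exb_block:
 assumes m: "mem_rel x0 i (pc, R, h, t, x, q) M" and inv: "pinv i (pc, R, h, t, x, q)"
  and pc: "pc < length P" and r: "regs4 (P ! pc)" and st: "pinstr_step A i (P ! pc) (pc, R, h, t, x, q) = (pc', R', h', t', x', q')"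
 shows "\<exists>M'. exb (ram_of P) A x0 (taddr P pc, M, q) (taddr P pc', M', q') (10 * (4 * i + 100)) \<and>
   mem_rel x0 (Suc i) (pc', R', h', t', x', q') M'"
proof -
 let ?c = "P ! pc" and ?b = "4 * i + 100" and ?Q = "ram_of P"
 define p where "p = Add 5 5 6 # tbody ?c"
 define s where "s = ttail (taddr P) (taddr P (Suc pc)) ?c"
 define n where "n = 10 - length p - length s"
 have B: "tblock (taddr P) (taddr P (Suc pc)) ?c = (p @ replicate n (Const 9 0)) @ s"
  by (simp add: tblock_def p_def s_def n_def Let_def)
 then have len: "length (p @ replicate n (Const 9 0)) + length s = 10"
  using length_tblock[of "taddr P" "taddr P (Suc pc)" ?c] by simp
 obtain M1 q1 where M1: "sl A x0 p (M, q) = (M1, q1)" by force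
 note body = mem_rel_body[OF m inv r refl, folded p_def, of A]
 obtain M2 where M2: "sl A x0 (replicate n (Const 9 0)) (M1, q1) = (M2, q1)" "M2 = M1 \<or> M2 = M1(9 := 0)"
  using sl_pad by blast
 have rel2: "mem_rel x0 j c M2" if "mem_rel x0 j c M1" for j c using that M2(2) mem_rel_9 by blast
 have M28: "M2 8 = M1 8" "M2 0 = M1 0" using M2(2) by auto
 have nthQ: "taddr P pc + j < length ?Q \<and> ?Q ! (taddr P pc + j) = ((p @ replicate n (Const 9 0)) @ s) ! j" if "j < 10" for j
  using ram_of_nth[OF pc that] pc that unfolding B by (auto simp: length_ram_of taddr_def)
 let ?e = "taddr P pc + length (p @ replicate n (Const 9 0))"
 have "exb ?Q A x0 (taddr P pc, (M, q)) (?e, sl A x0 (p @ replicate n (Const 9 0)) (M, q))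
   (length (p @ replicate n (Const 9 0)) * ?b)"
 proof (rule exb_sl)
  fix j assume "j < length (p @ replicate n (Const 9 0))"
  then show "taddr P pc + j < length ?Q \<and> ?Q ! (taddr P pc + j) = (p @ replicate n (Const 9 0)) ! j"
   using nthQ[of j] len by (auto simp: nth_append)
 next
  show "\<forall>c\<in>set (p @ replicate n (Const 9 0)). straight c"
   using straight_tbody unfolding p_def by (auto simp: straight_def)
  show "slb A x0 ?b (p @ replicate n (Const 9 0)) (M, q)"
   using body(1) by (simp add: slb_append M1 slb_pad)
 qed
 then have E: "exb ?Q A x0 (taddr P pc, M, q) (?e, M2, q1) (length (p @ replicate n (Const 9 0)) * ?b)"
  by (simp add: sl_append M1 M2(1))
 have nxt: "taddr P pc + 10 = taddr P (Suc pc)" using pc by (simp add: taddr_def)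
 then have nxt': "10 + taddr P pc = taddr P (Suc pc)" by simp
 have i1: "i \<ge> 1" and RB: "\<And>r. R r < i" using inv by auto
 show ?thesis
 proof (cases "s = []")
  case True
  then have "?e = taddr P (Suc pc)" using len nxt by simp
  moreover have "pc' = Suc pc" "q1 = q'" "mem_rel x0 (Suc i) (pc', R', h', t', x', q') M1"
   using body(2) M1 st True unfolding s_def by (cases ?c; auto)+
  moreover have "length (p @ replicate n (Const 9 0)) = 10" using len True by simp
  ultimately show ?thesis using E rel2 by metis
 next
  case False
  consider (jump) r l where "?c = TJnil r l" | (bool) r where "?c \<in> {TNext r, TEof r, TAsk r}"
   using False unfolding s_def by (cases ?c) auto
  then show ?thesis
  proof cases
   case jump
   then have s1: "s = [JumpZero (r + 1) (taddr P l)]" by (simp add: s_def)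
   then have l9: "length (p @ replicate n (Const 9 0)) = 9" using len by simp
   have rel: "mem_rel x0 (Suc i) (pc, R, h, t, x, q) M2" "q1 = q" "r < 4"
    using body(2) M1 jump rel2 r by (auto simp: regs4_def)
   have q9: "?e < length ?Q" "?Q ! ?e = JumpZero (r + 1) (taddr P l)"
    using nthQ[of 9] s1 l9 by (auto simp: nth_append)
   have Mr: "M2 (Suc r) = R r" using rel by (auto simp: mem_rel.simps)
   have "cost_instr (?Q ! ?e) M2 \<le> ?b"
    unfolding q9(2) using bit_cost_le[of "R r"] RB[of r] Mr by simp
   from exb_step[OF q9(1) this, of A x0 q1, unfolded q9(2)]
   have e1: "exb ?Q A x0 (?e, M2, q1) (taddr P pc', M2, q') ?b"
    using st rel nxt nxt' l9 Mr jump by auto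
   have "mem_rel x0 (Suc i) (pc', R', h', t', x', q') M2"
    using rel st jump by (auto simp: mem_rel.simps)
   moreover have "exb ?Q A x0 (taddr P pc, M, q) (taddr P pc', M2, q') (10 * ?b)"
    by (rule exb_mono[OF exb_trans[OF E e1]]) (simp only: l9, simp)
   ultimately show ?thesis by blast
  next
   case bool
   then have s1: "s = [JumpZero 8 (taddr P (Suc pc)), Add (r + 1) 5 0]" by (auto simp: s_def)
   then have l8: "length (p @ replicate n (Const 9 0)) = 8" using len by simp
   define v where "v = (case ?c of TNext r => x \<noteq> [] \<and> hd x | TEof r => x = [] | _ => q \<in> A)"
   have rel: "mem_rel x0 (Suc i) (pc, R(r := 0), h, t, x', q') M2" "q1 = q'" "r < 4" "M2 8 = of_bool v"
    "pc' = Suc pc" "R' = R(r := if v then i else 0)" "h' = h" "t' = t"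
    using body(2) M1 bool rel2 r st M28 unfolding v_def by (auto simp: regs4_def)
   have s8: "((p @ replicate n (Const 9 0)) @ s) ! 8 = s ! 0" "((p @ replicate n (Const 9 0)) @ s) ! 9 = s ! 1"
    using nth_append_length_plus[of "p @ replicate n (Const 9 0)" s 0]
     nth_append_length_plus[of "p @ replicate n (Const 9 0)" s 1] unfolding l8 by simp_all
   have q8: "?e < length ?Q" "?Q ! ?e = JumpZero 8 (taddr P (Suc pc))"
    "Suc ?e < length ?Q" "?Q ! Suc ?e = Add (r + 1) 5 0"
    using nthQ[of 8] nthQ[of 9] s8 s1 unfolding l8 by (simp_all add: eval_nat_numeral)
   have "cost_instr (?Q ! ?e) M2 \<le> ?b"
    unfolding q8(2) using bit_cost_le[of "of_bool v"] rel by (cases v) auto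
   from exb_step[OF q8(1) this, of A x0 q1, unfolded q8(2)]
   have e1: "exb ?Q A x0 (?e, M2, q1) (if v then Suc ?e else taddr P (Suc pc), M2, q') ?b"
    using rel by (simp split: if_splits)
   show ?thesis
   proof (cases v)
    case False
    have "exb ?Q A x0 (taddr P pc, M, q) (if v then Suc ?e else taddr P (Suc pc), M2, q') (10 * ?b)"
     by (rule exb_mono[OF exb_trans[OF E e1]]) (simp only: l8, simp)
    then show ?thesis using False rel by (intro exI[of _ M2]) (simp add: mem_rel.simps)
   next
    case True
    have M5: "M2 5 = i" "M2 0 = 0" using rel(1) by (auto simp: mem_rel.simps)
    have "cost_instr (?Q ! Suc ?e) M2 \<le> ?b"
     unfolding q8(4) using bit_cost_le[of i] bit_cost_le[of 0] M5 by simp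
    from exb_step[OF q8(3) this, of A x0 q', unfolded q8(4)]
    have e2: "exb ?Q A x0 (Suc ?e, M2, q') (taddr P (Suc pc), M2(Suc r := i), q') ?b"
     using M5 l8 nxt nxt' by simp
    have "mem_rel x0 (Suc i) (pc', R', h', t', x', q') (M2(Suc r := i))"
     using mem_rel_setreg[OF rel(1,3), of i] True rel by (simp add: mem_rel.simps)
    moreover have "exb ?Q A x0 (taddr P pc, M, q) (Suc ?e, M2, q') (9 * ?b)"
     using exb_mono[OF exb_trans[OF E e1], of "9 * ?b"] True unfolding l8 by simp
    from exb_mono[OF exb_trans[OF this e2], of "10 * ?b"]
    have "exb ?Q A x0 (taddr P pc, M, q) (taddr P pc', M2(Suc r := i), q') (10 * ?b)"
     using rel by simp
    ultimately show ?thesis by blast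
   qed
  qed
 qed
qed

text \<open>After halting, the step number of the pointer machine still grows while the clock of the
  random access machine stands still. The memory relation then holds for some earlier time
  \<open>j\<close> only.\<close>

lemma exb_prun:
 assumes P: "\<forall>c\<in>set P. regs4 c" and inv: "pinv i (pc, R, h, t, x, q)" and m: "mem_rel x0 i (pc, R, h, t, x, q) M"
 shows "prun A P n i (pc, R, h, t, x, q) = (pc', R', h', t', x', q') ==>
  \<exists>M'. exb (ram_of P) A x0 (taddr P pc, M, q) (taddr P pc', M', q') (n * (10 * (4 * (i + n) + 100))) \<and>
   (\<exists>j\<le>i + n. mem_rel x0 j (pc', R', h', t', x', q') M')  \<and> (pc' < length P --> mem_rel x0 (i + n) (pc', R', h', t', x', q') M')"
proof (induction n arbitrary: pc' R' h' t' x' q')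
 case 0
 then show ?case using m by (intro exI[of _ M]) (auto simp: exb_refl)
next
 case (Suc n)
 obtain pc1 R1 h1 t1 x1 q1 where c1: "prun A P n i (pc, R, h, t, x, q) = (pc1, R1, h1, t1, x1, q1)" by (metis prod_cases6)
 obtain M1 j where M1: "exb (ram_of P) A x0 (taddr P pc, M, q) (taddr P pc1, M1, q1) (n * (10 * (4 * (i + n) + 100)))"
  "j \<le> i + n" "mem_rel x0 j (pc1, R1, h1, t1, x1, q1) M1"
  "pc1 < length P --> mem_rel x0 (i + n) (pc1, R1, h1, t1, x1, q1) M1"
  using Suc.IH[OF c1] by blast
 have st: "pstep A P (i + n) (pc1, R1, h1, t1, x1, q1) = (pc', R', h', t', x', q')" using Suc.prems c1 by simp
 show ?case
 proof (cases "pc1 < length P")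
  case True
  have "regs4 (P ! pc1)" using P True by simp
  moreover have "pinv (i + n) (pc1, R1, h1, t1, x1, q1)" using pinv_prun[OF inv, of n A P] c1 by simp
  ultimately obtain M2 where M2: "exb (ram_of P) A x0 (taddr P pc1, M1, q1) (taddr P pc', M2, q') (10 * (4 * (i + n) + 100))"
   "mem_rel x0 (Suc (i + n)) (pc', R', h', t', x', q') M2"
   using exb_block[of x0 "i + n" pc1 R1 h1 t1 x1 q1 M1 P A] M1(4) True st by (auto simp: pstep_def)
  have "exb (ram_of P) A x0 (taddr P pc, M, q) (taddr P pc', M2, q') (Suc n * (10 * (4 * (i + Suc n) + 100)))"
   by (rule exb_mono[OF exb_trans[OF M1(1) M2(1)]]) (simp add: algebra_simps)
  then show ?thesis using M2(2) by (intro exI[of _ M2]) auto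
 next
  case False
  then have eq: "(pc', R', h', t', x', q') = (pc1, R1, h1, t1, x1, q1)" using st by (simp add: pstep_def)
  have "exb (ram_of P) A x0 (taddr P pc, M, q) (taddr P pc1, M1, q1) (Suc n * (10 * (4 * (i + Suc n) + 100)))"
   by (rule exb_mono[OF M1(1)]) (simp add: algebra_simps)
  moreover have "j \<le> i + Suc n" using M1(2) by simp
  ultimately show ?thesis using M1(3) False eq by auto
 qed
qed

text \<open>Quadratic, because an address is charged crudely by its value instead of its length. A
  polynomial loss is harmless here: the result serves to show membership in P and in E with an NP
  oracle.\<close>

theorem ram_of_correct:
 assumes P: "\<forall>c\<in>set P. regs4 c"
  and run: "trun A P n (0, %_. Lf, x, []) = (pc', T, x', q')" and halt: "length P \<le> pc'"
 shows "\<exists>t. computes_in (ram_of P) A x (of_bool (T 0 \<noteq> Lf)) t \<and> t \<le> 50 * (n + 30) ^ 2"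
proof -
 let ?Q = "ram_of P"
 obtain R' h' t' where c: "prun A P n 1 (pinit x) = (pc', R', h', t', x', q')"
  and rep: "prep h' t' (1 + n) (R' 0) (T 0)"
  using psim_prun[OF pinit_inv pinit_sim[of x], where n = n and A = A and P = P] unfolding run by (cases "prun A P n 1 (pinit x)") auto
 let ?M = "(%_. 0)(6 := 1, 7 := 20) :: nat => nat"
 have m: "mem_rel x 1 (0, %_. 0, %_. 0, %_. 0, x, []) ?M" by (auto simp: mem_rel.simps)
 obtain M' j where M': "exb ?Q A x (taddr P 0, ?M, []) (taddr P pc', M', q') (n * (10 * (4 * (1 + n) + 100)))"
  "mem_rel x j (pc', R', h', t', x', q') M'"
  using exb_prun[OF P pinit_inv[unfolded pinit_def] m c[unfolded pinit_def]] by blast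
 have "M' 1 = R' 0" "M' 0 = 0" using M'(2) by (auto simp: mem_rel.simps)
 have bound: "R' 0 < 1 + n" using pinv_prun[OF pinit_inv[of x], where n = n and A = A and P = P] unfolding c by auto
 have E: "taddr P pc' = 2 + 10 * length P" using halt by (simp add: taddr_def)
 have nth: "?Q ! 0 = Const 6 1" "?Q ! 1 = Const 7 20" by (simp_all add: ram_of_def)
 have nthE: "?Q ! (2 + 10 * length P) = JumpZero 1 (4 + 10 * length P)" "?Q ! (3 + 10 * length P) = Const 0 1"
 proof -
  let ?X = "concat (map (%k. tblock (taddr P) (taddr P (Suc k)) (P ! k)) [0..<length P])"
  have l: "length ?X = 10 * length P"
   by (subst length_concat_uniform[where n = 10]) auto
  have "?Q = ([Const 6 1, Const 7 20] @ ?X) @ [JumpZero 1 (4 + 10 * length P), Const 0 1]"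
   by (simp add: ram_of_def taddr_def)
  moreover have "length ([Const 6 1, Const 7 20] @ ?X) = 2 + 10 * length P" using l by simp
  ultimately show "?Q ! (2 + 10 * length P) = JumpZero 1 (4 + 10 * length P)" "?Q ! (3 + 10 * length P) = Const 0 1"
   by (simp_all only: nth_append) auto
 qed
 have len: "length ?Q = 10 * length P + 4" by (rule length_ram_of)
 have 1: "exb ?Q A x (0, %_. 0, []) (taddr P 0, ?M, []) (1 + 21)"
 proof (rule exb_trans)
  show "exb ?Q A x (0, %_. 0, []) (1, (%_. 0)(6 := 1), []) 1"
   using exb_step[of 0 ?Q "%_. 0" 1 A x "[]"] nth len by (simp add: bit_cost_def floorlog_def)
  show "exb ?Q A x (1, (%_. 0)(6 := 1), []) (taddr P 0, ?M, []) 21"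
   using exb_step[of 1 ?Q "(%_. 0)(6 := 1)" 21 A x "[]"] nth len bit_cost_le[of 20] by (simp add: taddr_def eval_nat_numeral)
 qed
 have halt_ex: "exec ?Q A x (4 + 10 * length P, M, q) (M 0) 0" for M q
  by (rule exec.halt) (simp add: len)
 have "\<exists>t. exec ?Q A x (taddr P pc', M', q') (of_bool (T 0 \<noteq> Lf)) t \<and> t \<le> n + 4"
 proof (cases "T 0 = Lf")
  case True
  then have "M' 1 = 0" using prep_0[OF rep] \<open>M' 1 = R' 0\<close> by simp
  then have "exb ?Q A x (2 + 10 * length P, M', q') (4 + 10 * length P, M', q') (n + 2)"
   using exb_step[of "2 + 10 * length P" ?Q M' "n + 2" A x q'] bit_cost_le[of 0] unfolding nthE by (simp add: len)
  then show ?thesis using halt_ex[of M' q'] True E \<open>M' 0 = 0\<close> unfolding exb_def by fastforce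
 next
  case False
  then have "M' 1 \<noteq> 0" using prep_0[OF rep] \<open>M' 1 = R' 0\<close> by simp
  moreover have "bit_cost (M' 1) \<le> n + 2" using bit_cost_le[of "M' 1"] bound \<open>M' 1 = R' 0\<close> by simp
  ultimately have e1: "exb ?Q A x (2 + 10 * length P, M', q') (3 + 10 * length P, M', q') (n + 2)"
   using exb_step[of "2 + 10 * length P" ?Q M' "n + 2" A x q'] unfolding nthE by (simp add: len eval_nat_numeral)
  have e2: "exb ?Q A x (3 + 10 * length P, M', q') (4 + 10 * length P, M'(0 := 1), q') 2"
   using exb_step[of "3 + 10 * length P" ?Q M' 2 A x q'] bit_cost_le[of 1] unfolding nthE by (simp add: len eval_nat_numeral)
  show ?thesis using exb_trans[OF e1 e2] halt_ex[of "M'(0 := 1)" q'] False E unfolding exb_def by fastforce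
 qed
 then obtain t where t: "exec ?Q A x (taddr P pc', M', q') (of_bool (T 0 \<noteq> Lf)) t" "t \<le> n + 4" by blast
 from exb_trans[OF 1 M'(1)] t(1) obtain t' where t': "exec ?Q A x (0, %_. 0, []) (of_bool (T 0 \<noteq> Lf)) t'"
  "t' \<le> 1 + 21 + n * (10 * (4 * (1 + n) + 100)) + t" unfolding exb_def by blast
 have "1 + 21 + n * (10 * (4 * (1 + n) + 100)) + (n + 4) \<le> 50 * (n + 30) ^ 2"
  by (simp add: power2_eq_square algebra_simps)
 then show ?thesis using t' t(2) unfolding computes_in_def by (intro exI[of _ t']) linarith
qed

lemma regs4_fcode: "c \<in> set (fcode a F) ==> regs4 c"
 by (induction F arbitrary: a) (auto simp: regs4_def)

theorem ram_of_fn: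
 assumes "ev A F (Lf, x, []) (y, x', q') n"
 shows "\<exists>t. computes_in (ram_of (fcode 0 F)) A x (of_bool (y \<noteq> Lf)) t \<and> t \<le> 50 * (n + 30) ^ 2"
proof -
 have "code_at (fcode 0 F) 0 (fcode 0 F)" unfolding code_at_def by (metis append_Nil append_Nil2 list.size(3))
 from trun_code[OF assms this, of "%_. Lf"]
 obtain R' where R': "trun A (fcode 0 F) n (0, %_. Lf, x, []) = (flen F, R', x', q')" "R' 0 = y" by auto
 show ?thesis using ram_of_correct[OF _ R'(1)] regs4_fcode R'(2) by auto
qed

section \<open>Routing permutations through a Benes network\<close>

text \<open>The two matchings \<open>s\<close> and \<open>t\<close> together form cycles of even
  length, which are coloured alternately. The induction cuts the pair \<open>x\<close>,
  \<open>s x\<close> out of its cycle and joins the two former \<open>t\<close>-partners by the new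
  matching \<open>t'\<close>.\<close>

lemma two_involutions_coloring:
 assumes "finite X"
  and "\<And>x. x \<in> X ==> s x \<in> X \<and> s (s x) = x \<and> s x \<noteq> x"
  and "\<And>x. x \<in> X ==> t x \<in> X \<and> t (t x) = x \<and> t x \<noteq> x"
 shows "\<exists>c :: 'a => bool. \<forall>x\<in>X. c (s x) = (\<not> c x) \<and> c (t x) = (\<not> c x)"
 using assms
proof (induction "card X" arbitrary: X t rule: less_induct)
 case less
 show ?case
 proof (cases "X = {}")
  case False
  then obtain x where x: "x \<in> X" by blast
  let ?y = "s x" and ?Y = "X - {x, s x}"
  note S = less.prems(2) and T = less.prems(3)
  have y: "?y \<in> X" "s ?y = x" "?y \<noteq> x" using S x by auto
  have fin: "finite ?Y" "card ?Y < card X" using less.prems(1) x by (auto intro!: psubset_card_mono)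
  have sY: "s z \<in> ?Y \<and> s (s z) = z \<and> s z \<noteq> z" if "z \<in> ?Y" for z
   using that S[of z] S[OF x] by auto
  define t' where "t' = (%z. if t z = x then t ?y else if t z = ?y then t x else t z)"
  show ?thesis
  proof (cases "t x = ?y")
   \<comment> \<open>Here \<open>x\<close> and \<open>s x\<close> form a cycle of their own, and the
     rest is closed under \<open>t\<close>.\<close>
   case True
   then have ty: "t ?y = x" using T[OF x] by simp
   have "t z \<in> ?Y \<and> t (t z) = z \<and> t z \<noteq> z" if "z \<in> ?Y" for z
    using that T[of z] True ty by auto
   then obtain c where c: "\<forall>z\<in>?Y. c (s z) = (\<not> c z) \<and> c (t z) = (\<not> c z)"
    using less.hyps[OF fin(2) fin(1) sY, of t] by blast
   let ?c = "c(x := True, ?y := False)"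
   have "?c (s z) = (\<not> ?c z) \<and> ?c (t z) = (\<not> ?c z)" if z: "z \<in> X" for z
   proof (cases "z \<in> ?Y")
    case True
    have "t z \<in> ?Y" using True T[of z] \<open>t x = ?y\<close> ty by auto
    then show ?thesis using c True sY[OF True] by auto
   next
    case False
    then show ?thesis using z y True ty by auto
   qed
   then show ?thesis by blast
  next
   case False
   have tx: "t x \<in> X" "t (t x) = x" "t x \<noteq> x" using T[OF x] by auto
   have ty: "t ?y \<in> X" "t (t ?y) = ?y" "t ?y \<noteq> ?y" using T[OF y(1)] by auto
   have ne: "t x \<noteq> t ?y" "t ?y \<noteq> x" using tx ty y False by metis+
   have inY: "t x \<in> ?Y" "t ?y \<in> ?Y" using tx ty False ne by auto
   have t'Y: "t' z \<in> ?Y \<and> t' (t' z) = z \<and> t' z \<noteq> z" if z: "z \<in> ?Y" for z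
   proof -
    have zX: "z \<in> X" "z \<noteq> x" "z \<noteq> ?y" using z by auto
    note tz = T[OF zX(1)]
    consider "t z = x" | "t z = ?y" | "t z \<noteq> x" "t z \<noteq> ?y" by blast
    then show ?thesis
    proof cases
     case 1
     then have "z = t x" using tz by auto
     then show ?thesis using inY ne tx ty y 1 by (auto simp: t'_def)
    next
     case 2
     then have "z = t ?y" using tz by auto
     then show ?thesis using inY ne tx ty y 2 by (auto simp: t'_def)
    next
     case 3
     then have "t' z = t z" "t (t z) = z" using tz by (auto simp: t'_def)
     moreover have "t' (t z) = z" using zX tz by (auto simp: t'_def)
     ultimately show ?thesis using tz 3 by auto
    qed
   qed
   obtain c where c: "\<forall>z\<in>?Y. c (s z) = (\<not> c z) \<and> c (t' z) = (\<not> c z)"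
    using less.hyps[OF fin(2) fin(1) sY t'Y] by blast
   have "t' (t x) = t ?y" using tx by (simp add: t'_def)
   then have cxy: "c (t ?y) = (\<not> c (t x))" using c inY by metis
   \<comment> \<open>The ends of the joined edge have different colours, hence the complements given
     to \<open>x\<close> and \<open>s x\<close> differ as well.\<close>
   let ?c = "c(x := \<not> c (t x), ?y := \<not> c (t ?y))"
   have "?c (s z) = (\<not> ?c z) \<and> ?c (t z) = (\<not> ?c z)" if z: "z \<in> X" for z
   proof (cases "z \<in> ?Y")
    case True
    have 1: "?c (s z) = (\<not> ?c z)" using c True sY[OF True] by auto
    have tz: "t z \<in> X" "t (t z) = z" using T[of z] True by auto
    consider "t z = x" | "t z = ?y" | "t z \<noteq> x" "t z \<noteq> ?y" by blast
    then have "?c (t z) = (\<not> ?c z)"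
    proof cases
     case 1
     have "t x = z" using tz(2) unfolding 1 .
     moreover have "z \<noteq> x" "z \<noteq> ?y" using True by auto
     ultimately show ?thesis unfolding 1 using y(3) by simp
    next
     case 2
     have "t ?y = z" using tz(2) unfolding 2 .
     moreover have "z \<noteq> x" "z \<noteq> ?y" using True by auto
     ultimately show ?thesis unfolding 2 by simp
    next
     case 3
     then have "t' z = t z" by (simp add: t'_def)
     then have "c (t z) = (\<not> c z)" using c True by metis
     moreover have "z \<noteq> x" "z \<noteq> ?y" using True by auto
     ultimately show ?thesis using 3 by simp
    qed
    then show ?thesis using 1 by blast
   next
    case F: False
    then consider "z = x" | "z = ?y" using z by auto
    then show ?thesis
    proof cases
     case 1
     have "t x \<noteq> x" "t x \<noteq> ?y" using inY by auto
     then show ?thesis unfolding 1 using cxy y(3) by simp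
    next
     case 2
     have "t ?y \<noteq> x" "t ?y \<noteq> ?y" using inY by auto
     then show ?thesis unfolding 2 using cxy y(2,3) by simp
    qed
   qed
   then show ?thesis by blast
  qed
 qed auto
qed

definition flip :: "nat => bits => bits" where
 "flip d xs = xs[d := \<not> xs ! d]"

text \<open>Not restricted to permutations: in the table every row carries its own switch, and the
  constraints do not couple the switches of two partners.\<close>

definition layer :: "nat => (bits => bits) => bool" where
 "layer d h \<longleftrightarrow> (\<forall>xs. h xs = xs \<or> h xs = flip d xs)"

primrec routes :: "nat list => (bits => bits) => bool" where
 "routes [] f \<longleftrightarrow> f = id"
| "routes (d # ds) f \<longleftrightarrow> (\<exists>h g. layer d h \<and> routes ds g \<and> f = h \<circ> g)"

lemma routes_append: "routes (ds @ ds2) f \<longleftrightarrow> (\<exists>g h. routes ds g \<and> routes ds2 h \<and> f = g \<circ> h)"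
proof (induction ds arbitrary: f)
 case (Cons d ds)
 have "routes ((d # ds) @ ds2) f \<longleftrightarrow> (\<exists>h g k. layer d h \<and> routes ds g \<and> routes ds2 k \<and> f = h \<circ> (g \<circ> k))"
  unfolding append_Cons routes.simps Cons.IH by blast
 also have "\<dots> \<longleftrightarrow> (\<exists>g h. routes (d # ds) g \<and> routes ds2 h \<and> f = g \<circ> h)"
  unfolding routes.simps by (metis comp_assoc)
 finally show ?case .
qed auto

definition rows :: "nat => bits set" where
 "rows K = {xs. length xs = K}"

lemma finite_rows: "finite (rows K)"
 using finite_lists_length_eq[OF finite, of "UNIV :: bool set" K] by (simp add: rows_def)

definition lift_fn :: "(bool => bits => bits) => bits => bits" where
 "lift_fn f xs = (case xs of [] => [] | b # bs => b # f b bs)"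

lemma routes_lift:
 "routes ds (f False) ==> routes ds (f True) ==> routes (map Suc ds) (lift_fn f)"
proof (induction ds arbitrary: f)
 case Nil
 then show ?case by (auto simp: lift_fn_def fun_eq_iff split: list.split) (metis (full_types) id_apply)
next
 case (Cons d ds)
 obtain h0 g0 where 0: "layer d h0" "routes ds g0" "f False = h0 \<circ> g0" using Cons.prems(1) by auto
 obtain h1 g1 where 1: "layer d h1" "routes ds g1" "f True = h1 \<circ> g1" using Cons.prems(2) by auto
 let ?h = "lift_fn (%b. if b then h1 else h0)" and ?g = "lift_fn (%b. if b then g1 else g0)"
 have "layer (Suc d) ?h"
  using 0(1) 1(1) unfolding layer_def lift_fn_def flip_def by (auto split: list.split)
 moreover have "routes (map Suc ds) ?g" using Cons.IH[of "%b. if b then g1 else g0"] 0 1 by simp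
 moreover have "lift_fn f = ?h \<circ> ?g"
 proof
  fix xs show "lift_fn f xs = (?h \<circ> ?g) xs"
   using 0(3) 1(3) by (cases xs; cases "hd xs") (auto simp: lift_fn_def)
 qed
 ultimately show ?case unfolding list.map routes.simps by blast
qed

primrec dims :: "nat => nat list" where
 "dims 0 = []"
| "dims (Suc K) = 0 # map Suc (dims K) @ [0]"

lemma length_dims: "length (dims K) = 2 * K"
 by (induction K) auto

lemma dims_less: "d \<in> set (dims K) ==> d < K"
 by (induction K arbitrary: d) auto

text \<open>Colour the rows so that two rows with equal tails, and two rows whose images have equal
  tails, get different colours. Row \<open>x\<close> travels through the half named by
  \<open>c x\<close>. Each half then sees every tail once on entry and once on exit, so it carries a
  permutation of tails, which is routed recursively.\<close>

theorem benes:
 assumes "bij_betw f (rows K) (rows K)"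
 shows "\<exists>g. routes (dims K) g \<and> (\<forall>xs\<in>rows K. g xs = f xs)"
 using assms
proof (induction K arbitrary: f)
 case 0
 then have "f [] = []" by (auto simp: rows_def bij_betw_def)
 then show ?case by (intro exI[of _ id]) (auto simp: rows_def)
next
 case (Suc K)
 let ?X = "rows (Suc K)"
 define fi where "fi = inv_into ?X f"
 have f: "f x \<in> ?X" "fi x \<in> ?X" "fi (f x) = x" "f (fi x) = x" if "x \<in> ?X" for x
  using Suc.prems that unfolding fi_def
  by (auto simp: bij_betw_def inv_into_into f_inv_into_f)
 let ?s = "%xs. (\<not> hd xs) # tl xs"
 have s: "?s x \<in> ?X \<and> ?s (?s x) = x \<and> ?s x \<noteq> x" if "x \<in> ?X" for x
  using that by (cases x) (auto simp: rows_def)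
 have t: "fi (?s (f x)) \<in> ?X \<and> fi (?s (f (fi (?s (f x))))) = x \<and> fi (?s (f x)) \<noteq> x" if x: "x \<in> ?X" for x
  using f(1)[OF x] f(2,4)[of "?s (f x)"] s[OF f(1)[OF x]] f(3)[OF x] by metis
 obtain c where c: "\<And>x. x \<in> ?X ==> c (?s x) = (\<not> c x)" "\<And>x. x \<in> ?X ==> c (fi (?s (f x))) = (\<not> c x)"
  using two_involutions_coloring[OF finite_rows[of "Suc K"] s, of "%x. fi (?s (f x))"] t by blast
 \<comment> \<open>The unique row with tail \<open>xs\<close> and colour \<open>b\<close>.\<close>
 define pick where "pick = (%b xs. if c (False # xs) = b then False # xs else True # xs)"
 have pick: "pick b xs \<in> ?X" "c (pick b xs) = b" "tl (pick b xs) = xs" if "xs \<in> rows K" for b xs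
  using that c(1)[of "False # xs"] by (auto simp: pick_def rows_def)
 have pick_tl: "pick (c x) (tl x) = x" if xX: "x \<in> ?X" for x
 proof -
  obtain b xs where x: "x = b # xs" using xX by (cases x) (auto simp: rows_def)
  show ?thesis using c(1)[of "False # xs"] xX unfolding x pick_def by (cases b) (auto simp: rows_def)
 qed
 define g where "g = (%b xs. tl (f (pick b xs)))"
 have gr: "g b xs \<in> rows K" if "xs \<in> rows K" for b xs
  using f(1)[OF pick(1)[OF that], of b] by (auto simp: g_def rows_def)
 have bij: "bij_betw (g b) (rows K) (rows K)" for b
 proof -
  have "inj_on (g b) (rows K)"
  proof (rule inj_onI)
   fix xs ys assume xy: "xs \<in> rows K" "ys \<in> rows K" "g b xs = g b ys"
   let ?x = "pick b xs" and ?y = "pick b ys"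
   have X: "?x \<in> ?X" "?y \<in> ?X" using pick xy by auto
   \<comment> \<open>Images with the same tail agree or differ in the head; in the second case the
     colours of the two rows would be different.\<close>
   have "f ?y = f ?x \<or> f ?y = ?s (f ?x)"
    using xy(3) f(1)[OF X(1)] f(1)[OF X(2)] unfolding g_def rows_def
    by (cases "f ?x"; cases "f ?y") auto
   moreover have "f ?y \<noteq> ?s (f ?x)"
   proof
    assume h: "f ?y = ?s (f ?x)"
    have "c (fi (f ?y)) = (\<not> c ?x)" unfolding h by (rule c(2)[OF X(1)])
    then have "c ?y = (\<not> c ?x)" unfolding f(3)[OF X(2)] .
    then show False unfolding pick(2)[OF xy(1)] pick(2)[OF xy(2)] by simp
   qed
   ultimately have "f ?y = f ?x" by blast
   then have "fi (f ?y) = fi (f ?x)" by (rule arg_cong)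
   then have "?y = ?x" unfolding f(3)[OF X(1)] f(3)[OF X(2)] .
   then have "tl ?y = tl ?x" by (rule arg_cong)
   then show "xs = ys" unfolding pick(3)[OF xy(1)] pick(3)[OF xy(2)] by simp
  qed
  moreover have "g b ` rows K \<subseteq> rows K" using gr by auto
  ultimately show ?thesis using endo_inj_surj[OF finite_rows] by (simp add: bij_betw_def)
 qed
 have "\<forall>b. \<exists>g'. routes (dims K) g' \<and> (\<forall>xs\<in>rows K. g' xs = g b xs)"
  using Suc.IH[OF bij] by blast
 from choice[OF this] obtain G where G: "\<And>b. routes (dims K) (G b)" "\<And>b xs. xs \<in> rows K ==> G b xs = g b xs"
  by blast
 define h1 where "h1 = (%xs. if xs \<in> ?X then c xs # tl xs else xs)"
 \<comment> \<open>Restores the correct head at the exit. The tail that leaves half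
   \<open>hd ys\<close> determines the row that entered, because the map of each half is
   injective.\<close>
 define h2 where "h2 = (%ys. if ys \<in> ?X \<and> (\<exists>xs\<in>rows K. ys = hd ys # g (hd ys) xs)
   then f (pick (hd ys) (SOME xs. xs \<in> rows K \<and> ys = hd ys # g (hd ys) xs)) else ys)"
 have l1: "layer 0 h1"
  unfolding layer_def
 proof
  fix xs show "h1 xs = xs \<or> h1 xs = flip 0 xs"
   by (cases xs) (auto simp: h1_def flip_def rows_def)
 qed
 have l2: "layer 0 h2"
  unfolding layer_def
 proof
  fix ys
  show "h2 ys = ys \<or> h2 ys = flip 0 ys"
  proof (cases "ys \<in> ?X \<and> (\<exists>xs\<in>rows K. ys = hd ys # g (hd ys) xs)")
   case True
   define xs where "xs = (SOME xs. xs \<in> rows K \<and> ys = hd ys # g (hd ys) xs)"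
   have xs: "xs \<in> rows K" "ys = hd ys # g (hd ys) xs"
    using someI_ex[of "%xs. xs \<in> rows K \<and> ys = hd ys # g (hd ys) xs"] True unfolding xs_def by auto
   have "h2 ys = f (pick (hd ys) xs)" unfolding h2_def xs_def using True by simp
   moreover have "tl (f (pick (hd ys) xs)) = tl ys" using xs(2) unfolding g_def by (metis list.sel(3))
   moreover have "f (pick (hd ys) xs) \<in> ?X" using f(1) pick(1) xs(1) by blast
   ultimately show ?thesis using True
    by (cases ys; cases "h2 ys") (auto simp: rows_def flip_def)
  next
   case False
   then show ?thesis unfolding h2_def by metis
  qed
 qed
 have inj: "xs = xs'" if "g b xs = g b xs'" "xs \<in> rows K" "xs' \<in> rows K" for b xs xs'
  using bij[of b] that unfolding bij_betw_def inj_on_def by blast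
 have "h2 (lift_fn G (h1 x)) = f x" if x: "x \<in> ?X" for x
 proof -
  have tlx: "tl x \<in> rows K" using x by (auto simp: rows_def)
  let ?y = "c x # g (c x) (tl x)"
  have 1: "lift_fn G (h1 x) = ?y" using x G(2)[OF tlx] by (simp add: h1_def lift_fn_def)
  have y: "?y \<in> ?X" using gr[OF tlx] by (simp add: rows_def)
  have ex: "\<exists>xs\<in>rows K. ?y = hd ?y # g (hd ?y) xs" using tlx by auto
  have "(SOME xs. xs \<in> rows K \<and> ?y = hd ?y # g (hd ?y) xs) = tl x"
  proof (rule some_equality)
   fix xs assume "xs \<in> rows K \<and> ?y = hd ?y # g (hd ?y) xs"
   then show "xs = tl x" using inj tlx by auto
  qed (use tlx in auto)
  then have "h2 ?y = f (pick (c x) (tl x))" unfolding h2_def using y ex by simp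
  then show ?thesis using 1 pick_tl[OF x] by simp
 qed
 moreover have "routes (dims (Suc K)) (h2 \<circ> (lift_fn G \<circ> h1))"
 proof -
  have "routes [0] h1" using l1 by auto
  moreover have "routes (map Suc (dims K)) (lift_fn G)" using routes_lift G(1) by blast
  ultimately have "routes (map Suc (dims K) @ [0]) (lift_fn G \<circ> h1)" unfolding routes_append by blast
  then show ?thesis using l2 by auto
 qed
 moreover have "\<forall>x\<in>?X. (h2 \<circ> (lift_fn G \<circ> h1)) x = f x" using calculation(1) by simp
 ultimately show ?case by blast
qed

section \<open>Computations as locally checkable tables\<close>

definition rnum :: "bits => nat" where
 "rnum xs = bval (rev xs)"

text \<open>Most significant bit first, so that comparing two row numbers means scanning upwards to
  the first difference.\<close>

definition row :: "nat => nat => bits" where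
 "row K i = rev (map (bit i) [0..<K])"

lemma bval_horner: "bval bs = horner_sum of_bool 2 bs"
 by (induction bs) auto

lemma length_row [simp]: "length (row K i) = K"
 by (simp add: row_def)

lemma row_in [simp]: "row K i \<in> rows K"
 by (simp add: rows_def)

lemma rnum_row: "i < 2 ^ K ==> rnum (row K i) = i"
 by (simp add: rnum_def row_def bval_horner horner_sum_bit_eq_take_bit take_bit_nat_eq_self)

lemma rnum_less: "xs \<in> rows K ==> rnum xs < 2 ^ K"
 using bval_less[of "rev xs"] by (simp add: rnum_def rows_def)

lemma bval_inj: "length xs = length ys ==> bval xs = bval ys ==> xs = ys"
proof (induction xs arbitrary: ys)
 case (Cons x xs)
 then obtain y zs where y: "ys = y # zs" by (cases ys) auto
 have "of_bool x + 2 * bval xs = of_bool y + 2 * bval zs" using Cons.prems y by simp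
 then have "x = y \<and> bval xs = bval zs" by (cases x; cases y) (auto, presburger+)
 then show ?case using Cons y by auto
qed simp

lemma rnum_inj: "xs \<in> rows K ==> ys \<in> rows K ==> rnum xs = rnum ys ==> xs = ys"
 using bval_inj[of "rev xs" "rev ys"] by (auto simp: rnum_def rows_def)

lemma row_rnum: "xs \<in> rows K ==> row K (rnum xs) = xs"
 by (rule rnum_inj[of _ K]) (auto simp: rnum_row rnum_less)

lemma row_inj: "i < 2 ^ K ==> j < 2 ^ K ==> row K i = row K j ==> i = j"
 by (metis rnum_row)

lemma bval_replicate: "bval (replicate k True) + 1 = 2 ^ k" "bval (replicate k False) = 0"
 by (induction k) auto

lemma rnum_succ_form:
 "rnum (pre @ True # replicate k False) = rnum (pre @ False # replicate k True) + 1"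
 using bval_replicate[of k] by (simp add: rnum_def bval_append)

lemma rnum_succ_ex:
 assumes "xs \<in> rows K" "rnum xs + 1 < 2 ^ K"
 shows "\<exists>pre k. xs = pre @ False # replicate k True"
proof -
 have "\<exists>k post. bs = replicate k True @ False # post \<or> bs = replicate k True" for bs
 proof (induction bs)
  case Nil
  then show ?case by (intro exI[of _ 0]) simp
 next
  case (Cons b bs)
  then obtain k post where k: "bs = replicate k True @ False # post \<or> bs = replicate k True" by blast
  show ?case
  proof (cases b)
   case True
   then show ?thesis using k by (intro exI[of _ "Suc k"] exI[of _ post]) auto
  next
   case False
   then show ?thesis by (intro exI[of _ 0] exI[of _ bs]) simp
  qed
 qed
 then obtain k post where "rev xs = replicate k True @ False # post \<or> rev xs = replicate k True" by blast
 then show ?thesis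
 proof
  assume "rev xs = replicate k True @ False # post"
  then have "xs = rev (replicate k True @ False # post)" by (metis rev_rev_ident)
  then show ?thesis by (intro exI[of _ "rev post"] exI[of _ k]) simp
 next
  assume r: "rev xs = replicate k True"
  then have "length (rev xs) = k" by simp
  then have "k = K" using assms(1) by (simp add: rows_def)
  then have "rnum xs + 1 = 2 ^ K" using r bval_replicate(1)[of K] by (simp add: rnum_def)
  then show ?thesis using assms(2) by simp
 qed
qed

text \<open>A symbol \<open>(True, b)\<close> of a pattern is the constant \<open>b\<close>, \<open>(False, _)\<close> is a wildcard.\<close>

type_synonym pattern = "(bool \<times> bool) list"

definition inst :: "pattern => bits => bits" where
 "inst \<pi> y = map (%p. if fst (fst p) then snd (fst p) else snd p) (zip \<pi> y)"

definition stars :: "nat => pattern" where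
 "stars n = replicate n (False, False)"

definition cpat :: "bits => pattern" where
 "cpat bs = map (%b. (True, b)) bs"

lemma length_stars [simp]: "length (stars n) = n" and length_cpat [simp]: "length (cpat bs) = length bs"
 by (simp_all add: stars_def cpat_def)

lemma inst_append: "length \<pi> = length y ==> inst (\<pi> @ \<pi>') (y @ y') = inst \<pi> y @ inst \<pi>' y'"
 by (simp add: inst_def)

lemma inst_stars: "length y = n ==> inst (stars n) y = y"
 by (rule nth_equalityI) (auto simp: inst_def stars_def)

lemma inst_cpat: "length y = length bs ==> inst (cpat bs) y = bs"
proof (induction bs arbitrary: y)
 case (Cons b bs)
 then obtain z zs where "y = z # zs" by (cases y) auto
 then show ?case using Cons by (auto simp: inst_def cpat_def)
qed (simp add: inst_def cpat_def)

lemma length_inst: "length \<pi> = length y ==> length (inst \<pi> y) = length y"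
 by (simp add: inst_def)

type_synonym shape = "pattern \<times> pattern"

text \<open>Both rows of a pair are instances under the same assignment \<open>y\<close>. This is
  what lets a constraint between two rows be quantified over \<open>K\<close> bits instead of
  \<open>2 * K\<close>.\<close>

definition srel :: "nat => shape list => (bits \<times> bits) set" where
 "srel K S = {(inst (fst s) y, inst (snd s) y) | s y. s \<in> set S \<and> y \<in> rows K}"

lemma srelI: "(\<pi>, \<pi>') \<in> set S ==> y \<in> rows K ==> inst \<pi> y = u ==> inst \<pi>' y = v ==> (u, v) \<in> srel K S"
 unfolding srel_def by force

lemma srelE:
 assumes "(u, v) \<in> srel K S"
 obtains \<pi> \<pi>' y where "(\<pi>, \<pi>') \<in> set S" "y \<in> rows K" "inst \<pi> y = u" "inst \<pi>' y = v"
 using assms unfolding srel_def by force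

definition allS :: "nat => shape list" where
 "allS K = [(stars K, stars K)]"

definition constS :: "bits => shape list" where
 "constS bs = [(cpat bs, cpat bs)]"

definition bitpat :: "nat => nat => bool => pattern" where
 "bitpat K p b = stars p @ (True, b) # stars (K - p - 1)"

definition bitS :: "nat => nat => bool => shape list" where
 "bitS K p b = [(bitpat K p b, bitpat K p b)]"

definition flipS :: "nat => nat => shape list" where
 "flipS K d = [(bitpat K d False, bitpat K d True), (bitpat K d True, bitpat K d False)]"

text \<open>Binary increment, with one shape for each number \<open>k\<close> of trailing ones
  through which the carry runs.\<close>

definition stepS :: "nat => shape list" where
 "stepS K = map (%k. (stars (K - k - 1) @ cpat (False # replicate k True),
   stars (K - k - 1) @ cpat (True # replicate k False))) [0..<K]"

lemma srel_allS: "srel K (allS K) = {(x, x) | x. x \<in> rows K}"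
proof -
 have "inst (stars K) y = y" if "y \<in> rows K" for y using inst_stars that by (auto simp: rows_def)
 then show ?thesis by (auto elim!: srelE intro!: srelI simp: allS_def)
qed

lemma srel_constS: "length bs = K ==> srel K (constS bs) = {(bs, bs)}"
proof -
 assume l: "length bs = K"
 have 1: "inst (cpat bs) y = bs" if "y \<in> rows K" for y using inst_cpat that l by (auto simp: rows_def)
 have "replicate K False \<in> rows K" by (simp add: rows_def)
 with 1 have "(bs, bs) \<in> srel K (constS bs)" by (intro srelI[of "cpat bs" "cpat bs"]) (auto simp: constS_def)
 moreover have "srel K (constS bs) \<subseteq> {(bs, bs)}"
 proof clarify
  fix u v assume "(u, v) \<in> srel K (constS bs)"
  then obtain y where "y \<in> rows K" "inst (cpat bs) y = u" "inst (cpat bs) y = v"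
   by (rule srelE) (auto simp: constS_def)
  then show "u = bs \<and> v = bs" using 1[of y] by simp
 qed
 ultimately show ?thesis by blast
qed

lemma inst_bitpat: "y \<in> rows K ==> p < K ==> inst (bitpat K p b) y = y[p := b]"
proof -
 assume y: "y \<in> rows K" "p < K"
 then have l: "length y = K" by (simp add: rows_def)
 have u: "y[p := b] = take p y @ b # drop (Suc p) y"
  by (rule upd_conv_take_nth_drop) (simp add: l y)
 have e: "take p y @ y ! p # drop (Suc p) y = y"
  by (rule id_take_nth_drop[symmetric]) (simp add: l y)
 have s1: "inst (stars p) (take p y) = take p y" "inst (stars (K - p - 1)) (drop (Suc p) y) = drop (Suc p) y"
  using inst_stars[of "take p y" p] inst_stars[of "drop (Suc p) y" "K - p - 1"] l y by simp_all
 have "inst (bitpat K p b) (take p y @ y ! p # drop (Suc p) y) =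
   inst (stars p) (take p y) @ inst ((True, b) # stars (K - p - 1)) (y ! p # drop (Suc p) y)"
  unfolding bitpat_def by (rule inst_append) (simp add: l y less_imp_le)
 also have "\<dots> = take p y @ b # inst (stars (K - p - 1)) (drop (Suc p) y)"
  by (simp add: s1(1)) (simp add: inst_def)
 finally show ?thesis unfolding e u s1 .
qed

lemma srel_bitS: "p < K ==> srel K (bitS K p b) = {(x, x) | x. x \<in> rows K \<and> x ! p = b}"
proof -
 assume p: "p < K"
 have "(x, x) \<in> srel K (bitS K p b)" if "x \<in> rows K" "x ! p = b" for x
  using inst_bitpat[OF that(1) p, of b] list_update_id[of x p] that
  by (intro srelI[of "bitpat K p b" "bitpat K p b" _ x]) (simp_all add: bitS_def)
 moreover have "u = v \<and> u \<in> rows K \<and> u ! p = b" if uv: "(u, v) \<in> srel K (bitS K p b)" for u v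
  using uv
 proof (rule srelE)
  fix \<pi> \<pi>' y assume "(\<pi>, \<pi>') \<in> set (bitS K p b)" "y \<in> rows K" "inst \<pi> y = u" "inst \<pi>' y = v"
  then have "u = y[p := b]" "v = y[p := b]" "y \<in> rows K" using inst_bitpat p by (auto simp: bitS_def)
  then show ?thesis using p by (simp add: rows_def)
 qed
 ultimately show ?thesis by force
qed

lemma srel_flipS: "d < K ==> srel K (flipS K d) = {(x, flip d x) | x. x \<in> rows K}"
proof -
 assume d: "d < K"
 have "(x, flip d x) \<in> srel K (flipS K d)" if x: "x \<in> rows K" for x
 proof (rule srelI[of "bitpat K d (x ! d)" "bitpat K d (\<not> x ! d)" _ x])
  show "(bitpat K d (x ! d), bitpat K d (\<not> x ! d)) \<in> set (flipS K d)" by (cases "x ! d") (simp_all add: flipS_def)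
 qed (use x d in \<open>auto simp: inst_bitpat flip_def\<close>)
 moreover have "v = flip d u \<and> u \<in> rows K" if uv: "(u, v) \<in> srel K (flipS K d)" for u v
  using uv
 proof (rule srelE)
  fix \<pi> \<pi>' y assume "(\<pi>, \<pi>') \<in> set (flipS K d)" "y \<in> rows K" "inst \<pi> y = u" "inst \<pi>' y = v"
  then obtain b where "u = y[d := b]" "v = y[d := \<not> b]" "y \<in> rows K" using inst_bitpat d by (auto simp: flipS_def)
  then show ?thesis using d by (simp add: rows_def flip_def)
 qed
 ultimately show ?thesis by force
qed

lemma srel_stepS: "srel K (stepS K) = {(x, y). x \<in> rows K \<and> y \<in> rows K \<and> rnum y = rnum x + 1}"
proof -
 have i: "inst (stars (K - k - 1) @ cpat (b # replicate k c)) y = take (K - k - 1) y @ b # replicate k c"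
  if "k < K" "y \<in> rows K" for k b c y
 proof -
  have "inst (stars (K - k - 1) @ cpat (b # replicate k c)) (take (K - k - 1) y @ drop (K - k - 1) y) =
    take (K - k - 1) y @ b # replicate k c"
   using that by (subst inst_append) (auto simp: rows_def inst_stars intro!: inst_cpat)
  then show ?thesis by simp
 qed
 show ?thesis
 proof (intro equalityI subsetI)
  fix z assume "z \<in> srel K (stepS K)"
  then obtain k y where k: "k < K" "y \<in> rows K" "z = (inst (stars (K - k - 1) @ cpat (False # replicate k True)) y,
    inst (stars (K - k - 1) @ cpat (True # replicate k False)) y)"
   unfolding srel_def stepS_def by auto
  then have "z = (take (K - k - 1) y @ False # replicate k True, take (K - k - 1) y @ True # replicate k False)"
   using i by simp
  then show "z \<in> {(x, y). x \<in> rows K \<and> y \<in> rows K \<and> rnum y = rnum x + 1}"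
   using k(1,2) by (auto simp: rnum_succ_form rows_def)
 next
  fix z assume "z \<in> {(x, y). x \<in> rows K \<and> y \<in> rows K \<and> rnum y = rnum x + 1}"
  then obtain x y where z: "z = (x, y)" "x \<in> rows K" "y \<in> rows K" "rnum y = rnum x + 1" by auto
  then obtain pre k where x: "x = pre @ False # replicate k True"
   using rnum_succ_ex[of x K] rnum_less[of y K] by auto
  have len: "length pre + k + 1 = K" using x z(2) by (simp add: rows_def)
  have "y = pre @ True # replicate k False"
   by (rule rnum_inj[OF z(3)]) (use len z(4) x rnum_succ_form[of pre k] in \<open>auto simp: rows_def\<close>)
  moreover have "inst (stars (K - k - 1) @ cpat (b # replicate k c)) x = pre @ b # replicate k c" for b c
   using i[of k x b c] len z(2) x by auto
  moreover have "k \<in> set [0..<K]" using len by simp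
  ultimately show "z \<in> srel K (stepS K)"
   unfolding z(1) using x z(2)
   by (intro srelI[of "stars (K - k - 1) @ cpat (False # replicate k True)"
      "stars (K - k - 1) @ cpat (True # replicate k False)" _ x]) (auto simp: stepS_def)
 qed
qed

section \<open>Entries of a row and the constraints between them\<close>

type_synonym tag = "nat \<times> nat \<times> nat \<times> nat"

text \<open>Unary blocks closed by \<open>False\<close> can be split off uniquely, and the padding
  gives all tags the same length; row and tag concatenated form an address in the table.\<close>

definition tagc :: "nat => tag => bits" where
 "tagc n t = (let s = replicate (fst t) True @ False # replicate (fst (snd t)) True @ False #
   replicate (fst (snd (snd t))) True @ False # replicate (snd (snd (snd t))) True @ [False]
  in s @ replicate (n - length s) False)"

definition tag_weight :: "tag => nat" where
 "tag_weight t = fst t + fst (snd t) + fst (snd (snd t)) + snd (snd (snd t)) + 4"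

lemma length_tagc: "tag_weight t \<le> n ==> length (tagc n t) = n"
 by (simp add: tagc_def tag_weight_def Let_def)

lemma unary_split: "replicate a True @ False # xs = replicate b True @ False # ys ==> a = b \<and> xs = ys"
proof (induction a arbitrary: b)
 case 0
 then show ?case by (cases b) auto
next
 case (Suc a)
 then show ?case by (cases b) auto
qed

lemma tagc_inj: "tagc n t = tagc n t' ==> t = t'"
proof -
 assume a: "tagc n t = tagc n t'"
 obtain a1 a2 a3 a4 where t: "t = (a1, a2, a3, a4)" by (metis prod_cases4)
 obtain b1 b2 b3 b4 where t': "t' = (b1, b2, b3, b4)" by (metis prod_cases4)
 from a show ?thesis unfolding t t' tagc_def Let_def
  by (auto dest!: unary_split)
qed

text \<open>\<open>IX\<close>: bits of the row's own number. \<open>PC\<close>, \<open>REG\<close>: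
  program counter and registers. \<open>CR\<close>: the row counts as creating its cell instead of
  reading one. \<open>REC l f p\<close>: bit \<open>p\<close> of field \<open>f\<close> of the
  record present after \<open>l\<close> layers of the network, with switches \<open>SW\<close>.
  \<open>EQ p\<close>: the time of the arriving record agrees with the row number in its first
  \<open>p\<close> bits. \<open>ZR p\<close>: the first \<open>p\<close> bits of the tested register
  are zero. \<open>GS\<close>: the guessed input bit.\<close>

abbreviation (input) "IX p \<equiv> (0::nat, p::nat, 0::nat, 0::nat)"
abbreviation (input) "PC l \<equiv> (1::nat, l::nat, 0::nat, 0::nat)"
abbreviation (input) "REG r p \<equiv> (2::nat, r::nat, p::nat, 0::nat)"
abbreviation (input) "CR \<equiv> (3::nat, 0::nat, 0::nat, 0::nat)"
abbreviation (input) "REC l f p \<equiv> (4::nat, l::nat, f::nat, p::nat)"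
abbreviation (input) "SW l \<equiv> (5::nat, l::nat, 0::nat, 0::nat)"
abbreviation (input) "EQ p \<equiv> (6::nat, p::nat, 0::nat, 0::nat)"
abbreviation (input) "ZR p \<equiv> (7::nat, p::nat, 0::nat, 0::nat)"
abbreviation (input) "GS \<equiv> (8::nat, 0::nat, 0::nat, 0::nat)"

text \<open>A literal \<open>(r, t, s)\<close> says that the entry \<open>t\<close> of the first or second row has value \<open>s\<close>.\<close>

type_synonym clit = "bool \<times> tag \<times> bool"

definition holds :: "(bits => tag => bool) => bits => bits => clit list => bool" where
 "holds w x y cl \<longleftrightarrow> (\<exists>l\<in>set cl. w (if fst l then y else x) (fst (snd l)) = snd (snd l))"

lemma holds_Cons [simp]: "holds w x y ((r, t, s) # cl) \<longleftrightarrow> w (if r then y else x) t = s \<or> holds w x y cl"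
 and holds_Nil [simp]: "holds w x y [] \<longleftrightarrow> False"
 by (auto simp: holds_def)

definition eqc :: "clit list => bool \<times> tag => bool \<times> tag => clit list list" where
 "eqc c a b = [(fst a, snd a, False) # (fst b, snd b, True) # c, (fst a, snd a, True) # (fst b, snd b, False) # c]"

lemma eqc_holds: "(\<forall>cl\<in>set (eqc c (ra, ta) (rb, tb)). holds w x y cl) \<longleftrightarrow>
  holds w x y c \<or> w (if ra then y else x) ta = w (if rb then y else x) tb"
 by (auto simp: eqc_def)

type_synonym icode = "nat \<times> nat \<times> nat \<times> nat"

definition keepc :: "nat => nat => nat => clit list list" where
 "keepc K l r = concat (map (%p. concat (map (%r'. eqc [(False, PC l, False)] (False, REG r' p) (True, REG r' p))
   (filter (%r'. r' \<noteq> r) [0..<4]))) [0..<K])"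

definition nextc :: "nat => clit list list" where
 "nextc l = [[(False, PC l, False), (True, PC (Suc l), True)]]"

text \<open>Every clause contains the negation of \<open>PC l\<close>, so only the current
  instruction has an effect. In a jump, any set bit of the register forces the next address, while
  \<open>ZR\<close> passes through zero bits and forces the target at the end;
  \<open>keepc K l 4\<close> exempts no register. A read of an input bit leaves an empty record, so
  that the row number can represent True.\<close>

definition icl :: "nat => nat => icode => clit list list" where
 "icl K l c = (let op = fst c; r = fst (snd c); s = fst (snd (snd c)); u = snd (snd (snd c)); n = (False, PC l, False) in
  if op = 0 then nextc l @ keepc K l r @ map (%p. [n, (True, REG r p, False)]) [0..<K]
  else if op = 1 then nextc l @ keepc K l r @ concat (map (%p. eqc [n] (False, REC 0 2 p) (False, REG s p) @
   eqc [n] (False, REC 0 3 p) (False, REG u p) @ eqc [n] (True, REG r p) (False, IX p)) [0..<K])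
  else if op = 2 then nextc l @ keepc K l r @ [[n, (False, CR, False)]] @
   concat (map (%p. eqc [n] (False, REC 0 0 p) (False, REG s p) @ eqc [n] (True, REG r p) (False, REC 0 2 p)) [0..<K])
  else if op = 3 then nextc l @ keepc K l r @ [[n, (False, CR, False)]] @
   concat (map (%p. eqc [n] (False, REC 0 0 p) (False, REG s p) @ eqc [n] (True, REG r p) (False, REC 0 3 p)) [0..<K])
  else if op = 4 then keepc K l 4 @ map (%p. [n, (False, REG r p, False), (True, PC (Suc l), True)]) [0..<K] @
   map (%p. [n, (False, ZR p, False), (False, REG r p, True), (False, ZR (Suc p), True)]) [0..<K] @
   [[n, (False, ZR K, False), (True, PC s, True)]]
  else nextc l @ keepc K l r @ concat (map (%p. [[n, (False, REC 0 2 p, False)], [n, (False, REC 0 3 p, False)],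
   [n, (True, REG r p, False), (False, GS, True)], [n, (True, REG r p, False), (False, IX p, True)],
   [n, (False, GS, False), (False, IX p, False), (True, REG r p, True)]]) [0..<K]))"

fun icode_of :: "tinstr => icode" where
 "icode_of (TNil r) = (0, r, 0, 0)"
| "icode_of (TCons r s u) = (1, r, s, u)"
| "icode_of (THd r s) = (2, r, s, 0)"
| "icode_of (TTl r s) = (3, r, s, 0)"
| "icode_of (TJnil r l) = (4, r, l, 0)"
| "icode_of (TNext r) = (5, r, 0, 0)"
| "icode_of _ = (0, 0, 0, 0)"

definition keep :: "nat => (bits => tag => bool) => bits => bits => nat => bool" where
 "keep K w x y r \<longleftrightarrow> (\<forall>p<K. \<forall>r'<4. r' \<noteq> r --> w x (REG r' p) = w y (REG r' p))"

fun iok :: "nat => (bits => tag => bool) => nat => tinstr => bits => bits => bool" where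
 "iok K w l (TNil r) x y \<longleftrightarrow> w y (PC (Suc l)) \<and> keep K w x y r \<and> (\<forall>p<K. \<not> w y (REG r p))"
| "iok K w l (TCons r s u) x y \<longleftrightarrow> w y (PC (Suc l)) \<and> keep K w x y r \<and>
   (\<forall>p<K. w x (REC 0 2 p) = w x (REG s p) \<and> w x (REC 0 3 p) = w x (REG u p) \<and> w y (REG r p) = w x (IX p))"
| "iok K w l (THd r s) x y \<longleftrightarrow> w y (PC (Suc l)) \<and> keep K w x y r \<and> \<not> w x CR \<and>
   (\<forall>p<K. w x (REC 0 0 p) = w x (REG s p) \<and> w y (REG r p) = w x (REC 0 2 p))"
| "iok K w l (TTl r s) x y \<longleftrightarrow> w y (PC (Suc l)) \<and> keep K w x y r \<and> \<not> w x CR \<and>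
   (\<forall>p<K. w x (REC 0 0 p) = w x (REG s p) \<and> w y (REG r p) = w x (REC 0 3 p))"
| "iok K w l (TJnil r l') x y \<longleftrightarrow> keep K w x y 4 \<and> (\<forall>p<K. w x (REG r p) --> w y (PC (Suc l))) \<and>
   (\<forall>p<K. w x (ZR p) \<and> \<not> w x (REG r p) --> w x (ZR (Suc p))) \<and> (w x (ZR K) --> w y (PC l'))"
| "iok K w l (TNext r) x y \<longleftrightarrow> w y (PC (Suc l)) \<and> keep K w x y r \<and>
   (\<forall>p<K. \<not> w x (REC 0 2 p) \<and> \<not> w x (REC 0 3 p) \<and> w y (REG r p) = (w x GS \<and> w x (IX p)))"
| "iok K w l _ x y \<longleftrightarrow> False"

definition tnoask :: "tinstr => bool" where
 "tnoask c = (case c of TEof r => False | TEmit r => False | TAsk r => False | _ => True)"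

lemma ball_concat_map: "(\<forall>c\<in>set (concat (map f xs)). Q c) \<longleftrightarrow> (\<forall>x\<in>set xs. \<forall>c\<in>set (f x). Q c)"
 by auto

lemma keepc_holds: "(\<forall>cl\<in>set (keepc K l r). holds w x y cl) \<longleftrightarrow> \<not> w x (PC l) \<or> keep K w x y r"
 unfolding keepc_def keep_def by (simp add: ball_concat_map eqc_holds del: set_concat) auto

lemma icl_holds:
 assumes "tnoask c"
 shows "(\<forall>cl\<in>set (icl K l (icode_of c)). holds w x y cl) \<longleftrightarrow> (w x (PC l) --> iok K w l c x y)"
proof (cases c)
 case (TNil r)
 then show ?thesis by (simp add: icl_def Let_def nextc_def ball_Un keepc_holds) auto
next
 case (TCons r s u)
 then show ?thesis by (simp add: icl_def Let_def nextc_def ball_Un keepc_holds ball_concat_map eqc_holds del: set_concat) auto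
next
 case (THd r s)
 then show ?thesis by (simp add: icl_def Let_def nextc_def ball_Un keepc_holds ball_concat_map eqc_holds del: set_concat) auto
next
 case (TTl r s)
 then show ?thesis by (simp add: icl_def Let_def nextc_def ball_Un keepc_holds ball_concat_map eqc_holds del: set_concat) auto
next
 case (TJnil r l)
 then show ?thesis by (simp add: icl_def Let_def nextc_def ball_Un keepc_holds) auto
next
 case (TNext r)
 then show ?thesis by (simp add: icl_def Let_def nextc_def ball_Un keepc_holds ball_concat_map del: set_concat) auto
qed (use assms in \<open>auto simp: tnoask_def\<close>)

text \<open>Fields of the records sent through the network: 0 address, 1 time, 2 head, 3 tail.\<close>

definition row_ok :: "nat => nat => (bits => tag => bool) => bits => bool" where
 "row_ok K rej w x \<longleftrightarrow> w x (ZR 0) \<and> \<not> w x (PC rej) \<and>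
   (\<forall>p<K. w x (REC 0 1 p) = w x (IX p) \<and> (w x CR --> w x (REC 0 0 p) = w x (IX p))) \<and>
   (\<not> w x CR --> w x (EQ 0) \<and> \<not> w x (EQ K) \<and> (\<forall>p<K.
    (w x (REC (2 * K) 0 p) = w x (REC 0 0 p)) \<and> (w x (REC (2 * K) 2 p) = w x (REC 0 2 p)) \<and>
    (w x (REC (2 * K) 3 p) = w x (REC 0 3 p)) \<and> (w x (EQ p) \<and> w x (REC (2 * K) 1 p) --> w x (IX p)) \<and>
    (w x (EQ p) \<and> w x (REC (2 * K) 1 p) = w x (IX p) --> w x (EQ (Suc p)))))"

text \<open>Row \<open>i\<close> describes time \<open>i\<close>, starting with row 1, and also the
  cell created at that time. Row 0 belongs to the nil address; its record is empty, which makes head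
  and tail of nil equal to nil.\<close>

definition table_ok :: "nat => tinstr list => nat => (bits => tag => bool) => bool" where
 "table_ok K Pg rej w \<longleftrightarrow> (\<forall>x\<in>rows K. \<forall>p<K. w x (IX p) = x ! p) \<and>
   w (row K 1) (PC 0) \<and> (\<forall>r<4. \<forall>p<K. \<not> w (row K 1) (REG r p)) \<and>
   (\<forall>p<K. \<not> w (row K 0) (REC 0 2 p) \<and> \<not> w (row K 0) (REC 0 3 p)) \<and>
   (\<forall>x\<in>rows K. row_ok K rej w x) \<and>
   (\<forall>l<2 * K. \<forall>x\<in>rows K. \<forall>f<4. \<forall>p<K. w x (REC (Suc l) f p) =
    (if w x (SW l) then w (flip (dims K ! l) x) (REC l f p) else w x (REC l f p))) \<and>
   (\<forall>x\<in>rows K. \<forall>y\<in>rows K. rnum y = Suc (rnum x) --> (\<forall>l<length Pg. w x (PC l) --> iok K w l (Pg ! l) x y))"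

lemma rnum_lex:
 assumes "x \<in> rows K" "z \<in> rows K" "p < K" "\<And>k. k < p ==> z ! k = x ! k" "\<not> z ! p" "x ! p"
 shows "rnum z < rnum x"
proof -
 have l: "length x = K" "length z = K" using assms(1,2) by (auto simp: rows_def)
 have "take p z = take p x" by (rule nth_equalityI) (use assms l in auto)
 moreover have "z = take p z @ z ! p # drop (Suc p) z" "x = take p x @ x ! p # drop (Suc p) x"
  by (rule id_take_nth_drop, simp add: l assms)+
 ultimately have z: "z = take p x @ False # drop (Suc p) z" and x: "x = take p x @ True # drop (Suc p) x"
  using assms(5,6) by auto
 have "rnum (a @ False # b) < rnum (a @ True # c)" if "length b = length c" for a b c
  using bval_less[of "rev b"] that by (simp add: rnum_def bval_append)
 from this[of "drop (Suc p) z" "drop (Suc p) x" "take p x"] show ?thesis using z x l by simp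
qed

lemma flip_rows: "x \<in> rows K ==> flip d x \<in> rows K"
 by (simp add: rows_def flip_def)

definition wd :: "nat => (nat => bool) => nat" where
 "wd K b = rnum (map b [0..<K])"

lemma wd_eqI: "n < 2 ^ K ==> (\<And>p. p < K ==> b p = row K n ! p) ==> wd K b = n"
proof -
 assume a: "n < 2 ^ K" "\<And>p. p < K ==> b p = row K n ! p"
 have "map b [0..<K] = row K n" by (rule nth_equalityI) (use a in auto)
 then show ?thesis using a by (simp add: wd_def rnum_row)
qed

lemma wd_cong: "(\<And>p. p < K ==> b p = b' p) ==> wd K b = wd K b'"
 unfolding wd_def by (rule arg_cong[of _ _ rnum]) (rule map_cong, auto)

lemma row_0: "p < K ==> row K 0 ! p = False"
 by (simp add: row_def rev_nth)

subsection \<open>Soundness\<close>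

text \<open>Whatever the switches are, a record that leaves the network entered it at some row.
  Soundness rests on this alone.\<close>

lemma table_network:
 assumes "table_ok K Pg rej w" "x \<in> rows K" "l \<le> 2 * K"
 shows "\<exists>z\<in>rows K. \<forall>f<4. \<forall>p<K. w x (REC l f p) = w z (REC 0 f p)"
 using assms(2,3)
proof (induction l arbitrary: x)
 case (Suc l)
 have e: "\<forall>f<4. \<forall>p<K. w x (REC (Suc l) f p) =
    (if w x (SW l) then w (flip (dims K ! l) x) (REC l f p) else w x (REC l f p))"
  using assms(1) Suc.prems unfolding table_ok_def by auto
 show ?case
 proof (cases "w x (SW l)")
  case True
  obtain z where "z \<in> rows K" "\<forall>f<4. \<forall>p<K. w (flip (dims K ! l) x) (REC l f p) = w z (REC 0 f p)"
   using Suc.IH[OF flip_rows[OF Suc.prems(1), of "dims K ! l"]] Suc_leD[OF Suc.prems(2)] by blast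
  then show ?thesis using e True by (intro bexI[of _ z]) auto
 next
  case False
  obtain z where "z \<in> rows K" "\<forall>f<4. \<forall>p<K. w x (REC l f p) = w z (REC 0 f p)"
   using Suc.IH[OF Suc.prems(1)] Suc.prems(2) by auto
  then show ?thesis using e False by (intro bexI[of _ z]) auto
 qed
qed auto

text \<open>A reading row receives a record with its own address and contents but a strictly smaller
  time. Following these records downwards must end at a creating row, whose address is its own
  number. Since cells are never overwritten, any earlier record for the address is as good as the
  latest.\<close>

lemma table_read:
 assumes t: "table_ok K Pg rej w"
 shows "x \<in> rows K ==> \<not> w x CR ==> p < K ==>
  w x (REC 0 2 p) = w (row K (wd K (%k. w x (REC 0 0 k)))) (REC 0 2 p) \<and>
  w x (REC 0 3 p) = w (row K (wd K (%k. w x (REC 0 0 k)))) (REC 0 3 p)"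
proof (induction "rnum x" arbitrary: x rule: less_induct)
 case less
 have rx: "row_ok K rej w x" using t less.prems(1) unfolding table_ok_def by auto
 note rx' = rx[unfolded row_ok_def]
 have ix: "w z (IX k) = z ! k" if "z \<in> rows K" "k < K" for z k using t that unfolding table_ok_def by auto
 obtain z where z: "z \<in> rows K" "\<And>f p. f < 4 ==> p < K ==> w x (REC (2 * K) f p) = w z (REC 0 f p)"
  using table_network[OF t less.prems(1), of "2 * K"] by auto
 have rz: "row_ok K rej w z" using t z(1) unfolding table_ok_def by auto
 have tm: "w x (REC (2 * K) 1 k) = z ! k" if "k < K" for k
  using z(2)[of 1 k] rz ix[OF z(1) that] that unfolding row_ok_def by auto
 \<comment> \<open>Otherwise \<open>EQ\<close> would propagate through all positions, but
   \<open>EQ K\<close> is forbidden for a reading row.\<close>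
 have "\<exists>p<K. z ! p \<noteq> x ! p"
 proof (rule ccontr)
  assume "\<not> (\<exists>p<K. z ! p \<noteq> x ! p)"
  then have "w x (EQ k)" if "k \<le> K" for k
   using that
  proof (induction k)
   case 0
   then show ?case using rx' less.prems(2) by blast
  next
   case (Suc k)
   then have k: "k < K" "w x (EQ k)" by auto
   then have "w x (REC (2 * K) 1 k) = w x (IX k)" using tm ix[OF less.prems(1)] \<open>\<not> (\<exists>p<K. z ! p \<noteq> x ! p)\<close> by auto
   then show ?case using rx' less.prems(2) k by blast
  qed
  then show False using rx' less.prems(2) by blast
 qed
 define p0 where "p0 = (LEAST p. p < K \<and> z ! p \<noteq> x ! p)"
 have p0: "p0 < K" "z ! p0 \<noteq> x ! p0"
  using LeastI_ex[of "%p. p < K \<and> z ! p \<noteq> x ! p"] \<open>\<exists>p<K. z ! p \<noteq> x ! p\<close> unfolding p0_def by auto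
 have pre: "z ! k = x ! k" if "k < p0" for k
  using not_less_Least[of k "%p. p < K \<and> z ! p \<noteq> x ! p"] that p0(1) unfolding p0_def by auto
 have "w x (EQ k)" if "k \<le> p0" for k
  using that
 proof (induction k)
  case 0
  then show ?case using rx' less.prems(2) by blast
 next
  case (Suc k)
  then have k: "k < K" "w x (EQ k)" using p0 by auto
  then have "w x (REC (2 * K) 1 k) = w x (IX k)" using tm ix[OF less.prems(1)] pre[of k] Suc.prems by auto
  then show ?case using rx' less.prems(2) k by blast
 qed
 \<comment> \<open>At the first difference the arriving time may have a 1 only where the row number
   has one; so it has 0 there and is smaller.\<close>
 then have "w x (REC (2 * K) 1 p0) --> w x (IX p0)" using rx' less.prems(2) p0(1) by blast
 then have "\<not> z ! p0" "x ! p0" using tm[OF p0(1)] ix[OF less.prems(1) p0(1)] p0(2) by auto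
 then have lt: "rnum z < rnum x" using rnum_lex[OF less.prems(1) z(1) p0(1)] pre by blast
 have eq: "w z (REC 0 f k) = w x (REC 0 f k)" if "k < K" "f \<in> {0, 2, 3}" for f k
  using rx' less.prems(2) that z(2)[of f k] by auto
 have ad: "wd K (%k. w z (REC 0 0 k)) = wd K (%k. w x (REC 0 0 k))"
  by (rule wd_cong) (use eq in auto)
 show ?case
 proof (cases "w z CR")
  case True
  then have "wd K (%k. w z (REC 0 0 k)) = rnum z"
   by (intro wd_eqI rnum_less z(1)) (use rz ix[OF z(1)] in \<open>auto simp: row_ok_def row_rnum[OF z(1)]\<close>)
  then have "row K (wd K (%k. w x (REC 0 0 k))) = z" using ad row_rnum[OF z(1)] by simp
  then show ?thesis using eq[of p 2] eq[of p 3] less.prems(3) by simp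
 next
  case False
  from less.hyps[OF lt z(1) False less.prems(3)] show ?thesis
   using eq[of p 2] eq[of p 3] less.prems(3) ad by simp
 qed
qed

text \<open>Required only of addresses held in registers or in cells: the record of a reading row
  describes another cell than the one numbered by that row.\<close>

definition good :: "nat => (bits => tag => bool) => (nat => nat) => (nat => nat) => nat => bool" where
 "good K w h t p \<longleftrightarrow> (\<forall>k<K. w (row K p) (REC 0 2 k) = row K (h p) ! k \<and> w (row K p) (REC 0 3 k) = row K (t p) ! k)"

definition tinv :: "nat => (bits => tag => bool) => nat => nat => (nat => nat) => (nat => nat) => (nat => nat) => bool" where
 "tinv K w i pc R h t \<longleftrightarrow> w (row K i) (PC pc) \<and> (\<forall>r<4. \<forall>p<K. w (row K i) (REG r p) = row K (R r) ! p) \<and>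
   (\<forall>r. good K w h t (R r)) \<and> (\<forall>p. good K w h t (h p) \<and> good K w h t (t p))"

lemma tinv_step:
 assumes tab: "table_ok K Pg rej w" and inv: "tinv K w i pc R h t" and pinv: "pinv i (pc, R, h, t, x, [])"
  and i: "Suc i < 2 ^ K" and pc: "pc < length Pg" "regs4 (Pg ! pc)" "tnoask (Pg ! pc)"
  and st: "pinstr_step {} i (Pg ! pc) (pc, R, h, t, x, []) = (pc', R', h', t', x', q')"
  and x: "(\<exists>r. Pg ! pc = TNext r) ==> x \<noteq> [] \<and> hd x = w (row K i) GS"
 shows "tinv K w (Suc i) pc' R' h' t' \<and> q' = []"
proof -
 let ?x = "row K i" and ?y = "row K (Suc i)"
 have num: "rnum ?y = Suc (rnum ?x)" using i by (simp add: rnum_row)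
 have ok: "iok K w pc (Pg ! pc) ?x ?y"
  using tab inv pc(1) num unfolding table_ok_def tinv_def by (meson row_in)
 have REG: "w ?x (REG r p) = row K (R r) ! p" if "r < 4" "p < K" for r p using inv that unfolding tinv_def by auto
 have G: "good K w h t (R r)" "good K w h t (h p)" "good K w h t (t p)" for r p using inv unfolding tinv_def by auto
 have P: "R r < i" "h p < i" "t p < i" "h 0 = 0" "t 0 = 0" "1 \<le> i" for r p using pinv by auto
 have Pi: "h i = 0" "t i = 0" using pinv by auto
 have ix: "w ?x (IX p) = ?x ! p" if "p < K" for p using tab that unfolding table_ok_def by auto
 have zero: "good K w h t 0"
  unfolding good_def using tab P by (auto simp: table_ok_def row_0)
 have gupd: "good K w (h(i := a)) (t(i := b)) p" if "good K w h t p" "p < i" for a b p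
  using that by (simp add: good_def)
 have kp: "w ?y (REG r' p) = row K (R r') ! p" if "keep K w ?x ?y r" "r' < 4" "r' \<noteq> r" "p < K" for r r' p
  using that REG[of r' p] by (simp add: keep_def)
 have read: "w ?x (REC 0 2 p) = row K (h (R s)) ! p \<and> w ?x (REC 0 3 p) = row K (t (R s)) ! p"
  if "\<not> w ?x CR" "\<forall>p<K. w ?x (REC 0 0 p) = w ?x (REG s p)" "s < 4" "p < K" for s p
 proof -
  have "wd K (%k. w ?x (REC 0 0 k)) = R s"
   by (rule wd_eqI) (use that REG P(1)[of s] i in auto)
  then show ?thesis using table_read[OF tab row_in that(1) that(4)] G(1)[of s] that(4) by (simp add: good_def)
 qed
 show ?thesis
 proof (cases "Pg ! pc")
  case (TNil r)
  then have R': "pc' = Suc pc" "R' = R(r := 0)" "h' = h" "t' = t" "q' = []" using st by auto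
  show ?thesis using ok TNil G zero kp unfolding R' tinv_def by (auto simp: row_0)
 next
  case (TCons r s u)
  then have R': "pc' = Suc pc" "R' = R(r := i)" "h' = h(i := R s)" "t' = t(i := R u)" "q' = []" using st by auto
  have rs: "r < 4" "s < 4" "u < 4" using pc(2) TCons by (auto simp: regs4_def)
  have gi: "good K w h' t' i" using ok TCons REG rs unfolding R' good_def by auto
  have g2: "good K w h' t' (R r)" "good K w h' t' (h p)" "good K w h' t' (t p)" for r p
   unfolding R' using G P gupd by auto
  have g3: "good K w h' t' (h' p)" "good K w h' t' (t' p)" for p using g2 unfolding R' by auto
  have g1: "good K w h' t' (R' r)" for r using g2 gi unfolding R' by auto
  have "w ?y (PC (Suc pc)) \<and> (\<forall>r'<4. \<forall>p<K. w ?y (REG r' p) = row K (R' r') ! p)"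
   using ok TCons kp ix unfolding R' by auto
  then show ?thesis using g1 g3 R' unfolding tinv_def by auto
 next
  case (THd r s)
  then have R': "pc' = Suc pc" "R' = R(r := h (R s))" "h' = h" "t' = t" "q' = []" using st by auto
  have rs: "r < 4" "s < 4" using pc(2) THd by (auto simp: regs4_def)
  show ?thesis using ok THd G kp read[of s] rs unfolding R' tinv_def by auto
 next
  case (TTl r s)
  then have R': "pc' = Suc pc" "R' = R(r := t (R s))" "h' = h" "t' = t" "q' = []" using st by auto
  have rs: "r < 4" "s < 4" using pc(2) TTl by (auto simp: regs4_def)
  show ?thesis using ok TTl G kp read[of s] rs unfolding R' tinv_def by auto
 next
  case (TJnil r l)
  then have R': "pc' = (if R r = 0 then l else Suc pc)" "R' = R" "h' = h" "t' = t" "q' = []" using st by auto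
  have rs: "r < 4" using pc(2) TJnil by (auto simp: regs4_def)
  have "w ?y (PC pc')"
  proof (cases "R r = 0")
   case True
   have "w ?x (ZR k)" if "k \<le> K" for k
    using that
   proof (induction k)
    case 0
    then show ?case using tab row_in[of K i] unfolding table_ok_def row_ok_def by blast
   next
    case (Suc k)
    then show ?case using ok TJnil REG[OF rs, of k] True by (auto simp: row_0)
   qed
   then show ?thesis using ok TJnil True R'(1) by auto
  next
   case False
   have "\<exists>p<K. row K (R r) ! p"
   proof (rule ccontr)
    assume "\<not> (\<exists>p<K. row K (R r) ! p)"
    then have "row K (R r) = row K 0" by (intro nth_equalityI) (auto simp: row_0)
    then show False using row_inj[of "R r" K 0] P(1)[of r] i False by auto
   qed
   then show ?thesis using ok TJnil REG[OF rs] False R'(1) by auto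
  qed
  then show ?thesis using ok TJnil G kp[of 4] unfolding R'(2-5) tinv_def by auto
 next
  case (TNext r)
  then have R': "pc' = Suc pc" "R' = R(r := if x \<noteq> [] \<and> hd x then i else 0)" "h' = h" "t' = t" "q' = []" using st by auto
  have gi: "good K w h t i" using ok TNext Pi unfolding good_def by (auto simp: row_0)
  have "x \<noteq> [] \<and> hd x \<longleftrightarrow> w ?x GS" using x TNext by auto
  then show ?thesis using ok TNext G gi zero kp ix unfolding R' tinv_def by (auto simp: row_0)
 qed (use pc(3) in \<open>auto simp: tnoask_def\<close>)
qed

text \<open>The \<open>GS\<close> entries dictate the consumed prefix \<open>xs\<close>; as the
  program cannot test for the end of its input, the run is the same for every continuation
  \<open>suf\<close>. Several \<open>PC\<close> entries may be set in one row; the run follows those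
  that its own steps force.\<close>

lemma table_sound:
 assumes tab: "table_ok K Pg rej w" and K: "K \<ge> 1" and P: "\<forall>c\<in>set Pg. regs4 c \<and> tnoask c"
 shows "n + 1 < 2 ^ K ==> \<exists>xs pc R h t. \<forall>suf. prun {} Pg n 1 (pinit (xs @ suf)) = (pc, R, h, t, suf, []) \<and>
   (pc < length Pg --> tinv K w (n + 1) pc R h t) \<and> pc \<noteq> rej"
proof (induction n)
 case 0
 have "good K w (%_. 0) (%_. 0) 0"
  unfolding good_def using tab by (auto simp: table_ok_def row_0)
 then have inv: "tinv K w 1 0 (%_. 0) (%_. 0) (%_. 0)"
  unfolding tinv_def using tab by (auto simp: table_ok_def row_0)
 have "\<not> w (row K 1) (PC rej)" using tab unfolding table_ok_def row_ok_def by simp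
 moreover have "w (row K 1) (PC 0)" using inv unfolding tinv_def by blast
 ultimately have "0 \<noteq> rej" by (cases "rej = 0") auto
 then show ?case using inv by (intro exI[of _ "[]"] exI[of _ 0] exI[of _ "%_. 0"]) (auto simp: pinit_def)
next
 case (Suc n)
 have "n + 1 < 2 ^ K" using Suc.prems by simp
 from Suc.IH[OF this] obtain xs pc R h t where IH: "\<And>suf. prun {} Pg n 1 (pinit (xs @ suf)) = (pc, R, h, t, suf, [])"
  "pc < length Pg ==> tinv K w (n + 1) pc R h t" "pc \<noteq> rej" by blast
 show ?case
 proof (cases "pc < length Pg")
  case False
  then show ?thesis using IH by (intro exI[of _ xs] exI[of _ pc] exI[of _ R] exI[of _ h] exI[of _ t]) (auto simp: pstep_def)
 next
  case True
  \<comment> \<open>The bit consumed by this step, if it consumes one.\<close>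
  define e where "e = (if \<exists>r. Pg ! pc = TNext r then [w (row K (n + 1)) GS] else [])"
  have c: "regs4 (Pg ! pc)" "tnoask (Pg ! pc)" using P True by auto
  have pinv: "pinv (n + 1) (pc, R, h, t, suf, [])" for suf
   using pinv_prun[OF pinit_inv[of "xs @ suf"], where n = n and A = "{}" and P = Pg] IH(1)[of suf] by simp
  obtain pc' R' h' t' q' where st: "pinstr_step {} (n + 1) (Pg ! pc) (pc, R, h, t, e, []) = (pc', R', h', t', [], q')"
   using c(2) by (cases "Pg ! pc") (auto simp: e_def tnoask_def)
  have st2: "pinstr_step {} (n + 1) (Pg ! pc) (pc, R, h, t, e @ suf, []) = (pc', R', h', t', suf, q')" for suf
   using st c(2) by (cases "Pg ! pc") (auto simp: e_def tnoask_def)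
  have inv': "tinv K w (Suc (n + 1)) pc' R' h' t' \<and> q' = []"
   by (rule tinv_step[OF tab IH(2)[OF True] pinv _ True c st]) (use Suc.prems in \<open>auto simp: e_def\<close>)
  have "\<not> w (row K (Suc (n + 1))) (PC rej)" using tab unfolding table_ok_def row_ok_def by simp
  then have "pc' \<noteq> rej" using inv' by (auto simp: tinv_def)
  moreover have "prun {} Pg (Suc n) 1 (pinit ((xs @ e) @ suf)) = (pc', R', h', t', suf, [])" for suf
   using IH(1)[of "e @ suf"] st2[of suf] inv' True by (simp add: pstep_def)
  ultimately show ?thesis using inv' by (intro exI[of _ "xs @ e"]) auto
 qed
qed

subsection \<open>Completeness\<close>

text \<open>\<open>G l x\<close> is the row whose record is present at row \<open>x\<close> after
  \<open>l\<close> layers.\<close>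

lemma routes_layers:
 "routes ds f ==> \<exists>G. G 0 = id \<and> G (length ds) = f \<and>
   (\<forall>l<length ds. \<forall>x. G (Suc l) x = G l x \<or> G (Suc l) x = G l (flip (ds ! l) x))"
proof (induction ds arbitrary: f)
 case Nil
 then show ?case by (intro exI[of _ "%_. id"]) simp
next
 case (Cons d ds)
 then obtain h g where hg: "layer d h" "routes ds g" "f = h \<circ> g" by auto
 from Cons.IH[OF hg(2)] obtain G where G: "G 0 = id" "G (length ds) = g"
  "\<And>l x. l < length ds ==> G (Suc l) x = G l x \<or> G (Suc l) x = G l (flip (ds ! l) x)" by blast
 define G' where "G' = (%l. case l of 0 => id | Suc m => h \<circ> G m)"
 have "G' (Suc l) x = G' l x \<or> G' (Suc l) x = G' l (flip ((d # ds) ! l) x)" if "l < length (d # ds)" for l x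
 proof (cases l)
  case 0
  then show ?thesis using hg(1) G(1) unfolding G'_def layer_def by auto
 next
  case (Suc m)
  then show ?thesis using G(3)[of m x] that unfolding G'_def by auto
 qed
 then show ?case using G hg(3) by (intro exI[of _ G']) (auto simp: G'_def)
qed

text \<open>Only reading rows prescribe where their record comes from. The other rows receive the
  leftovers, which makes the map a permutation that the network can route.\<close>

lemma extend_injection:
 assumes "finite S" "A \<subseteq> S" "inj_on f A" "f ` A \<subseteq> S"
 shows "\<exists>g. bij_betw g S S \<and> (\<forall>x\<in>A. g x = f x)"
proof -
 have fin: "finite A" "finite (f ` A)" using assms finite_subset by auto
 have "card (S - A) = card (S - f ` A)"
  using assms fin by (simp add: card_Diff_subset card_image)
 then obtain k where k: "bij_betw k (S - A) (S - f ` A)"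
  using assms(1) by (metis finite_Diff finite_same_card_bij)
 let ?g = "%x. if x \<in> A then f x else k x"
 have "bij_betw ?g A (f ` A)" using assms(3) by (simp add: bij_betw_def inj_on_def)
 moreover have "bij_betw ?g (S - A) (S - f ` A)"
  by (rule iffD2[OF bij_betw_cong k]) auto
 ultimately have "bij_betw ?g (A \<union> (S - A)) (f ` A \<union> (S - f ` A))"
  by (rule bij_betw_combine) auto
 moreover have "A \<union> (S - A) = S" "f ` A \<union> (S - f ` A) = S" using assms by auto
 ultimately show ?thesis by (intro exI[of _ ?g]) auto
qed

locale traced =
 fixes K :: nat and Pg :: "tinstr list" and rej :: nat and x0 :: bits
 assumes K1: "K \<ge> 1" and Pg: "\<forall>c\<in>set Pg. regs4 c \<and> tnoask c"
  and norej: "\<And>n. fst (prun {} Pg n 1 (pinit x0)) \<noteq> rej"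
begin

text \<open>Row \<open>i\<close> shows the configuration after \<open>i - 1\<close> steps. By
  truncation row 0 repeats the initial one; \<open>act\<close> and the entry \<open>PC\<close>
  therefore exclude row 0.\<close>

definition cfg :: "nat => pconf" where "cfg i = prun {} Pg (i - 1) 1 (pinit x0)"

definition pcs :: "nat => nat" where "pcs i = fst (cfg i)"
definition Rs :: "nat => nat => nat" where "Rs i = fst (snd (cfg i))"
definition hs :: "nat => nat => nat" where "hs i = fst (snd (snd (cfg i)))"
definition ts :: "nat => nat => nat" where "ts i = fst (snd (snd (snd (cfg i))))"
definition xs :: "nat => bits" where "xs i = fst (snd (snd (snd (snd (cfg i)))))"
definition qs :: "nat => bits" where "qs i = snd (snd (snd (snd (snd (cfg i)))))"

lemma cfg_eq: "cfg i = (pcs i, Rs i, hs i, ts i, xs i, qs i)"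
 by (simp add: pcs_def Rs_def hs_def ts_def xs_def qs_def)

lemma cfg_Suc: "i \<ge> 1 ==> cfg (Suc i) = pstep {} Pg i (cfg i)"
 unfolding cfg_def by (cases i) auto

lemma cfg_inv: "i \<ge> 1 ==> pinv i (pcs i, Rs i, hs i, ts i, xs i, qs i)"
 using pinv_prun[OF pinit_inv[of x0], where n = "i - 1" and A = "{}" and P = Pg] cfg_eq[of i] by (simp add: cfg_def)

definition act :: "nat => bool" where "act i \<longleftrightarrow> i \<ge> 1 \<and> pcs i < length Pg"
definition ins :: "nat => tinstr" where "ins i = Pg ! pcs i"

lemma cfg_step: "act i ==> (pcs (Suc i), Rs (Suc i), hs (Suc i), ts (Suc i), xs (Suc i), qs (Suc i)) =
  pinstr_step {} i (ins i) (pcs i, Rs i, hs i, ts i, xs i, qs i)"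
 using cfg_Suc[of i] cfg_eq[of i] cfg_eq[of "Suc i"] unfolding act_def ins_def pstep_def by auto

lemma cfg_idle: "i \<ge> 1 ==> \<not> act i ==> cfg (Suc i) = cfg i"
 using cfg_Suc[of i] unfolding act_def pstep_def by (simp add: pcs_def)

definition src :: "tinstr => nat option" where
 "src c = (case c of THd r s => Some s | TTl r s => Some s | _ => None)"

definition rd :: "nat => bool" where "rd i \<longleftrightarrow> act i \<and> src (ins i) \<noteq> None"
text \<open>Every row that does not read counts as the creator of the cell with its own number, even
  if this cell stays empty.\<close>

definition AD :: "nat => nat" where "AD i = (if rd i then Rs i (the (src (ins i))) else i)"

lemma heap_step: "i \<ge> 1 ==> p \<noteq> i ==> hs (Suc i) p = hs i p \<and> ts (Suc i) p = ts i p"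
proof (cases "act i")
 case True
 assume "i \<ge> 1" "p \<noteq> i"
 then show ?thesis using cfg_step[OF True] by (cases "ins i") auto
next
 case False
 assume "i \<ge> 1"
 then show ?thesis using cfg_idle[OF _ False] by (simp add: hs_def ts_def)
qed

lemma heap_later:
 assumes "1 \<le> i" "i \<le> j" "p < i"
 shows "hs j p = hs i p \<and> ts j p = ts i p"
 using assms(2)
proof (induction rule: dec_induct)
 case (step j)
 then show ?case using heap_step[of j p] assms by auto
qed simp

text \<open>Fresh pointers are numbers of allocating steps and all others are copies, so no pointer
  equals the number of a reading step. The address accessed by a reading row thus belongs to a
  creating row, where the chain of accesses begins.\<close>

lemma not_rd_pointers: "i \<ge> 1 ==> \<not> rd (Rs i r) \<and> \<not> rd (hs i p) \<and> \<not> rd (ts i p)"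
proof (induction i arbitrary: r p rule: nat_induct_at_least[of 1])
 case base
 have "\<not> rd 0" by (simp add: rd_def act_def)
 then show ?case by (simp add: Rs_def hs_def ts_def cfg_def pinit_def)
next
 case (Suc i)
 have 0: "\<not> rd 0" by (simp add: rd_def act_def)
 show ?case
 proof (cases "act i")
  case True
  have "\<not> rd i" if "\<nexists>r s. ins i = THd r s" "\<nexists>r s. ins i = TTl r s"
   using that by (cases "ins i") (auto simp: rd_def src_def)
  then show ?thesis using cfg_step[OF True] Suc.IH 0 by (cases "ins i") (auto split: if_splits)
 next
  case False
  then show ?thesis using cfg_idle[of i] Suc by (simp add: Rs_def hs_def ts_def)
 qed
qed

lemma AD_less: "rd i ==> AD i < i"
 using cfg_inv[of i] unfolding AD_def rd_def act_def by auto

lemma AD_AD: "AD (AD i) = AD i"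
proof (cases "rd i")
 case True
 then have "\<not> rd (AD i)" using not_rd_pointers[of i] unfolding AD_def rd_def act_def by auto
 then show ?thesis by (simp add: AD_def[of "AD i"])
qed (simp add: AD_def)

definition prev :: "nat => nat" where "prev i = Max {j. j < i \<and> AD j = AD i}"

lemma prev:
 assumes "rd i"
 shows "prev i < i" "AD (prev i) = AD i"
proof -
 have "AD i \<in> {j. j < i \<and> AD j = AD i}" using AD_less[OF assms] AD_AD by auto
 then have "prev i \<in> {j. j < i \<and> AD j = AD i}" unfolding prev_def by (intro Max_in) auto
 then show "prev i < i" "AD (prev i) = AD i" by auto
qed

text \<open>Two reading rows with the same predecessor would access the same cell, and the earlier
  of them would be a closer predecessor of the later one.\<close>

lemma prev_inj: "inj_on prev {i. rd i}"
proof -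
 have "prev i \<noteq> prev j" if "rd i" "rd j" "i < j" for i j
 proof
  assume e: "prev i = prev j"
  then have "AD i = AD j" using prev that by metis
  then have "i \<le> prev j" unfolding prev_def using that by (intro Max_ge) auto
  then show False using prev(1)[OF that(1)] e by simp
 qed
 then show ?thesis unfolding inj_on_def by (metis linorder_neqE_nat mem_Collect_eq)
qed

text \<open>A cell keeps its contents once it is written, so the final heap supplies the contents of
  all records, whatever the time of the access.\<close>

definition hF :: "nat => nat" where "hF = hs (2 ^ K)"
definition tF :: "nat => nat" where "tF = ts (2 ^ K)"

lemma final_heap: "1 \<le> i ==> i \<le> 2 ^ K ==> p < i ==> hF p = hs i p \<and> tF p = ts i p"
 unfolding hF_def tF_def by (rule heap_later)

definition fld :: "nat => nat => nat" where
 "fld f i = (if f = 0 then AD i else if f = 1 then i else if f = 2 then hF (AD i) else tF (AD i))"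

definition jr :: "nat => nat" where
 "jr i = (case ins i of TJnil r l => r | _ => 0)"

definition tab :: "(nat => bits => bits) => bits => tag => bool" where
 "tab G x t = (let i = rnum x; k = fst t; a = fst (snd t); b = fst (snd (snd t)); c = snd (snd (snd t)) in
   if k = 0 then x ! a
   else if k = 1 then i \<ge> 1 \<and> pcs i = a
   else if k = 2 then row K (Rs i a) ! b
   else if k = 3 then \<not> rd i
   else if k = 4 then row K (fld b (rnum (G a x))) ! c
   else if k = 5 then G (Suc a) x \<noteq> G a x
   else if k = 6 then \<forall>p<a. G (2 * K) x ! p = x ! p
   else if k = 7 then \<forall>p<a. \<not> row K (Rs i (jr i)) ! p
   else xs i \<noteq> [] \<and> hd (xs i))"

lemma tab_simps:
 "tab G x (IX p) = x ! p"
 "tab G x (PC l) \<longleftrightarrow> rnum x \<ge> 1 \<and> pcs (rnum x) = l"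
 "tab G x (REG r p) = row K (Rs (rnum x) r) ! p"
 "tab G x CR \<longleftrightarrow> \<not> rd (rnum x)"
 "tab G x (REC l f p) = row K (fld f (rnum (G l x))) ! p"
 "tab G x (SW l) \<longleftrightarrow> G (Suc l) x \<noteq> G l x"
 "tab G x (EQ p) \<longleftrightarrow> (\<forall>k<p. G (2 * K) x ! k = x ! k)"
 "tab G x (ZR p) \<longleftrightarrow> (\<forall>k<p. \<not> row K (Rs (rnum x) (jr (rnum x))) ! k)"
 "tab G x GS \<longleftrightarrow> xs (rnum x) \<noteq> [] \<and> hd (xs (rnum x))"
 by (simp_all add: tab_def Let_def)

lemmas tab_simps' = tab_simps tab_simps(2)[unfolded One_nat_def]

lemma iok_tab:
 assumes G0: "G 0 = id" and xy: "x \<in> rows K" "y \<in> rows K" "rnum y = Suc (rnum x)" and pc: "tab G x (PC l)" "l < length Pg"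
 shows "iok K (tab G) l (Pg ! l) x y"
proof -
 define i where "i = rnum x"
 have i: "act i" "l = pcs i" "Pg ! l = ins i" "i \<ge> 1" "Suc i < 2 ^ K"
  using pc xy rnum_less[OF xy(2)] unfolding act_def ins_def i_def by (auto simp: tab_simps')
 have y: "rnum y = Suc i" using xy by (simp add: i_def)
 have x: "rnum x = i" "row K i = x" using row_rnum[OF xy(1)] by (auto simp: i_def)
 note st = cfg_step[OF i(1)]
 have c: "regs4 (ins i)" "tnoask (ins i)" using Pg i(3) pc(2) nth_mem by metis+
 have fin: "hF i = hs (Suc i) i" "tF i = ts (Suc i) i" "\<And>p. p < i ==> hF p = hs i p" "\<And>p. p < i ==> tF p = ts i p"
  using final_heap[of "Suc i" i] final_heap[of i] i by auto
 have inv: "pinv i (pcs i, Rs i, hs i, ts i, xs i, qs i)" by (rule cfg_inv[OF i(4)])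
 have keepI: "keep K (tab G) x y r" if "\<And>r'. r' \<noteq> r ==> Rs (Suc i) r' = Rs i r'" for r
  using that unfolding keep_def by (simp add: tab_simps' x y)
 note T = tab_simps' G0 x y
 show ?thesis
 proof (cases "ins i")
  case (TNil r)
  then show ?thesis using st i keepI[of r] by (auto simp: T row_0)
 next
  case (TCons r s u)
  then have "\<not> rd i" by (simp add: rd_def src_def)
  then show ?thesis using TCons st i keepI[of r] fin by (auto simp: T fld_def AD_def)
 next
  case (THd r s)
  then have "rd i" "AD i = Rs i s" using i by (auto simp: rd_def src_def AD_def)
  moreover have "Rs i s < i" using inv by auto
  ultimately show ?thesis using THd st i keepI[of r] fin by (auto simp: T fld_def)
 next
  case (TTl r s)
  then have "rd i" "AD i = Rs i s" using i by (auto simp: rd_def src_def AD_def)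
  moreover have "Rs i s < i" using inv by auto
  ultimately show ?thesis using TTl st i keepI[of r] fin by (auto simp: T fld_def)
 next
  case (TJnil r l')
  have R: "Rs (Suc i) = Rs i" "pcs (Suc i) = (if Rs i r = 0 then l' else Suc (pcs i))" using st TJnil by auto
  have jr: "jr i = r" by (simp add: jr_def TJnil)
  have "Rs i r < i" using inv by simp
  then have lt: "Rs i r < 2 ^ K" using i(5) by simp
  have "Rs i r = 0" if "\<forall>k<K. \<not> row K (Rs i r) ! k"
  proof -
   have "row K (Rs i r) = row K 0" by (rule nth_equalityI) (use that in \<open>auto simp: row_0\<close>)
   then show ?thesis using row_inj[OF lt, of 0] by simp
  qed
  then show ?thesis using TJnil R i keepI[of 4] by (auto simp: T jr less_Suc_eq row_0)
 next
  case (TNext r)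
  then have "\<not> rd i" by (simp add: rd_def src_def)
  moreover have "hF i = 0" "tF i = 0" using fin st TNext inv by auto
  ultimately show ?thesis using TNext st i keepI[of r] fin by (auto simp: T fld_def AD_def row_0)
 qed (use c in \<open>auto simp: tnoask_def\<close>)
qed

text \<open>The partial map from reading rows to preceding accesses is completed to a permutation
  and routed by \<open>benes\<close>; the layers give the switches and all other entries are read
  off the run.\<close>

lemma table_complete: "\<exists>w. table_ok K Pg rej w"
proof -
 let ?A = "{x \<in> rows K. rd (rnum x)}"
 have "inj_on (%x. row K (prev (rnum x))) ?A"
 proof (rule inj_onI)
  fix x y assume xy: "x \<in> ?A" "y \<in> ?A" "row K (prev (rnum x)) = row K (prev (rnum y))"
  then have "prev (rnum x) < 2 ^ K" "prev (rnum y) < 2 ^ K"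
   using prev(1)[of "rnum x"] prev(1)[of "rnum y"] rnum_less[of x K] rnum_less[of y K] by auto
  then have "prev (rnum x) = prev (rnum y)" using row_inj xy(3) by blast
  then have "rnum x = rnum y" using prev_inj xy unfolding inj_on_def by auto
  then show "x = y" using rnum_inj xy by auto
 qed
 then obtain f where f: "bij_betw f (rows K) (rows K)" "\<And>x. x \<in> rows K ==> rd (rnum x) ==> f x = row K (prev (rnum x))"
  using extend_injection[OF finite_rows, of ?A K "%x. row K (prev (rnum x))"] by (auto simp: image_subset_iff)
 obtain g where g: "routes (dims K) g" "\<And>x. x \<in> rows K ==> g x = f x" using benes[OF f(1)] by blast
 obtain G where G: "G 0 = id" "G (2 * K) = g"
  "\<And>l x. l < 2 * K ==> G (Suc l) x = G l x \<or> G (Suc l) x = G l (flip (dims K ! l) x)"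
  using routes_layers[OF g(1)] by (auto simp: length_dims)
 let ?w = "tab G"
 have "1 < (2 :: nat) ^ K" using K1 one_less_power[of "2 :: nat" K] by simp
 then have r0: "rnum (row K 0) = 0" "rnum (row K 1) = 1" using rnum_row[of 0 K] rnum_row[of 1 K] by auto
 have R1: "Rs 1 r = 0" "pcs 1 = 0" for r by (simp_all add: Rs_def pcs_def cfg_def pinit_def)
 have F0: "hF 0 = 0" "tF 0 = 0" using cfg_inv[of "2 ^ K"] unfolding hF_def tF_def by auto
 have rd0: "\<not> rd 0" by (simp add: rd_def act_def)
 have rowok: "row_ok K rej ?w x" if x: "x \<in> rows K" for x
 proof -
  define i where "i = rnum x"
  have xi: "rnum x = i" "row K i = x" "i < 2 ^ K" using row_rnum[OF x] rnum_less[OF x] by (auto simp: i_def)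
  have "pcs i \<noteq> rej" using norej[of "i - 1"] by (simp add: pcs_def cfg_def)
  then have 1: "?w x (ZR 0) \<and> \<not> ?w x (PC rej)" by (auto simp: tab_simps' xi)
  have 2: "?w x (REC 0 1 p) = ?w x (IX p) \<and> (?w x CR --> ?w x (REC 0 0 p) = ?w x (IX p))" for p
   by (auto simp: tab_simps' G xi fld_def AD_def)
  have 3: "?w x (EQ 0) \<and> \<not> ?w x (EQ K) \<and> (\<forall>p<K.
    (?w x (REC (2 * K) 0 p) = ?w x (REC 0 0 p)) \<and> (?w x (REC (2 * K) 2 p) = ?w x (REC 0 2 p)) \<and>
    (?w x (REC (2 * K) 3 p) = ?w x (REC 0 3 p)) \<and> (?w x (EQ p) \<and> ?w x (REC (2 * K) 1 p) --> ?w x (IX p)) \<and>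
    (?w x (EQ p) \<and> ?w x (REC (2 * K) 1 p) = ?w x (IX p) --> ?w x (EQ (Suc p))))"
   if "\<not> ?w x CR"
  proof -
   have rdi: "rd i" using that by (simp add: tab_simps' xi)
   define z where "z = row K (prev i)"
   have z: "G (2 * K) x = z" using g(2)[OF x] f(2)[OF x] rdi by (simp add: G z_def xi)
   have zr: "rnum z = prev i" "z \<in> rows K" using prev(1)[OF rdi] xi(3) by (auto simp: z_def rnum_row)
   have lt: "rnum z < rnum x" using prev(1)[OF rdi] by (simp add: zr xi)
   have zz: "row K (rnum z) = z" using row_rnum zr by blast
   have fl: "fld f (rnum z) = fld f i" if "f \<noteq> 1" for f
    using prev(2)[OF rdi] that by (simp add: fld_def zr)
   have neg: "\<not> (\<forall>k<K. z ! k = x ! k)"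
   proof
    assume "\<forall>k<K. z ! k = x ! k"
    then have "z = x" using zr(2) x by (intro nth_equalityI) (auto simp: rows_def)
    then show False using lt by simp
   qed
   have ord: "x ! p" if "p < K" "\<forall>k<p. z ! k = x ! k" "z ! p" for p
    using rnum_lex[OF zr(2) x that(1)] that lt by force
   have fl': "?w x (REC (2 * K) f p) = ?w x (REC 0 f p)" if "f \<noteq> 1" for f p
    using fl[OF that] by (simp only: tab_simps' z G(1) id_apply xi)
   have rt: "?w x (REC (2 * K) 1 p) = z ! p" for p
    unfolding tab_simps' z by (simp add: fld_def zz)
   have eqp: "?w x (EQ p) \<longleftrightarrow> (\<forall>k<p. z ! k = x ! k)" for p unfolding tab_simps' z ..
   have ixp: "?w x (IX p) = x ! p" for p unfolding tab_simps' ..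
   show ?thesis unfolding eqp rt ixp
   proof (intro conjI allI impI)
    fix p assume p: "p < K"
    show "x ! p" if "(\<forall>k<p. z ! k = x ! k) \<and> z ! p" using ord[OF p] that by blast
    show "z ! k = x ! k" if "(\<forall>k<p. z ! k = x ! k) \<and> z ! p = x ! p" "k < Suc p" for k
     using that by (cases "k = p") auto
   qed (use neg fl' in auto)
  qed
  show ?thesis unfolding row_ok_def using 1 2 3 by blast
 qed
 have net: "?w x (REC (Suc l) f p) = (if ?w x (SW l) then ?w (flip (dims K ! l) x) (REC l f p) else ?w x (REC l f p))"
  if "l < 2 * K" for l x f p
  using G(3)[OF that, of x] by (auto simp: tab_simps')
 have 1: "?w x (IX p) = x ! p" for x p unfolding tab_simps' ..
 have 2: "?w (row K 1) (PC 0)" "p < K ==> \<not> ?w (row K 1) (REG r p)" for r p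
  unfolding tab_simps' r0 R1 by (simp_all add: row_0)
 have 3: "\<not> ?w (row K 0) (REC 0 2 p)" "\<not> ?w (row K 0) (REC 0 3 p)" if "p < K" for p
  unfolding tab_simps' G id_apply r0 fld_def using that by (simp_all add: AD_def rd0 F0 row_0)
 have "table_ok K Pg rej ?w"
  unfolding table_ok_def using 1 2 3 rowok net iok_tab[where G = G, OF G(1)] by blast
 then show ?thesis by blast
qed

end

section \<open>The constraint system of a computation\<close>

type_synonym family = "(pattern \<times> bool) list"

definition fam_ok :: "(bits => bool) => nat => family => bool" where
 "fam_ok W L fam \<longleftrightarrow> (\<forall>y\<in>rows L. \<exists>l\<in>set fam. W (inst (fst l) y) = snd l)"

definition sat :: "nat => family list => (bits => bool) => bool" where
 "sat L \<Phi> W \<longleftrightarrow> (\<forall>fam\<in>set \<Phi>. fam_ok W L fam)"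

text \<open>The tag is constant in every pattern. The last \<open>n\<close> bits of an assignment
  are thus overwritten; they only give patterns and assignments the length of a table
  address.\<close>

definition mkfam :: "nat => shape => clit list => family" where
 "mkfam n sh cl = map (%l. ((if fst l then snd sh else fst sh) @ cpat (tagc n (fst (snd l))), snd (snd l))) cl"

lemma fam_ok_mkfam:
 assumes "length (fst sh) = K" "length (snd sh) = K" "\<And>l. l \<in> set cl ==> tag_weight (fst (snd l)) \<le> n"
  and w: "\<And>x t. x \<in> rows K ==> tag_weight t \<le> n ==> W (x @ tagc n t) = w x t"
 shows "fam_ok W (K + n) (mkfam n sh cl) \<longleftrightarrow> (\<forall>y\<in>rows K. holds w (inst (fst sh) y) (inst (snd sh) y) cl)"
proof -
 have 1: "W (inst ((if r then snd sh else fst sh) @ cpat (tagc n t)) (y @ z)) = w (if r then inst (snd sh) y else inst (fst sh) y) t"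
  if "y \<in> rows K" "z \<in> rows n" "tag_weight t \<le> n" for r t y z
 proof -
  have l: "length y = K" "length z = n" using that by (auto simp: rows_def)
  have "inst ((if r then snd sh else fst sh) @ cpat (tagc n t)) (y @ z) =
    inst (if r then snd sh else fst sh) y @ inst (cpat (tagc n t)) z"
   by (rule inst_append) (use assms l in auto)
  also have "inst (cpat (tagc n t)) z = tagc n t" by (rule inst_cpat) (simp add: l length_tagc that)
  finally have 2: "inst ((if r then snd sh else fst sh) @ cpat (tagc n t)) (y @ z) =
    (if r then inst (snd sh) y else inst (fst sh) y) @ tagc n t" by (simp split: if_splits)
  have "(if r then inst (snd sh) y else inst (fst sh) y) \<in> rows K"
   using length_inst assms l by (auto simp: rows_def)
  then show ?thesis unfolding 2 using w that(3) by blast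
 qed
 have split: "(\<forall>y\<in>rows (K + n). Q y) \<longleftrightarrow> (\<forall>y\<in>rows K. \<forall>z\<in>rows n. Q (y @ z))" for Q
 proof
  assume a: "\<forall>y\<in>rows K. \<forall>z\<in>rows n. Q (y @ z)"
  show "\<forall>y\<in>rows (K + n). Q y"
  proof
   fix y assume "y \<in> rows (K + n)"
   then have "take K y \<in> rows K" "drop K y \<in> rows n" by (auto simp: rows_def)
   then have "Q (take K y @ drop K y)" using a by blast
   then show "Q y" by simp
  qed
 qed (auto simp: rows_def)
 have 3: "(\<exists>l\<in>set (mkfam n sh cl). W (inst (fst l) (y @ z)) = snd l) \<longleftrightarrow> holds w (inst (fst sh) y) (inst (snd sh) y) cl"
  if "y \<in> rows K" "z \<in> rows n" for y z
  unfolding mkfam_def holds_def using 1[OF that] assms(3) by auto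
 have "replicate n False \<in> rows n" by (simp add: rows_def)
 then show ?thesis unfolding fam_ok_def split using 3 by blast
qed

text \<open>The last two clauses of a position cover the two ways in which a bit of the arriving
  time can agree with a bit of the row number. They are the clauses of length five.\<close>

definition rowc :: "nat => nat => clit list list" where
 "rowc K rej = [[(False, ZR 0, True)], [(False, PC rej, False)], [(False, CR, True), (False, EQ 0, True)],
   [(False, CR, True), (False, EQ K, False)]] @
  concat (map (%p. eqc [] (False, REC 0 1 p) (False, IX p) @
   eqc [(False, CR, False)] (False, REC 0 0 p) (False, IX p) @
   eqc [(False, CR, True)] (False, REC (2 * K) 0 p) (False, REC 0 0 p) @
   eqc [(False, CR, True)] (False, REC (2 * K) 2 p) (False, REC 0 2 p) @
   eqc [(False, CR, True)] (False, REC (2 * K) 3 p) (False, REC 0 3 p) @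
   [[(False, CR, True), (False, EQ p, False), (False, REC (2 * K) 1 p, False), (False, IX p, True)],
    [(False, CR, True), (False, EQ p, False), (False, REC (2 * K) 1 p, False), (False, IX p, False), (False, EQ (Suc p), True)],
    [(False, CR, True), (False, EQ p, False), (False, REC (2 * K) 1 p, True), (False, IX p, True), (False, EQ (Suc p), True)]])
   [0..<K])"

lemma rowc_holds: "(\<forall>cl\<in>set (rowc K rej). holds w x y cl) \<longleftrightarrow> row_ok K rej w x"
proof -
 let ?E = "%p. (w x (REC 0 1 p) = w x (IX p)) \<and> (w x CR --> w x (REC 0 0 p) = w x (IX p)) \<and>
   (\<not> w x CR --> (w x (REC (2 * K) 0 p) = w x (REC 0 0 p)) \<and> (w x (REC (2 * K) 2 p) = w x (REC 0 2 p)) \<and>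
    (w x (REC (2 * K) 3 p) = w x (REC 0 3 p)) \<and> (w x (EQ p) \<and> w x (REC (2 * K) 1 p) --> w x (IX p)) \<and>
    (w x (EQ p) \<and> w x (REC (2 * K) 1 p) = w x (IX p) --> w x (EQ (Suc p))))"
 let ?C = "%p. eqc [] (False, REC 0 1 p) (False, IX p) @
   eqc [(False, CR, False)] (False, REC 0 0 p) (False, IX p) @
   eqc [(False, CR, True)] (False, REC (2 * K) 0 p) (False, REC 0 0 p) @
   eqc [(False, CR, True)] (False, REC (2 * K) 2 p) (False, REC 0 2 p) @
   eqc [(False, CR, True)] (False, REC (2 * K) 3 p) (False, REC 0 3 p) @
   [[(False, CR, True), (False, EQ p, False), (False, REC (2 * K) 1 p, False), (False, IX p, True)],
    [(False, CR, True), (False, EQ p, False), (False, REC (2 * K) 1 p, False), (False, IX p, False), (False, EQ (Suc p), True)],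
    [(False, CR, True), (False, EQ p, False), (False, REC (2 * K) 1 p, True), (False, IX p, True), (False, EQ (Suc p), True)]]"
 have 1: "(\<forall>cl\<in>set (?C p). holds w x y cl) \<longleftrightarrow> ?E p" for p
  unfolding set_append ball_Un eqc_holds by (cases "w x CR") auto
 have "(\<forall>cl\<in>set (rowc K rej). holds w x y cl) \<longleftrightarrow> (w x (ZR 0) \<and> \<not> w x (PC rej) \<and> (w x CR \<or> w x (EQ 0)) \<and> (w x CR \<or> \<not> w x (EQ K))) \<and>
   (\<forall>p\<in>set [0..<K]. \<forall>cl\<in>set (?C p). holds w x y cl)"
  unfolding rowc_def set_append ball_Un ball_concat_map by simp
 also have "\<dots> \<longleftrightarrow> row_ok K rej w x"
 proof -
  define R where "R = (%p. (w x (REC (2 * K) 0 p) = w x (REC 0 0 p)) \<and> (w x (REC (2 * K) 2 p) = w x (REC 0 2 p)) \<and>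
    (w x (REC (2 * K) 3 p) = w x (REC 0 3 p)) \<and> (w x (EQ p) \<and> w x (REC (2 * K) 1 p) --> w x (IX p)) \<and>
    (w x (EQ p) \<and> w x (REC (2 * K) 1 p) = w x (IX p) --> w x (EQ (Suc p))))"
  define S where "S = (%p. (w x (REC 0 1 p) = w x (IX p)) \<and> (w x CR --> w x (REC 0 0 p) = w x (IX p)))"
  have 2: "?E p \<longleftrightarrow> S p \<and> (\<not> w x CR --> R p)" for p by (simp only: R_def S_def conj_assoc)
  have 3: "row_ok K rej w x \<longleftrightarrow> w x (ZR 0) \<and> \<not> w x (PC rej) \<and> (\<forall>p<K. S p) \<and>
    (\<not> w x CR --> w x (EQ 0) \<and> \<not> w x (EQ K) \<and> (\<forall>p<K. R p))"
   by (simp only: row_ok_def R_def S_def)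
  have 4: "p \<in> set [0..<K] \<longleftrightarrow> p < K" for p by simp
  have "(\<forall>p\<in>set [0..<K]. \<forall>cl\<in>set (?C p). holds w x y cl) \<longleftrightarrow> (\<forall>p<K. S p \<and> (\<not> w x CR --> R p))"
   using 1 2 4 by (simp only: Ball_def)
  then show ?thesis unfolding 3 by auto
 qed
 finally show ?thesis .
qed

definition netc :: "nat => nat => clit list list" where
 "netc K l = concat (map (%f. concat (map (%p.
   eqc [(False, SW l, False)] (True, REC l f p) (False, REC (Suc l) f p) @
   eqc [(False, SW l, True)] (False, REC l f p) (False, REC (Suc l) f p)) [0..<K])) [0..<4])"

lemma netc_holds: "(\<forall>cl\<in>set (netc K l). holds w x y cl) \<longleftrightarrow>
  (\<forall>f<4. \<forall>p<K. w x (REC (Suc l) f p) = (if w x (SW l) then w y (REC l f p) else w x (REC l f p)))"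
proof -
 have "(\<forall>cl\<in>set (eqc [(False, SW l, False)] (True, REC l f p) (False, REC (Suc l) f p) @
   eqc [(False, SW l, True)] (False, REC l f p) (False, REC (Suc l) f p)). holds w x y cl) \<longleftrightarrow>
   w x (REC (Suc l) f p) = (if w x (SW l) then w y (REC l f p) else w x (REC l f p))" for f p
  unfolding set_append ball_Un eqc_holds by auto
 then show ?thesis unfolding netc_def ball_concat_map by auto
qed

definition initc :: "nat => clit list list" where
 "initc K = [(False, PC 0, True)] # concat (map (%r. map (%p. [(False, REG r p, False)]) [0..<K]) [0..<4])"

definition zeroc :: "nat => clit list list" where
 "zeroc K = concat (map (%p. [[(False, REC 0 2 p, False)], [(False, REC 0 3 p, False)]]) [0..<K])"

text \<open>Rows 1 and 0 and the list of network dimensions are written out as explicit lists, which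
  keeps the system evidently computable in polynomial time.\<close>

definition groups :: "nat => icode list => nat => (shape list \<times> clit list list) list" where
 "groups K cs rej =
   concat (map (%p. map (%b. (bitS K p b, [[(False, IX p, b)]])) [False, True]) [0..<K]) @
   [(constS (replicate (K - 1) False @ [True]), initc K), (constS (replicate K False), zeroc K), (allS K, rowc K rej),
   (stepS K, concat (map (%c. icl K (fst c) (snd c)) (zip [0..<length cs] cs)))] @
   map (%d. (flipS K (snd d), netc K (fst d))) (zip [0..<2 * K] ([0..<K] @ rev [0..<K]))"

lemma dims_eq: "dims K = [0..<K] @ rev [0..<K]"
proof (induction K)
 case (Suc K)
 have "0 # map Suc [0..<K] = [0..<Suc K]" by (simp add: map_Suc_upt upt_conv_Cons)
 moreover have "map Suc (rev [0..<K]) @ [0] = rev [0..<Suc K]"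
  by (simp add: rev_map[symmetric] map_Suc_upt upt_conv_Cons del: upt_Suc)
 ultimately show ?case using Suc by (metis append_Cons append_assoc dims.simps(2) map_append)
qed simp

definition csp :: "nat => nat => icode list => nat => family list" where
 "csp K n cs rej = concat (map (%g. concat (map (%sh. map (%cl. mkfam n sh cl) (snd g)) (fst g))) (groups K cs rej))"

lemma row_one: "K \<ge> 1 ==> replicate (K - 1) False @ [True] = row K 1"
proof (rule rnum_inj[of _ K])
 assume K: "K \<ge> 1"
 then show "replicate (K - 1) False @ [True] \<in> rows K" by (simp add: rows_def)
 have "1 < (2 :: nat) ^ K" using K one_less_power[of "2 :: nat" K] by simp
 then have "rnum (row K 1) = 1" by (rule rnum_row)
 moreover have "rnum (replicate (K - 1) False @ [True]) = 1" by (simp add: rnum_def bval_replicate)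
 ultimately show "rnum (replicate (K - 1) False @ [True]) = rnum (row K 1)" by simp
qed simp

lemma row_zero: "replicate K False = row K 0"
 by (rule nth_equalityI) (auto simp: row_0)

lemma set_zip_upt: "set (zip [0..<length cs] cs) = (%l. (l, cs ! l)) ` {..<length cs}"
proof -
 have "zip [0..<length cs] cs = map (%l. (l, cs ! l)) [0..<length cs]"
  by (rule nth_equalityI) auto
 then show ?thesis by (simp add: atLeast0LessThan)
qed

lemma groups_table:
 assumes "K \<ge> 1" "\<forall>c\<in>set Pg. tnoask c"
 shows "(\<forall>g\<in>set (groups K (map icode_of Pg) rej). \<forall>(x, y)\<in>srel K (fst g). \<forall>cl\<in>set (snd g). holds w x y cl) \<longleftrightarrow>
  table_ok K Pg rej w"
proof -
 have bits: "(\<forall>g\<in>set (concat (map (%p. map (%b. (bitS K p b, [[(False, IX p, b)]])) [False, True]) [0..<K])).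
   \<forall>(x, y)\<in>srel K (fst g). \<forall>cl\<in>set (snd g). holds w x y cl) \<longleftrightarrow> (\<forall>x\<in>rows K. \<forall>p<K. w x (IX p) = x ! p)"
 proof -
  have 1: "(\<forall>(x, y)\<in>srel K (bitS K p b). \<forall>cl\<in>set [[(False, IX p, b)]]. holds w x y cl) \<longleftrightarrow>
    (\<forall>x\<in>rows K. x ! p = b --> w x (IX p) = b)" if "p < K" for p b
   unfolding srel_bitS[OF that] by auto
  have "(\<forall>g\<in>set (concat (map (%p. map (%b. (bitS K p b, [[(False, IX p, b)]])) [False, True]) [0..<K])).
   \<forall>(x, y)\<in>srel K (fst g). \<forall>cl\<in>set (snd g). holds w x y cl) \<longleftrightarrow>
   (\<forall>p<K. \<forall>b\<in>{False, True}. \<forall>(x, y)\<in>srel K (bitS K p b). \<forall>cl\<in>set [[(False, IX p, b)]]. holds w x y cl)"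
   unfolding ball_concat_map by auto
  also have "\<dots> \<longleftrightarrow> (\<forall>p<K. \<forall>b\<in>{False, True}. \<forall>x\<in>rows K. x ! p = b --> w x (IX p) = b)"
   using 1 by (simp only: cong: imp_cong)
  also have "\<dots> \<longleftrightarrow> (\<forall>x\<in>rows K. \<forall>p<K. w x (IX p) = x ! p)" by auto
  finally show ?thesis .
 qed
 have one: "(\<forall>(x, y)\<in>srel K (constS (replicate (K - 1) False @ [True])). \<forall>cl\<in>set (initc K). holds w x y cl) \<longleftrightarrow>
   w (row K 1) (PC 0) \<and> (\<forall>r<4. \<forall>p<K. \<not> w (row K 1) (REG r p))"
  unfolding row_one[OF assms(1)] initc_def by (simp add: srel_constS ball_concat_map del: set_concat) auto
 have zero: "(\<forall>(x, y)\<in>srel K (constS (replicate K False)). \<forall>cl\<in>set (zeroc K). holds w x y cl) \<longleftrightarrow>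
   (\<forall>p<K. \<not> w (row K 0) (REC 0 2 p) \<and> \<not> w (row K 0) (REC 0 3 p))"
  unfolding row_zero zeroc_def by (simp add: srel_constS ball_concat_map del: set_concat) auto
 have all: "(\<forall>(x, y)\<in>srel K (allS K). \<forall>cl\<in>set (rowc K rej). holds w x y cl) \<longleftrightarrow> (\<forall>x\<in>rows K. row_ok K rej w x)"
  unfolding srel_allS rowc_holds by blast
 have zz: "(\<forall>c\<in>set (zip [0..<length cs] cs). Q (fst c) (snd c)) \<longleftrightarrow> (\<forall>l<length cs. Q l (cs ! l))" for Q and cs :: "'z list"
  unfolding set_zip_upt by auto
 have step: "(\<forall>(x, y)\<in>srel K (stepS K). \<forall>cl\<in>set (concat (map (%c. icl K (fst c) (snd c)) (zip [0..<length (map icode_of Pg)] (map icode_of Pg)))).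
   holds w x y cl) \<longleftrightarrow>
   (\<forall>x\<in>rows K. \<forall>y\<in>rows K. rnum y = Suc (rnum x) --> (\<forall>l<length Pg. w x (PC l) --> iok K w l (Pg ! l) x y))"
 proof -
  have "(\<forall>cl\<in>set (concat (map (%c. icl K (fst c) (snd c)) (zip [0..<length (map icode_of Pg)] (map icode_of Pg)))). holds w x y cl) \<longleftrightarrow>
    (\<forall>l<length Pg. w x (PC l) --> iok K w l (Pg ! l) x y)" for x y
   unfolding ball_concat_map zz[of "map icode_of Pg" "%l c. \<forall>cl\<in>set (icl K l c). holds w x y cl"]
   using assms(2) by (simp add: icl_holds[simplified])
  then show ?thesis unfolding srel_stepS by auto
 qed
 have len: "length (dims K) = 2 * K" by (rule length_dims)
 have net: "(\<forall>g\<in>set (map (%d. (flipS K (snd d), netc K (fst d))) (zip [0..<2 * K] (dims K))).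
   \<forall>(x, y)\<in>srel K (fst g). \<forall>cl\<in>set (snd g). holds w x y cl) \<longleftrightarrow>
   (\<forall>l<2 * K. \<forall>x\<in>rows K. \<forall>f<4. \<forall>p<K. w x (REC (Suc l) f p) =
    (if w x (SW l) then w (flip (dims K ! l) x) (REC l f p) else w x (REC l f p)))"
 proof -
  have "(\<forall>g\<in>set (map (%d. (flipS K (snd d), netc K (fst d))) (zip [0..<2 * K] (dims K))).
   \<forall>(x, y)\<in>srel K (fst g). \<forall>cl\<in>set (snd g). holds w x y cl) \<longleftrightarrow>
   (\<forall>c\<in>set (zip [0..<length (dims K)] (dims K)). \<forall>(x, y)\<in>srel K (flipS K (snd c)). \<forall>cl\<in>set (netc K (fst c)). holds w x y cl)"
   unfolding len by simp
  also have "\<dots> \<longleftrightarrow> (\<forall>l<2 * K. \<forall>(x, y)\<in>srel K (flipS K (dims K ! l)). \<forall>cl\<in>set (netc K l). holds w x y cl)"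
   using zz[of "dims K" "%l d. \<forall>(x, y)\<in>srel K (flipS K d). \<forall>cl\<in>set (netc K l). holds w x y cl"] unfolding len .
  also have "\<dots> \<longleftrightarrow> (\<forall>l<2 * K. \<forall>x\<in>rows K. \<forall>f<4. \<forall>p<K. w x (REC (Suc l) f p) =
    (if w x (SW l) then w (flip (dims K ! l) x) (REC l f p) else w x (REC l f p)))"
  proof -
   have "(\<forall>(x, y)\<in>srel K (flipS K (dims K ! l)). \<forall>cl\<in>set (netc K l). holds w x y cl) \<longleftrightarrow>
    (\<forall>x\<in>rows K. \<forall>f<4. \<forall>p<K. w x (REC (Suc l) f p) =
     (if w x (SW l) then w (flip (dims K ! l) x) (REC l f p) else w x (REC l f p)))" if "l < 2 * K" for l
   proof -
    have "dims K ! l < K" using that len dims_less nth_mem by metis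
    then show ?thesis unfolding srel_flipS[OF \<open>dims K ! l < K\<close>] netc_holds by blast
   qed
   then show ?thesis by blast
  qed
  finally show ?thesis .
 qed
 show ?thesis
  unfolding groups_def dims_eq[symmetric] set_append ball_Un bits net table_ok_def
  using one zero all step by (simp del: set_concat, simp only: conj_ac)
qed

lemma groups_shape: "g \<in> set (groups K cs rej) ==> K \<ge> 1 ==> sh \<in> set (fst g) ==> length (fst sh) = K \<and> length (snd sh) = K"
 by (auto simp: groups_def bitS_def bitpat_def constS_def allS_def stepS_def flipS_def set_zip nth_append rev_nth)

definition regs4c :: "nat => icode => bool" where
 "regs4c m c \<longleftrightarrow> fst (snd c) < 4 \<and> fst (snd (snd c)) \<le> m + 3 \<and> snd (snd (snd c)) < 4"

lemma weight_eqc: "cl \<in> set (eqc c a b) ==> l \<in> set cl ==> l \<in> set c \<or> fst (snd l) = snd a \<or> fst (snd l) = snd b"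
 by (auto simp: eqc_def)

lemma weight_keepc: "cl \<in> set (keepc K i r) ==> l \<in> set cl ==> tag_weight (fst (snd l)) \<le> K + i + 15"
 unfolding keepc_def by (auto dest!: weight_eqc simp: tag_weight_def)

lemma weight_icl:
 assumes "regs4c m c" "i \<le> m" "cl \<in> set (icl K i c)" "l \<in> set cl"
 shows "tag_weight (fst (snd l)) \<le> K + m + 20"
proof -
 obtain op r s u where c: "c = (op, r, s, u)" by (metis prod_cases4)
 have b: "r < 4" "s \<le> m + 3" "u < 4" using assms(1) by (auto simp: c regs4c_def)
 consider "cl \<in> set (keepc K i r)" | "cl \<in> set (keepc K i 4)" | "cl \<in> set (nextc i)" | "cl \<notin> set (keepc K i r)" "cl \<notin> set (keepc K i 4)" "cl \<notin> set (nextc i)"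
  by blast
 then show ?thesis
 proof cases
  case 1
  then show ?thesis using weight_keepc[OF 1 assms(4)] assms(2) by simp
 next
  case 2
  then show ?thesis using weight_keepc[OF 2 assms(4)] assms(2) by simp
 next
  case 3
  then show ?thesis using assms(2,4) by (auto simp: nextc_def tag_weight_def)
 next
  case 4
  then show ?thesis using assms(2,3,4) b unfolding c icl_def Let_def
   by (auto split: if_splits dest!: weight_eqc simp: tag_weight_def)
 qed
qed

lemma weight_rowc: "cl \<in> set (rowc K rej) ==> l \<in> set cl ==> tag_weight (fst (snd l)) \<le> 4 * K + rej + 20"
 unfolding rowc_def by (auto dest!: weight_eqc simp: tag_weight_def)

lemma weight_netc: "cl \<in> set (netc K i) ==> i < 2 * K ==> l \<in> set cl ==> tag_weight (fst (snd l)) \<le> 4 * K + 20"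
 unfolding netc_def by (auto dest!: weight_eqc simp: tag_weight_def)

text \<open>Tags have to fit into \<open>n\<close> bits. Their weight grows with levels and
  positions in the network, hence with \<open>K\<close>, and with addresses in the program, hence
  with \<open>m\<close>.\<close>

lemma weight_groups:
 assumes "g \<in> set (groups K cs rej)" "cl \<in> set (snd g)" "l \<in> set cl" "\<forall>c\<in>set cs. regs4c m c" "length cs \<le> m" "rej \<le> m + 3"
 shows "tag_weight (fst (snd l)) \<le> 4 * K + m + 30"
proof -
 have icl: "tag_weight (fst (snd l)) \<le> K + m + 20" if a: "cl \<in> set (concat (map (%c. icl K (fst c) (snd c)) (zip [0..<length cs] cs)))"
 proof -
  obtain i where i: "i < length cs" "cl \<in> set (icl K i (cs ! i))" using a by (auto simp: set_zip_upt)
  show ?thesis by (rule weight_icl[OF _ _ i(2) assms(3)]) (use i assms(4,5) in auto)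
 qed
 have net: "tag_weight (fst (snd l)) \<le> 4 * K + 20" if "i < 2 * K" "cl \<in> set (netc K i)" for i
  using weight_netc[OF that(2,1) assms(3)] .
 have init: "tag_weight (fst (snd l)) \<le> K + 20" if "cl \<in> set (initc K) \<or> cl \<in> set (zeroc K)"
  using that assms(3) unfolding initc_def zeroc_def by (auto simp: tag_weight_def)
 consider "snd g = initc K \<or> snd g = zeroc K" | "snd g = rowc K rej"
  | "snd g = concat (map (%c. icl K (fst c) (snd c)) (zip [0..<length cs] cs))"
  | i where "i < 2 * K" "snd g = netc K i" | "\<exists>p<K. \<exists>b. snd g = [[(False, IX p, b)]]"
 proof -
  assume h: "snd g = initc K \<or> snd g = zeroc K ==> thesis" "snd g = rowc K rej ==> thesis"
   "snd g = concat (map (%c. icl K (fst c) (snd c)) (zip [0..<length cs] cs)) ==> thesis"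
   "\<And>i. i < 2 * K ==> snd g = netc K i ==> thesis" "\<exists>p<K. \<exists>b. snd g = [[(False, IX p, b)]] ==> thesis"
  have "(\<exists>p<K. \<exists>b. snd g = [[(False, IX p, b)]]) \<or> snd g = initc K \<or> snd g = zeroc K \<or> snd g = rowc K rej \<or>
    snd g = concat (map (%c. icl K (fst c) (snd c)) (zip [0..<length cs] cs)) \<or> (\<exists>i<2 * K. snd g = netc K i)"
   using assms(1) unfolding groups_def by (auto simp: set_zip simp del: set_concat) (auto)
  then show thesis using h by blast
 qed
 then show ?thesis
 proof cases
  case 1
  then show ?thesis using init assms(2) by fastforce
 next
  case 2
  then show ?thesis using weight_rowc[of cl K rej l] assms by auto
 next
  case 3
  then show ?thesis using icl assms(2) by fastforce
 next
  case 4
  then show ?thesis using net assms(2) by fastforce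
 next
  case 5
  then show ?thesis using assms(2,3) by (auto simp: tag_weight_def)
 qed
qed

lemma csp_sat_iff:
 assumes K: "K \<ge> 1" and cs: "\<forall>c\<in>set cs. regs4c m c" "length cs \<le> m" "rej \<le> m + 3" and n: "4 * K + m + 30 \<le> n"
  and w: "\<And>x t. x \<in> rows K ==> tag_weight t \<le> n ==> W (x @ tagc n t) = w x t"
 shows "sat (K + n) (csp K n cs rej) W \<longleftrightarrow>
  (\<forall>g\<in>set (groups K cs rej). \<forall>(x, y)\<in>srel K (fst g). \<forall>cl\<in>set (snd g). holds w x y cl)"
proof -
 have 1: "fam_ok W (K + n) (mkfam n sh cl) \<longleftrightarrow> (\<forall>y\<in>rows K. holds w (inst (fst sh) y) (inst (snd sh) y) cl)"
  if "g \<in> set (groups K cs rej)" "sh \<in> set (fst g)" "cl \<in> set (snd g)" for g sh cl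
 proof (rule fam_ok_mkfam)
  show "length (fst sh) = K" "length (snd sh) = K" using groups_shape[OF that(1) K that(2)] by auto
  show "tag_weight (fst (snd l)) \<le> n" if "l \<in> set cl" for l
   using weight_groups[OF \<open>g \<in> set (groups K cs rej)\<close> \<open>cl \<in> set (snd g)\<close> that cs] n by simp
 qed (rule w)
 have "sat (K + n) (csp K n cs rej) W \<longleftrightarrow> (\<forall>g\<in>set (groups K cs rej). \<forall>sh\<in>set (fst g). \<forall>cl\<in>set (snd g). fam_ok W (K + n) (mkfam n sh cl))"
  unfolding sat_def csp_def ball_concat_map by auto
 also have "\<dots> \<longleftrightarrow> (\<forall>g\<in>set (groups K cs rej). \<forall>sh\<in>set (fst g). \<forall>cl\<in>set (snd g). \<forall>y\<in>rows K. holds w (inst (fst sh) y) (inst (snd sh) y) cl)"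
  using 1 by blast
 also have "\<dots> \<longleftrightarrow> (\<forall>g\<in>set (groups K cs rej). \<forall>(x, y)\<in>srel K (fst g). \<forall>cl\<in>set (snd g). holds w x y cl)"
 proof -
  have "(\<forall>sh\<in>set S. \<forall>cl\<in>X. \<forall>y\<in>rows K. holds w (inst (fst sh) y) (inst (snd sh) y) cl) \<longleftrightarrow>
    (\<forall>(x, y)\<in>srel K S. \<forall>cl\<in>X. holds w x y cl)" for S X
   unfolding srel_def by blast
  then show ?thesis by simp
 qed
 finally show ?thesis .
qed

lemma regs4c_icode: "regs4 c ==> tnoask c ==> (\<And>r l. c = TJnil r l ==> l \<le> m + 3) ==> regs4c m (icode_of c)"
 by (cases c) (auto simp: regs4_def regs4c_def tnoask_def)

text \<open>Rows 1 to \<open>2 ^ K - 1\<close> are linked by \<open>2 ^ K - 2\<close> transitions,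
  so a solution certifies that many steps without \<open>rej\<close>. In the other direction the run
  has to avoid \<open>rej\<close> forever; the two meet for programs that halt in time.\<close>

theorem csp_correct:
 assumes K: "K \<ge> 1" and Pg: "\<forall>c\<in>set Pg. regs4 c \<and> tnoask c" "\<forall>r l. TJnil r l \<in> set Pg --> l \<le> length Pg + 3"
  "rej \<le> length Pg + 3" and n: "4 * K + length Pg + 30 \<le> n"
 shows "sat (K + n) (csp K n (map icode_of Pg) rej) W ==>
   \<exists>xs. \<forall>suf. fst (trun {} Pg (2 ^ K - 2) (0, %_. Lf, xs @ suf, [])) \<noteq> rej"
  and "(\<And>k. fst (trun {} Pg k (0, %_. Lf, x0, [])) \<noteq> rej) ==> \<exists>W. sat (K + n) (csp K n (map icode_of Pg) rej) W"
proof -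
 have cs: "\<forall>c\<in>set (map icode_of Pg). regs4c (length Pg) c"
 proof
  fix c' assume "c' \<in> set (map icode_of Pg)"
  then obtain c where c: "c \<in> set Pg" "c' = icode_of c" by auto
  show "regs4c (length Pg) c'" unfolding c(2)
   by (rule regs4c_icode) (use c(1) Pg in auto)
 qed
 have na: "\<forall>c\<in>set Pg. tnoask c" using Pg by auto
 have pcs: "fst (prun {} Pg k 1 (pinit x)) = fst (trun {} Pg k (0, %_. Lf, x, []))" for k x
  using psim_prun[OF pinit_inv pinit_sim[of x], where n = k and A = "{}" and P = Pg]
  by (cases "prun {} Pg k 1 (pinit x)"; cases "trun {} Pg k (0, %_. Lf, x, [])") auto
 {
  assume s: "sat (K + n) (csp K n (map icode_of Pg) rej) W"
  define w where "w = (%x t. W (x @ tagc n t))"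
  have tab: "table_ok K Pg rej w"
   using csp_sat_iff[OF K cs _ Pg(3) n, of W w] groups_table[OF K na, of rej w] s by (simp add: w_def)
  have "1 < (2 :: nat) ^ K" using K one_less_power[of "2 :: nat" K] by simp
  then have "2 ^ K - 2 + 1 < (2 :: nat) ^ K" by simp
  from table_sound[OF tab K Pg(1) this] show "\<exists>xs. \<forall>suf. fst (trun {} Pg (2 ^ K - 2) (0, %_. Lf, xs @ suf, [])) \<noteq> rej"
   unfolding pcs[symmetric] by (metis fst_conv)
 }
 assume nr: "\<And>k. fst (trun {} Pg k (0, %_. Lf, x0, [])) \<noteq> rej"
 have "traced K Pg rej x0" by unfold_locales (use K Pg nr in \<open>auto simp: pcs[simplified]\<close>)
 then obtain w where tab: "table_ok K Pg rej w" using traced.table_complete by blast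
 \<comment> \<open>Well defined on proper addresses, because the row is determined by its length and
   the tag by \<open>tagc_inj\<close>.\<close>
 define W where "W = (%s. \<exists>x\<in>rows K. \<exists>t. s = x @ tagc n t \<and> w x t)"
 have W: "W (x @ tagc n t) = w x t" if "x \<in> rows K" "tag_weight t \<le> n" for x t
 proof -
  have "x' = x \<and> t' = t" if "x' \<in> rows K" "x @ tagc n t = x' @ tagc n t'" for x' t'
  proof -
   have "length x = length x'" using that \<open>x \<in> rows K\<close> by (simp add: rows_def)
   then have "x = x' \<and> tagc n t = tagc n t'" using that(2) by simp
   then show ?thesis using tagc_inj by blast
  qed
  then show ?thesis unfolding W_def using that(1) by blast
 qed
 show "\<exists>W. sat (K + n) (csp K n (map icode_of Pg) rej) W"
  using csp_sat_iff[OF K cs _ Pg(3) n, of W w, OF _ W] groups_table[OF K na, of rej w] tab by auto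
qed

section \<open>Hard-wiring the arguments of a program\<close>

definition shiftc :: "nat => icode => icode" where
 "shiftc a c = (fst c, fst (snd c), (if fst c = 4 then fst (snd (snd c)) + a else fst (snd (snd c))), snd (snd (snd c)))"

fun shiftt :: "nat => tinstr => tinstr" where
 "shiftt a (TJnil r l) = TJnil r (l + a)"
| "shiftt a c = c"

lemma icode_shift: "icode_of (shiftt a c) = shiftc a (icode_of c)"
 by (cases c) (auto simp: shiftc_def)

lemma fcode_shift: "fcode (b + a) F = map (shiftt a) (fcode b F)"
proof (induction F arbitrary: b)
 case (FPair F G)
 show ?case using FPair.IH(1)[of "b + 1"] FPair.IH(2)[of "b + flen F + 6"] by (simp add: algebra_simps)
next
 case (FComp F G)
 show ?case using FComp.IH(1)[of b] FComp.IH(2)[of "b + flen F"] by (simp add: algebra_simps)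
next
 case (FIf B F G)
 show ?case using FIf.IH(1)[of "b + 1"] FIf.IH(2)[of "b + flen B + 4"] FIf.IH(3)[of "b + flen B + flen F + 8"]
  by (simp add: algebra_simps)
next
 case (FWhile F)
 show ?case using FWhile.IH[of "b + 2"] by (simp add: algebra_simps)
qed auto

text \<open>Straight-line code that builds the tree of a bit list from its last element on. The
  arguments thus become part of the program, and the input stream carries nothing but
  guesses.\<close>

definition ldbits :: "nat => bits => icode list" where
 "ldbits r bs = (0, r, 0, 0) # concat (map (%b. if b then [(0, 2, 0, 0), (1, 2, 2, 2), (1, r, 2, r)] else [(0, 2, 0, 0), (1, r, 2, r)]) (rev bs))"

definition loader :: "bits => bits => icode list" where
 "loader as bs = ldbits 0 as @ ldbits 1 bs @ [(1, 0, 0, 1)]"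

definition ldbitst :: "nat => bits => tinstr list" where
 "ldbitst r bs = TNil r # concat (map (%b. if b then [TNil 2, TCons 2 2 2, TCons r 2 r] else [TNil 2, TCons r 2 r]) (rev bs))"

definition loadert :: "bits => bits => tinstr list" where
 "loadert as bs = ldbitst 0 as @ ldbitst 1 bs @ [TCons 0 0 1]"

lemma ldbitst_icode: "map icode_of (ldbitst r bs) = ldbits r bs"
 unfolding ldbitst_def ldbits_def by (induction bs rule: rev_induct) auto

lemma set_ldbitst: "c \<in> set (ldbitst r bs) ==> c \<in> {TNil r, TNil 2, TCons 2 2 2, TCons r 2 r}"
 unfolding ldbitst_def by (induction bs rule: rev_induct) (auto split: if_splits)

lemma loadert_icode: "map icode_of (loadert as bs) = loader as bs"
 by (simp add: loadert_def loader_def ldbitst_icode)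

lemma length_ldbits: "length (ldbits r bs) \<le> 3 * length bs + 1" "length (ldbitst r bs) \<le> 3 * length bs + 1"
 unfolding ldbits_def ldbitst_def by (induction bs rule: rev_induct) auto

lemma trun_one: "code_at P a (c # ds) ==> trun A P (Suc n) (a, R, i, q) = trun A P n (tinstr_step A c (a, R, i, q))"
 by (simp add: trun_Suc tstep_code_at)

lemma trun_ldbitst:
 assumes "code_at P a (ldbitst r bs)" "r \<noteq> 2"
 shows "\<exists>R'. trun A P (length (ldbitst r bs)) (a, R, i, q) = (a + length (ldbitst r bs), R', i, q) \<and>
  R' r = enc bs \<and> (\<forall>s. s \<noteq> r \<and> s \<noteq> 2 --> R' s = R s)"
proof -
 let ?f = "%b. if b then [TNil 2, TCons 2 2 2, TCons r 2 r] else [TNil 2, TCons r 2 r]"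
 have main: "\<exists>R'. trun A P (length (concat (map ?f (rev bs)))) (a, R, i, q) = (a + length (concat (map ?f (rev bs))), R', i, q) \<and>
  R' r = enc (bs @ cs) \<and> (\<forall>s. s \<noteq> r \<and> s \<noteq> 2 --> R' s = R s)"
  if "code_at P a (concat (map ?f (rev bs)))" "R r = enc cs" for a R bs cs
  using that
 proof (induction bs arbitrary: a R cs rule: rev_induct)
  case (snoc b bs)
  have c: "code_at P a (?f b)" "code_at P (a + length (?f b)) (concat (map ?f (rev bs)))"
   using snoc.prems(1) by (simp_all add: code_at_append split: if_splits)
  let ?R1 = "R(2 := enc b, r := enc (b # cs))"
  have 1: "trun A P (length (?f b)) (a, R, i, q) = (a + length (?f b), ?R1, i, q)"
   using c(1) snoc.prems(2) assms(2)
   by (cases b) (simp_all add: code_at_Cons trun_Suc tstep_def eval_nat_numeral fun_upd_twist)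
  have "?R1 r = enc (b # cs)" by simp
  from snoc.IH[where R = ?R1 and cs = "b # cs", OF c(2) this] obtain R' where R':
   "trun A P (length (concat (map ?f (rev bs)))) (a + length (?f b), ?R1, i, q) =
    (a + length (?f b) + length (concat (map ?f (rev bs))), R', i, q)"
   "R' r = enc (bs @ b # cs)" "\<forall>s. s \<noteq> r \<and> s \<noteq> 2 --> R' s = ?R1 s" by blast
  have "length (concat (map ?f (rev (bs @ [b])))) = length (?f b) + length (concat (map ?f (rev bs)))" by simp
  then show ?case using R' by (intro exI[of _ R']) (simp only: trun_add 1, simp add: add.assoc)
 qed (auto intro!: exI[of _ R])
 have "code_at P a ([TNil r] @ concat (map ?f (rev bs)))"
  using assms(1) unfolding ldbitst_def by simp
 then have c: "code_at P a [TNil r]" "code_at P (Suc a) (concat (map ?f (rev bs)))"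
  unfolding code_at_append by simp_all
 let ?R0 = "R(r := Lf)"
 have "?R0 r = enc ([] :: bits)" by simp
 from main[where R = ?R0 and cs = "[]", OF c(2) this] obtain R' where R': "trun A P (length (concat (map ?f (rev bs)))) (Suc a, ?R0, i, q) = (Suc a + length (concat (map ?f (rev bs))), R', i, q)"
  "R' r = enc bs" "\<forall>s. s \<noteq> r \<and> s \<noteq> 2 --> R' s = ?R0 s" by auto
 have "trun A P (length (ldbitst r bs)) (a, R, i, q) = trun A P (length (concat (map ?f (rev bs)))) (Suc a, ?R0, i, q)"
  unfolding ldbitst_def list.size(4) using trun_one[OF c(1), of A _ R i q] by simp
 then show ?thesis using R' by (intro exI[of _ R']) (auto simp: ldbitst_def)
qed

lemma trun_loadert:
 assumes "code_at P 0 (loadert as bs)"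
 shows "\<exists>R'. trun A P (length (loadert as bs)) (0, R, i, q) = (length (loadert as bs), R', i, q) \<and> R' 0 = enc (as, bs)"
proof -
 let ?a = "length (ldbitst 0 as)" and ?b = "length (ldbitst 1 bs)"
 have c: "code_at P 0 (ldbitst 0 as)" "code_at P ?a (ldbitst 1 bs)" "code_at P (?a + ?b) [TCons 0 0 1]"
  using assms unfolding loadert_def by (auto simp: code_at_append)
 obtain R1 where R1: "trun A P ?a (0, R, i, q) = (?a, R1, i, q)" "R1 0 = enc as"
  using trun_ldbitst[OF c(1), of A R i q] by auto
 obtain R2 where R2: "trun A P ?b (?a, R1, i, q) = (?a + ?b, R2, i, q)" "R2 1 = enc bs" "R2 0 = enc as"
  using trun_ldbitst[OF c(2), of A R1 i q] R1(2) by auto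
 have "length (loadert as bs) = ?a + (?b + 1)" by (simp add: loadert_def)
 moreover have "trun A P (?a + (?b + 1)) (0, R, i, q) = trun A P 1 (?a + ?b, R2, i, q)"
  by (simp only: trun_add R1(1) R2(1))
 ultimately show ?thesis using R2 trun_one[OF c(3), of A 0 R2 i q] by simp
qed

text \<open>The final jump leads to the rejecting address if the result is nil. Otherwise control
  falls off the end, one address below; both addresses lie outside the program, so the machine rests
  there.\<close>

definition fullc :: "icode list => bits => bits => icode list" where
 "fullc e as bs = (let ld = loader as bs in
   ld @ map (shiftc (length ld)) e @ [(4, 0, length ld + length e + 2, 0)])"

definition stage_csp :: "nat => nat => icode list => bits => bits => family list" where
 "stage_csp K n e as bs = csp K n (fullc e as bs) (length (loader as bs) + length e + 2)"

lemma noask_fcode: "noask F ==> c \<in> set (fcode a F) ==> tnoask c"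
 by (induction F arbitrary: a) (auto simp: tnoask_def)

lemma fcode_jumps: "TJnil r l \<in> set (fcode a F) ==> l \<le> a + flen F"
 by (induction F arbitrary: a) (force simp: algebra_simps)+

lemma trun_idle: "length P \<le> pc ==> trun A P n (pc, R, i, q) = (pc, R, i, q)"
 by (induction n) (auto simp: trun_Suc tstep_def)

lemma stage_program:
 fixes as bs :: bits and F :: fn and K n :: nat
 assumes F: "noask F"
 defines "l0 \<equiv> length (loadert as bs)"
 defines "rej \<equiv> l0 + flen F + 2"
 defines "Pg \<equiv> loadert as bs @ fcode l0 F @ [TJnil 0 rej]"
 shows "l0 \<le> 3 * length as + 3 * length bs + 3" "length Pg = l0 + flen F + 1"
  "stage_csp K n (map icode_of (fcode 0 F)) as bs = csp K n (map icode_of Pg) rej"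
  "\<forall>c\<in>set Pg. regs4 c \<and> tnoask c" "\<forall>r l. TJnil r l \<in> set Pg --> l \<le> length Pg + 3"
proof -
 let ?ld = "loadert as bs"
 show l0: "l0 \<le> 3 * length as + 3 * length bs + 3"
  using length_ldbits(2)[of 0 as] length_ldbits(2)[of 1 bs] by (simp add: l0_def loadert_def)
 show lP: "length Pg = l0 + flen F + 1" by (simp add: Pg_def l0_def)
 have lld: "length (loader as bs) = l0" unfolding loadert_icode[symmetric] l0_def by simp
 have full: "fullc (map icode_of (fcode 0 F)) as bs = map icode_of Pg"
  using fcode_shift[of 0 l0 F] by (simp add: fullc_def Let_def Pg_def lld loadert_icode icode_shift rej_def comp_def)
 show scsp: "stage_csp K n (map icode_of (fcode 0 F)) as bs = csp K n (map icode_of Pg) rej"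
  by (simp add: stage_csp_def full lld rej_def)
 have ldP: "regs4 c \<and> tnoask c \<and> (\<forall>r l. c \<noteq> TJnil r l)" if "c \<in> set ?ld" for c
 proof -
  have "c \<in> {TNil 0, TNil 1, TNil 2, TCons 2 2 2, TCons 0 2 0, TCons 1 2 1, TCons 0 0 1}"
   using that set_ldbitst[of c 0 as] set_ldbitst[of c 1 bs] unfolding loadert_def by auto
  then show ?thesis by (auto simp: regs4_def tnoask_def)
 qed
 show P1: "\<forall>c\<in>set Pg. regs4 c \<and> tnoask c"
 proof
  fix c assume "c \<in> set Pg"
  then consider "c \<in> set ?ld" | "c \<in> set (fcode l0 F)" | "c = TJnil 0 rej" by (auto simp: Pg_def)
  then show "regs4 c \<and> tnoask c"
   by cases (use ldP regs4_fcode noask_fcode[OF F] in \<open>auto simp: regs4_def tnoask_def\<close>)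
 qed
 have "l \<le> length Pg + 3" if "TJnil r l \<in> set Pg" for r l
 proof -
  have "TJnil r l \<notin> set ?ld" using ldP by blast
  then have "TJnil r l \<in> set (fcode l0 F) \<or> l = rej" using that by (auto simp: Pg_def)
  then show ?thesis using fcode_jumps[of r l l0 F] lP by (auto simp: rej_def)
 qed
 then show P2: "\<forall>r l. TJnil r l \<in> set Pg --> l \<le> length Pg + 3" by blast
qed

text \<open>Since the program halts within the time covered by the table, avoiding the rejecting
  address is the same as accepting. The number \<open>m\<close> is the amount of guesses from which
  on the behaviour is specified.\<close>

theorem stage_csp_correct:
 assumes F: "noask F" and K: "K \<ge> 1" and n: "4 * K + 3 * length as + 3 * length bs + flen F + 40 \<le> n"
  and halts: "\<And>x. length x \<ge> m ==> \<exists>t y i q. ev {} F (enc (as, bs), x, []) (y, i, q) t \<and> (y \<noteq> Lf \<longleftrightarrow> acc x) \<and>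
    3 * length as + 3 * length bs + t + 10 < 2 ^ K"
 shows "(\<exists>W. sat (K + n) (stage_csp K n (map icode_of (fcode 0 F)) as bs) W) \<longleftrightarrow> (\<exists>x. length x \<ge> m \<and> acc x)"
proof -
 let ?ld = "loadert as bs"
 define l0 where "l0 = length ?ld"
 define rej where "rej = l0 + flen F + 2"
 define Pg where "Pg = ?ld @ fcode l0 F @ [TJnil 0 rej]"
 note prog = stage_program[OF F, where as = as and bs = bs, folded l0_def, folded rej_def, folded Pg_def]
 note l0 = prog(1) and lP = prog(2) and scsp = prog(3)[where K = K and n = n] and P1 = prog(4) and P2 = prog(5)
 have c1: "code_at Pg 0 ?ld" unfolding code_at_def Pg_def by (rule exI[of _ "[]"]) simp
 have c2: "code_at Pg l0 (fcode l0 F)" unfolding code_at_def Pg_def l0_def by blast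
 have c3: "code_at Pg (l0 + flen F) [TJnil 0 rej]"
  unfolding code_at_def Pg_def by (rule exI[of _ "?ld @ fcode l0 F"]) (simp add: l0_def)
 have run: "\<exists>k. k \<le> 2 ^ K - 2 \<and> (\<exists>R i q. trun {} Pg k (0, %_. Lf, x, []) = (if acc x then Suc (l0 + flen F) else rej, R, i, q)) \<and>
   (\<forall>j<k. fst (trun {} Pg j (0, %_. Lf, x, [])) \<noteq> rej)" if lx: "length x \<ge> m" for x
 proof -
  obtain t y i q where e: "ev {} F (enc (as, bs), x, []) (y, i, q) t" "y \<noteq> Lf \<longleftrightarrow> acc x"
   "3 * length as + 3 * length bs + t + 10 < 2 ^ K" using halts[OF lx] by blast
  obtain R1 where R1: "trun {} Pg l0 (0, %_. Lf, x, []) = (l0, R1, x, [])" "R1 0 = enc (as, bs)"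
   using trun_loadert[OF c1, of "{}" "%_. Lf" x "[]"] by (auto simp: l0_def)
  obtain R2 where R2: "trun {} Pg t (l0, R1, x, []) = (l0 + flen F, R2, i, q)" "R2 0 = y"
   using trun_code[OF e(1) c2, of R1] R1(2) by auto
  let ?k = "l0 + (t + 1)"
  have end1: "trun {} Pg ?k (0, %_. Lf, x, []) = (if acc x then Suc (l0 + flen F) else rej, R2, i, q)"
  proof -
   have "trun {} Pg ?k (0, %_. Lf, x, []) = trun {} Pg 1 (l0 + flen F, R2, i, q)"
    by (simp only: trun_add R1(1) R2(1))
   then show ?thesis using R2(2) e(2) trun_one[OF c3, of "{}" 0 R2 i q] by auto
  qed
  \<comment> \<open>The rejecting address is a resting place: had it been met earlier, the program
    counter would still be there at time \<open>l0 + t\<close>, where it is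
    \<open>l0 + flen F\<close>.\<close>
  have "fst (trun {} Pg j (0, %_. Lf, x, [])) \<noteq> rej" if "j < ?k" for j
  proof
   assume r: "fst (trun {} Pg j (0, %_. Lf, x, [])) = rej"
   have idle: "trun {} Pg d (trun {} Pg j (0, %_. Lf, x, [])) = trun {} Pg j (0, %_. Lf, x, [])" for d
    using trun_idle[of Pg rej "{}" d] r lP by (cases "trun {} Pg j (0, %_. Lf, x, [])") (auto simp: rej_def)
   have "trun {} Pg (l0 + t) (0, %_. Lf, x, []) = trun {} Pg (j + (l0 + t - j)) (0, %_. Lf, x, [])" using that by simp
   also have "\<dots> = trun {} Pg j (0, %_. Lf, x, [])" unfolding trun_add idle ..
   finally have "fst (trun {} Pg (l0 + t) (0, %_. Lf, x, [])) = rej" using r by simp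
   then show False using R1 R2 by (simp add: trun_add rej_def)
  qed
  moreover have "?k \<le> 2 ^ K - 2" using e(3) l0 by linarith
  ultimately show ?thesis using end1 by blast
 qed
 have n': "4 * K + length Pg + 30 \<le> n" using n l0 by (simp add: lP)
 have rb: "rej \<le> length Pg + 3" by (simp add: rej_def lP)
 show ?thesis unfolding scsp
 proof
  assume "\<exists>W. sat (K + n) (csp K n (map icode_of Pg) rej) W"
  then obtain xs where xs: "\<And>suf. fst (trun {} Pg (2 ^ K - 2) (0, %_. Lf, xs @ suf, [])) \<noteq> rej"
   using csp_correct(1)[OF K P1 P2 rb n'] by blast
  \<comment> \<open>The certified prefix may be shorter than \<open>m\<close>; by the quantifier
    over continuations it can be padded.\<close>
  define x where "x = xs @ replicate m False"
  have "length x \<ge> m" by (simp add: x_def)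
  from run[OF this] obtain k R i q where k: "k \<le> 2 ^ K - 2"
   "trun {} Pg k (0, %_. Lf, x, []) = (if acc x then Suc (l0 + flen F) else rej, R, i, q)" by blast
  have "acc x"
  proof (rule ccontr)
   assume "\<not> acc x"
   then have "trun {} Pg (k + (2 ^ K - 2 - k)) (0, %_. Lf, x, []) = (rej, R, i, q)"
    unfolding trun_add k(2) using trun_idle[of Pg rej] lP by (simp add: rej_def)
   moreover have "k + (2 ^ K - 2 - k) = 2 ^ K - 2" using k(1) by simp
   ultimately show False using xs[of "replicate m False"] unfolding x_def by (metis fst_conv)
  qed
  then show "\<exists>x. length x \<ge> m \<and> acc x" using \<open>length x \<ge> m\<close> by blast
 next
  assume "\<exists>x. length x \<ge> m \<and> acc x"
  then obtain x where x: "length x \<ge> m" "acc x" by blast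
  from run[OF x(1)] obtain k R i q where k: "trun {} Pg k (0, %_. Lf, x, []) = (Suc (l0 + flen F), R, i, q)"
   "\<And>j. j < k ==> fst (trun {} Pg j (0, %_. Lf, x, [])) \<noteq> rej" using x(2) by auto
  have "fst (trun {} Pg j (0, %_. Lf, x, [])) \<noteq> rej" for j
  proof (cases "j < k")
   case False
   then have "trun {} Pg j (0, %_. Lf, x, []) = trun {} Pg (k + (j - k)) (0, %_. Lf, x, [])" by simp
   also have "\<dots> = (Suc (l0 + flen F), R, i, q)" unfolding trun_add k(1) by (rule trun_idle) (simp add: lP)
   finally show ?thesis by (simp add: rej_def)
  qed (rule k(2))
  from csp_correct(2)[OF K P1 P2 rb n' this] show "\<exists>W. sat (K + n) (csp K n (map icode_of Pg) rej) W" .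
 qed
qed

section \<open>Checking a circuit against a constraint system with MAX-SAT\<close>

text \<open>A gate assigns to every input position a pair: \<open>(True, b)\<close> for the literal with value \<open>b\<close>,
 \<open>(False, False)\<close> for no literal, and \<open>(False, True)\<close> makes the gate constantly false.\<close>

type_synonym gate = "(bool \<times> bool) list"

definition geval :: "gate => bits => bool" where
 "geval g x \<longleftrightarrow> (\<forall>z\<in>set (zip g x). if fst (fst z) then snd (fst z) = snd z else \<not> snd (fst z))"

definition tnth :: "bits => nat => bool" where
 "tnth l n = (case drop n l of [] => False | b # _ => b)"

lemma tnth_nth: "n < length l ==> tnth l n = l ! n"
 by (simp add: tnth_def Cons_nth_drop_Suc[symmetric])

definition deval :: "gate list \<times> bits => bits => bool" where
 "deval D x = tnth (snd D) (length (filter (%g. geval g x) (fst D)))"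

definition dead :: "gate => pattern => bool" where
 "dead g \<pi> \<longleftrightarrow> (\<exists>z\<in>set (zip g \<pi>). (\<not> fst (fst z) \<and> snd (fst z)) \<or>
   (fst (fst z) \<and> fst (snd z) \<and> \<not> (snd (fst z) = snd (snd z))))"

definition lits :: "gate => pattern => literal list" where
 "lits g \<pi> = map (%z. (snd z, snd (fst (fst z)))) (filter (%z. fst (fst (fst z)) \<and> \<not> fst (snd (fst z)))
   (zip (zip g \<pi>) [0..<length g]))"

definition rgates :: "gate list => pattern => literal list list" where
 "rgates gs \<pi> = map (%g. lits g \<pi>) (filter (%g. \<not> dead g \<pi>) gs)"

definition uval :: "bits => literal list => bool" where
 "uval y u \<longleftrightarrow> (\<forall>l\<in>set u. y ! fst l = snd l)"

lemma set_zip_image: "length a = length b ==> set (zip a b) = (%i. (a ! i, b ! i)) ` {..<length a}"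
proof -
 assume "length a = length b"
 then have "zip a b = map (%i. (a ! i, b ! i)) [0..<length a]" by (intro nth_equalityI) auto
 then show ?thesis by (simp add: atLeast0LessThan)
qed

lemma inst_nth: "length \<pi> = length y ==> i < length y ==> inst \<pi> y ! i = (if fst (\<pi> ! i) then snd (\<pi> ! i) else y ! i)"
 by (simp add: inst_def)

lemma geval_inst:
 assumes "length g = L" "length \<pi> = L" "length y = L"
 shows "geval g (inst \<pi> y) \<longleftrightarrow> \<not> dead g \<pi> \<and> uval y (lits g \<pi>)"
proof -
 have 1: "geval g (inst \<pi> y) \<longleftrightarrow> (\<forall>i<L. if fst (g ! i) then snd (g ! i) = (if fst (\<pi> ! i) then snd (\<pi> ! i) else y ! i) else \<not> snd (g ! i))"
 proof -
  have len: "length g = length (inst \<pi> y)" using assms length_inst[of \<pi> y] by simp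
  have n: "inst \<pi> y ! i = (if fst (\<pi> ! i) then snd (\<pi> ! i) else y ! i)" if "i < L" for i
   by (rule inst_nth) (use assms that in auto)
  have "geval g (inst \<pi> y) \<longleftrightarrow> (\<forall>i<L. if fst (g ! i) then snd (g ! i) = inst \<pi> y ! i else \<not> snd (g ! i))"
   unfolding geval_def set_zip_image[OF len] using assms(1) by auto
  then show ?thesis using n by auto
 qed
 have 2: "dead g \<pi> \<longleftrightarrow> (\<exists>i<L. (\<not> fst (g ! i) \<and> snd (g ! i)) \<or> (fst (g ! i) \<and> fst (\<pi> ! i) \<and> \<not> (snd (g ! i) = snd (\<pi> ! i))))"
  unfolding dead_def using assms by (auto simp: set_zip_image)
 have 3: "uval y (lits g \<pi>) \<longleftrightarrow> (\<forall>i<L. fst (g ! i) \<and> \<not> fst (\<pi> ! i) --> y ! i = snd (g ! i))"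
 proof -
  have z: "zip (zip g \<pi>) [0..<L] = map (%i. ((g ! i, \<pi> ! i), i)) [0..<L]"
   using assms by (intro nth_equalityI) auto
  show ?thesis unfolding uval_def lits_def assms(1) z filter_map comp_def by auto
 qed
 show ?thesis unfolding 1 2 3 by auto
qed

text \<open>The constants of a pattern falsify some gates and shorten the others, without changing
  the count that enters the symmetric gate.\<close>

lemma count_inst:
 assumes "\<And>g. g \<in> set gs ==> length g = L" "length \<pi> = L" "length y = L"
 shows "length (filter (%g. geval g (inst \<pi> y)) gs) = length (filter (uval y) (rgates gs \<pi>))"
 using assms(1)
proof (induction gs)
 case (Cons g gs)
 then show ?case using geval_inst[of g L \<pi> y] assms(2,3) by (simp add: rgates_def)
qed (simp add: rgates_def)

section \<open>Counting true terms by violated clauses\<close>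

definition neg :: "literal list => literal list" where
 "neg u = map (%l. (fst l, \<not> snd l)) u"

text \<open>Clause \<open>j\<close> says that if the first \<open>j\<close> literals hold then so
  does the next one. If the term is false exactly one clause fails, at its first false literal; so
  the number of failures is 0 or 1 and no new variables arise.\<close>

definition rw :: "literal list => cnf" where
 "rw u = map (%j. neg (take j u) @ take 1 (drop j u)) [0..<length u]"

text \<open>With c true terms, the ordered pairs of true terms violate \<open>c * c\<close> clauses,
  and every false term contributes \<open>2 * snd p\<close> further violations.\<close>

definition slot_cnf :: "literal list list \<times> nat => cnf" where
 "slot_cnf p = concat (map (%u. map (%v. neg u @ neg v) (fst p)) (fst p)) @
   concat (replicate (2 * snd p) (concat (map rw (fst p))))"

text \<open>The two empty clauses ensure at least two clauses in total, so that the logarithm in the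
  assumed running time is at least 1.\<close>

definition slots_cnf :: "(literal list list \<times> nat) list => cnf" where
 "slots_cnf S = [[], []] @ concat (map slot_cnf S)"

text \<open>The sum of the minima \<open>a * (2 * s - a)\<close> of the slots, and 2 for the empty
  clauses. It is written as the length of a list to be computable by list operations.\<close>

definition slots_loss :: "(literal list list \<times> nat) list => nat" where
 "slots_loss S = length (concat (map (%p. replicate (snd p * (2 * length (fst p) - snd p)) Lf) S)) + 2"

definition unsat :: "(nat => bool) => cnf => nat" where
 "unsat \<alpha> F = length (filter (%C. \<not> clause_true \<alpha> C) F)"

definition aval :: "(nat => bool) => literal list => bool" where
 "aval \<alpha> u \<longleftrightarrow> (\<forall>l\<in>set u. \<alpha> (fst l) = snd l)"

lemma unsat_append: "unsat \<alpha> (F @ G) = unsat \<alpha> F + unsat \<alpha> G"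
 by (simp add: unsat_def)

lemma unsat_Nil [simp]: "unsat \<alpha> [] = 0"
 by (simp add: unsat_def)

lemma unsat_concat: "unsat \<alpha> (concat Fs) = sum_list (map (unsat \<alpha>) Fs)"
 by (induction Fs) (simp_all add: unsat_append)

lemma clause_neg: "clause_true \<alpha> (neg u @ C) \<longleftrightarrow> \<not> aval \<alpha> u \<or> clause_true \<alpha> C"
proof -
 have "clause_true \<alpha> E \<longleftrightarrow> (\<exists>l\<in>set E. \<alpha> (fst l) = snd l)" for E
  by (simp add: clause_true_def case_prod_beta)
 then show ?thesis by (simp add: neg_def aval_def bex_Un)
qed

lemma unsat_rw: "unsat \<alpha> (rw u) = of_bool (\<not> aval \<alpha> u)"
proof (induction u rule: rev_induct)
 case Nil
 then show ?case by (simp add: rw_def unsat_def aval_def)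
next
 case (snoc l u)
 have e: "rw (u @ [l]) = rw u @ [neg u @ [l]]"
  unfolding rw_def by (simp add: neg_def)
 have c: "clause_true \<alpha> (neg u @ [l]) \<longleftrightarrow> \<not> aval \<alpha> u \<or> \<alpha> (fst l) = snd l"
  unfolding clause_neg by (simp add: clause_true_def case_prod_beta)
 have a: "aval \<alpha> (u @ [l]) \<longleftrightarrow> aval \<alpha> u \<and> \<alpha> (fst l) = snd l" by (auto simp: aval_def)
 have o: "unsat \<alpha> [C] = of_bool (\<not> clause_true \<alpha> C)" for C by (simp add: unsat_def)
 show ?case unfolding e unsat_append snoc o c a by auto
qed

lemma unsat_slot:
 "unsat \<alpha> (slot_cnf (Gs, a)) = (length (filter (aval \<alpha>) Gs))\<^sup>2 + 2 * a * (length Gs - length (filter (aval \<alpha>) Gs))"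
proof -
 let ?c = "length (filter (aval \<alpha>) Gs)"
 have 1: "unsat \<alpha> (map (%v. neg u @ neg v) Gs) = (if aval \<alpha> u then ?c else 0)" for u
 proof -
  have nv: "clause_true \<alpha> (neg v) \<longleftrightarrow> \<not> aval \<alpha> v" for v
   using clause_neg[of \<alpha> v "[]"] unfolding append_Nil2 by (simp add: clause_true_def[of _ "[]"])
  show ?thesis by (simp add: unsat_def filter_map comp_def clause_neg nv)
 qed
 have "unsat \<alpha> (concat (map (%u. map (%v. neg u @ neg v) Gs) Gs')) = length (filter (aval \<alpha>) Gs') * ?c" for Gs'
  by (induction Gs') (simp_all add: unsat_append 1)
 from this[of Gs] have 2: "unsat \<alpha> (concat (map (%u. map (%v. neg u @ neg v) Gs) Gs)) = ?c * ?c" .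
 have 3: "unsat \<alpha> (concat (map rw Gs')) = length Gs' - length (filter (aval \<alpha>) Gs')" for Gs'
 proof (induction Gs')
  case (Cons u Gs')
  have "length (filter (aval \<alpha>) Gs') \<le> length Gs'" by simp
  then show ?case using Cons by (auto simp: unsat_append unsat_rw Suc_diff_le)
 qed (simp add: unsat_def)
 have 4: "unsat \<alpha> (concat (replicate k X)) = k * unsat \<alpha> X" for k X
  by (induction k) (simp_all add: unsat_append)
 show ?thesis unfolding slot_cnf_def fst_conv snd_conv unsat_append 2 4 3 by (simp add: power2_eq_square)
qed

text \<open>The two sides differ by the square of \<open>c - a\<close>.\<close>

lemma slot_arith:
 fixes a c s :: nat
 assumes "a \<le> s" "c \<le> s"
 shows "a * (2 * s - a) \<le> c\<^sup>2 + 2 * a * (s - c)" "c\<^sup>2 + 2 * a * (s - c) = a * (2 * s - a) \<longleftrightarrow> c = a"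
proof -
 have e: "int (c\<^sup>2 + 2 * a * (s - c)) = int (a * (2 * s - a)) + (int c - int a)\<^sup>2"
 proof -
  obtain d where d: "s = c + d" using assms(2) le_Suc_ex by blast
  obtain r where r: "s = a + r" using assms(1) le_Suc_ex by blast
  have 1: "2 * s - a = s + r" "s - c = d" using d r by simp_all
  have 2: "int d = int s - int c" "int r = int s - int a" using d r by simp_all
  show ?thesis unfolding 1 of_nat_add of_nat_mult of_nat_power 2 by (simp add: power2_eq_square algebra_simps)
 qed
 have "int (a * (2 * s - a)) \<le> int (c\<^sup>2 + 2 * a * (s - c))" unfolding e by simp
 then show "a * (2 * s - a) \<le> c\<^sup>2 + 2 * a * (s - c)" by linarith
 have "c\<^sup>2 + 2 * a * (s - c) = a * (2 * s - a) \<longleftrightarrow> int (c\<^sup>2 + 2 * a * (s - c)) = int (a * (2 * s - a))" by linarith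
 also have "\<dots> \<longleftrightarrow> c = a" unfolding e by simp
 finally show "c\<^sup>2 + 2 * a * (s - c) = a * (2 * s - a) \<longleftrightarrow> c = a" .
qed

lemma unsat_slots:
 assumes "\<And>p. p \<in> set S ==> snd p \<le> length (fst p)"
 shows "slots_loss S \<le> unsat \<alpha> (slots_cnf S)"
  "unsat \<alpha> (slots_cnf S) = slots_loss S \<longleftrightarrow> (\<forall>p\<in>set S. length (filter (aval \<alpha>) (fst p)) = snd p)"
proof -
 have 0: "unsat \<alpha> [[], []] = 2" by (simp add: unsat_def clause_true_def)
 define A where "A = (%p :: literal list list \<times> nat. snd p * (2 * length (fst p) - snd p))"
 define U where "U = (%p. unsat \<alpha> (slot_cnf p))"
 have l: "slots_loss S = sum_list (map A S) + 2"
  by (simp add: slots_loss_def length_concat comp_def A_def)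
 have u: "unsat \<alpha> (slots_cnf S) = sum_list (map U S) + 2"
  unfolding slots_cnf_def unsat_append 0 unsat_concat U_def by (simp add: comp_def)
 have 1: "A p \<le> U p" "U p = A p \<longleftrightarrow> length (filter (aval \<alpha>) (fst p)) = snd p" if "p \<in> set S" for p
  using slot_arith[of "snd p" "length (fst p)" "length (filter (aval \<alpha>) (fst p))"] assms[OF that]
   unsat_slot[of \<alpha> "fst p" "snd p"] by (auto simp: A_def U_def)
 have "sum_list (map A S) \<le> sum_list (map U S) \<and> (sum_list (map U S) = sum_list (map A S) \<longleftrightarrow> (\<forall>p\<in>set S. U p = A p))"
  using 1(1)
 proof (induction S)
  case (Cons p S)
  have "A p \<le> U p" using Cons.prems by auto
  moreover have "sum_list (map A S) \<le> sum_list (map U S) \<and> (sum_list (map U S) = sum_list (map A S) \<longleftrightarrow> (\<forall>p\<in>set S. U p = A p))"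
   using Cons by auto
  ultimately show ?case by auto
 qed simp
 then show "slots_loss S \<le> unsat \<alpha> (slots_cnf S)"
  "unsat \<alpha> (slots_cnf S) = slots_loss S \<longleftrightarrow> (\<forall>p\<in>set S. length (filter (aval \<alpha>) (fst p)) = snd p)"
  using 1(2) by (auto simp: l u)
qed

lemma max_sat_unsat:
 assumes "\<And>\<alpha>. k \<le> unsat \<alpha> F"
 shows "max_sat F = length F - k \<longleftrightarrow> (\<exists>\<alpha>. unsat \<alpha> F = k)"
proof -
 have e: "length (filter (clause_true \<alpha>) F) = length F - unsat \<alpha> F" "unsat \<alpha> F \<le> length F" for \<alpha>
  using sum_length_filter_compl[of "clause_true \<alpha>" F] by (auto simp: unsat_def)
 let ?R = "range (%\<alpha>. length (filter (clause_true \<alpha>) F))"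
 have fin: "finite ?R" by (rule finite_subset[of _ "{..length F}"]) auto
 have le: "length (filter (clause_true \<alpha>) F) \<le> length F - k" for \<alpha> using e[of \<alpha>] assms[of \<alpha>] by simp
 have "max_sat F \<in> ?R" unfolding max_sat_def using fin by (intro Max_in) auto
 then obtain \<alpha> where \<alpha>: "max_sat F = length F - unsat \<alpha> F" using e by auto
 show ?thesis
 proof
  assume "max_sat F = length F - k"
  then have "unsat \<alpha> F = k" using \<alpha> e(2)[of \<alpha>] assms[of \<alpha>] by linarith
  then show "\<exists>\<alpha>. unsat \<alpha> F = k" by blast
 next
  assume "\<exists>\<alpha>. unsat \<alpha> F = k"
  then obtain \<beta> where "unsat \<beta> F = k" by blast
  then have "length F - k \<in> ?R" using e(1)[of \<beta>] by (metis rangeI)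
  moreover have "x \<le> length F - k" if "x \<in> ?R" for x using that le by auto
  ultimately show "max_sat F = length F - k" unfolding max_sat_def using fin by (intro Max_eqI) auto
 qed
qed

lemma max_sat_slots:
 assumes "\<And>p. p \<in> set S ==> snd p \<le> length (fst p)"
 shows "max_sat (slots_cnf S) = length (slots_cnf S) - slots_loss S \<longleftrightarrow>
  (\<exists>\<alpha>. \<forall>p\<in>set S. length (filter (aval \<alpha>) (fst p)) = snd p)"
 using max_sat_unsat[of "slots_loss S" "slots_cnf S"] unsat_slots[OF assms] by blast

section \<open>Violated families as MAX-SAT questions\<close>

definition choices :: "gate list \<times> bits => pattern \<times> bool => (literal list list \<times> nat) list" where
 "choices D l = (let Gs = rgates (fst D) (fst l) in
   map (%a. (Gs, a)) (filter (%a. \<not> (tnth (snd D) a = snd l)) [0..<Suc (length Gs)]))"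

text \<open>A family with fewer than five literals is filled up with the slot
  \<open>([], 0)\<close>, which every assignment meets. With five slots the number of tuples stays
  polynomial in the number of gates.\<close>

definition pick :: "gate list \<times> bits => family => nat => (literal list list \<times> nat) list" where
 "pick D fam k = (case drop k fam of [] => [([], 0)] | l # _ => choices D l)"

definition tuples :: "gate list \<times> bits => family => (literal list list \<times> nat) list list" where
 "tuples D fam = concat (map (%s0. concat (map (%s1. concat (map (%s2. concat (map (%s3. map (%s4.
   [s0, s1, s2, s3, s4]) (pick D fam 4)) (pick D fam 3))) (pick D fam 2))) (pick D fam 1))) (pick D fam 0))"

lemma in_tuples: "S \<in> set (tuples D fam) \<longleftrightarrow> (\<exists>s0\<in>set (pick D fam 0). \<exists>s1\<in>set (pick D fam 1).
  \<exists>s2\<in>set (pick D fam 2). \<exists>s3\<in>set (pick D fam 3). \<exists>s4\<in>set (pick D fam 4). S = [s0, s1, s2, s3, s4])"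
 unfolding tuples_def by (simp add: image_iff del: One_nat_def)

lemma tuples_pick: "S \<in> set (tuples D fam) ==> p \<in> set S ==> \<exists>k. p \<in> set (pick D fam k)"
 unfolding tuples_def by auto

lemma tuples_bound: "S \<in> set (tuples D fam) ==> p \<in> set S ==> snd p \<le> length (fst p)"
proof -
 have c: "snd p \<le> length (fst p)" if "p \<in> set (choices D l)" for p l
  using that by (auto simp: choices_def Let_def simp del: upt_Suc)
 have "snd p \<le> length (fst p)" if "p \<in> set (pick D fam k)" for p k
  using that c by (auto simp: pick_def split: list.splits)
 then show "S \<in> set (tuples D fam) ==> p \<in> set S ==> snd p \<le> length (fst p)"
  using tuples_pick by blast
qed

lemma aval_uval:
 "(\<And>l. l \<in> set u ==> fst l < L) ==> aval \<alpha> u \<longleftrightarrow> uval (map \<alpha> [0..<L]) u"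
 by (auto simp: aval_def uval_def)

lemma lits_bound: "length g = L ==> l \<in> set (lits g \<pi>) ==> fst l < L"
 by (auto simp: lits_def dest!: set_zip_rightD)

text \<open>A family fails at \<open>y\<close> iff all its literals fail, that is, iff the counts of
  true gates at \<open>y\<close> form one of the tuples. By \<open>max_sat_slots\<close> the
  existence of such a \<open>y\<close> shows in the value of MAX-SAT, because only an exact hit in
  all slots reaches the minimal loss.\<close>

theorem fam_ok_tuples:
 assumes g: "\<And>g. g \<in> set (fst D) ==> length g = L" and fam: "length fam \<le> 5" "\<And>l. l \<in> set fam ==> length (fst l) = L"
 shows "fam_ok (deval D) L fam \<longleftrightarrow>
  (\<forall>S\<in>set (tuples D fam). max_sat (slots_cnf S) \<noteq> length (slots_cnf S) - slots_loss S)"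
proof -
 let ?cnt = "%y l. length (filter (uval y) (rgates (fst D) (fst l)))"
 have dv: "deval D (inst (fst l) y) = tnth (snd D) (?cnt y l)" if "l \<in> set fam" "y \<in> rows L" for l y
  using count_inst[OF g fam(2)[OF that(1)]] that(2) by (simp add: deval_def rows_def)
 have rb: "fst m < L" if um: "u \<in> set (rgates (fst D) \<pi>)" "m \<in> set u" for u m \<pi>
 proof -
  obtain g' where g': "g' \<in> set (fst D)" "u = lits g' \<pi>" using um(1) by (auto simp: rgates_def)
  show ?thesis using lits_bound[OF g[OF g'(1)]] um(2) g'(2) by blast
 qed
 \<comment> \<open>Assignments of all variables may be replaced by rows, since literals only mention
   positions below \<open>L\<close>.\<close>
 have alpha: "(\<exists>\<alpha>. \<forall>p\<in>set S. length (filter (aval \<alpha>) (fst p)) = snd p) \<longleftrightarrow>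
   (\<exists>y\<in>rows L. \<forall>p\<in>set S. length (filter (uval y) (fst p)) = snd p)"
  if S: "\<And>p. p \<in> set S ==> fst p = [] \<or> (\<exists>\<pi>. fst p = rgates (fst D) \<pi>)" for S :: "(literal list list \<times> nat) list"
 proof -
  have eq: "filter (aval \<alpha>) (fst p) = filter (uval (map \<alpha> [0..<L])) (fst p)" if pS: "p \<in> set S" for p \<alpha>
  proof (rule filter_cong[OF refl])
   fix u assume "u \<in> set (fst p)"
   then obtain \<pi> where "u \<in> set (rgates (fst D) \<pi>)" using S[OF pS] by auto
   then show "aval \<alpha> u = uval (map \<alpha> [0..<L]) u" using rb by (intro aval_uval) blast
  qed
  show ?thesis
  proof
   assume "\<exists>\<alpha>. \<forall>p\<in>set S. length (filter (aval \<alpha>) (fst p)) = snd p"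
   then obtain \<alpha> where "\<forall>p\<in>set S. length (filter (aval \<alpha>) (fst p)) = snd p" by blast
   then have "\<forall>p\<in>set S. length (filter (uval (map \<alpha> [0..<L])) (fst p)) = snd p" using eq[of _ \<alpha>] by simp
   moreover have "map \<alpha> [0..<L] \<in> rows L" by (simp add: rows_def)
   ultimately show "\<exists>y\<in>rows L. \<forall>p\<in>set S. length (filter (uval y) (fst p)) = snd p" by blast
  next
   assume "\<exists>y\<in>rows L. \<forall>p\<in>set S. length (filter (uval y) (fst p)) = snd p"
   then obtain y where y: "y \<in> rows L" "\<forall>p\<in>set S. length (filter (uval y) (fst p)) = snd p" by blast
   have "map ((!) y) [0..<L] = y" using y(1) by (intro nth_equalityI) (auto simp: rows_def)
   then have "\<forall>p\<in>set S. length (filter (aval ((!) y)) (fst p)) = snd p" using eq[of _ "(!) y"] y(2) by simp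
   then show "\<exists>\<alpha>. \<forall>p\<in>set S. length (filter (aval \<alpha>) (fst p)) = snd p" by blast
  qed
 qed
 have pickS: "fst p = [] \<or> (\<exists>\<pi>. fst p = rgates (fst D) \<pi>)" if "p \<in> set (pick D fam k)" for p k
  using that by (auto simp: pick_def choices_def Let_def split: list.splits)
 have tS: "fst p = [] \<or> (\<exists>\<pi>. fst p = rgates (fst D) \<pi>)" if "S \<in> set (tuples D fam)" "p \<in> set S" for S p
  using tuples_pick[OF that] pickS by blast
 have pk: "p \<in> set (pick D fam k) \<and> length (filter (uval y) (fst p)) = snd p \<longleftrightarrow>
   (if k < length fam then p = (rgates (fst D) (fst (fam ! k)), ?cnt y (fam ! k)) \<and> deval D (inst (fst (fam ! k)) y) \<noteq> snd (fam ! k) else p = ([], 0))"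
  if y: "y \<in> rows L" for p k y
 proof (cases "k < length fam")
  case True
  then have d: "drop k fam = fam ! k # drop (Suc k) fam" by (simp add: Cons_nth_drop_Suc)
  have "?cnt y (fam ! k) < Suc (length (rgates (fst D) (fst (fam ! k))))" by (simp add: le_imp_less_Suc)
  then show ?thesis using True dv[OF nth_mem[OF True] y] unfolding pick_def d
   by (cases p) (auto simp: choices_def Let_def simp del: upt_Suc)
 next
  case False
  then show ?thesis by (cases p) (auto simp: pick_def)
 qed
 have "(\<exists>S\<in>set (tuples D fam). \<exists>y\<in>rows L. \<forall>p\<in>set S. length (filter (uval y) (fst p)) = snd p) \<longleftrightarrow>
   (\<exists>y\<in>rows L. \<forall>k<5. \<exists>p. p \<in> set (pick D fam k) \<and> length (filter (uval y) (fst p)) = snd p)"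
  (is "?A \<longleftrightarrow> ?B")
 proof
  assume ?A
  then obtain s0 s1 s2 s3 s4 y where s: "s0 \<in> set (pick D fam 0)" "s1 \<in> set (pick D fam 1)" "s2 \<in> set (pick D fam 2)"
   "s3 \<in> set (pick D fam 3)" "s4 \<in> set (pick D fam 4)" "y \<in> rows L"
   "\<forall>p\<in>set [s0, s1, s2, s3, s4]. length (filter (uval y) (fst p)) = snd p"
   unfolding tuples_def by (auto simp del: One_nat_def)
  have "\<exists>p. p \<in> set (pick D fam k) \<and> length (filter (uval y) (fst p)) = snd p" if "k < 5" for k
  proof -
   have "k = 0 \<or> k = 1 \<or> k = 2 \<or> k = 3 \<or> k = 4" using that by auto
   moreover have "length (filter (uval y) (fst s0)) = snd s0" "length (filter (uval y) (fst s1)) = snd s1"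
    "length (filter (uval y) (fst s2)) = snd s2" "length (filter (uval y) (fst s3)) = snd s3"
    "length (filter (uval y) (fst s4)) = snd s4" using s(7) by simp_all
   ultimately show ?thesis using s(1-5) by blast
  qed
  then show ?B using s(6) by blast
 next
  assume ?B
  then obtain y f where y: "y \<in> rows L" and f: "\<forall>k<5. f k \<in> set (pick D fam k) \<and> length (filter (uval y) (fst (f k))) = snd (f k)"
   by metis
  have "[f 0, f 1, f 2, f 3, f 4] \<in> set (tuples D fam)"
  proof -
   have h: "f 0 \<in> set (pick D fam 0)" "f 1 \<in> set (pick D fam 1)" "f 2 \<in> set (pick D fam 2)"
    "f 3 \<in> set (pick D fam 3)" "f 4 \<in> set (pick D fam 4)" using f by simp_all
   show ?thesis unfolding in_tuples
    by (rule bexI[OF bexI[OF bexI[OF bexI[OF bexI[OF refl h(5)] h(4)] h(3)] h(2)] h(1)])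
  qed
  moreover have "\<forall>p\<in>set [f 0, f 1, f 2, f 3, f 4]. length (filter (uval y) (fst p)) = snd p" using f by simp
  ultimately show ?A using y by blast
 qed
 also have "?B \<longleftrightarrow> (\<exists>y\<in>rows L. \<forall>k<length fam. deval D (inst (fst (fam ! k)) y) \<noteq> snd (fam ! k))"
  using pk fam(1) by (auto split: if_splits) (meson order_less_le_trans, metis)
 also have "\<dots> \<longleftrightarrow> \<not> fam_ok (deval D) L fam"
 proof -
  have "(\<forall>k<length fam. deval D (inst (fst (fam ! k)) y) \<noteq> snd (fam ! k)) \<longleftrightarrow>
    \<not> (\<exists>l\<in>set fam. deval D (inst (fst l) y) = snd l)" for y
   by (metis in_set_conv_nth)
  then show ?thesis unfolding fam_ok_def by blast
 qed
 finally have "\<not> fam_ok (deval D) L fam \<longleftrightarrow> (\<exists>S\<in>set (tuples D fam). \<exists>y\<in>rows L. \<forall>p\<in>set S. length (filter (uval y) (fst p)) = snd p)" ..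
 moreover have "(\<exists>y\<in>rows L. \<forall>p\<in>set S. length (filter (uval y) (fst p)) = snd p) \<longleftrightarrow>
   max_sat (slots_cnf S) = length (slots_cnf S) - slots_loss S" if "S \<in> set (tuples D fam)" for S
  using alpha[OF tS[OF that]] max_sat_slots[OF tuples_bound[OF that]] by simp
 ultimately show ?thesis by blast
qed

section \<open>The stages as polynomial-time functions\<close>

lemma length_eqc: "cl \<in> set (eqc c a b) ==> length cl = length c + 2"
 by (auto simp: eqc_def)

lemma length_icl: "cl \<in> set (icl K l c) ==> length cl \<le> 5"
proof -
 have k: "cl \<in> set (keepc K l r) ==> length cl \<le> 5" for r by (auto simp: keepc_def dest!: length_eqc)
 have n: "cl \<in> set (nextc l) ==> length cl \<le> 5" by (auto simp: nextc_def)
 assume "cl \<in> set (icl K l c)"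
 then show ?thesis unfolding icl_def Let_def
  by (auto split: if_splits dest!: length_eqc k n)
qed

lemma length_groups:
 assumes "g \<in> set (groups K cs rej)" "cl \<in> set (snd g)"
 shows "length cl \<le> 5"
proof -
 have r: "cl \<in> set (rowc K rej) ==> length cl \<le> 5" unfolding rowc_def by (auto dest!: length_eqc)
 have n: "cl \<in> set (netc K i) ==> length cl \<le> 5" for i unfolding netc_def by (auto dest!: length_eqc)
 have z: "cl \<in> set (zeroc K) ==> length cl \<le> 5" unfolding zeroc_def by auto
 have i: "cl \<in> set (initc K) ==> length cl \<le> 5" unfolding initc_def by auto
 show ?thesis using assms r n z i length_icl unfolding groups_def by auto
qed

text \<open>The third claim is the decisive one: from position \<open>K\<close> on the patterns are
  constant. The formulas derived from them have only \<open>K\<close> variables, although the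
  circuits have \<open>K + n\<close> inputs.\<close>

lemma stage_csp_families:
 assumes F: "noask F" and K: "K \<ge> 1" and n: "4 * K + 3 * length as + 3 * length bs + flen F + 40 \<le> n"
  and fam: "fam \<in> set (stage_csp K n (map icode_of (fcode 0 F)) as bs)"
 shows "length fam \<le> 5" "l \<in> set fam ==> length (fst l) = K + n"
  "l \<in> set fam ==> K \<le> i ==> i < K + n ==> fst (fst l ! i)"
proof -
 define l0 where "l0 = length (loadert as bs)"
 define rej where "rej = l0 + flen F + 2"
 define Pg where "Pg = loadert as bs @ fcode l0 F @ [TJnil 0 rej]"
 note prog = stage_program[OF F, where as = as and bs = bs, folded l0_def, folded rej_def, folded Pg_def]
 have cs: "\<forall>c\<in>set (map icode_of Pg). regs4c (length Pg) c"
 proof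
  fix c' assume "c' \<in> set (map icode_of Pg)"
  then obtain c where c: "c \<in> set Pg" "c' = icode_of c" by auto
  show "regs4c (length Pg) c'" unfolding c(2)
   by (rule regs4c_icode) (use c(1) prog(4,5) in auto)
 qed
 obtain g sh cl where g: "g \<in> set (groups K (map icode_of Pg) rej)" "sh \<in> set (fst g)" "cl \<in> set (snd g)"
  "fam = mkfam n sh cl"
  using fam unfolding prog(3) csp_def by auto
 show "length fam \<le> 5" using length_groups[OF g(1,3)] by (simp add: g(4) mkfam_def)
 have w: "tag_weight (fst (snd c)) \<le> n" if "c \<in> set cl" for c
  using weight_groups[OF g(1,3) that cs] n prog(1,2) by (simp add: rej_def)
 have sh: "length (fst sh) = K" "length (snd sh) = K" using groups_shape[OF g(1) K g(2)] by auto
 {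
  assume "l \<in> set fam"
  then obtain c where c: "c \<in> set cl" "l = ((if fst c then snd sh else fst sh) @ cpat (tagc n (fst (snd c))), snd (snd c))"
   unfolding g(4) mkfam_def by auto
  show "length (fst l) = K + n" using sh w[OF c(1)] by (simp add: c(2) length_tagc)
  assume "K \<le> i" "i < K + n"
  then show "fst (fst l ! i)" using sh w[OF c(1)] by (simp add: c(2) nth_append cpat_def length_tagc)
 }
qed

text \<open>Two bits for each position of each of the \<open>s\<close> gates, and the values of the
  symmetric gate at the counts from 0 to \<open>s\<close>.\<close>

definition lenD :: "nat => nat => nat" where
 "lenD s L = s * (2 * L) + s + 1"

definition decodeD :: "nat => nat => bits => gate list \<times> bits" where
 "decodeD s L b = (map (%i. zip (take L (drop (2 * L * i) b)) (take L (drop (2 * L * i + L) b))) [0..<s], drop (2 * L * s) b)"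

definition struct :: "nat => nat => gate list \<times> bits => bool" where
 "struct s L D \<longleftrightarrow> length (fst D) = s \<and> (\<forall>g\<in>set (fst D). length g = L) \<and> length (snd D) = s + 1"

lemma struct_decodeD: "length b = lenD s L ==> struct s L (decodeD s L b)"
proof -
 assume b: "length b = lenD s L"
 have "length (zip (take L (drop (2 * L * i) b)) (take L (drop (2 * L * i + L) b))) = L" if "i < s" for i
 proof -
  have "2 * L * Suc i \<le> 2 * L * s" using that by (intro mult_le_mono2) simp
  then show ?thesis using b by (simp add: lenD_def mult_ac)
 qed
 then have "\<forall>g\<in>set (fst (decodeD s L b)). length g = L"
  unfolding decodeD_def fst_conv set_map set_upt by (intro ballI) (elim imageE, simp only: atLeastLessThan_iff)
 moreover have "length (snd (decodeD s L b)) = s + 1" using b by (simp add: decodeD_def lenD_def mult_ac)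
 ultimately show ?thesis by (simp add: struct_def) (simp add: decodeD_def)
qed

text \<open>Guessing or enumerating strings of length \<open>lenD s L\<close> therefore covers all
  circuits of this shape.\<close>

lemma decodeD_surj: "struct s L D ==> \<exists>b. length b = lenD s L \<and> decodeD s L b = D"
proof -
 assume D: "struct s L D"
 let ?e = "%g. map fst g @ map snd g :: bits"
 have 1: "length (concat (map ?e gs)) = 2 * L * length gs" if "\<forall>g\<in>set gs. length g = L" for gs :: "gate list"
  using that by (induction gs) auto
 have 2: "zip (take L (drop (2 * L * i) (concat (map ?e gs) @ r))) (take L (drop (2 * L * i + L) (concat (map ?e gs) @ r))) = gs ! i"
  if "\<forall>g\<in>set gs. length g = L" "i < length gs" for gs :: "gate list" and i r
  using that
 proof (induction gs arbitrary: i)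
  case (Cons g gs)
  show ?case
  proof (cases i)
   case 0
   then show ?thesis using Cons.prems by (simp add: zip_map_fst_snd)
  next
   case (Suc j)
   have d: "drop (2 * L * i + k) (concat (map ?e (g # gs)) @ r) = drop (2 * L * j + k) (concat (map ?e gs) @ r)" for k
   proof -
    have 1: "2 * L * i + k = length (?e g) + (2 * L * j + k)" using Cons.prems Suc by simp
    have 2: "concat (map ?e (g # gs)) @ r = ?e g @ (concat (map ?e gs) @ r)" by simp
    have 3: "drop (length a + m) (a @ b) = drop m b" for m and a b :: bits by simp
    show ?thesis unfolding 1 2 by (rule 3)
   qed
   show ?thesis using Cons.IH[of j] Cons.prems Suc unfolding d[of L] d[of 0, unfolded add_0_right] by simp
  qed
 qed simp
 let ?b = "concat (map ?e (fst D)) @ snd D"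
 have "length ?b = lenD s L" using D 1[of "fst D"] by (simp add: struct_def lenD_def mult_ac)
 moreover have "decodeD s L ?b = D"
 proof -
  have "map (%i. zip (take L (drop (2 * L * i) ?b)) (take L (drop (2 * L * i + L) ?b))) [0..<s] = fst D"
   using 2[of "fst D" _ "snd D"] D by (intro nth_equalityI) (auto simp: struct_def)
  moreover have "drop (2 * L * s) ?b = snd D" using 1[of "fst D"] D by (simp add: struct_def)
  ultimately show ?thesis unfolding decodeD_def by (metis prod.collapse)
 qed
 ultimately show ?thesis by blast
qed

text \<open>The word \<open>w\<close> is hard-wired into the gate. A literal that contradicts
  \<open>w\<close>, or two opposite literals, turn into the mark for a gate that is always
  false.\<close>

definition conv_gate :: "bits => nat => literal list => gate" where
 "conv_gate w L G = map (%p. if (\<exists>(i, b)\<in>set G. i < length w \<and> w ! i \<noteq> b) \<or>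
    ((length w + p, True) \<in> set G \<and> (length w + p, False) \<in> set G) then (False, True)
   else if (length w + p, True) \<in> set G then (True, True)
   else if (length w + p, False) \<in> set G then (True, False) else (False, False)) [0..<L]"

lemma geval_conv:
 assumes "length x = L" "L \<ge> 1" "\<forall>(i, b)\<in>set G. i < length w + L"
 shows "geval (conv_gate w L G) x \<longleftrightarrow> (\<forall>(i, b)\<in>set G. (w @ x) ! i = b)"
proof -
 let ?bad = "\<exists>(i, b)\<in>set G. i < length w \<and> w ! i \<noteq> b"
 let ?m = "%p b. (length w + p, b) \<in> set G"
 have "geval (conv_gate w L G) x \<longleftrightarrow> (\<forall>p<L. \<not> ?bad \<and> (\<forall>b. ?m p b --> x ! p = b))"
 proof -
  have z: "zip (conv_gate w L G) x = map (%p. (conv_gate w L G ! p, x ! p)) [0..<L]"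
   using assms(1) by (intro nth_equalityI) (auto simp: conv_gate_def)
  have st: "(if fst (conv_gate w L G ! p) then snd (conv_gate w L G ! p) = x ! p else \<not> snd (conv_gate w L G ! p)) \<longleftrightarrow>
    \<not> ?bad \<and> (\<forall>b. ?m p b --> x ! p = b)" if "p < L" for p
   using that unfolding conv_gate_def
   by (cases ?bad; cases "?m p True"; cases "?m p False") (simp_all add: all_bool_eq)
  have "geval (conv_gate w L G) x \<longleftrightarrow>
    (\<forall>p<L. if fst (conv_gate w L G ! p) then snd (conv_gate w L G ! p) = x ! p else \<not> snd (conv_gate w L G ! p))"
   unfolding geval_def z by (simp add: atLeast0LessThan lessThan_def del: if_split)
  then show ?thesis using st by (simp only: cong: imp_cong)
 qed
 also have "\<dots> \<longleftrightarrow> \<not> ?bad \<and> (\<forall>p<L. \<forall>b. ?m p b --> x ! p = b)" using assms(2) by auto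
 also have "\<dots> \<longleftrightarrow> (\<forall>(i, b)\<in>set G. (w @ x) ! i = b)"
 proof
  assume a: "\<not> ?bad \<and> (\<forall>p<L. \<forall>b. ?m p b --> x ! p = b)"
  show "\<forall>(i, b)\<in>set G. (w @ x) ! i = b"
  proof clarify
   fix i b assume ib: "(i, b) \<in> set G"
   show "(w @ x) ! i = b"
   proof (cases "i < length w")
    case True
    then show ?thesis using a ib by (auto simp: nth_append)
   next
    case False
    then have "?m (i - length w) b" "i - length w < L" using ib assms(3) by auto
    then show ?thesis using a False by (auto simp: nth_append)
   qed
  qed
 next
  assume a: "\<forall>(i, b)\<in>set G. (w @ x) ! i = b"
  then have "\<not> ?bad" by (force simp: nth_append)
  moreover have "x ! p = b" if "?m p b" for p b using bspec[OF a that] by (simp add: nth_append)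
  ultimately show "\<not> ?bad \<and> (\<forall>p<L. \<forall>b. ?m p b --> x ! p = b)" by blast
 qed
 finally show ?thesis .
qed

text \<open>Gates that are always false fill the circuit up to exactly \<open>s\<close> gates and
  leave the count unchanged. They need at least one position to carry their mark.\<close>

lemma circuit_struct:
 assumes c: "circuit_on (length w + L) (SymAnd f Gs)" and L: "L \<ge> 1" and s: "length Gs \<le> s"
 shows "\<exists>D. struct s L D \<and> (\<forall>x. length x = L --> deval D x = circuit_eval (SymAnd f Gs) (w @ x))"
proof -
 define gs where "gs = map (conv_gate w L) Gs @ replicate (s - length Gs) (replicate L (False, True))"
 define D where "D = (gs, map f [0..<s + 1])"
 have "struct s L D" using s by (auto simp: struct_def D_def gs_def conv_gate_def)
 moreover have "deval D x = circuit_eval (SymAnd f Gs) (w @ x)" if x: "length x = L" for x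
 proof -
  have d: "\<not> geval (replicate L (False, True)) x"
   unfolding geval_def using x L by (cases L; cases x) auto
  have "length (filter (%g. geval g x) (map (conv_gate w L) Gs)) = (\<Sum>G\<leftarrow>Gs. of_bool (\<forall>(i, b)\<in>set G. (w @ x) ! i = b))"
   using c
  proof (induction Gs)
   case (Cons G Gs)
   have "geval (conv_gate w L G) x \<longleftrightarrow> (\<forall>(i, b)\<in>set G. (w @ x) ! i = b)"
    using Cons.prems by (intro geval_conv[OF x L]) auto
   then show ?case using Cons by simp
  qed simp
  moreover have "filter (%g. geval g x) gs = filter (%g. geval g x) (map (conv_gate w L) Gs)"
   using d by (auto simp: gs_def filter_empty_conv)
  ultimately have e: "length (filter (%g. geval g x) gs) = (\<Sum>G\<leftarrow>Gs. of_bool (\<forall>(i, b)\<in>set G. (w @ x) ! i = b))" by simp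
  have "length gs = s" using s by (simp add: gs_def)
  then have "length (filter (%g. geval g x) gs) < s + 1"
   using length_filter_le[of "%g. geval g x" gs] by linarith
  then show ?thesis unfolding deval_def D_def by (simp add: tnth_nth e del: upt_Suc)
 qed
 ultimately show ?thesis by blast
qed

section \<open>The encodings and constraint systems in polynomial time\<close>

lemma nb_bits: "nb n = map (bit n) [0..<floorlog 2 n]"
proof (induction n rule: nb.induct)
 case (1 n)
 show ?case
 proof (cases "n = 0")
  case False
  have l: "floorlog 2 n = Suc (floorlog 2 (n div 2))"
   using False by (subst compute_floorlog) simp
  have "map (bit n) [0..<floorlog 2 n] = bit n 0 # map (%j. bit n (Suc j)) [0..<floorlog 2 (n div 2)]"
   unfolding l by (simp add: upt_conv_Cons map_Suc_upt[symmetric] comp_def del: upt_Suc)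
  also have "\<dots> = odd n # map (bit (n div 2)) [0..<floorlog 2 (n div 2)]" by (simp add: bit_0 bit_Suc)
  finally show ?thesis using 1 False by (subst nb.simps) simp
 qed (simp add: floorlog_def)
qed

lemma nat_code_nb: "nat_code n = concat (map (%b. [b, b]) (nb n)) @ [False, True]"
 by (simp add: nat_code_def nb_bits comp_def)

lemma poly_nat_code [poly_intros]: "poly f ==> poly (%x. nat_code (f x))"
 unfolding nat_code_nb by (intro poly_intros)

lemma poly_clause_code [poly_intros]: "poly f ==> poly (%x. clause_code (f x))"
 unfolding clause_code_def case_prod_beta by (intro poly_intros)

lemma poly_cnf_code [poly_intros]: "poly f ==> poly g ==> poly (%x. cnf_code (f x) (g x))"
 unfolding cnf_code_def by (intro poly_intros)

lemma poly_tnth [poly_intros]: "poly f ==> poly g ==> poly (%x. tnth (f x) (g x))"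
 unfolding tnth_def by (intro poly_intros)

lemma poly_dead [poly_intros]: "poly f ==> poly g ==> poly (%x. dead (f x) (g x))"
 unfolding dead_def by (intro poly_intros)

lemma poly_lits [poly_intros]: "poly f ==> poly g ==> poly (%x. lits (f x) (g x))"
 unfolding lits_def by (intro poly_intros)

lemma poly_rgates [poly_intros]:
 assumes "poly f" "poly g" shows "poly (%x. rgates (f x) (g x))"
 by (rule poly2[OF _ assms]) (unfold rgates_def, intro poly_intros)

lemma poly_neg [poly_intros]: "poly f ==> poly (%x. neg (f x))"
 unfolding neg_def by (intro poly_intros)

lemma poly_rw [poly_intros]: assumes "poly f" shows "poly (%x. rw (f x))"
 by (rule poly_comp[OF _ assms]) (unfold rw_def, intro poly_intros)

lemma poly_slot_cnf [poly_intros]: assumes "poly f" shows "poly (%x. slot_cnf (f x))"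
 by (rule poly_comp[OF _ assms]) (unfold slot_cnf_def, intro poly_intros)

lemma poly_slots_cnf [poly_intros]: "poly f ==> poly (%x. slots_cnf (f x))"
 unfolding slots_cnf_def by (intro poly_intros)

lemma poly_slots_loss [poly_intros]: "poly f ==> poly (%x. slots_loss (f x))"
 unfolding slots_loss_def by (intro poly_intros)

lemma poly_choices [poly_intros]: assumes "poly f" "poly g" shows "poly (%x. choices (f x) (g x))"
 by (rule poly2[OF _ assms]) (unfold choices_def Let_def, intro poly_intros)

lemma poly_pick [poly_intros]: assumes "poly f" "poly g" "poly h" shows "poly (%x. pick (f x) (g x) (h x))"
 by (rule poly3[OF _ assms]) (unfold pick_def, intro poly_intros)

lemma poly_tuples [poly_intros]: assumes "poly f" "poly g" shows "poly (%x. tuples (f x) (g x))"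
 by (rule poly2[OF _ assms]) (unfold tuples_def, intro poly_intros)

lemma poly_decodeD [poly_intros]: assumes "poly f" "poly g" "poly h" shows "poly (%x. decodeD (f x) (g x) (h x))"
 by (rule poly3[OF _ assms]) (unfold decodeD_def, intro poly_intros)

lemma poly_lenD [poly_intros]: "poly f ==> poly g ==> poly (%x. lenD (f x) (g x))"
 unfolding lenD_def by (simp, intro poly_intros)

lemma poly_eqc [poly_intros]: "poly f ==> poly g ==> poly h ==> poly (%x. eqc (f x) (g x) (h x))"
 unfolding eqc_def by (intro poly_intros)

lemma poly_tagc [poly_intros]: assumes "poly f" "poly g" shows "poly (%x. tagc (f x) (g x))"
 by (rule poly2[OF _ assms]) (unfold tagc_def Let_def, intro poly_intros)

lemma poly_cpat [poly_intros]: "poly f ==> poly (%x. cpat (f x))"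
 unfolding cpat_def by (intro poly_intros)

lemma poly_stars [poly_intros]: "poly f ==> poly (%x. stars (f x))"
 unfolding stars_def by (intro poly_intros)

lemma poly_mkfam [poly_intros]: assumes "poly f" "poly g" "poly h" shows "poly (%x. mkfam (f x) (g x) (h x))"
 by (rule poly3[OF _ assms]) (unfold mkfam_def, intro poly_intros)

lemma poly_rowc [poly_intros]: assumes "poly f" "poly g" shows "poly (%x. rowc (f x) (g x))"
 by (rule poly2[OF _ assms]) (unfold rowc_def, intro poly_intros)

lemma poly_netc [poly_intros]: assumes "poly f" "poly g" shows "poly (%x. netc (f x) (g x))"
 by (rule poly2[OF _ assms]) (unfold netc_def, intro poly_intros)

lemma poly_initc [poly_intros]: assumes "poly f" shows "poly (%x. initc (f x))"
 by (rule poly_comp[OF _ assms]) (unfold initc_def, intro poly_intros)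

lemma poly_zeroc [poly_intros]: "poly f ==> poly (%x. zeroc (f x))"
 unfolding zeroc_def by (intro poly_intros)

lemma poly_keepc [poly_intros]: assumes "poly f" "poly g" "poly h" shows "poly (%x. keepc (f x) (g x) (h x))"
 by (rule poly3[OF _ assms]) (unfold keepc_def, intro poly_intros)

lemma poly_nextc [poly_intros]: "poly f ==> poly (%x. nextc (f x))"
 unfolding nextc_def by (intro poly_intros)

lemma poly_icl [poly_intros]: assumes "poly f" "poly g" "poly h" shows "poly (%x. icl (f x) (g x) (h x))"
 by (rule poly3[OF _ assms]) (unfold icl_def Let_def, intro poly_intros)

lemma poly_bitpat [poly_intros]: "poly f ==> poly g ==> poly h ==> poly (%x. bitpat (f x) (g x) (h x))"
 unfolding bitpat_def by (intro poly_intros)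

lemma poly_shapes [poly_intros]:
 "poly b ==> poly (%x. constS (b x))" "poly f ==> poly (%x. allS (f x))"
 "poly f ==> poly g ==> poly h ==> poly (%x. bitS (f x) (g x) (h x))"
 "poly f ==> poly g ==> poly (%x. flipS (f x) (g x))"
 unfolding constS_def allS_def bitS_def flipS_def by (intro poly_intros; assumption)+

lemma poly_stepS [poly_intros]: assumes "poly f" shows "poly (%x. stepS (f x))"
 by (rule poly_comp[OF _ assms]) (unfold stepS_def, intro poly_intros)

lemma poly_groups [poly_intros]: assumes "poly f" "poly g" "poly h" shows "poly (%x. groups (f x) (g x) (h x))"
 by (rule poly3[OF _ assms]) (unfold groups_def, intro poly_intros)

lemma poly_csp [poly_intros]: assumes "poly f" "poly g" "poly h" "poly k" shows "poly (%x. csp (f x) (g x) (h x) (k x))"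
proof -
 have "poly (%p. csp (fst p) (fst (snd p)) (fst (snd (snd p))) (snd (snd (snd p))))"
  unfolding csp_def by (intro poly_intros)
 from poly_comp[OF this, of "%x. (f x, g x, h x, k x)"] show ?thesis using assms by (simp add: poly_pair)
qed

lemma poly_shiftc [poly_intros]: "poly f ==> poly g ==> poly (%x. shiftc (f x) (g x))"
 unfolding shiftc_def by (intro poly_intros)

lemma poly_ldbits [poly_intros]: assumes "poly f" "poly g" shows "poly (%x. ldbits (f x) (g x))"
 by (rule poly2[OF _ assms]) (unfold ldbits_def, intro poly_intros)

lemma poly_loader [poly_intros]: "poly f ==> poly g ==> poly (%x. loader (f x) (g x))"
 unfolding loader_def by (intro poly_intros)

lemma poly_fullc [poly_intros]: assumes "poly f" "poly g" "poly h" shows "poly (%x. fullc (f x) (g x) (h x))"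
 by (rule poly3[OF _ assms]) (unfold fullc_def Let_def, intro poly_intros)

lemma poly_stage_csp [poly_intros]: "poly f ==> poly g ==> poly h ==> poly k ==> poly l ==>
  poly (%x. stage_csp (f x) (g x) (h x) (k x) (l x))"
 unfolding stage_csp_def by (intro poly_intros)

section \<open>Tokens: a parameter and a program as one bit string\<close>

definition nums :: "bits => nat list" where
 "nums tk = rev (snd (foldl (%st b. if b then (Suc (fst st), snd st) else (0, fst st # snd st)) (0, []) tk))"

definition unums :: "nat list => bits" where
 "unums ns = concat (map (%n. replicate n True @ [False]) ns)"

lemma nums_unums: "nums (unums ns) = ns"
proof -
 let ?f = "%st b. if b then (Suc (fst st), snd st) else (0, fst st # snd st)"
 have 1: "foldl ?f (a, l) (replicate n True) = (a + n, l)" for a n l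
  by (induction n arbitrary: a) auto
 have "foldl ?f (0, l) (unums ns) = (0, rev ns @ l)" for l
  by (induction ns arbitrary: l) (auto simp: unums_def 1)
 from this[of "[]"] show ?thesis by (simp add: nums_def)
qed

lemma poly_nums [poly_intros]: assumes "poly f" shows "poly (%x. nums (f x))"
proof (rule poly_comp[OF _ assms])
 let ?f = "%st b. if b then (Suc (fst st), snd st) else (0, fst st # snd st)"
 have e: "es (foldl ?f (0, []) ys) \<le> 10 * length ys + 10" for ys
 proof (induction ys rule: rev_induct)
  case (snoc b ys)
  then show ?case by (cases "foldl ?f (0, []) ys") auto
 qed simp
 have "poly (%tk. foldl ?f (0, []) tk)"
 proof (rule poly_foldl[where B = "%x. 10 * length x + 10"])
  show "es (foldl ?f (0, []) ys) \<le> 10 * length x + 10" if "x = ys @ zs" for x ys zs :: bits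
   using e[of ys] that by simp
 qed (intro poly_intros pbound_intros pbound_length)+
 then show "poly nums" unfolding nums_def by (intro poly_intros)
qed

definition nnth :: "nat list => nat => nat" where
 "nnth l n = (case drop n l of [] => 0 | b # _ => b)"

lemma nnth_nth: "n < length l ==> nnth l n = l ! n"
 by (simp add: nnth_def Cons_nth_drop_Suc[symmetric])

lemma poly_nnth [poly_intros]: "poly f ==> poly g ==> poly (%x. nnth (f x) (g x))"
 unfolding nnth_def by (intro poly_intros)

definition quads :: "nat list => icode list" where
 "quads ns = map (%i. (nnth ns (4 * i), nnth ns (4 * i + 1), nnth ns (4 * i + 2), nnth ns (4 * i + 3)))
   (filter (%i. 4 * i + 3 < length ns) [0..<length ns])"

definition flat :: "icode list => nat list" where
 "flat e = concat (map (%c. [fst c, fst (snd c), fst (snd (snd c)), snd (snd (snd c))]) e)"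

lemma quads_flat: "quads (flat e) = e"
proof -
 have l: "length (flat e) = 4 * length e" for e by (induction e) (auto simp: flat_def)
 have n: "i < length e ==> flat e ! (4 * i) = fst (e ! i) \<and> flat e ! (4 * i + 1) = fst (snd (e ! i)) \<and>
   flat e ! (4 * i + 2) = fst (snd (snd (e ! i))) \<and> flat e ! (4 * i + 3) = snd (snd (snd (e ! i)))" for i
 proof (induction e arbitrary: i)
  case (Cons c e)
  show ?case
  proof (cases i)
   case 0
   then show ?thesis by (simp add: flat_def)
  next
   case (Suc j)
   have "flat (c # e) ! (4 * i + k) = flat e ! (4 * j + k)" for k by (simp add: flat_def Suc)
   from this[of 0] this[of 1] this[of 2] this[of 3] show ?thesis using Cons Suc by simp
  qed
 qed simp
 have f: "filter (%i. 4 * i + 3 < 4 * m) [0..<4 * m] = [0..<m]" for m :: nat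
 proof -
  have "[0..<4 * m] = [0..<m] @ [m..<4 * m]" using upt_add_eq_append[of 0 m "3 * m"] by simp
  moreover have "filter (%i. 4 * i + 3 < 4 * m) [m..<4 * m] = []" by (auto simp: filter_empty_conv)
  moreover have "filter (%i. 4 * i + 3 < 4 * m) [0..<m] = [0..<m]" by (auto simp: filter_id_conv)
  ultimately show ?thesis by simp
 qed
 have nn: "nnth (flat e) k = flat e ! k" if "k < 4 * length e" for k by (rule nnth_nth) (use that l in simp)
 show ?thesis unfolding quads_def l f
 proof (rule nth_equalityI)
  fix i assume "i < length (map (%i. (nnth (flat e) (4 * i), nnth (flat e) (4 * i + 1), nnth (flat e) (4 * i + 2), nnth (flat e) (4 * i + 3))) [0..<length e])"
  then have i: "i < length e" by simp
  then show "map (%i. (nnth (flat e) (4 * i), nnth (flat e) (4 * i + 1), nnth (flat e) (4 * i + 2), nnth (flat e) (4 * i + 3))) [0..<length e] ! i = e ! i"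
   using n[OF i] nn[of "4 * i"] nn[of "4 * i + 1"] nn[of "4 * i + 2"] nn[of "4 * i + 3"] by simp
 qed simp
qed

lemma poly_quads [poly_intros]: assumes "poly f" shows "poly (%x. quads (f x))"
 by (rule poly_comp[OF _ assms]) (unfold quads_def, intro poly_intros)

definition tkq :: "bits => nat" where "tkq tk = nnth (nums tk) 0"
definition tke :: "bits => icode list" where "tke tk = quads (tl (nums tk))"

text \<open>Carries the parameter \<open>q\<close> and the code of the verifier. The verifier
  receives it as an argument and thereby learns both.\<close>

definition token :: "nat => icode list => bits" where "token q e = unums (q # flat e)"

lemma token_simps [simp]: "tkq (token q e) = q" "tke (token q e) = e"
 by (simp_all add: tkq_def tke_def token_def nums_unums nnth_def quads_flat)

text \<open>The bound demanded by \<open>stage_csp_correct\<close>, where the second argument has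
  length \<open>K\<close> too; hence \<open>4 * K + 3 * K\<close>.\<close>

definition sn :: "bits => nat => nat" where
 "sn tk K = 7 * K + 3 * length tk + length (tke tk) + 40"

text \<open>For positive \<open>q\<close> this is the floor of sqrt(K) / q, without real
  numbers.\<close>

definition sroot :: "nat => nat => nat" where
 "sroot q K = length (filter (%x. q * Suc x * (q * Suc x) \<le> K) [0..<K])"

text \<open>Equal to \<open>2 ^ x\<close> if \<open>U\<close> has at least that many elements. A
  power is not polynomial in a unary exponent, so \<open>U\<close> is passed along as a stock of
  sufficient size, and running times are measured in it.\<close>

definition sgates :: "tree list => nat => nat" where
 "sgates U x = length (filter (%i. length (nb i) \<le> x) [0..<length U])"

text \<open>The token is used twice: its code is the program to be encoded, and the token itself is
  the first argument of that program. This is the self-reference.\<close>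

definition stage :: "bits => bits => family list" where
 "stage tk w = stage_csp (length w) (sn tk (length w)) (tke tk) tk w"

text \<open>A start word is a block of ones closed by a zero, so its length can be recovered from
  any extension.\<close>

definition start :: "bits => nat" where
 "start w = Suc (length (filter (%i. \<forall>b\<in>set (take (Suc i) w). b) [0..<length w]))"

definition sD :: "tree list => bits => nat => nat" where
 "sD U tk K = lenD (sgates U (sroot (tkq tk) K)) (K + sn tk K)"

definition dD :: "tree list => bits => nat => bits => gate list \<times> bits" where
 "dD U tk K b = decodeD (sgates U (sroot (tkq tk) K)) (K + sn tk K) b"

definition vdiag :: "tree list => bits => bits => bool" where
 "vdiag U tk w \<longleftrightarrow> length w = start w + sD U tk (start w)"

definition vcount :: "tree list => bits => bits => nat" where
 "vcount U tk w = (if vdiag U tk w then 0 else 2 * sD U tk (Suc (length w)))"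

text \<open>Each job is a MAX-SAT instance together with the value, in binary, that would refute
  \<open>D\<close>.\<close>

definition jobs :: "bits => bits => gate list \<times> bits => (bits \<times> bits) list" where
 "jobs tk w D = concat (map (%fam. map (%S. (cnf_code (length w) (slots_cnf S),
   nb (length (slots_cnf S) - slots_loss S))) (tuples D fam)) (stage tk w))"

definition vjobs :: "tree list => bits => bits => bits => (bits \<times> bits) list" where
 "vjobs U tk w b = (if vdiag U tk w then jobs tk (take (start w) w) (dD U tk (start w) (drop (start w) w))
   else let s = sD U tk (Suc (length w)) in
    jobs tk (w @ [False]) (dD U tk (Suc (length w)) (take s b)) @
    jobs tk (w @ [True]) (dD U tk (Suc (length w)) (drop s b)))"

lemma poly_tkq [poly_intros]: "poly f ==> poly (%x. tkq (f x))"
 and poly_tke [poly_intros]: "poly f ==> poly (%x. tke (f x))"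
 unfolding tkq_def tke_def by (intro poly_intros; assumption)+

lemma poly_sn [poly_intros]: "poly f ==> poly g ==> poly (%x. sn (f x) (g x))"
 unfolding sn_def by (intro poly_intros)

lemma poly_sroot [poly_intros]: assumes "poly f" "poly g" shows "poly (%x. sroot (f x) (g x))"
 by (rule poly2[OF _ assms]) (unfold sroot_def, intro poly_intros)

lemma poly_sgates [poly_intros]: assumes "poly f" "poly g" shows "poly (%x. sgates (f x) (g x))"
 by (rule poly2[OF _ assms]) (unfold sgates_def, intro poly_intros)

lemma poly_stage [poly_intros]: "poly f ==> poly g ==> poly (%x. stage (f x) (g x))"
 unfolding stage_def by (intro poly_intros)

lemma poly_start [poly_intros]: assumes "poly f" shows "poly (%x. start (f x))"
 by (rule poly_comp[OF _ assms]) (unfold start_def, intro poly_intros)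

lemma poly_sD [poly_intros]: "poly f ==> poly g ==> poly h ==> poly (%x. sD (f x) (g x) (h x))"
 unfolding sD_def by (intro poly_intros)

lemma poly_dD [poly_intros]: "poly f ==> poly g ==> poly h ==> poly k ==> poly (%x. dD (f x) (g x) (h x) (k x))"
 unfolding dD_def by (intro poly_intros)

lemma poly_vdiag [poly_intros]: "poly f ==> poly g ==> poly h ==> poly (%x. vdiag (f x) (g x) (h x))"
 unfolding vdiag_def by (intro poly_intros)

lemma poly_vcount [poly_intros]: "poly f ==> poly g ==> poly h ==> poly (%x. vcount (f x) (g x) (h x))"
 unfolding vcount_def by (intro poly_intros)

lemma poly_jobs [poly_intros]: assumes "poly f" "poly g" "poly h" shows "poly (%x. jobs (f x) (g x) (h x))"
 by (rule poly3[OF _ assms]) (unfold jobs_def, intro poly_intros)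

lemma poly_vjobs [poly_intros]: "poly f ==> poly g ==> poly h ==> poly k ==> poly (%x. vjobs (f x) (g x) (h x) (k x))"
 unfolding vjobs_def Let_def by (intro poly_intros)

section \<open>The verifier of the stages\<close>

lemma poly_run:
 assumes "poly f"
 shows "\<exists>F \<tau>. noask F \<and> pbound \<tau> \<and> (\<forall>x. rn F (enc x) (enc (f x)) (\<tau> x))"
proof -
 obtain \<tau> where "pbound \<tau>" "ctime f \<tau>" using assms unfolding poly_def by blast
 then obtain F C where F: "noask F" "\<And>x. rn F (enc x) (enc (f x)) (C * (\<tau> x + 1))" unfolding ctime_def by blast
 have "pbound (%x. C * (\<tau> x + 1))" by (intro pbound_intros \<open>pbound \<tau>\<close>)
 then show ?thesis using F by blast
qed

lemma ev_loop:
 assumes "\<And>i. i < n ==> thd (fst (c i)) \<noteq> Lf \<and> (\<exists>t\<le>T. ev A G (c i) (c (Suc i)) t)" "thd (fst (c n)) = Lf"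
 shows "\<exists>t\<le>n * (T + 4) + 2. ev A (FWhile G) (c 0) (c n) t"
 using assms
proof (induction n arbitrary: c)
 case 0
 then have e: "ev A (FWhile G) (c 0) (c 0) 2"
  using ev_While_end[of "fst (c 0)" A G "fst (snd (c 0))" "snd (snd (c 0))"] by simp
 show ?case by (intro exI[of _ 2] conjI) (simp, rule e)
next
 case (Suc n)
 obtain t where t: "t \<le> n * (T + 4) + 2" "ev A (FWhile G) (c 1) (c (Suc n)) t"
  using Suc.IH[of "%i. c (Suc i)"] Suc.prems by auto
 obtain u where u: "u \<le> T" "ev A G (c 0) (c 1) u" "thd (fst (c 0)) \<noteq> Lf" using Suc.prems(1)[of 0] by auto
 obtain x i q where c0: "c 0 = (x, i, q)" by (metis prod_cases3)
 have "ev A (FWhile G) (c 0) (c (Suc n)) (u + t + 4)"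
  using ev_While[of x A G i q "c 1" u "c (Suc n)" t] u t c0 by simp
 moreover have "u + t + 4 \<le> Suc n * (T + 4) + 2" using u(1) t(1) by simp
 ultimately show ?case by blast
qed

lemma rn_loop:
 assumes "\<And>i. i < n ==> thd (c i) \<noteq> Lf \<and> rn G (c i) (c (Suc i)) T" "thd (c n) = Lf"
 shows "rn (FWhile G) (c 0) (c n) (n * (T + 4) + 2)"
 unfolding rn_def
proof (intro allI)
 fix A i q
 show "\<exists>t\<le>n * (T + 4) + 2. ev A (FWhile G) (c 0, i, q) (c n, i, q) t"
  by (rule ev_loop[where c = "%j. (c j, i, q)"]) (use assms in \<open>auto simp: rn_def\<close>)
qed

definition FRead :: fn where
 "FRead = FWhile (FPair (FComp FHd FTl) (FPair (FPair FNext (FComp FTl FHd)) (FComp FTl FTl)))"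

lemma ev_read:
 assumes "n \<le> length x"
 shows "\<exists>t\<le>n * 100 + 2. ev A FRead (enc (n, [] :: bits, r), x, q) (enc (0 :: nat, rev (take n x), r), drop n x, q) t"
proof -
 let ?c = "%j. (enc (n - j, rev (take j x), r), drop j x, q)"
 let ?B = "FPair (FComp FHd FTl) (FPair (FPair FNext (FComp FTl FHd)) (FComp FTl FTl))"
 have "\<exists>t\<le>96. ev A ?B (?c j) (?c (Suc j)) t" if j: "j < n" for j
 proof -
  have nj: "n - j = Suc (n - Suc j)" using j by simp
  have d: "drop j x = x ! j # drop (Suc j) x" using j assms by (simp add: Cons_nth_drop_Suc)
  have tk: "rev (take (Suc j) x) = x ! j # rev (take j x)" using j assms by (simp add: take_Suc_conv_app_nth)
  have b: "tnext (drop j x) = enc (x ! j)" by (simp add: d tnext_def enc_bool_def)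
  let ?y = "enc (n - j, rev (take j x), r)"
  have 1: "ev A (FComp FHd FTl) (?y, drop j x, q) (enc (n - Suc j), drop j x, q) (1 + 1)"
   using ev_Comp[OF ev_Hd[of A ?y "drop j x" q] ev_Tl] by (simp add: nj)
  have 2: "ev A FNext (?y, drop j x, q) (enc (x ! j), drop (Suc j) x, q) 1"
   using ev_Next[of A ?y "drop j x" q] unfolding b by (simp add: d)
  have 3: "ev A (FComp FTl FHd) (?y, drop (Suc j) x, q) (enc (rev (take j x)), drop (Suc j) x, q) (1 + 1)"
   using ev_Comp[OF ev_Tl[of A ?y "drop (Suc j) x" q] ev_Hd] by simp
  have 4: "ev A (FComp FTl FTl) (?y, drop (Suc j) x, q) (enc r, drop (Suc j) x, q) (1 + 1)"
   using ev_Comp[OF ev_Tl[of A ?y "drop (Suc j) x" q] ev_Tl] by simp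
  from ev_Pair[OF 1 ev_Pair[OF ev_Pair[OF 2 3] 4]] have "ev A ?B (?c j) (?c (Suc j)) 34" unfolding tk by simp
  moreover have "34 \<le> (96 :: nat)" by simp
  ultimately show ?thesis by blast
 qed
 then have "\<exists>t\<le>n * (96 + 4) + 2. ev A FRead (?c 0) (?c n) t" unfolding FRead_def
  by (intro ev_loop) auto
 then show ?thesis using assms by simp
qed

lemma ev_rn: "rn F x y T ==> \<exists>t\<le>T. ev A F (x, i, q) (y, i, q) t"
 by (simp add: rn_def)

definition vx :: "bits => bits => nat" where
 "vx tk w = sroot (tkq tk) (Suc (length w))"

text \<open>The power of two is produced by repeated doubling, and the time is polynomial in the
  list produced, not in the exponent.\<close>

lemma double_run:
 "\<exists>G \<tau>. noask G \<and> pbound \<tau> \<and> (\<forall>n (r :: bits \<times> bits). rn G (enc (n, [Lf], r)) (enc (0 :: nat, replicate (2 ^ n) Lf, r))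
   (\<tau> (n, replicate (2 ^ n) Lf, r)))"
proof -
 let ?f = "%s :: nat \<times> tree list \<times> bits \<times> bits. (fst s - 1, fst (snd s) @ fst (snd s), snd (snd s))"
 have "poly ?f" by (intro poly_intros)
 then obtain G \<tau> where G: "noask G" "pbound \<tau>" "\<And>s. rn G (enc s) (enc (?f s)) (\<tau> s)" using poly_run by blast
 obtain k where k: "\<And>s. \<tau> s \<le> (es s + 1) ^ k" using G(2) unfolding pbound_def by blast
 have eU: "es (replicate m Lf) = 2 * m + 1" for m by (induction m) (auto simp: es_def)
 have "rn (FWhile G) (enc (n, [Lf], r)) (enc (0 :: nat, replicate (2 ^ n) Lf, r))
   (es (n, replicate (2 ^ n) Lf, r) * ((es (n, replicate (2 ^ n) Lf, r) + 1) ^ k + 4) + 2)" for n and r :: "bits \<times> bits"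
 proof -
  let ?E = "es (n, replicate (2 ^ n) Lf, r)"
  let ?c = "%j. enc (n - j, replicate (2 ^ j) Lf, r)"
  have "rn (FWhile G) (?c 0) (?c n) (n * ((?E + 1) ^ k + 4) + 2)"
  proof (rule rn_loop)
   fix j assume j: "j < n"
   have "(2 :: nat) ^ j \<le> 2 ^ n" using j by (intro power_increasing) auto
   then have "es (n - j, replicate (2 ^ j) Lf, r) \<le> ?E" by (simp only: es_simps eU)
   then have "(es (n - j, replicate (2 ^ j) Lf, r) + 1) ^ k \<le> (?E + 1) ^ k" by (intro power_mono) auto
   then have t: "\<tau> (n - j, replicate (2 ^ j) Lf, r) \<le> (?E + 1) ^ k"
    using k[of "(n - j, replicate (2 ^ j) Lf, r)"] by linarith
   have f: "?f (n - j, replicate (2 ^ j) Lf, r) = (n - Suc j, replicate (2 ^ Suc j) Lf, r)"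
    by (simp add: replicate_add[symmetric] mult_2)
   have "rn G (?c j) (?c (Suc j)) (\<tau> (n - j, replicate (2 ^ j) Lf, r))"
    using G(3)[of "(n - j, replicate (2 ^ j) Lf, r)"] unfolding f .
   then have "rn G (?c j) (?c (Suc j)) ((?E + 1) ^ k)" using t by (rule rn_mono)
   then show "thd (?c j) \<noteq> Lf \<and> rn G (?c j) (?c (Suc j)) ((?E + 1) ^ k)" using j by simp
  qed simp
  moreover have "n * ((?E + 1) ^ k + 4) + 2 \<le> ?E * ((?E + 1) ^ k + 4) + 2" by (intro add_mono mult_le_mono1) auto
  ultimately show ?thesis using rn_mono by auto
 qed
 moreover have "pbound (%s :: nat \<times> tree list \<times> bits \<times> bits. es s * ((es s + 1) ^ k + 4) + 2)"
  by (intro pbound_intros pbound_es)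
 moreover have "noask (FWhile G)" using G(1) by simp
 ultimately show ?thesis by (intro exI[of _ "FWhile G"] exI[of _ "%s. es s * ((es s + 1) ^ k + 4) + 2"]) blast
qed

text \<open>The time \<open>B\<close> of one MAX-SAT call enters linearly, and everything else is
  polynomial in the size of the job list. That \<open>val j\<close> is at most the length of the
  instance keeps the results short enough for the polynomial comparison.\<close>

lemma jobs_run:
 "\<exists>G \<tau>. noask G \<and> pbound \<tau> \<and> (\<forall>J d B val. (\<forall>j\<in>set J. val j \<le> length (fst j) \<and> (\<exists>t\<le>B. computes_in P {} (fst j) (val j) t)) -->
   rn G (enc (J, False, d)) (enc ([] :: (bits \<times> bits) list, (\<exists>j\<in>set J. nb (val j) = snd j), d :: bool)) (\<tau> J * (B + 1)))"
proof -
 obtain R C k where R: "noask R" "\<And>x v t. computes_in P {} x v t ==> rn R (enc x) (enc (nb v)) (C * (t + (es x + 1) ^ k))"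
  using ram_simulation[of P] by blast
 let ?f = "%s :: bits \<times> (bits \<times> bits) list \<times> bool \<times> bool. case fst (snd s) of [] => snd s
   | j # J => (J, fst (snd (snd s)) \<or> fst s = snd j, snd (snd (snd s)))"
 have "poly ?f" by (intro poly_intros)
 then obtain H \<sigma> where H: "noask H" "pbound \<sigma>" "\<And>s. rn H (enc s) (enc (?f s)) (\<sigma> s)" using poly_run by blast
 obtain l where l: "\<And>s. \<sigma> s \<le> (es s + 1) ^ l" using H(2) unfolding pbound_def by blast
 let ?G = "FComp (FPair (FComp FHd (FComp FHd (FComp FHd R))) FId) H"
 define T where "T = (%J :: (bits \<times> bits) list. C * (1 + (es J + 1) ^ k) + (10 * es J + 20) ^ l + 20)"
 have pT: "pbound (%J. es J * (T J + 4) + 2)" unfolding T_def by (intro pbound_intros pbound_es)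
 have "rn (FWhile ?G) (enc (J, False, d)) (enc ([] :: (bits \<times> bits) list, (\<exists>j\<in>set J. nb (val j) = snd j), d))
   ((es J * (T J + 4) + 2) * (B + 1))"
  if J: "\<forall>j\<in>set J. val j \<le> length (fst j) \<and> (\<exists>t\<le>B. computes_in P {} (fst j) (val j) t)" for J and d :: bool and B val
 proof -
  let ?s = "%i. (drop i J, (\<exists>j\<in>set (take i J). nb (val j) = snd j), d)"
  have "rn (FWhile ?G) (enc (?s 0)) (enc (?s (length J))) (length J * (T J * (B + 1) + 4) + 2)"
  proof (rule rn_loop)
   fix i assume i: "i < length J"
   let ?j = "J ! i"
   have d': "drop i J = ?j # drop (Suc i) J" using i by (simp add: Cons_nth_drop_Suc)
   have jJ: "?j \<in> set J" using i by simp
   obtain t where t: "t \<le> B" "computes_in P {} (fst ?j) (val ?j) t" using J jJ by blast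
   have ej: "es ?j \<le> es J" using es_mem[OF jJ] .
   have e1: "es (fst ?j) \<le> es J" using ej by (cases ?j) simp
   have h: "thd (thd (thd (enc (?s i)))) = enc (fst ?j)" by (simp add: d' enc_prod_def)
   have hh: "rn (FComp FHd (FComp FHd (FComp FHd R))) (enc (?s i)) (enc (nb (val ?j))) (1 + (1 + (1 + C * (t + (es (fst ?j) + 1) ^ k))))"
    using rn_Comp[OF rn_Hd rn_Comp[OF rn_Hd rn_Comp[OF rn_Hd R(2)[OF t(2), folded h]]]] by simp
   have vb: "es (nb (val ?j)) \<le> 4 * es J + 1"
   proof -
    have "length (nb (val ?j)) \<le> val ?j" by (rule length_nb_le_self)
    also have "\<dots> \<le> length (fst ?j)" using J jJ by blast
    also have "\<dots> \<le> es J" using length_le_es[of "fst ?j"] e1 by simp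
    finally have n: "length (nb (val ?j)) \<le> es J" .
    have "es (nb (val ?j)) \<le> length (nb (val ?j)) * 4 + 1" using es_list_le[of "nb (val ?j)" 3] es_bool by simp
    then show ?thesis using n by linarith
   qed
   have ed: "es (drop i J) \<le> es J" using es_append[of "take i J" "drop i J"] es_pos[of "take i J"] by simp
   have es: "es (nb (val ?j), ?s i) + 1 \<le> 10 * es J + 20"
    using vb ed es_bool[of "\<exists>j\<in>set (take i J). nb (val j) = snd j"] es_bool[of d] by simp
   have "\<sigma> (nb (val ?j), ?s i) \<le> (es (nb (val ?j), ?s i) + 1) ^ l" by (rule l)
   also have "\<dots> \<le> (10 * es J + 20) ^ l" by (rule power_mono[OF es]) simp
   finally have sb: "\<sigma> (nb (val ?j), ?s i) \<le> (10 * es J + 20) ^ l" .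
   have f: "?f (nb (val ?j), ?s i) = ?s (Suc i)"
    unfolding fst_conv snd_conv d' using i by (auto simp: take_Suc_conv_app_nth)
   have p: "rn (FPair (FComp FHd (FComp FHd (FComp FHd R))) FId) (enc (?s i)) (enc (nb (val ?j), ?s i))
     (1 + (1 + (1 + C * (t + (es (fst ?j) + 1) ^ k))) + 0 + 9)"
    using rn_Pair[OF hh rn_Id] by simp
   have r: "rn ?G (enc (?s i)) (enc (?s (Suc i)))
     (1 + (1 + (1 + C * (t + (es (fst ?j) + 1) ^ k))) + 0 + 9 + \<sigma> (nb (val ?j), ?s i))"
    using rn_Comp[OF p H(3)] unfolding f .
   have a1: "C * (t + (es (fst ?j) + 1) ^ k) \<le> C * ((1 + (es J + 1) ^ k) * (B + 1))"
   proof (rule mult_le_mono2)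
    have "(es (fst ?j) + 1) ^ k \<le> (es J + 1) ^ k" using e1 by (intro power_mono) auto
    moreover have "(es J + 1) ^ k \<le> (es J + 1) ^ k * (B + 1)" by simp
    ultimately have y: "(es (fst ?j) + 1) ^ k \<le> (es J + 1) ^ k * (B + 1)" by (rule le_trans)
    have "t \<le> B + 1" using t(1) by simp
    from add_mono[OF this y] show "t + (es (fst ?j) + 1) ^ k \<le> (1 + (es J + 1) ^ k) * (B + 1)"
     by (simp only: distrib_right mult_1)
   qed
   have a2: "(10 * es J + 20) ^ l \<le> (10 * es J + 20) ^ l * (B + 1)" by simp
   have a3: "T J * (B + 1) = C * ((1 + (es J + 1) ^ k) * (B + 1)) + (10 * es J + 20) ^ l * (B + 1) + 20 * (B + 1)"
    by (simp only: T_def distrib_right mult.assoc)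
   have ar: "a \<le> A ==> p \<le> Q ==> X = A + Q + 20 * (B + 1) ==> s \<le> p ==> 1 + (1 + (1 + a)) + 0 + 9 + s \<le> X"
    for a A p Q X s :: nat by simp
   note ar[OF a1 a2 a3 sb]
   then have "rn ?G (enc (?s i)) (enc (?s (Suc i))) (T J * (B + 1))" by (rule rn_mono[OF r])
   moreover have "thd (enc (?s i)) \<noteq> Lf" using i by simp
   ultimately show "thd (enc (?s i)) \<noteq> Lf \<and> rn ?G (enc (?s i)) (enc (?s (Suc i))) (T J * (B + 1))" by blast
  qed simp
  moreover have "length J * (T J * (B + 1) + 4) + 2 \<le> (es J * (T J + 4) + 2) * (B + 1)"
  proof -
   have "length J * (T J * (B + 1) + 4) \<le> es J * (T J * (B + 1) + 4)" by (rule mult_le_mono1[OF length_le_es])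
   also have "\<dots> \<le> es J * ((T J + 4) * (B + 1))" by (rule mult_le_mono2) (simp add: distrib_right)
   finally have a: "length J * (T J * (B + 1) + 4) \<le> es J * ((T J + 4) * (B + 1))" .
   have "(es J * (T J + 4) + 2) * (B + 1) = es J * ((T J + 4) * (B + 1)) + 2 * (B + 1)" by (simp only: distrib_right mult.assoc)
   then show ?thesis using add_mono[OF a, of 2 "2 * (B + 1)"] by simp
  qed
  ultimately show ?thesis using rn_mono by auto
 qed
 moreover have "noask (FWhile ?G)" using R(1) H(1) by simp
 ultimately show ?thesis using pT by (intro exI[of _ "FWhile ?G"] exI[of _ "%J. es J * (T J + 4) + 2"]) blast
qed

text \<open>Comparing the event that some job refutes with \<open>vdiag\<close> treats both modes at
  once: in the diagonal case a refutation has to exist, otherwise there must be none. The time is a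
  polynomial in the size of \<open>U\<close> and the arguments, times the cost of a single MAX-SAT
  call.\<close>

lemma verifier:
 "\<exists>V \<tau>. noask V \<and> pbound \<tau> \<and> (\<forall>tk w x B val U n J. U = replicate (2 ^ vx tk w) Lf --> n = vcount U tk w -->
   J = vjobs U tk w (take n x) --> n \<le> length x -->
   (\<forall>j\<in>set J. val j \<le> length (fst j) \<and> (\<exists>t\<le>B. computes_in P {} (fst j) (val j) t)) -->
   (\<exists>t i. t \<le> \<tau> (U, vx tk w, tk, w) * (B + 1) \<and>
    ev {} V (enc (tk, w), x, []) (enc ((\<exists>j\<in>set J. nb (val j) = snd j) = vdiag U tk w), i, []) t))"
proof -
 have "poly (%s :: bits \<times> bits. (vx (fst s) (snd s), [Lf], s))" unfolding vx_def by (intro poly_intros)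
 then obtain F1 t1 where F1: "noask F1" "pbound t1" "\<And>s. rn F1 (enc s) (enc (vx (fst s) (snd s), [Lf], s)) (t1 s)" using poly_run by blast
 obtain F2 t2 where F2: "noask F2" "pbound t2" "\<And>n (r :: bits \<times> bits). rn F2 (enc (n, [Lf], r)) (enc (0 :: nat, replicate (2 ^ n) Lf, r))
   (t2 (n, replicate (2 ^ n) Lf, r))" using double_run by blast
 define f3 where "f3 = (%s :: nat \<times> tree list \<times> bits \<times> bits. (vcount (fst (snd s)) (fst (snd (snd s))) (snd (snd (snd s))), [] :: bits, snd s))"
 have "poly f3" unfolding f3_def by (intro poly_intros)
 then obtain F3 t3 where F3: "noask F3" "pbound t3" "\<And>s. rn F3 (enc s) (enc (f3 s)) (t3 s)" using poly_run by blast
 define f4 where "f4 = (%s :: nat \<times> bits \<times> tree list \<times> bits \<times> bits. (vjobs (fst (snd (snd s))) (fst (snd (snd (snd s)))) (snd (snd (snd (snd s)))) (rev (fst (snd s))),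
  False, vdiag (fst (snd (snd s))) (fst (snd (snd (snd s)))) (snd (snd (snd (snd s))))))"
 have p4: "poly f4" unfolding f4_def by (intro poly_intros)
 then obtain F4 t4 where F4: "noask F4" "pbound t4" "\<And>s. rn F4 (enc s) (enc (f4 s)) (t4 s)" using poly_run by blast
 obtain F5 t5 where F5: "noask F5" "pbound t5" "\<And>J (d :: bool) B val. \<forall>j\<in>set J. val j \<le> length (fst j) \<and> (\<exists>t\<le>B. computes_in P {} (fst j) (val j) t) ==>
   rn F5 (enc (J, False, d)) (enc ([] :: (bits \<times> bits) list, (\<exists>j\<in>set J. nb (val j) = snd j), d)) (t5 J * (B + 1))"
 proof -
  from jobs_run[of P] obtain G \<tau> where G: "noask G" "pbound \<tau>" "\<forall>J d B val. (\<forall>j\<in>set J. val j \<le> length (fst j) \<and> (\<exists>t\<le>B. computes_in P {} (fst j) (val j) t)) -->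
   rn G (enc (J, False, d)) (enc ([] :: (bits \<times> bits) list, (\<exists>j\<in>set J. nb (val j) = snd j), d :: bool)) (\<tau> J * (B + 1))"
   by (elim exE conjE)
  show thesis by (rule that[OF G(1,2)]) (rule G(3)[THEN spec, THEN spec, THEN spec, THEN spec, THEN mp])
 qed
 have "poly (%s :: (bits \<times> bits) list \<times> bool \<times> bool. fst (snd s) = snd (snd s))" by (intro poly_intros)
 then obtain F6 t6 where F6: "noask F6" "pbound t6" "\<And>s :: (bits \<times> bits) list \<times> bool \<times> bool. rn F6 (enc s) (enc (fst (snd s) = snd (snd s))) (t6 s)" using poly_run by blast
 obtain k4 where k4: "\<And>s. t4 s \<le> (es s + 1) ^ k4" using F4(2) unfolding pbound_def by blast
 have "pbound (%s. es (fst (f4 s)))" by (intro poly_es poly_fst p4)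
 with F5(2) have "pbound (%s. t5 (fst (f4 s)))" by (rule pbound_comp)
 then obtain k5 where k5: "\<And>s. t5 (fst (f4 s)) \<le> (es s + 1) ^ k5" unfolding pbound_def by blast
 obtain k6 where k6: "\<And>s. t6 s \<le> (es s + 1) ^ k6" using F6(2) unfolding pbound_def by blast
 let ?V = "FComp F1 (FComp F2 (FComp F3 (FComp FRead (FComp F4 (FComp F5 F6)))))"
 define vc where "vc = (%e :: tree list \<times> nat \<times> bits \<times> bits. vcount (fst e) (fst (snd (snd e))) (snd (snd (snd e))))"
 \<comment> \<open>Bounds the size of the state after reading: a guessed bit adds at most four to
   it.\<close>
 define E where "E = (%e :: tree list \<times> nat \<times> bits \<times> bits. 4 * vc e + es e + 10)"
 define \<tau> where "\<tau> = (%e. t1 (snd (snd e)) + t2 (fst (snd e), fst e, snd (snd e)) + t3 (0, fst e, snd (snd e)) + (vc e * 100 + 2)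
   + E e ^ k4 + E e ^ k5 + 20 ^ k6)"
 have pvc: "pbound vc"
 proof -
  have "poly vc" unfolding vc_def by (intro poly_intros)
  from poly_es[OF this] show ?thesis by (rule pbound_mono) simp
 qed
 have pt: "pbound \<tau>" unfolding \<tau>_def E_def
  by (intro pbound_intros pbound_es pvc pbound_comp[OF F1(2)] pbound_comp[OF F2(2)] pbound_comp[OF F3(2)] poly_es poly_intros)
 have "\<exists>t i. t \<le> \<tau> (U, vx tk w, tk, w) * (B + 1) \<and>
    ev {} ?V (enc (tk, w), x, []) (enc ((\<exists>j\<in>set J. nb (val j) = snd j) = vdiag U tk w), i, []) t"
  if U: "U = replicate (2 ^ vx tk w) Lf" and n: "n = vcount U tk w" and J: "J = vjobs U tk w (take n x)" and nx: "n \<le> length x"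
   and val: "\<forall>j\<in>set J. val j \<le> length (fst j) \<and> (\<exists>t\<le>B. computes_in P {} (fst j) (val j) t)" for tk w x B val U n J
 proof -
  let ?e = "(U, vx tk w, tk, w)"
  have vce: "vc ?e = n" by (simp add: vc_def n)
  have r1: "rn F1 (enc (tk, w)) (enc (vx tk w, [Lf], tk, w)) (t1 (tk, w))" using F1(3)[of "(tk, w)"] by simp
  have r2: "rn F2 (enc (vx tk w, [Lf], tk, w)) (enc (0 :: nat, U, tk, w)) (t2 (vx tk w, U, tk, w))" using F2(3)[of "vx tk w" "(tk, w)"] unfolding U .
  have r3: "rn F3 (enc (0 :: nat, U, tk, w)) (enc (n, [] :: bits, U, tk, w)) (t3 (0, U, tk, w))"
   using F3(3)[of "(0, U, tk, w)"] by (simp add: f3_def n)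
  let ?s4 = "(0 :: nat, rev (take n x), U, tk, w)"
  have f4: "f4 ?s4 = (J, False, vdiag U tk w)" by (simp add: f4_def J)
  have r4: "rn F4 (enc ?s4) (enc (J, False, vdiag U tk w)) (t4 ?s4)" using F4(3)[of ?s4] unfolding f4 .
  let ?h = "\<exists>j\<in>set J. nb (val j) = snd j"
  have r5: "rn F5 (enc (J, False, vdiag U tk w)) (enc ([] :: (bits \<times> bits) list, ?h, vdiag U tk w)) (t5 J * (B + 1))"
   by (rule F5(3)[OF val])
  have r6: "rn F6 (enc ([] :: (bits \<times> bits) list, ?h, vdiag U tk w)) (enc (?h = vdiag U tk w)) (t6 ([], ?h, vdiag U tk w))"
   using F6(3)[of "([], ?h, vdiag U tk w)"] by simp
  obtain u1 where u1: "u1 \<le> t1 (tk, w)" "ev {} F1 (enc (tk, w), x, []) (enc (vx tk w, [Lf], tk, w), x, []) u1" using ev_rn[OF r1] by blast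
  obtain u2 where u2: "u2 \<le> t2 (vx tk w, U, tk, w)" "ev {} F2 (enc (vx tk w, [Lf], tk, w), x, []) (enc (0 :: nat, U, tk, w), x, []) u2" using ev_rn[OF r2] by blast
  obtain u3 where u3: "u3 \<le> t3 (0, U, tk, w)" "ev {} F3 (enc (0 :: nat, U, tk, w), x, []) (enc (n, [] :: bits, U, tk, w), x, []) u3" using ev_rn[OF r3] by blast
  obtain ur where ur: "ur \<le> n * 100 + 2" "ev {} FRead (enc (n, [] :: bits, U, tk, w), x, []) (enc ?s4, drop n x, []) ur"
   using ev_read[OF nx, of "{}" "(U, tk, w)" "[]"] by blast
  obtain u4 where u4: "u4 \<le> t4 ?s4" "ev {} F4 (enc ?s4, drop n x, []) (enc (J, False, vdiag U tk w), drop n x, []) u4" using ev_rn[OF r4] by blast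
  obtain u5 where u5: "u5 \<le> t5 J * (B + 1)" "ev {} F5 (enc (J, False, vdiag U tk w), drop n x, []) (enc ([] :: (bits \<times> bits) list, ?h, vdiag U tk w), drop n x, []) u5"
   using ev_rn[OF r5] by blast
  obtain u6 where u6: "u6 \<le> t6 ([], ?h, vdiag U tk w)" "ev {} F6 (enc ([] :: (bits \<times> bits) list, ?h, vdiag U tk w), drop n x, []) (enc (?h = vdiag U tk w), drop n x, []) u6"
   using ev_rn[OF r6] by blast
  have run: "ev {} ?V (enc (tk, w), x, []) (enc (?h = vdiag U tk w), drop n x, []) (u1 + (u2 + (u3 + (ur + (u4 + (u5 + u6))))))"
   by (rule ev_Comp[OF u1(2) ev_Comp[OF u2(2) ev_Comp[OF u3(2) ev_Comp[OF ur(2) ev_Comp[OF u4(2) ev_Comp[OF u5(2) u6(2)]]]]]])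
  have es4: "es ?s4 + 1 \<le> E ?e"
  proof -
   have "es (take n x) \<le> length (take n x) * (3 + 1) + 1" by (rule es_list_le) (rule es_bool)
   then show ?thesis using nx by (simp add: E_def vce)
  qed
  have b4: "u4 \<le> E ?e ^ k4" using u4(1) k4[of ?s4] power_mono[OF es4, of k4] by simp
  have "t5 J \<le> (es ?s4 + 1) ^ k5" using k5[of ?s4] unfolding f4 by simp
  also have "\<dots> \<le> E ?e ^ k5" by (rule power_mono[OF es4]) simp
  finally have "t5 J * (B + 1) \<le> E ?e ^ k5 * (B + 1)" by (rule mult_le_mono1)
  then have b5: "u5 \<le> E ?e ^ k5 * (B + 1)" using u5(1) by linarith
  have "es ([] :: (bits \<times> bits) list, ?h, vdiag U tk w) + 1 \<le> 20" using es_bool[of ?h] es_bool[of "vdiag U tk w"] by simp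
  then have b6: "u6 \<le> 20 ^ k6" using u6(1) k6[of "([], ?h, vdiag U tk w)"] power_mono[of "es ([] :: (bits \<times> bits) list, ?h, vdiag U tk w) + 1" 20 k6] by linarith
  define X where "X = t1 (tk, w) + t2 (vx tk w, U, tk, w) + t3 (0, U, tk, w) + (n * 100 + 2) + E ?e ^ k4 + 20 ^ k6"
  have "\<tau> ?e = X + E ?e ^ k5" by (simp add: \<tau>_def X_def vce)
  moreover have "X \<le> X * (B + 1)" by simp
  ultimately have "X + E ?e ^ k5 * (B + 1) \<le> \<tau> ?e * (B + 1)" by (simp only: distrib_right)
  moreover have "u1 + (u2 + (u3 + (ur + (u4 + (u5 + u6))))) \<le> X + E ?e ^ k5 * (B + 1)"
   using u1(1) u2(1) u3(1) ur(1) b4 b5 b6 unfolding X_def by linarith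
  ultimately show ?thesis using run le_trans by blast
 qed
 moreover have "noask ?V" using F1(1) F2(1) F3(1) F4(1) F5(1) F6(1) by (simp add: FRead_def)
 ultimately show ?thesis using pt by (intro exI[of _ ?V] exI[of _ \<tau>]) blast
qed

section \<open>Witnesses in E relative to NP\<close>

text \<open>Addresses are numbered with the least significant bit first, because this numbering can
  be computed from \<open>nb\<close>.\<close>

definition idx :: "nat => nat => bits" where
 "idx L i = take L (nb i @ replicate L False)"

definition lk :: "bits => bits => bool" where
 "lk W x \<longleftrightarrow> (\<exists>i\<in>set [0..<length W]. idx (length x) i = x \<and> tnth W i)"

definition sL :: "bits => nat => nat" where
 "sL tk K = K + sn tk K"

text \<open>The first conjunct says that the length of \<open>W\<close> is a certain power of two.
  It is phrased through the binary expansion, so that the test stays polynomial in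
  \<open>W\<close>.\<close>

definition wok :: "bits => bits => bits => bool" where
 "wok tk w W \<longleftrightarrow> nb (length W) = replicate (sL tk (length w)) False @ [True] \<and>
   (\<forall>fam\<in>set (stage tk w). \<forall>i\<in>set [0..<length W]. \<exists>l\<in>set fam. lk W (inst (fst l) (idx (sL tk (length w)) i)) = snd l)"

lemma idx_row: "idx L i = rev (row L i)"
proof (rule nth_equalityI)
 fix j assume "j < length (idx L i)"
 then have j: "j < L" by (simp add: idx_def)
 have "bit i j \<longleftrightarrow> False" if "floorlog 2 i \<le> j"
 proof -
  have "i < 2 ^ j" using floorlog_leD[of 2 i j] that by simp
  then show ?thesis by (simp add: bit_iff_odd)
 qed
 then show "idx L i ! j = rev (row L i) ! j" using j by (auto simp: idx_def row_def nb_bits nth_append)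
qed (simp add: idx_def)

lemma length_idx [simp]: "length (idx L i) = L"
 by (simp add: idx_row)

lemma rows_idx: "rows L = idx L ` {..<2 ^ L}"
proof
 show "rows L \<subseteq> idx L ` {..<2 ^ L}"
 proof
  fix x assume "x \<in> rows L"
  then have r: "rev x \<in> rows L" by (simp add: rows_def)
  have "x = idx L (rnum (rev x))" using row_rnum[OF r] by (simp add: idx_row)
  then show "x \<in> idx L ` {..<2 ^ L}" using rnum_less[OF r] by blast
 qed
qed (auto simp: rows_def)

lemma idx_inj: "i < 2 ^ L ==> j < 2 ^ L ==> idx L i = idx L j ==> i = j"
 using row_inj[of i L j] by (simp add: idx_row)

lemma nb_power: "nb (2 ^ L) = replicate L False @ [True]"
proof (induction L)
 case (Suc L)
 have "nb (of_bool False + 2 * 2 ^ L) = False # nb (2 ^ L)" by (rule nb_double) simp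
 then show ?case using Suc by simp
qed (simp add: nb_small)

lemma wok_iff: "wok tk w W \<longleftrightarrow> length W = 2 ^ sL tk (length w) \<and> sat (sL tk (length w)) (stage tk w) (lk W)"
proof -
 have "sat L \<Phi> (lk W) \<longleftrightarrow> (\<forall>fam\<in>set \<Phi>. \<forall>i\<in>set [0..<length W]. \<exists>l\<in>set fam. lk W (inst (fst l) (idx L i)) = snd l)"
  if "length W = 2 ^ L" for L \<Phi>
  unfolding sat_def fam_ok_def rows_idx that by (simp add: atLeast0LessThan)
 then show ?thesis unfolding wok_def nb_power[symmetric] nb_inj by blast
qed

text \<open>The families query addresses of length \<open>L\<close> only, so a solution can be
  written down as a truth table.\<close>

lemma sat_wok:
 assumes s: "sat L (stage tk w) W" and L: "L = sL tk (length w)"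
  and p: "\<And>fam l. fam \<in> set (stage tk w) ==> l \<in> set fam ==> length (fst l) = L"
 shows "\<exists>V. wok tk w V"
proof -
 define V where "V = map (%i. W (idx L i)) [0..<2 ^ L]"
 have lV: "length V = 2 ^ L" by (simp add: V_def)
 have e: "lk V x = W x" if x: "x \<in> rows L" for x
 proof -
  obtain j where j: "j < 2 ^ L" "x = idx L j" using x unfolding rows_idx by auto
  have "lk V x \<longleftrightarrow> (\<exists>i<2 ^ L. idx L i = x \<and> V ! i)"
   using x lV by (auto simp: lk_def rows_def tnth_nth)
  also have "\<dots> \<longleftrightarrow> V ! j" using j idx_inj by blast
  finally show ?thesis using j by (simp add: V_def)
 qed
 have "sat L (stage tk w) (lk V)" unfolding sat_def fam_ok_def
 proof (intro ballI)
  fix fam y assume f: "fam \<in> set (stage tk w)" and y: "y \<in> rows L"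
  then obtain l where l: "l \<in> set fam" "W (inst (fst l) y) = snd l" using s unfolding sat_def fam_ok_def by blast
  have "inst (fst l) y \<in> rows L" using p[OF f l(1)] y length_inst[of "fst l" y] by (simp add: rows_def)
  then show "\<exists>l\<in>set fam. lk V (inst (fst l) y) = snd l" using e l by auto
 qed
 then show ?thesis using lV unfolding wok_iff L by blast
qed

definition ext :: "bits => bits => bits => bool" where
 "ext tk w p \<longleftrightarrow> (\<exists>v. wok tk w (p @ v))"

text \<open>Prefix search, preferring True. Each bit is one question to an NP oracle, and the
  solution so determined depends on \<open>w\<close> alone, which makes its bits a language.\<close>

primrec greedy :: "bits => bits => nat => bits" where
 "greedy tk w 0 = []"
| "greedy tk w (Suc n) = greedy tk w n @ [ext tk w (greedy tk w n @ [True])]"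

lemma length_greedy [simp]: "length (greedy tk w n) = n"
 by (induction n) auto

lemma greedy_wok:
 assumes "wok tk w V"
 shows "wok tk w (greedy tk w (2 ^ sL tk (length w)))"
proof -
 let ?N = "2 ^ sL tk (length w) :: nat"
 have l: "length V = ?N" if "wok tk w V" for V using that unfolding wok_iff by blast
 have "n \<le> ?N ==> ext tk w (greedy tk w n)" for n
 proof (induction n)
  case 0
  then show ?case using assms by (auto simp: ext_def)
 next
  case (Suc n)
  then obtain v where v: "wok tk w (greedy tk w n @ v)" by (auto simp: ext_def)
  have "v \<noteq> []" using l[OF v] Suc.prems by auto
  then obtain b u where b: "v = b # u" by (cases v) auto
  show ?case
  proof (cases "ext tk w (greedy tk w n @ [True])")
   case False
   then have "\<not> b" using v unfolding b ext_def by (cases b) auto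
   then have "wok tk w ((greedy tk w n @ [False]) @ u)" using v unfolding b by simp
   moreover have "greedy tk w (Suc n) = greedy tk w n @ [False]" using False by simp
   ultimately show ?thesis unfolding ext_def by auto
  qed simp
 qed
 from this[of ?N] obtain v where v: "wok tk w (greedy tk w ?N @ v)" by (auto simp: ext_def)
 then show ?thesis using l[OF v] by simp
qed

lemma poly_idx [poly_intros]: "poly f ==> poly g ==> poly (%x. idx (f x) (g x))"
 unfolding idx_def by (intro poly_intros)

lemma poly_lk [poly_intros]: assumes "poly f" "poly g" shows "poly (%x. lk (f x) (g x))"
 by (rule poly2[OF _ assms]) (unfold lk_def, intro poly_intros)

lemma poly_sL [poly_intros]: "poly f ==> poly g ==> poly (%x. sL (f x) (g x))"
 unfolding sL_def by (intro poly_intros)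

lemma poly_inst [poly_intros]: "poly f ==> poly g ==> poly (%x. inst (f x) (g x))"
 unfolding inst_def by (intro poly_intros)

lemma poly_wok [poly_intros]: assumes "poly f" "poly g" "poly h" shows "poly (%x. wok (f x) (g x) (h x))"
 by (rule poly3[OF _ assms]) (unfold wok_def, intro poly_intros)

section \<open>From tree programs to the classes P and NP\<close>

lemma poly_pair_code [poly_intros]: "poly f ==> poly g ==> poly (%x. pair_code (f x) (g x))"
 unfolding pair_code_def by (intro poly_intros)

text \<open>The state records whether the separator has been passed, a pending first half of a
  doubled bit, and the two components in reverse.\<close>

definition upstep :: "bool \<times> bits \<times> bits \<times> bits => bool => bool \<times> bits \<times> bits \<times> bits" where
 "upstep s b = (if fst s then (True, [], fst (snd (snd s)), b # snd (snd (snd s)))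
   else case fst (snd s) of [] => (False, [b], snd (snd s))
   | c # _ => if b = c then (False, [], b # fst (snd (snd s)), []) else (True, [], snd (snd s)))"

definition unpair :: "bits => bits \<times> bits" where
 "unpair x = (let s = foldl upstep (False, [], [], []) x in (rev (fst (snd (snd s))), rev (snd (snd (snd s)))))"

lemma unpair_pair_code [simp]: "unpair (pair_code x w) = (x, w)"
proof -
 have 1: "foldl upstep (False, [], a, []) (concat (map (%b. [b, b]) x)) = (False, [], rev x @ a, [])" for a
  by (induction x arbitrary: a) (auto simp: upstep_def)
 have 2: "foldl upstep (True, [], a, r) w = (True, [], a, rev w @ r)" for a r
  by (induction w arbitrary: r) (auto simp: upstep_def)
 have "foldl upstep (False, [], [], []) (pair_code x w) = (True, [], rev x, rev w)"
  unfolding pair_code_def foldl_append 1 by (simp add: upstep_def 2)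
 then show ?thesis by (simp add: unpair_def)
qed

lemma poly_unpair [poly_intros]: assumes "poly f" shows "poly (%x. unpair (f x))"
proof (rule poly_comp[OF _ assms])
 have e: "es (foldl upstep (False, [], [], []) ys) \<le> 10 * length ys + 10" for ys
 proof (induction ys rule: rev_induct)
  case (snoc b ys)
  have "es (upstep s b) \<le> es s + 10" for s
   using es_bool[of "fst s"] es_bool[of b] es_bool[of True] es_bool[of False]
   by (cases s) (auto simp: upstep_def split: list.splits)
  from this[of "foldl upstep (False, [], [], []) ys"] snoc show ?case by simp
 qed (use es_bool[of False] in simp)
 have "poly (%x. foldl upstep (False, [], [], []) x)"
 proof (rule poly_foldl[where B = "%x. 10 * length x + 10"])
  show "es (foldl upstep (False, [], [], []) ys) \<le> 10 * length x + 10" if "x = ys @ zs" for x ys zs :: bits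
   using e[of ys] that by simp
  show "poly (%p :: (bits \<times> bool \<times> bits \<times> bits \<times> bits) \<times> bool. upstep (snd (fst p)) (snd p))"
   unfolding upstep_def by (intro poly_intros)
 qed (intro poly_intros pbound_intros pbound_length)+
 then show "poly unpair" unfolding unpair_def Let_def by (intro poly_intros)
qed

definition FNotEof :: fn where "FNotEof = FIf FEof FNil (FPair FNil FNil)"

definition FAll :: fn where
 "FAll = FComp (FPair FNotEof FNil) (FWhile (FComp (FPair (FPair FNext FTl) FNotEof) (FPair FTl FHd)))"

lemma ev_notEof: "\<exists>t\<le>20. ev A FNotEof (y, i, q) (enc (i \<noteq> []), i, q) t"
proof (cases "i = []")
 case True
 have "ev A FNotEof (y, i, q) (Lf, i, q) (1 + 1 + 6)" unfolding FNotEof_def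
  by (rule ev_If_True[OF ev_Eof _ ev_Nil]) (simp add: True tbool_def)
 then show ?thesis using True by (intro exI[of _ "1 + 1 + 6"]) simp
next
 case False
 have "ev A FEof (y, i, q) (Lf, i, q) 1" using ev_Eof[of A y i q] False by (simp add: tbool_def)
 from ev_If_False[OF this ev_Pair[OF ev_Nil ev_Nil]]
 have "ev A FNotEof (y, i, q) (Nd Lf Lf, i, q) (1 + (1 + 1 + 9) + 4)" unfolding FNotEof_def .
 then show ?thesis using False by (intro exI[of _ "1 + (1 + 1 + 9) + 4"]) simp
qed

lemma ev_all: "\<exists>t\<le>length x * 100 + 50. ev A FAll (y, x, q) (enc (False, rev x), [], q) t"
proof -
 let ?c = "%j. (enc (drop j x \<noteq> [], rev (take j x)), drop j x, q)"
 let ?B = "FComp (FPair (FPair FNext FTl) FNotEof) (FPair FTl FHd)"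
 have "\<exists>t\<le>90. ev A ?B (?c j) (?c (Suc j)) t" if j: "j < length x" for j
 proof -
  have d: "drop j x = x ! j # drop (Suc j) x" using j by (simp add: Cons_nth_drop_Suc)
  have tk: "rev (take (Suc j) x) = x ! j # rev (take j x)" using j by (simp add: take_Suc_conv_app_nth)
  have b: "tnext (drop j x) = enc (x ! j)" by (simp add: d tnext_def enc_bool_def)
  let ?y = "enc (drop j x \<noteq> [], rev (take j x))"
  have 2: "ev A FNext (?y, drop j x, q) (enc (x ! j), drop (Suc j) x, q) 1"
   using ev_Next[of A ?y "drop j x" q] unfolding b by (simp add: d)
  have 3: "ev A FTl (?y, drop (Suc j) x, q) (enc (rev (take j x)), drop (Suc j) x, q) 1"
   using ev_Tl[of A ?y "drop (Suc j) x" q] by simp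
  obtain u where u: "u \<le> 20" "ev A FNotEof (?y, drop (Suc j) x, q) (enc (drop (Suc j) x \<noteq> []), drop (Suc j) x, q) u"
   using ev_notEof by blast
  note p = ev_Pair[OF ev_Pair[OF 2 3] u(2)]
  have "ev A ?B (?y, drop j x, q) (?c (Suc j)) (1 + 1 + 9 + u + 9 + (1 + 1 + 9))"
   unfolding tk using ev_Comp[OF p ev_Pair[OF ev_Tl ev_Hd]] by simp
  then show ?thesis using u(1) by (intro exI[of _ "1 + 1 + 9 + u + 9 + (1 + 1 + 9)"]) simp
 qed
 then have "\<exists>t\<le>length x * (90 + 4) + 2. ev A (FWhile ?B) (?c 0) (?c (length x)) t"
  by (intro ev_loop) auto
 then obtain t where t: "t \<le> length x * (90 + 4) + 2" "ev A (FWhile ?B) (?c 0) (?c (length x)) t" by blast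
 obtain u where u: "u \<le> 20" "ev A FNotEof (y, x, q) (enc (x \<noteq> []), x, q) u" using ev_notEof by blast
 have "ev A FAll (y, x, q) (enc (False, rev x), [], q) (u + 1 + 9 + t)"
  unfolding FAll_def using ev_Comp[OF ev_Pair[OF u(2) ev_Nil], of _ "?c (length x)" t] t(2) by simp
 then show ?thesis using u(1) t(1) by (intro exI[of _ "u + 1 + 9 + t"]) simp
qed

text \<open>Brings a polynomial into the form \<open>n ^ k + k\<close> used by
  \<open>class_P\<close>; the additive constant takes care of \<open>n\<close> at most 1.\<close>

lemma power_bound: "\<exists>k'. \<forall>n. (a * n + b) ^ k \<le> n ^ k' + (k' :: nat)" for a b k :: nat
proof (intro exI allI)
 fix n :: nat
 let ?k = "(a + b) ^ k + (a + b + 1) * k"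
 show "(a * n + b) ^ k \<le> n ^ ?k + ?k"
 proof (cases "n \<le> 1")
  case True
  then have "(a * n + b) ^ k \<le> (a + b) ^ k" by (intro power_mono) (cases n; simp)+
  then show ?thesis by linarith
 next
  case False
  have "a * n + b \<le> a * n + b * n" using False by (cases n) auto
  also have "\<dots> = (a + b) * n" by (simp add: distrib_right)
  also have "\<dots> \<le> n ^ (a + b) * n"
  proof (rule mult_le_mono1)
   have "a + b \<le> 2 ^ (a + b)" by (simp add: less_imp_le)
   also have "\<dots> \<le> n ^ (a + b)" using False by (intro power_mono) auto
   finally show "a + b \<le> n ^ (a + b)" .
  qed
  finally have "a * n + b \<le> n ^ (a + b + 1)" by (simp add: mult.commute)
  then have "(a * n + b) ^ k \<le> (n ^ (a + b + 1)) ^ k" by (intro power_mono) auto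
  also have "\<dots> = n ^ ((a + b + 1) * k)" by (simp only: power_mult)
  also have "\<dots> \<le> n ^ ?k" using False by (intro power_increasing) auto
  finally show ?thesis by linarith
 qed
qed

lemma es_bits: "es (x :: bits) \<le> 4 * length x + 1"
 using es_list_le[of x 3] es_bool by simp

text \<open>Here the end-of-input test is available: \<open>FAll\<close> collects the whole input
  before the polynomial-time function is applied to it.\<close>

lemma class_P_poly:
 assumes "poly (f :: bits => bool)"
 shows "{x. f x} \<in> class_P"
proof -
 have "poly (%s :: bool \<times> bits. f (rev (snd s)))" by (rule poly_comp[OF assms]) (intro poly_intros)
 then obtain F \<tau> where F: "noask F" "pbound \<tau>" "\<And>s :: bool \<times> bits. rn F (enc s) (enc (f (rev (snd s)))) (\<tau> s)" using poly_run by blast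
 let ?P = "ram_of (fcode 0 (FComp FAll F))"
 define h where "h = (%x :: bits. 50 * (length x * 100 + 50 + \<tau> (False, rev x) + 30) ^ 2)"
 have "pbound h" unfolding h_def by (intro pbound_intros pbound_length pbound_comp[OF F(2)] poly_es poly_intros)
 then obtain k where k: "\<And>x. h x \<le> (es x + 1) ^ k" unfolding pbound_def by blast
 obtain k' where k': "\<And>n. (4 * n + 2) ^ k \<le> n ^ k' + k'" using power_bound[of 4 2 k] by blast
 have "\<exists>t. computes_in ?P {} x (of_bool (x \<in> {x. f x})) t \<and> real t \<le> real (length x ^ k' + k')" for x
 proof -
  obtain t1 where t1: "t1 \<le> length x * 100 + 50" "ev {} FAll (Lf, x, []) (enc (False, rev x), [], []) t1"
   using ev_all by blast
  obtain t2 where t2: "t2 \<le> \<tau> (False, rev x)" "ev {} F (enc (False, rev x), [], []) (enc (f x), [], []) t2"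
   using ev_rn[OF F(3)[of "(False, rev x)"], of "{}" "[]" "[]"] by auto
  obtain t where t: "computes_in ?P {} x (of_bool (enc (f x) \<noteq> Lf)) t" "t \<le> 50 * (t1 + t2 + 30) ^ 2"
   using ram_of_fn[OF ev_Comp[OF t1(2) t2(2)]] by blast
  have "(t1 + t2 + 30) ^ 2 \<le> (length x * 100 + 50 + \<tau> (False, rev x) + 30) ^ 2" using t1(1) t2(1) by (intro power_mono) auto
  then have "t \<le> h x" using t(2) unfolding h_def by linarith
  also have "\<dots> \<le> (es x + 1) ^ k" by (rule k)
  also have "\<dots> \<le> (4 * length x + 2) ^ k" using es_bits[of x] by (intro power_mono) auto
  also have "\<dots> \<le> length x ^ k' + k'" by (rule k')
  finally have "real t \<le> real (length x ^ k' + k')" by (simp only: of_nat_le_iff)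
  then show ?thesis using t(1) by auto
 qed
 then show ?thesis unfolding class_P_def decides_in_time_def by blast
qed

text \<open>The unary padding makes the query as long as the truth table, so that a completion of
  the prefix is a certificate of admissible length.\<close>

definition query :: "bits => bits => bits => tree list => bits" where
 "query tk w p U = pair_code w (pair_code p (map (%_. True) U))"

definition wsets :: "bits => bits set" where
 "wsets tk = {q. \<exists>v. length v \<le> length q ^ 1 + 1 \<and> pair_code q v \<in> {x. let a = unpair x; b = unpair (fst a); c = unpair (snd b) in
   wok tk (fst b) (fst c @ snd a)}}"

lemma wsets_NP: "wsets tk \<in> class_NP"
proof -
 have "poly (%x. let a = unpair x; b = unpair (fst a); c = unpair (snd b) in wok tk (fst b) (fst c @ snd a))"
  unfolding Let_def by (intro poly_intros)
 from class_P_poly[OF this] show ?thesis unfolding class_NP_def wsets_def by blast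
qed

lemma wsets_query: "length U = 2 ^ sL tk (length w) ==> query tk w p U \<in> wsets tk \<longleftrightarrow> ext tk w p"
proof -
 assume U: "length U = 2 ^ sL tk (length w)"
 have "length U \<le> length (query tk w p U)" by (simp add: query_def pair_code_def)
 moreover have "length v \<le> length U" if "wok tk w (p @ v)" for v using that U unfolding wok_iff by simp
 ultimately have "length v \<le> length (query tk w p U) ^ 1 + 1" if "wok tk w (p @ v)" for v
  using that by (simp only: power_one_right) (meson le_trans trans_le_add1)
 then show ?thesis unfolding wsets_def ext_def by (auto simp: query_def)
qed

definition FSend :: fn where
 "FSend = FWhile (FComp (FPair (FComp FHd (FComp FHd FEmit)) (FPair (FComp FHd FTl) FTl)) FTl)"

lemma ev_send: "\<exists>t\<le>length v * 100 + 2. ev A FSend (enc (v :: bits, s), i, q) (enc ([] :: bits, s), i, q @ v) t"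
proof -
 let ?c = "%j. (enc (drop j v, s), i, q @ take j v)"
 let ?B = "FComp (FPair (FComp FHd (FComp FHd FEmit)) (FPair (FComp FHd FTl) FTl)) FTl"
 have "\<exists>t\<le>90. ev A ?B (?c j) (?c (Suc j)) t" if j: "j < length v" for j
 proof -
  have d: "drop j v = v ! j # drop (Suc j) v" using j by (simp add: Cons_nth_drop_Suc)
  have tk: "q @ take (Suc j) v = (q @ take j v) @ [v ! j]" using j by (simp add: take_Suc_conv_app_nth)
  let ?y = "enc (drop j v, s)" and ?q = "q @ take j v"
  have y: "?y = Nd (Nd (enc (v ! j)) (enc (drop (Suc j) v))) (enc s)" by (simp add: d)
  have 1: "ev A (FComp FHd (FComp FHd FEmit)) (?y, i, ?q) (enc (v ! j), i, ?q @ [v ! j]) (1 + (1 + 1))"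
   using ev_Comp[OF ev_Hd[of A ?y i ?q] ev_Comp[OF ev_Hd ev_Emit]] unfolding y by simp
  have 2: "ev A (FComp FHd FTl) (?y, i, ?q @ [v ! j]) (enc (drop (Suc j) v), i, ?q @ [v ! j]) (1 + 1)"
   using ev_Comp[OF ev_Hd[of A ?y i "?q @ [v ! j]"] ev_Tl] unfolding y by simp
  have 3: "ev A FTl (?y, i, ?q @ [v ! j]) (enc s, i, ?q @ [v ! j]) 1"
   using ev_Tl[of A ?y i "?q @ [v ! j]"] unfolding y by simp
  have "ev A ?B (?y, i, ?q) (?c (Suc j)) (1 + (1 + 1) + (1 + 1 + 1 + 9) + 9 + 1)"
   unfolding tk using ev_Comp[OF ev_Pair[OF 1 ev_Pair[OF 2 3]] ev_Tl] by simp
  then show ?thesis by (intro exI[of _ "1 + (1 + 1) + (1 + 1 + 1 + 9) + 9 + 1"]) simp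
 qed
 then have "\<exists>t\<le>length v * (90 + 4) + 2. ev A FSend (?c 0) (?c (length v)) t" unfolding FSend_def
  by (intro ev_loop) auto
 then obtain t where t: "t \<le> length v * (90 + 4) + 2" "ev A FSend (?c 0) (?c (length v)) t" by blast
 then show ?thesis by (intro exI[of _ t]) simp
qed

text \<open>One string holds the word and an address in its table. A circuit for this language at
  one length therefore computes, after \<open>w\<close> is hard-wired, the whole table of
  \<open>w\<close>.\<close>

definition witlang :: "bits => bits set" where
 "witlang tk = {z. \<exists>w y. z = w @ y \<and> length y = sL tk (length w) \<and> lk (greedy tk w (2 ^ sL tk (length w))) y}"

type_synonym wstate = "tree list \<times> bits \<times> tree list \<times> bits \<times> bits"

text \<open>The list \<open>U\<close> has two uses: one copy is consumed as loop counter, the other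
  pads the queries.\<close>

lemma greedy_run:
 "\<exists>G \<tau>. pbound \<tau> \<and> (\<forall>(U :: tree list) w (y :: bits) i. length U = 2 ^ sL tk (length w) -->
   (\<exists>t\<le>\<tau> (U, w, y). ev (wsets tk) G (enc (U, [] :: bits, U, w, y), i, []) (enc ([] :: tree list, greedy tk w (length U), U, w, y), i, []) t))"
proof -
 let ?f = "%s :: wstate. (query tk (fst (snd (snd (snd s)))) (fst (snd s) @ [True]) (fst (snd (snd s))), s)"
 have pf: "poly ?f" unfolding query_def by (intro poly_intros)
 then obtain F \<sigma> where F: "pbound \<sigma>" "\<And>s. rn F (enc s) (enc (?f s)) (\<sigma> s)" using poly_run by blast
 let ?g = "%s :: bool \<times> wstate. (tl (fst (snd s)), fst (snd (snd s)) @ [fst s], snd (snd (snd s)))"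
 have "poly ?g" by (intro poly_intros)
 then obtain G \<rho> where G: "pbound \<rho>" "\<And>s. rn G (enc s) (enc (?g s)) (\<rho> s)" using poly_run by blast
 obtain k where k: "\<And>s. \<sigma> s \<le> (es s + 1) ^ k" using F(1) unfolding pbound_def by blast
 obtain l where l: "\<And>s. \<rho> s \<le> (es s + 1) ^ l" using G(1) unfolding pbound_def by blast
 obtain m where m: "\<And>s. es (?f s) \<le> (es s + 1) ^ m" using poly_es[OF pf] unfolding pbound_def by blast
 let ?H = "FComp F (FComp FSend (FComp (FPair FAsk FTl) G))"
 define E where "E = (%e :: tree list \<times> bits \<times> bits. 10 * es e + 20)"
 define T where "T = (%e. E e ^ k + (E e ^ m * 100 + 2) + 20 + E e ^ l)"
 define \<tau> where "\<tau> = (%e :: tree list \<times> bits \<times> bits. length (fst e) * (T e + 4) + 2)"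
 have r: "\<exists>t\<le>\<tau> (U, w, y). ev (wsets tk) (FWhile ?H) (enc (U, [] :: bits, U, w, y), i, [])
   (enc ([] :: tree list, greedy tk w (length U), U, w, y), i, []) t"
  if U: "length U = 2 ^ sL tk (length w)" for U w y i
 proof -
  let ?s = "%j. (drop j U, greedy tk w j, U, w, y)"
  let ?c = "%j. (enc (?s j), i, [] :: bits)"
  have "\<exists>t\<le>T (U, w, y). ev (wsets tk) ?H (?c j) (?c (Suc j)) t" if j: "j < length U" for j
  proof -
   let ?q = "query tk w (greedy tk w j @ [True]) U"
   have lU: "length U \<le> es U" by (rule length_le_es)
   have ed: "es (drop j U) \<le> es U" using es_append[of "take j U" "drop j U"] es_pos[of "take j U"] by simp
   have eg: "es (greedy tk w j) \<le> 4 * es U + 1" using es_bits[of "greedy tk w j"] j lU by simp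
   have e1: "es (?s j) + 1 \<le> E (U, w, y)" using ed eg by (simp add: E_def)
   have e2: "es (b, ?s j) + 1 \<le> E (U, w, y)" for b :: bool using es_bool[of b] ed eg by (simp add: E_def)
   obtain t1 where t1: "t1 \<le> \<sigma> (?s j)" "ev (wsets tk) F (enc (?s j), i, []) (enc (?q, ?s j), i, []) t1"
    using ev_rn[OF F(2)[of "?s j"], of "wsets tk" i "[]"] by auto
   obtain t2 where t2: "t2 \<le> length ?q * 100 + 2" "ev (wsets tk) FSend (enc (?q, ?s j), i, []) (enc ([] :: bits, ?s j), i, [] @ ?q) t2"
    using ev_send by blast
   let ?a = "ext tk w (greedy tk w j @ [True])"
   have 3: "ev (wsets tk) (FPair FAsk FTl) (enc ([] :: bits, ?s j), i, ?q) (enc (?a, ?s j), i, []) (1 + 1 + 9)"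
    using ev_Pair[OF ev_Ask[of "wsets tk" "enc ([] :: bits, ?s j)" i ?q] ev_Tl] wsets_query[OF U, of "greedy tk w j @ [True]"]
    by (simp add: enc_bool_def)
   have g: "?g (?a, ?s j) = ?s (Suc j)" using j by (simp add: drop_Suc tl_drop)
   obtain t4 where t4: "t4 \<le> \<rho> (?a, ?s j)" "ev (wsets tk) G (enc (?a, ?s j), i, []) (enc (?s (Suc j)), i, []) t4"
    using ev_rn[OF G(2)[of "(?a, ?s j)"], of "wsets tk" i "[]"] unfolding g by auto
   have "ev (wsets tk) ?H (?c j) (?c (Suc j)) (t1 + (t2 + (1 + 1 + 9 + t4)))"
    using ev_Comp[OF t1(2) ev_Comp[OF t2(2)[unfolded append_Nil] ev_Comp[OF 3 t4(2)]]] .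
   moreover have "t1 \<le> E (U, w, y) ^ k" using t1(1) k[of "?s j"] power_mono[OF e1, of k] by linarith
   moreover have "length ?q \<le> E (U, w, y) ^ m"
    using length_le_es[of ?q] m[of "?s j"] power_mono[OF e1, of m] by simp
   moreover have "t4 \<le> E (U, w, y) ^ l" using t4(1) l[of "(?a, ?s j)"] power_mono[OF e2[of ?a], of l] by linarith
   ultimately show ?thesis using t2(1) by (intro exI[of _ "t1 + (t2 + (1 + 1 + 9 + t4))"]) (simp add: T_def)
  qed
  then have "\<exists>t\<le>length U * (T (U, w, y) + 4) + 2. ev (wsets tk) (FWhile ?H) (?c 0) (?c (length U)) t"
   by (intro ev_loop) auto
  then show ?thesis by (simp add: \<tau>_def)
 qed
 have "pbound \<tau>" unfolding \<tau>_def T_def E_def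
  by (intro pbound_intros pbound_es pbound_length poly_intros)
 then show ?thesis using r by (intro exI[of _ "FWhile ?H"] exI[of _ \<tau>]) blast
qed

text \<open>The function \<open>K + sL tk K\<close> is strictly increasing, so the total length
  determines the cut. Strings of other lengths get the cut 0, for which the size of the table is a
  constant.\<close>

definition wsplit :: "bits => bits => nat" where
 "wsplit tk z = (case filter (%K. K + sL tk K = length z) [0..<length z] of [] => 0 | K # _ => K)"

lemma wsplit_Cons:
 assumes "filter (%K. K + sL tk K = length z) [0..<length z] = K # l"
 shows "K + sL tk K = length z" "K < length z"
proof -
 have "K \<in> set (filter (%K. K + sL tk K = length z) [0..<length z])" unfolding assms by simp
 then show "K + sL tk K = length z" "K < length z" by simp_all
qed

lemma wsplit_bound: "sL tk (wsplit tk z) \<le> length z + sn tk 0"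
proof (cases "filter (%K. K + sL tk K = length z) [0..<length z]")
 case (Cons K l)
 then show ?thesis using wsplit_Cons(1)[OF Cons] by (simp add: wsplit_def)
qed (simp add: wsplit_def sL_def)

lemma wsplit_append: "length y = sL tk (length w) ==> wsplit tk (w @ y) = length w"
proof -
 assume y: "length y = sL tk (length w)"
 have u: "K = length w" if "K + sL tk K = length (w @ y)" for K
 proof (rule ccontr)
  assume "K \<noteq> length w"
  then consider "K < length w" | "K > length w" by linarith
  then show False by cases (use that y in \<open>auto simp: sL_def sn_def\<close>)
 qed
 have "length w \<in> set (filter (%K. K + sL tk K = length (w @ y)) [0..<length (w @ y)])"
  using y by (simp add: sL_def sn_def)
 then have "filter (%K. K + sL tk K = length (w @ y)) [0..<length (w @ y)] \<noteq> []" by (metis empty_iff list.set(1))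
 then obtain K l where K: "filter (%K. K + sL tk K = length (w @ y)) [0..<length (w @ y)] = K # l"
  unfolding neq_Nil_conv by blast
 then have "K = length w" using u wsplit_Cons(1)[OF K] by blast
 then show ?thesis unfolding wsplit_def K by simp
qed

lemma witlang_iff:
 "z \<in> witlang tk \<longleftrightarrow> (let K = wsplit tk z; w = take K z; y = drop K z in
   length y = sL tk (length w) \<and> lk (greedy tk w (2 ^ sL tk (length w))) y)"
proof
 assume "z \<in> witlang tk"
 then obtain w y where z: "z = w @ y" "length y = sL tk (length w)" "lk (greedy tk w (2 ^ sL tk (length w))) y"
  by (auto simp: witlang_def)
 then show "let K = wsplit tk z; w = take K z; y = drop K z in
   length y = sL tk (length w) \<and> lk (greedy tk w (2 ^ sL tk (length w))) y"
  using wsplit_append[OF z(2)] by (simp add: Let_def)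
next
 assume a: "let K = wsplit tk z; w = take K z; y = drop K z in
   length y = sL tk (length w) \<and> lk (greedy tk w (2 ^ sL tk (length w))) y"
 show "z \<in> witlang tk" unfolding witlang_def mem_Collect_eq
  by (rule exI[of _ "take (wsplit tk z) z"], rule exI[of _ "drop (wsplit tk z) z"]) (use a in \<open>auto simp: Let_def\<close>)
qed

lemma poly_wsplit [poly_intros]: assumes "poly f" shows "poly (%x. wsplit tk (f x))"
 by (rule poly_comp[OF _ assms]) (unfold wsplit_def, intro poly_intros)

text \<open>The table has \<open>2 ^ L\<close> entries with \<open>L\<close> linear in the input
  length. There is one query per entry, of length polynomial in \<open>2 ^ L\<close>, which
  altogether gives time exponential in a linear function.\<close>

lemma witlang_E_NP: "witlang tk \<in> class_E_NP"
proof -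
 define f1 where "f1 = (%s :: bool \<times> bits. (sL tk (wsplit tk (rev (snd s))), [Lf], take (wsplit tk (rev (snd s))) (rev (snd s)), drop (wsplit tk (rev (snd s))) (rev (snd s))))"
 have "poly f1" unfolding f1_def by (intro poly_intros)
 then obtain F1 t1 where F1: "pbound t1" "\<And>s. rn F1 (enc s) (enc (f1 s)) (t1 s)" using poly_run by blast
 obtain F2 t2 where F2: "pbound t2" "\<And>n (r :: bits \<times> bits). rn F2 (enc (n, [Lf], r)) (enc (0 :: nat, replicate (2 ^ n) Lf, r))
   (t2 (n, replicate (2 ^ n) Lf, r))" using double_run by blast
 have "poly (%s :: nat \<times> tree list \<times> bits \<times> bits. (fst (snd s), [] :: bits, snd s))" by (intro poly_intros)
 then obtain F3 t3 where F3: "pbound t3" "\<And>s :: nat \<times> tree list \<times> bits \<times> bits. rn F3 (enc s) (enc (fst (snd s), [] :: bits, snd s)) (t3 s)"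
  using poly_run by blast
 obtain F4 t4 where F4: "pbound t4" "\<And>(U :: tree list) w (y :: bits) i. length U = 2 ^ sL tk (length w) ==>
   \<exists>t\<le>t4 (U, w, y). ev (wsets tk) F4 (enc (U, [] :: bits, U, w, y), i, []) (enc ([] :: tree list, greedy tk w (length U), U, w, y), i, []) t"
  using greedy_run[of tk] by blast
 define f5 where "f5 = (%s :: wstate. length (snd (snd (snd (snd s)))) = sL tk (length (fst (snd (snd (snd s))))) \<and> lk (fst (snd s)) (snd (snd (snd (snd s)))))"
 have "poly f5" unfolding f5_def by (intro poly_intros)
 then obtain F5 t5 where F5: "pbound t5" "\<And>s. rn F5 (enc s) (enc (f5 s)) (t5 s)" using poly_run by blast
 obtain k1 where k1: "\<And>s. t1 s \<le> (es s + 1) ^ k1" using F1(1) unfolding pbound_def by blast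
 obtain k2 where k2: "\<And>s. t2 s \<le> (es s + 1) ^ k2" using F2(1) unfolding pbound_def by blast
 obtain k3 where k3: "\<And>s. t3 s \<le> (es s + 1) ^ k3" using F3(1) unfolding pbound_def by blast
 obtain k4 where k4: "\<And>s. t4 s \<le> (es s + 1) ^ k4" using F4(1) unfolding pbound_def by blast
 obtain k5 where k5: "\<And>s. t5 s \<le> (es s + 1) ^ k5" using F5(1) unfolding pbound_def by blast
 define k where "k = k1 + k2 + k3 + k4 + k5 + 1"
 let ?F = "FComp FAll (FComp F1 (FComp F2 (FComp F3 (FComp F4 F5))))"
 let ?P = "ram_of (fcode 0 ?F)"
 define s0 where "s0 = sn tk 0"
 \<comment> \<open>Exponent of \<open>2 ^ 22 * (Y ^ k) ^ 2\<close>: each phase takes at most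
   \<open>Y ^ k\<close> steps with \<open>Y = 2 ^ (n + s0 + 10)\<close>, the compilation squares the
   total, and the constant \<open>50 * 36\<close> is absorbed in \<open>2 ^ 22\<close>.\<close>
 define G where "G = (%n. 22 + (n + s0 + 10) * (2 * k))"
 have main: "\<exists>t. computes_in ?P (wsets tk) z (of_bool (z \<in> witlang tk)) t \<and> real t \<le> 2 powr real (G (length z))" for z
 proof -
  define K where "K = wsplit tk z"
  define w where "w = take K z"
  define y where "y = drop K z"
  define n where "n = sL tk K"
  define U where "U = replicate (2 ^ n) Lf"
  define p where "p = greedy tk w (length U)"
  have Kz: "K \<le> length z"
  proof (cases "filter (%K. K + sL tk K = length z) [0..<length z]")
   case (Cons j l)
   then show ?thesis using wsplit_Cons(2)[OF Cons] by (simp add: K_def wsplit_def)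
  qed (simp add: K_def wsplit_def)
  have lw: "length w = K" using Kz by (simp add: w_def)
  have lU: "length U = 2 ^ sL tk (length w)" by (simp add: U_def lw n_def)
  have f1: "f1 (False, rev z) = (n, [Lf], w, y)" by (simp add: f1_def K_def[symmetric] n_def w_def y_def)
  have f5: "f5 ([], p, U, w, y) \<longleftrightarrow> z \<in> witlang tk"
   unfolding witlang_iff Let_def K_def[symmetric] unfolding w_def[symmetric] y_def[symmetric]
   by (simp only: f5_def p_def lU fst_conv snd_conv)
  obtain u0 where u0: "u0 \<le> length z * 100 + 50" "ev (wsets tk) FAll (Lf, z, []) (enc (False, rev z), [], []) u0" using ev_all by blast
  obtain u1 where u1: "u1 \<le> t1 (False, rev z)" "ev (wsets tk) F1 (enc (False, rev z), [], []) (enc (n, [Lf], w, y), [], []) u1"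
   using ev_rn[OF F1(2)[of "(False, rev z)"], of "wsets tk" "[]" "[]"] unfolding f1 by blast
  obtain u2 where u2: "u2 \<le> t2 (n, U, w, y)" "ev (wsets tk) F2 (enc (n, [Lf], w, y), [], []) (enc (0 :: nat, U, w, y), [], []) u2"
   using ev_rn[OF F2(2)[of n "(w, y)"], of "wsets tk" "[]" "[]"] unfolding U_def by blast
  obtain u3 where u3: "u3 \<le> t3 (0, U, w, y)" "ev (wsets tk) F3 (enc (0 :: nat, U, w, y), [], []) (enc (U, [] :: bits, U, w, y), [], []) u3"
   using ev_rn[OF F3(2)[of "(0, U, w, y)"], of "wsets tk" "[]" "[]"] unfolding fst_conv snd_conv by blast
  obtain u4 where u4: "u4 \<le> t4 (U, w, y)" "ev (wsets tk) F4 (enc (U, [] :: bits, U, w, y), [], []) (enc ([] :: tree list, p, U, w, y), [], []) u4"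
   using F4(2)[OF lU, of y "[]"] unfolding p_def by blast
  obtain u5 where u5: "u5 \<le> t5 ([], p, U, w, y)" "ev (wsets tk) F5 (enc ([] :: tree list, p, U, w, y), [], []) (enc (z \<in> witlang tk), [], []) u5"
   using ev_rn[OF F5(2)[of "([], p, U, w, y)"], of "wsets tk" "[]" "[]"] unfolding f5 by blast
  define u where "u = u0 + (u1 + (u2 + (u3 + (u4 + u5))))"
  have "ev (wsets tk) ?F (Lf, z, []) (enc (z \<in> witlang tk), [], []) u" unfolding u_def
   by (rule ev_Comp[OF u0(2) ev_Comp[OF u1(2) ev_Comp[OF u2(2) ev_Comp[OF u3(2) ev_Comp[OF u4(2) u5(2)]]]]])
  from ram_of_fn[OF this] obtain t where t: "computes_in ?P (wsets tk) z (of_bool (enc (z \<in> witlang tk) \<noteq> Lf)) t" "t \<le> 50 * (u + 30) ^ 2" by blast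
  \<comment> \<open>By \<open>wsplit_bound\<close> the exponent of the table size is at most this,
    also when no proper cut exists.\<close>
  define M where "M = length z + s0"
  define Y where "Y = (2 :: nat) ^ (M + 10)"
  have nM: "n \<le> M" using wsplit_bound[of tk z] by (simp add: n_def K_def M_def s0_def)
  have M2: "M + 1 \<le> 2 ^ M" by (simp add: Suc_leI)
  have "(2 :: nat) ^ n \<le> 2 ^ M" using nM by (intro power_increasing) auto
  moreover have eU: "es (replicate m Lf) = 2 * m + 1" for m by (induction m) (auto simp: es_def)
  ultimately have esU: "es U \<le> 2 * 2 ^ M + 1" unfolding U_def by simp
  have lUM: "length U \<le> 2 ^ M" using \<open>(2 :: nat) ^ n \<le> 2 ^ M\<close> by (simp add: U_def)
  have esw: "es w \<le> 4 * M + 1" using es_bits[of w] by (simp add: w_def M_def)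
  have esy: "es y \<le> 4 * M + 1" using es_bits[of y] by (simp add: y_def M_def)
  have esp: "es p \<le> 4 * 2 ^ M + 1" using es_bits[of p] lUM by (simp add: p_def)
  have Y: "Y = 1024 * 2 ^ M" by (simp add: Y_def power_add)
  have e1: "es (False, rev z) + 1 \<le> Y" using es_bits[of z] es_bool[of False] M2 unfolding Y M_def by simp
  have e2: "es (n, U, w, y) + 1 \<le> Y" using nM esU esw esy M2 unfolding Y by simp
  have e3: "es (0 :: nat, U, w, y) + 1 \<le> Y" using esU esw esy M2 unfolding Y by simp
  have e4: "es (U, w, y) + 1 \<le> Y" using esU esw esy M2 unfolding Y by simp
  have e5: "es ([] :: tree list, p, U, w, y) + 1 \<le> Y" using esU esw esy esp M2 unfolding Y by simp
  have Y1: "1 \<le> Y" by (simp add: Y_def)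
  have up: "x \<le> Y ^ k" if "x \<le> a" "a \<le> (e + 1) ^ j" "e + 1 \<le> Y" "j \<le> k" for x a e j
   using that power_mono[OF that(3), of j] power_increasing[OF that(4) Y1] by (meson le_trans zero_le)
  have "u1 \<le> Y ^ k" by (rule up[OF u1(1) k1 e1]) (simp add: k_def)
  moreover have "u2 \<le> Y ^ k" by (rule up[OF u2(1) k2 e2]) (simp add: k_def)
  moreover have "u3 \<le> Y ^ k" by (rule up[OF u3(1) k3 e3]) (simp add: k_def)
  moreover have "u4 \<le> Y ^ k" by (rule up[OF u4(1) k4 e4]) (simp add: k_def)
  moreover have "u5 \<le> Y ^ k" by (rule up[OF u5(1) k5 e5]) (simp add: k_def)
  moreover have "u0 + 30 \<le> Y ^ k"
  proof -
   have "u0 + 30 \<le> Y" using u0(1) M2 unfolding Y M_def by simp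
   also have "\<dots> \<le> Y ^ k" using power_increasing[of 1 k Y] Y1 by (simp add: k_def)
   finally show ?thesis .
  qed
  ultimately have "u + 30 \<le> 6 * Y ^ k" unfolding u_def by linarith
  then have "(u + 30) ^ 2 \<le> (6 * Y ^ k) ^ 2" by (intro power_mono) auto
  then have "t \<le> 50 * (6 * Y ^ k) ^ 2" using t(2) by linarith
  also have "\<dots> = 1800 * (Y ^ k) ^ 2" by (simp add: power_mult_distrib)
  also have "\<dots> \<le> 2 ^ 22 * (Y ^ k) ^ 2" by (intro mult_le_mono1) simp
  also have "(Y ^ k) ^ 2 = 2 ^ ((length z + s0 + 10) * (2 * k))"
   unfolding Y_def M_def by (simp only: power_mult[symmetric]) (simp add: algebra_simps)
  finally have "t \<le> 2 ^ G (length z)" by (simp add: G_def power_add)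
  then have "real t \<le> 2 ^ G (length z)" by (metis of_nat_le_iff of_nat_numeral of_nat_power)
  then show ?thesis using t(1) by (auto simp: powr_realpow)
 qed
 have "(%n. real (G n)) \<in> O(%n. real n)"
 proof (rule bigoI[where c = "real (G 1)"])
  have "real (G n) \<le> real (G 1) * real n" if "n \<ge> 1" for n
  proof -
   have "G n \<le> G 1 * n" using that unfolding G_def by (cases n) (auto simp: algebra_simps)
   then show ?thesis by (metis of_nat_le_iff of_nat_mult)
  qed
  then show "\<forall>\<^sub>F n in at_top. norm (real (G n)) \<le> real (G 1) * norm (real n)"
   by (intro eventually_sequentiallyI[of 1]) simp
 qed
 then show ?thesis unfolding class_E_NP_def decides_in_time_def using main wsets_NP[of tk]
  by (intro CollectI bexI[of _ "wsets tk"] exI[of _ ?P] bexI[of _ "%n. real (G n)"]) auto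
qed

section \<open>The contradiction\<close>

lemma exec_det: "exec P A x c v t ==> exec P A x c v' t' ==> v' = v"
proof (induction arbitrary: v' t' rule: exec.induct)
 case (halt pc M q)
 from halt(2) show ?case by cases (use halt(1) in auto)
next
 case (step pc M q v t)
 from step.prems show ?case by cases (use step.hyps(1) step.IH in auto)
qed

text \<open>The inequality ln z <= z - 1, applied to the fourth root z of the argument, makes the
  logarithm O(K ^ (1/4)), far below sqrt K.\<close>

lemma log_le_sqrt:
 fixes s :: real and T :: nat
 assumes s: "s > 0"
 shows "\<exists>K0. \<forall>K\<ge>K0. log 2 (20 * real K + real T + 1) \<le> s / 2 * sqrt (real K) \<and> K \<ge> 1"
proof (intro exI allI impI)
 fix K :: nat
 \<comment> \<open>With r the fourth root of K, the logarithm will be at most \<open>24 * r\<close>,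
   and this is at most \<open>s / 2 * (r * r)\<close> once r reaches \<open>48 / s\<close>.\<close>
 assume "K \<ge> nat \<lceil>(48 / s) ^ 4\<rceil> + T + 1"
 then have K: "nat \<lceil>(48 / s) ^ 4\<rceil> \<le> K" "T + 1 \<le> K" by linarith+
 define r where "r = sqrt (sqrt (real K))"
 define z where "z = sqrt (sqrt (20 * real K + real T + 1))"
 have "((48 / s)\<^sup>2)\<^sup>2 = (48 / s) ^ 4" by (simp only: power_mult[symmetric]) simp
 also have "\<dots> \<le> real K" using K(1) by linarith
 finally have "(48 / s)\<^sup>2 \<le> sqrt (real K)" by (rule real_le_rsqrt)
 then have r: "48 / s \<le> r" unfolding r_def by (rule real_le_rsqrt)
 have rr: "sqrt (real K) = r * r" by (simp add: r_def)
 have "real (T + 1) \<le> real K" using K(2) by (simp only: of_nat_le_iff)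
 \<comment> \<open>81 is a convenient upper bound because its fourth root is 3.\<close>
 then have "20 * real K + real T + 1 \<le> 81 * real K" by simp
 then have "z \<le> sqrt (sqrt (81 * real K))" unfolding z_def by simp
 also have "\<dots> = sqrt (sqrt 81) * r" by (simp add: real_sqrt_mult r_def)
 also have "sqrt 81 = sqrt ((9 :: real)\<^sup>2)" by simp
 also have "sqrt ((9 :: real)\<^sup>2) = 3\<^sup>2" by (subst real_sqrt_abs) simp
 also have "sqrt ((3 :: real)\<^sup>2) = 3" by (subst real_sqrt_abs) simp
 finally have z3: "z \<le> 3 * r" .
 have z0: "z > 0" unfolding z_def by (simp add: add_nonneg_pos)
 have "z ^ 4 = (z\<^sup>2)\<^sup>2" by (simp only: power_mult[symmetric]) simp
 also have "\<dots> = 20 * real K + real T + 1" by (simp add: z_def)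
 finally have z4: "z ^ 4 = 20 * real K + real T + 1" .
 have "ln (z ^ 4) = 4 * ln z" using z0 by (simp add: ln_realpow)
 also have "\<dots> \<le> 4 * z" using ln_le_minus_one[OF z0] by simp
 finally have l4: "ln (z ^ 4) \<le> 4 * z" .
 have "ln (1 / 2 :: real) \<le> 1 / 2 - 1" by (rule ln_le_minus_one) simp
 then have l2: "1 / 2 \<le> ln (2 :: real)" by (simp add: ln_div)
 have "log 2 (z ^ 4) = ln (z ^ 4) / ln 2" by (simp add: log_def)
 also have "\<dots> \<le> 4 * z / (1 / 2)" using l4 l2 z0 by (intro order_trans[OF divide_right_mono[OF l4]] divide_left_mono) auto
 finally have "log 2 (z ^ 4) \<le> 8 * z" by simp
 also have "\<dots> \<le> 24 * r" using z3 by simp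
 also have "\<dots> \<le> s / 2 * (r * r)"
 proof -
  have "48 \<le> s * r" using r s by (simp add: field_simps)
  moreover have "r \<ge> 0" by (simp add: r_def)
  ultimately have "48 * r \<le> (s * r) * r" by (rule mult_right_mono)
  then show ?thesis by simp
 qed
 finally show "log 2 (20 * real K + real T + 1) \<le> s / 2 * sqrt (real K) \<and> K \<ge> 1" using K(2) unfolding z4 rr by simp
qed

text \<open>In the exponent of 2, the polynomial factor costs \<open>A * l\<close> with l = log Z,
  and the saving is about \<open>c * K / (a * l)\<close>. The saving wins as soon as
  \<open>l * l\<close> is below a small multiple of K, which a large q ensures. The number
  \<open>T\<close> is quantified after q because it will involve the length of a token that contains
  q.\<close>

lemma growth:
 fixes c :: real and a A :: nat
 assumes c: "0 < c" and a: "1 \<le> a"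
 shows "\<exists>q\<ge>1. \<forall>T :: nat. \<exists>K0. \<forall>K\<ge>K0. \<forall>(Z :: nat) (x :: nat). real x \<le> sqrt (real (K + 1)) / real q --> 2 \<le> Z -->
  Z \<le> 2 ^ x * (20 * K + T) --> real Z ^ A * 2 powr (real (K + 1) * (1 - c / (real a * log 2 (real Z)))) < 2 ^ K"
proof -
 \<comment> \<open>Chosen so that \<open>l * l < d * K\<close> amounts to
   \<open>(A + 1) * l < c * K / (a * l)\<close>. One surplus l, being at least 1, pays for the step
   from K + 1 to K.\<close>
 define d where "d = c / (real (A + 1) * real a)"
 have d: "d > 0" using c a by (simp add: d_def)
 \<comment> \<open>Then x contributes at most 3/2 * 1/4 = 3/8 of sqrt(d K) to l, and
   \<open>log_le_sqrt\<close> adds one half: 7/8 in total.\<close>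
 define q where "q = nat \<lceil>4 / sqrt d\<rceil>"
 have q4: "real q \<ge> 4 / sqrt d" unfolding q_def by linarith
 have "4 / sqrt d > 0" using d by simp
 then have q0: "real q > 0" using q4 by linarith
 then have q1: "q \<ge> 1" by simp
 have qd: "1 / real q \<le> sqrt d / 4" using q4 q0 d by (simp add: field_simps)
 have "\<exists>K0. \<forall>K\<ge>K0. \<forall>(Z :: nat) (x :: nat). real x \<le> sqrt (real (K + 1)) / real q --> 2 \<le> Z -->
  Z \<le> 2 ^ x * (20 * K + T) --> real Z ^ A * 2 powr (real (K + 1) * (1 - c / (real a * log 2 (real Z)))) < 2 ^ K" for T :: nat
 proof -
  define s where "s = sqrt d"
  have s: "s > 0" using d by (simp add: s_def)
  obtain K0 where K0: "\<And>K. K \<ge> K0 ==> log 2 (20 * real K + real T + 1) \<le> s / 2 * sqrt (real K) \<and> K \<ge> 1"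
   using log_le_sqrt[OF s, of T] by blast
  have "real Z ^ A * 2 powr (real (K + 1) * (1 - c / (real a * log 2 (real Z)))) < 2 ^ K"
   if K: "K \<ge> K0" and x: "real x \<le> sqrt (real (K + 1)) / real q" and Z: "2 \<le> Z" "Z \<le> 2 ^ x * (20 * K + T)" for K x Z
  proof -
   define l where "l = log 2 (real Z)"
   have l1: "l \<ge> 1" using Z(1) by (simp add: l_def le_log_iff)
   have Zl: "real Z = 2 powr l" using Z(1) by (simp add: l_def)
   have K1: "K \<ge> 1" using K0[OF K] by simp
   have sk: "sqrt (real K) > 0" using K1 by simp
   have "real Z \<le> real (2 ^ x * (20 * K + T))" using Z(2) of_nat_le_iff by blast
   also have "\<dots> \<le> 2 ^ x * (20 * real K + real T + 1)" by simp
   finally have "l \<le> log 2 (2 ^ x * (20 * real K + real T + 1))" unfolding l_def using Z(1) by (intro log_mono) auto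
   also have "\<dots> = real x + log 2 (20 * real K + real T + 1)"
    by (subst log_mult) (auto simp: add_nonneg_pos log_nat_power)
   also have "\<dots> \<le> real x + s / 2 * sqrt (real K)" using K0[OF K] by simp
   finally have l: "l \<le> real x + s / 2 * sqrt (real K)" .
   have "sqrt (real (K + 1)) \<le> 3 / 2 * sqrt (real K)"
    by (rule real_le_lsqrt) (use K1 in \<open>auto simp: power_mult_distrib power2_eq_square\<close>)
   then have "sqrt (real (K + 1)) * (1 / real q) \<le> (3 / 2 * sqrt (real K)) * (s / 4)"
    using qd s sk unfolding s_def[symmetric] by (intro mult_mono) auto
   moreover have "sqrt (real (K + 1)) * (1 / real q) = sqrt (real (K + 1)) / real q" by simp
   ultimately have "real x \<le> (3 / 2 * sqrt (real K)) * (s / 4)" using x by linarith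
   then have "l \<le> 7 / 8 * (s * sqrt (real K))" using l by (simp add: mult_ac)
   also have "\<dots> < s * sqrt (real K)" using s sk by simp
   finally have ls: "l < s * sqrt (real K)" .
   have "l\<^sup>2 < (s * sqrt (real K))\<^sup>2" using ls l1 by (intro power_strict_mono) auto
   also have "\<dots> = d * real K" using d by (simp add: power_mult_distrib s_def)
   finally have l2: "l * l < d * real K" by (simp add: power2_eq_square)
   have pos: "real (A + 1) * real a > 0" using a by simp
   have "real (A + 1) * real a * (l * l) < real (A + 1) * real a * (d * real K)" using l2 pos by (intro mult_strict_left_mono)
   also have "\<dots> = c * real K" using a by (simp add: d_def)
   finally have "(real (A + 1) * l) * (real a * l) < c * real K" by (simp add: mult_ac)
   moreover have al: "real a * l > 0" using a l1 by simp
   ultimately have "real (A + 1) * l < c * real K / (real a * l)" by (simp add: pos_less_divide_eq)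
   also have "\<dots> \<le> c * real (K + 1) / (real a * l)" using c al by (intro divide_right_mono mult_left_mono) auto
   finally have "real A * l + 1 < c * real (K + 1) / (real a * l)" using l1 by (simp add: distrib_right)
   then have ex: "real A * l + real (K + 1) * (1 - c / (real a * l)) < real K" by (simp add: algebra_simps)
   have "real Z ^ A = 2 powr (real A * l)" unfolding Zl by (simp add: powr_power mult.commute)
   then have "real Z ^ A * 2 powr (real (K + 1) * (1 - c / (real a * l))) = 2 powr (real A * l + real (K + 1) * (1 - c / (real a * l)))"
    by (simp add: powr_add)
   also have "\<dots> < 2 powr real K" using ex by simp
   finally show ?thesis unfolding l_def by (simp add: powr_realpow)
  qed
  then show ?thesis by blast
 qed
 then show ?thesis using q1 by blast
qed

section \<open>The sizes used by the verifier\<close>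

lemma length_filter_upt: "length (filter Q [0..<n]) = card {i. i < n \<and> Q i}"
proof -
 have "{i. Q i} \<inter> set [0..<n] = {i. i < n \<and> Q i}" by auto
 then show ?thesis using distinct_length_filter[of "[0..<n]" Q] by simp
qed

lemma sroot_bounds:
 assumes "q \<ge> 1"
 shows "real (sroot q K) \<le> sqrt (real K) / real q" "sqrt (real K) / real q - 1 \<le> real (sroot q K)"
proof -
 define m where "m = nat \<lfloor>sqrt (real K) / real q\<rfloor>"
 have nn: "sqrt (real K) / real q \<ge> 0" by simp
 have m: "real m \<le> sqrt (real K) / real q" "sqrt (real K) / real q < real m + 1" using nn unfolding m_def by linarith+
 have iff: "q * Suc x * (q * Suc x) \<le> K \<longleftrightarrow> x < m" for x
 proof -
  have "q * Suc x * (q * Suc x) \<le> K \<longleftrightarrow> (real (q * Suc x))\<^sup>2 \<le> real K"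
   unfolding power2_eq_square of_nat_mult[symmetric] of_nat_le_iff ..
  also have "\<dots> \<longleftrightarrow> real (q * Suc x) \<le> sqrt (real K)" by (metis of_nat_0_le_iff real_le_rsqrt real_sqrt_le_iff real_sqrt_abs abs_of_nat)
  also have "\<dots> \<longleftrightarrow> real (Suc x) \<le> sqrt (real K) / real q" using assms by (simp add: field_simps)
  also have "\<dots> \<longleftrightarrow> x < m" using m by linarith
  finally show ?thesis .
 qed
 have "m \<le> K"
 proof (cases m)
  case (Suc x)
  then have "q * Suc x * (q * Suc x) \<le> K" using iff[of x] by simp
  moreover have "1 * Suc x * (1 * 1) \<le> q * Suc x * (q * Suc x)" using assms by (intro mult_le_mono) auto
  ultimately show ?thesis using Suc by simp
 qed simp
 have "sroot q K = length (filter (%x. x < m) [0..<K])" unfolding sroot_def iff ..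
 also have "\<dots> = card {x. x < K \<and> x < m}" by (rule length_filter_upt)
 also have "{x. x < K \<and> x < m} = {..<m}" using \<open>m \<le> K\<close> by auto
 finally have "sroot q K = m" by simp
 then show "real (sroot q K) \<le> sqrt (real K) / real q" "sqrt (real K) / real q - 1 \<le> real (sroot q K)" using m by simp_all
qed

lemma sroot_mono: "K \<le> K' ==> sroot q K \<le> sroot q K'"
proof -
 assume K: "K \<le> K'"
 have "sroot q K = card {x. x < K \<and> q * Suc x * (q * Suc x) \<le> K}" for K
  unfolding sroot_def by (rule length_filter_upt)
 moreover have "card {x. x < K \<and> q * Suc x * (q * Suc x) \<le> K} \<le> card {x. x < K' \<and> q * Suc x * (q * Suc x) \<le> K'}"
  using K by (intro card_mono) auto
 ultimately show ?thesis by simp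
qed

lemma sgates_eq:
 assumes "x \<le> n"
 shows "sgates (replicate (2 ^ n) Lf) x = 2 ^ x"
proof -
 have p: "(2 :: nat) ^ x \<le> 2 ^ n" using assms by (intro power_increasing) auto
 have "i < 2 ^ n" if "i < 2 ^ x" for i :: nat using that p by (rule less_le_trans)
 then have e: "{i. i < 2 ^ n \<and> length (nb i) \<le> x} = {..<2 ^ x}"
  by (auto simp: length_nb floorlog_le_iff)
 have "sgates (replicate (2 ^ n) Lf) x = card {i. i < 2 ^ n \<and> length (nb i) \<le> x}"
  unfolding sgates_def length_replicate by (rule length_filter_upt)
 then show ?thesis unfolding e by simp
qed

lemma start_eq: "start (replicate m True @ False # v) = Suc m"
proof -
 let ?w = "replicate m True @ False # v"
 have "(\<forall>b\<in>set (take (Suc i) ?w). b) \<longleftrightarrow> i < m" for i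
 proof (cases "i < m")
  case False
  then have "take (Suc i) ?w = replicate m True @ False # take (i - m) v" by (simp add: Suc_diff_le)
  then show ?thesis using False by simp
 qed (auto)
 then have "start ?w = Suc (length (filter (%i. i < m) [0..<length ?w]))" unfolding start_def by presburger
 also have "length (filter (%i. i < m) [0..<length ?w]) = card {i. i < length ?w \<and> i < m}"
  by (rule length_filter_upt)
 also have "{i. i < length ?w \<and> i < m} = {..<m}" by auto
 finally show ?thesis by simp
qed

lemma length_cnf_code: "length F \<le> length (cnf_code n F)"
proof -
 have "length F \<le> length (concat (map clause_code F))"
 proof (induction F)
  case (Cons C F)
  have "1 \<le> length (clause_code C)" by (simp add: clause_code_def)
  then show ?case using Cons by simp
 qed simp
 then show ?thesis by (simp add: cnf_code_def)
qed

lemma max_sat_le: "max_sat F \<le> length F"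
 unfolding max_sat_def by (rule Max.boundedI) (auto intro: finite_subset[of _ "{..length F}"])

lemma bex_concat_map: "(\<exists>j\<in>set (concat (map (%x. map f (h x)) xs)). Q j) \<longleftrightarrow> (\<exists>x\<in>set xs. \<exists>y\<in>set (h x). Q (f y))"
 by auto

locale stages =
 fixes V :: fn and q :: nat
 assumes V: "noask V"
begin

text \<open>The verifier is built for arbitrary tokens; handing it the token with its own code
  closes the circle.\<close>

definition "tk = token q (map icode_of (fcode 0 V))"

lemma stage_families:
 assumes "length w \<ge> 1" "fam \<in> set (stage tk w)"
 shows "length fam \<le> 5" "l \<in> set fam ==> length (fst l) = sL tk (length w)"
  "l \<in> set fam ==> length w \<le> i ==> i < sL tk (length w) ==> fst (fst l ! i)"
proof -
 have n: "4 * length w + 3 * length tk + 3 * length w + flen V + 40 \<le> sn tk (length w)"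
  by (simp add: sn_def tk_def)
 have f: "fam \<in> set (stage_csp (length w) (sn tk (length w)) (map icode_of (fcode 0 V)) tk w)"
  using assms(2) by (simp add: stage_def) (simp add: tk_def)
 note s = stage_csp_families[OF V assms(1) n f]
 show "length fam \<le> 5" by (rule s(1))
 show "l \<in> set fam ==> length (fst l) = sL tk (length w)" using s(2) by (simp add: sL_def)
 show "l \<in> set fam ==> length w \<le> i ==> i < sL tk (length w) ==> fst (fst l ! i)" using s(3) by (simp add: sL_def)
qed

text \<open>A variable of the formula is a position where the pattern has no constant, hence a
  position inside \<open>w\<close>.\<close>

lemma slots_cnf_on:
 assumes w: "length w \<ge> 1" and D: "struct s (sL tk (length w)) D" and f: "fam \<in> set (stage tk w)" "S \<in> set (tuples D fam)"
 shows "cnf_on (length w) (slots_cnf S)"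
proof -
 have "fst l < length w" if l: "p \<in> set S" "u \<in> set (fst p)" "l \<in> set u" for p u l
 proof -
  obtain k where k: "p \<in> set (pick D fam k)" using tuples_pick[OF f(2) l(1)] by blast
  have "drop k fam \<noteq> []" using k l(2) by (auto simp: pick_def)
  then obtain m r where mr: "drop k fam = m # r" by (cases "drop k fam") auto
  have m: "m \<in> set fam" using mr by (metis in_set_dropD list.set_intros(1))
  have "p \<in> set (choices D m)" using k by (simp add: pick_def mr)
  then have "fst p = rgates (fst D) (fst m)" by (auto simp: choices_def Let_def simp del: upt_Suc)
  then obtain g where g: "g \<in> set (fst D)" "u = lits g (fst m)" using l(2) by (auto simp: rgates_def)
  have lg: "length g = sL tk (length w)" using D g(1) by (simp add: struct_def)
  have "zip (zip g (fst m)) [0..<length g] = map (%i. ((g ! i, fst m ! i), i)) [0..<length g]"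
   using stage_families(2)[OF w f(1) m] lg by (intro nth_equalityI) auto
  then have "fst l < length g \<and> \<not> fst (fst m ! fst l)" using l(3) unfolding g(2) lits_def by auto
  then show ?thesis using stage_families(3)[OF w f(1) m, of "fst l"] lg by (cases "length w \<le> fst l") auto
 qed
 then have v: "\<forall>p\<in>set S. \<forall>u\<in>set (fst p). \<forall>l\<in>set u. fst l < length w" by blast
 have "fst l < length w" if C: "C \<in> set (slots_cnf S)" and l: "l \<in> set C" for C l
 proof -
  have "\<exists>p\<in>set S. \<exists>u\<in>set (fst p). \<exists>m\<in>set u. fst m = fst l"
  proof -
   obtain p where p: "p \<in> set S" "C \<in> set (slot_cnf p)" using C l by (auto simp: slots_cnf_def)
   consider u v where "u \<in> set (fst p)" "v \<in> set (fst p)" "C = neg u @ neg v"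
    | u j where "u \<in> set (fst p)" "C = neg (take j u) @ take 1 (drop j u)"
    using p(2) by (auto simp: slot_cnf_def rw_def split: if_splits)
   then have "\<exists>u\<in>set (fst p). \<exists>m\<in>set u. fst m = fst l"
   proof cases
    case 1
    then have "l \<in> set (neg u) \<or> l \<in> set (neg v)" using l by simp
    then have "(\<exists>m\<in>set u. fst m = fst l) \<or> (\<exists>m\<in>set v. fst m = fst l)" by (force simp: neg_def)
    then show ?thesis using 1(1,2) by blast
   next
    case 2
    then have "l \<in> set (neg (take j u)) \<or> l \<in> set (take 1 (drop j u))" using l by simp
    moreover have "\<exists>m\<in>set (take j u). fst m = fst l" if "l \<in> set (neg (take j u))" using that by (force simp: neg_def)
    moreover have "l \<in> set u" if "l \<in> set (take 1 (drop j u))" using that by (meson in_set_takeD in_set_dropD)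
    ultimately have "\<exists>m\<in>set u. fst m = fst l" using in_set_takeD[of _ j u] by blast
    then show ?thesis using 2(1) by blast
   qed
   then show ?thesis using p(1) by blast
  qed
  then show ?thesis using v by metis
 qed
 then show ?thesis unfolding cnf_on_def by force
qed

lemma jobs_cnf:
 assumes w: "length w \<ge> 1" and D: "struct s (sL tk (length w)) D" and j: "j \<in> set (jobs tk w D)"
 shows "\<exists>F. fst j = cnf_code (length w) F \<and> cnf_on (length w) F \<and> 2 \<le> length F"
proof -
 obtain fam S where f: "fam \<in> set (stage tk w)" "S \<in> set (tuples D fam)" "fst j = cnf_code (length w) (slots_cnf S)"
  using j by (auto simp: jobs_def)
 moreover have "2 \<le> length (slots_cnf S)" by (simp add: slots_cnf_def)
 ultimately show ?thesis using slots_cnf_on[OF w D] by blast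
qed

text \<open>Instances have variables below the length of \<open>w\<close>, so \<open>val\<close> is
  their MAX-SAT value; then \<open>fam_ok_tuples\<close> translates a hit into a violated
  family.\<close>

lemma jobs_hit:
 assumes w: "length w \<ge> 1" and D: "struct s (sL tk (length w)) D"
  and val: "\<And>j n F. fst j = cnf_code n F ==> cnf_on n F ==> val j = max_sat F"
 shows "(\<exists>j\<in>set (jobs tk w D). nb (val j) = snd j) \<longleftrightarrow> \<not> sat (sL tk (length w)) (stage tk w) (deval D)"
proof -
 let ?j = "%S. (cnf_code (length w) (slots_cnf S), nb (length (slots_cnf S) - slots_loss S))"
 have v: "nb (val (?j S)) = snd (?j S) \<longleftrightarrow> max_sat (slots_cnf S) = length (slots_cnf S) - slots_loss S"
  if "fam \<in> set (stage tk w)" "S \<in> set (tuples D fam)" for fam S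
  using val[of "?j S" "length w" "slots_cnf S"] slots_cnf_on[OF w D that] by simp
 have "(\<exists>j\<in>set (jobs tk w D). nb (val j) = snd j) \<longleftrightarrow>
   (\<exists>fam\<in>set (stage tk w). \<exists>S\<in>set (tuples D fam). nb (val (?j S)) = snd (?j S))"
  unfolding jobs_def by (rule bex_concat_map)
 also have "\<dots> \<longleftrightarrow> (\<exists>fam\<in>set (stage tk w). \<exists>S\<in>set (tuples D fam). max_sat (slots_cnf S) = length (slots_cnf S) - slots_loss S)"
  using v by blast
 also have "\<dots> \<longleftrightarrow> (\<exists>fam\<in>set (stage tk w). \<not> fam_ok (deval D) (sL tk (length w)) fam)"
 proof -
  have "fam_ok (deval D) (sL tk (length w)) fam \<longleftrightarrow>
    (\<forall>S\<in>set (tuples D fam). max_sat (slots_cnf S) \<noteq> length (slots_cnf S) - slots_loss S)" if "fam \<in> set (stage tk w)" for fam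
   by (rule fam_ok_tuples) (use D stage_families[OF w that] in \<open>auto simp: struct_def\<close>)
  then show ?thesis by blast
 qed
 finally show ?thesis unfolding sat_def by blast
qed

lemma vjobs_cnf:
 assumes b: "length b = vcount U tk w" and j: "j \<in> set (vjobs U tk w b)"
 shows "\<exists>n F. fst j = cnf_code n F \<and> cnf_on n F \<and> 2 \<le> length F \<and> n \<le> Suc (length w)"
proof (cases "vdiag U tk w")
 case True
 have l: "length (take (start w) w) = start w" "length (drop (start w) w) = sD U tk (start w)" using True by (auto simp: vdiag_def)
 have "struct (sgates U (sroot (tkq tk) (start w))) (sL tk (length (take (start w) w))) (dD U tk (start w) (drop (start w) w))"
  unfolding dD_def l(1) sL_def by (rule struct_decodeD) (use l(2) in \<open>simp add: sD_def\<close>)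
 moreover have "length (take (start w) w) \<ge> 1" unfolding l(1) by (simp add: start_def)
 moreover have "length (take (start w) w) \<le> Suc (length w)" by simp
 ultimately show ?thesis using jobs_cnf[of "take (start w) w"] j True by (simp add: vjobs_def) blast
next
 case False
 let ?s = "sD U tk (Suc (length w))"
 have l: "length b = 2 * ?s" using b False by (simp add: vcount_def)
 have st: "struct (sgates U (sroot (tkq tk) (Suc (length w)))) (sL tk (length (w @ [c]))) (dD U tk (Suc (length w)) b')" if "length b' = ?s" for c b'
  unfolding dD_def length_append_singleton sL_def by (rule struct_decodeD) (use that in \<open>simp add: sD_def\<close>)
 have "j \<in> set (jobs tk (w @ [False]) (dD U tk (Suc (length w)) (take ?s b))) \<or> j \<in> set (jobs tk (w @ [True]) (dD U tk (Suc (length w)) (drop ?s b)))"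
  using j False by (simp add: vjobs_def Let_def)
 then show ?thesis
 proof
  assume "j \<in> set (jobs tk (w @ [False]) (dD U tk (Suc (length w)) (take ?s b)))"
  from jobs_cnf[OF _ st this] l show ?thesis by fastforce
 next
  assume "j \<in> set (jobs tk (w @ [True]) (dD U tk (Suc (length w)) (drop ?s b)))"
  from jobs_cnf[OF _ st this] l show ?thesis by fastforce
 qed
qed

text \<open>The universal quantifier over all circuits for the start word is spread over a binary
  tree: each inner node guesses correct circuits for its two children, which expresses a conjunction
  of acceptances. At a leaf the negation concerns the single circuit spelled out by the word and is
  checked without guessing.\<close>

lemma diagonal:
 assumes circ: "\<And>w. length w \<ge> K1 ==> \<exists>W. sat (sL tk (length w)) (stage tk w) W ==>
   \<exists>D. struct (2 ^ sroot q (length w)) (sL tk (length w)) D \<and> sat (sL tk (length w)) (stage tk w) (deval D)"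
  and run: "\<And>w U n. length w \<ge> K1 ==> U = replicate (2 ^ vx tk w) Lf ==> n = vcount U tk w ==>
   (\<exists>W. sat (sL tk (length w)) (stage tk w) W) \<longleftrightarrow>
   (\<exists>x. length x \<ge> n \<and> ((\<exists>j\<in>set (vjobs U tk w (take n x)). nb (val j) = snd j) = vdiag U tk w))"
  and val: "\<And>j n F. fst j = cnf_code n F ==> cnf_on n F ==> val j = max_sat F"
 shows False
proof -
 define A where "A = (%w. \<exists>W. sat (sL tk (length w)) (stage tk w) W)"
 define dec where "dec = (%K b. decodeD (2 ^ sroot q K) (sL tk K) b)"
 define S where "S = (%K. lenD (2 ^ sroot q K) (sL tk K))"
 have q: "tkq tk = q" by (simp add: tk_def)
 \<comment> \<open>The list \<open>U\<close> is made for words of length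
   \<open>Suc (length w)\<close>. As \<open>sroot\<close> is monotone, it is also long enough for
   the shorter start word.\<close>
 have sD: "sD U tk K = S K" "dD U tk K = dec K" if "U = replicate (2 ^ vx tk w) Lf" "K \<le> Suc (length w)" for U w K
 proof -
  have "sgates U (sroot q K) = 2 ^ sroot q K" unfolding that(1)
   by (rule sgates_eq) (use sroot_mono[OF that(2)] in \<open>simp add: vx_def q\<close>)
  then show "sD U tk K = S K" "dD U tk K = dec K" by (simp_all add: sD_def dD_def S_def dec_def q sL_def fun_eq_iff)
 qed
 have dst: "struct (2 ^ sroot q K) (sL tk K) (dec K b)" if "length b = S K" for K b
  unfolding dec_def by (rule struct_decodeD) (use that in \<open>simp add: S_def\<close>)
 have eqA: "A w \<longleftrightarrow> (\<exists>b. length b = S (length w) \<and> sat (sL tk (length w)) (stage tk w) (deval (dec (length w) b)))"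
  if w: "length w \<ge> K1" for w
 proof
  assume "A w"
  then obtain D where D: "struct (2 ^ sroot q (length w)) (sL tk (length w)) D" "sat (sL tk (length w)) (stage tk w) (deval D)"
   using circ[OF w] unfolding A_def by blast
  from decodeD_surj[OF D(1)] obtain b where "length b = S (length w)" "dec (length w) b = D" unfolding S_def dec_def by blast
  then show "\<exists>b. length b = S (length w) \<and> sat (sL tk (length w)) (stage tk w) (deval (dec (length w) b))" using D(2) by blast
 qed (auto simp: A_def)
 have hit: "(\<exists>j\<in>set (jobs tk w (dec (length w) b)). nb (val j) = snd j) \<longleftrightarrow> \<not> sat (sL tk (length w)) (stage tk w) (deval (dec (length w) b))"
  if "length w \<ge> 1" "length b = S (length w)" for w b
  by (rule jobs_hit[OF that(1) dst[OF that(2)] val])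
 \<comment> \<open>Long enough for \<open>circ\<close> and \<open>run\<close> to apply to it and to
   all its extensions.\<close>
 define w1 where "w1 = replicate K1 True @ [False]"
 define N where "N = S (Suc K1)"
 have lw1: "length w1 = Suc K1" by (simp add: w1_def)
 have start: "start (w1 @ v) = Suc K1" for v using start_eq[of K1 v] by (simp add: w1_def)
 have dg: "vdiag U tk (w1 @ v) \<longleftrightarrow> length v = N" if "U = replicate (2 ^ vx tk (w1 @ v)) Lf" for U v
  unfolding vdiag_def start using sD(1)[OF that, of "Suc K1"] by (simp add: lw1 N_def)
 have step: "A (w1 @ v) \<longleftrightarrow> A (w1 @ v @ [False]) \<and> A (w1 @ v @ [True])" if v: "length v < N" for v
 proof -
  let ?w = "w1 @ v"
  define U where "U = replicate (2 ^ vx tk ?w) Lf"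
  define s where "s = S (Suc (length ?w))"
  define K' where "K' = Suc (length ?w)"
  have nd: "\<not> vdiag U tk ?w" using dg[OF U_def] v by simp
  have n: "vcount U tk ?w = 2 * s" using nd sD(1)[OF U_def] by (simp add: vcount_def s_def)
  have lw: "length (?w @ [c]) = K'" for c by (simp add: K'_def)
  let ?ok = "%c b. sat (sL tk (length (?w @ [c]))) (stage tk (?w @ [c])) (deval (dec (length (?w @ [c])) b))"
  have vj: "(\<exists>j\<in>set (vjobs U tk ?w b). nb (val j) = snd j) \<longleftrightarrow> \<not> ?ok False (take s b) \<or> \<not> ?ok True (drop s b)" if b: "length b = 2 * s" for b
  proof -
   have "vjobs U tk ?w b = jobs tk (?w @ [False]) (dec (length (?w @ [False])) (take s b)) @ jobs tk (?w @ [True]) (dec (length (?w @ [True])) (drop s b))"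
    using nd sD[OF U_def, of "Suc (length ?w)"] by (simp add: vjobs_def Let_def s_def)
   moreover have "length (take s b) = S (length (?w @ [False]))" "length (drop s b) = S (length (?w @ [True]))"
    using b by (simp_all add: s_def)
   ultimately show ?thesis using hit[of "?w @ [False]" "take s b"] hit[of "?w @ [True]" "drop s b"] by (simp add: bex_Un)
  qed
  have "A ?w \<longleftrightarrow> (\<exists>x. length x \<ge> 2 * s \<and> ?ok False (take s (take (2 * s) x)) \<and> ?ok True (drop s (take (2 * s) x)))"
  proof -
   have "A ?w \<longleftrightarrow> (\<exists>x. length x \<ge> 2 * s \<and> \<not> (\<exists>j\<in>set (vjobs U tk ?w (take (2 * s) x)). nb (val j) = snd j))"
    using run[of ?w U "2 * s"] nd n U_def lw1 unfolding A_def by simp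
   also have "\<dots> \<longleftrightarrow> (\<exists>x. length x \<ge> 2 * s \<and> ?ok False (take s (take (2 * s) x)) \<and> ?ok True (drop s (take (2 * s) x)))"
   proof (intro ex_cong1 conj_cong refl)
    fix x :: bits assume "2 * s \<le> length x"
    then have "length (take (2 * s) x) = 2 * s" by simp
    from vj[OF this] show "\<not> (\<exists>j\<in>set (vjobs U tk ?w (take (2 * s) x)). nb (val j) = snd j) \<longleftrightarrow>
      ?ok False (take s (take (2 * s) x)) \<and> ?ok True (drop s (take (2 * s) x))" by blast
   qed
   finally show ?thesis .
  qed
  also have "\<dots> \<longleftrightarrow> (\<exists>b. length b = s \<and> ?ok False b) \<and> (\<exists>b. length b = s \<and> ?ok True b)"
  proof
   assume "\<exists>x. length x \<ge> 2 * s \<and> ?ok False (take s (take (2 * s) x)) \<and> ?ok True (drop s (take (2 * s) x))"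
   then obtain x where x: "length x \<ge> 2 * s" "?ok False (take s (take (2 * s) x))" "?ok True (drop s (take (2 * s) x))" by blast
   have "length (take s (take (2 * s) x)) = s" "length (drop s (take (2 * s) x)) = s" using x(1) by auto
   then show "(\<exists>b. length b = s \<and> ?ok False b) \<and> (\<exists>b. length b = s \<and> ?ok True b)" using x(2,3) by blast
  next
   assume "(\<exists>b. length b = s \<and> ?ok False b) \<and> (\<exists>b. length b = s \<and> ?ok True b)"
   then obtain b b' where b: "length b = s" "?ok False b" "length b' = s" "?ok True b'" by blast
   have "take (2 * s) (b @ b') = b @ b'" "take s (b @ b') = b" "drop s (b @ b') = b'" "length (b @ b') \<ge> 2 * s" using b by auto
   then show "\<exists>x. length x \<ge> 2 * s \<and> ?ok False (take s (take (2 * s) x)) \<and> ?ok True (drop s (take (2 * s) x))"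
    using b(2,4) by metis
  qed
  also have "\<dots> \<longleftrightarrow> A (?w @ [False]) \<and> A (?w @ [True])"
   using eqA[of "?w @ [False]"] eqA[of "?w @ [True]"] by (simp add: lw1 s_def)
  finally show ?thesis by simp
 qed
 have final: "A (w1 @ v) \<longleftrightarrow> \<not> sat (sL tk (length w1)) (stage tk w1) (deval (dec (length w1) v))" if v: "length v = N" for v
 proof -
  let ?w = "w1 @ v"
  define U where "U = replicate (2 ^ vx tk ?w) Lf"
  have d: "vdiag U tk ?w" using dg[OF U_def] v by simp
  then have n: "vcount U tk ?w = 0" by (simp add: vcount_def)
  have "vjobs U tk ?w b = jobs tk w1 (dec (length w1) v)" for b
   using d sD(2)[OF U_def, of "Suc K1"] by (simp add: vjobs_def start lw1[symmetric])
  then have "A ?w \<longleftrightarrow> (\<exists>j\<in>set (jobs tk w1 (dec (length w1) v)). nb (val j) = snd j)"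
   using run[of ?w U 0] d n U_def lw1 unfolding A_def by auto
  also have "\<dots> \<longleftrightarrow> \<not> sat (sL tk (length w1)) (stage tk w1) (deval (dec (length w1) v))"
   by (rule hit) (use v in \<open>simp_all add: lw1 N_def\<close>)
  finally show ?thesis .
 qed
 have "A (w1 @ v) \<longleftrightarrow> (\<forall>u. length u = j --> A (w1 @ v @ u))" if "length v + j = N" for v j
  using that
 proof (induction j arbitrary: v)
  case (Suc j)
  have "A (w1 @ v) \<longleftrightarrow> A (w1 @ v @ [False]) \<and> A (w1 @ v @ [True])" by (rule step) (use Suc.prems in simp)
  also have "\<dots> \<longleftrightarrow> (\<forall>c. A (w1 @ (v @ [c])))" by (auto simp: all_bool_eq)
  also have "\<dots> \<longleftrightarrow> (\<forall>c u. length u = j --> A (w1 @ (v @ [c]) @ u))" using Suc.IH[of "v @ [_]"] Suc.prems by simp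
  also have "\<dots> \<longleftrightarrow> (\<forall>u. length u = Suc j --> A (w1 @ v @ u))" by (auto simp: length_Suc_conv)
  finally show ?case .
 qed simp
 from this[of "[]" N] have "A w1 \<longleftrightarrow> (\<forall>u. length u = N --> A (w1 @ u))" by simp
 also have "\<dots> \<longleftrightarrow> \<not> (\<exists>u. length u = N \<and> sat (sL tk (length w1)) (stage tk w1) (deval (dec (length w1) u)))" using final by blast
 also have "\<dots> \<longleftrightarrow> \<not> A w1" using eqA[of w1] by (simp add: lw1 N_def)
 finally show False by blast
qed

end

theorem theorem1p17:
  assumes "\<exists>P c. c > 0 \<and>
    solves_MAX_SAT_in_time P (\<lambda>n m. 2 powr (real n - c * (real n / log 2 (real m))))"
  shows "\<forall>g. g \<in> o(\<lambda>n. sqrt (real n)) \<longrightarrow> E_NP_lacks_sym_and_circuits (\<lambda>n. 2 powr g n)"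
proof (intro allI impI, rule ccontr)
 fix g :: "nat => real"
 assume g: "g \<in> o(%n. sqrt (real n))" and neg: "\<not> E_NP_lacks_sym_and_circuits (%n. 2 powr g n)"
 obtain P c0 k0 where c0: "c0 > 0" and solver: "\<And>n F. cnf_on n F ==>
   \<exists>t. computes_in P {} (cnf_code n F) (max_sat F) t \<and>
    real t \<le> real (length (cnf_code n F) ^ k0 + k0) * 2 powr (real n - c0 * (real n / log 2 (real (length F))))"
  using assms unfolding solves_MAX_SAT_in_time_def by blast
 \<comment> \<open>With \<open>c\<close> at most 1 the exponent in the time bound is nonnegative, so
   \<open>R\<close> below is at least 1 and absorbs additive terms.\<close>
 define c where "c = min c0 1"
 have c: "0 < c" "c \<le> 1" "c \<le> c0" using c0 by (auto simp: c_def)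
 obtain V \<tau> where V: "noask V" "pbound \<tau>" and ver: "\<forall>tk w x B val U n J. U = replicate (2 ^ vx tk w) Lf --> n = vcount U tk w -->
   J = vjobs U tk w (take n x) --> n \<le> length x -->
   (\<forall>j\<in>set J. val j \<le> length (fst j) \<and> (\<exists>t\<le>B. computes_in P {} (fst j) (val j) t)) -->
   (\<exists>t i. t \<le> \<tau> (U, vx tk w, tk, w) * (B + 1) \<and>
    ev {} V (enc (tk, w), x, []) (enc ((\<exists>j\<in>set J. nb (val j) = snd j) = vdiag U tk w), i, []) t)"
  using verifier[of P] by (elim exE conjE)
 obtain a2 where a2: "\<And>e. \<tau> e \<le> (es e + 1) ^ a2" using V(2) unfolding pbound_def by blast
 have "poly (%s :: tree list \<times> bits \<times> bits \<times> bits. vjobs (fst s) (fst (snd (snd s))) (snd (snd (snd s))) (fst (snd s)))"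
  by (intro poly_intros)
 from poly_es[OF this] obtain kJ where kJ: "\<And>s :: tree list \<times> bits \<times> bits \<times> bits.
   es (vjobs (fst s) (fst (snd (snd s))) (snd (snd (snd s))) (fst (snd s))) \<le> (es s + 1) ^ kJ"
  unfolding pbound_def by blast
 define vc where "vc = (%e :: tree list \<times> nat \<times> bits \<times> bits. vcount (fst e) (fst (snd (snd e))) (snd (snd (snd e))))"
 have "poly vc" unfolding vc_def by (intro poly_intros)
 from poly_es[OF this] have pvc: "pbound vc" by (rule pbound_mono) simp
 have "pbound (%e. (4 * vc e + es e + 10) ^ kJ)" by (intro pbound_intros pbound_es pvc)
 then obtain a1 where a1: "\<And>e. (4 * vc e + es e + 10) ^ kJ \<le> (es e + 1) ^ a1" unfolding pbound_def by blast
 \<comment> \<open>\<open>Z ^ a\<close> bounds the running-time polynomial through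
   \<open>a2\<close>, and the size of the job list, hence the number of clauses of every instance,
   through \<open>a1\<close>.\<close>
 define a where "a = a1 + a2 + 1"
 \<comment> \<open>Leaves room for \<open>Z ^ a\<close> times the solver's factor
   \<open>(Z ^ a) ^ k0 + k0\<close>, for the loading time, and for summing these terms.\<close>
 define A where "A = a + a * k0 + k0 + 10"
 have "1 \<le> a" by (simp add: a_def)
 from growth[OF c(1) this, of A] obtain q where q: "q \<ge> 1" and gr: "\<And>T :: nat. \<exists>K0. \<forall>K\<ge>K0. \<forall>(Z :: nat) (x :: nat).
   real x \<le> sqrt (real (K + 1)) / real q --> 2 \<le> Z --> Z \<le> 2 ^ x * (20 * K + T) -->
   real Z ^ A * 2 powr (real (K + 1) * (1 - c / (real a * log 2 (real Z)))) < 2 ^ K" by blast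
 interpret stages V q by unfold_locales (rule V(1))
 obtain K0 where K0: "\<And>K Z x. K \<ge> K0 ==> real x \<le> sqrt (real (K + 1)) / real q ==> 2 \<le> Z ==>
   Z \<le> 2 ^ x * (20 * K + (4 * length tk + 20)) ==>
   real Z ^ A * 2 powr (real (K + 1) * (1 - c / (real a * log 2 (real Z)))) < 2 ^ K"
  using gr[of "4 * length tk + 20"] by blast
 have tkq: "tkq tk = q" by (simp add: tk_def)
 define a0 where "a0 = 3 * length tk + length (tke tk) + 40"
 have sL: "sL tk K = 8 * K + a0" for K by (simp add: sL_def sn_def a0_def)
 have "\<forall>\<^sub>\<infinity>n. has_sym_and_circuit (witlang tk) n (2 powr g n)"
  using neg witlang_E_NP[of tk] unfolding E_NP_lacks_sym_and_circuits_def by (auto simp: not_frequently)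
 then obtain N1 where N1: "\<And>n. n \<ge> N1 ==> has_sym_and_circuit (witlang tk) n (2 powr g n)" unfolding cofinite_eq_sequentially eventually_sequentially by blast
 \<comment> \<open>The relevant n will be at most \<open>16 * K\<close>, which makes
   \<open>g n\<close> at most half of sqrt K / q.\<close>
 have "eventually (%n. norm (g n) \<le> 1 / (8 * real q) * norm (sqrt (real n))) at_top"
  by (rule landau_o.smallD[OF g]) (use q in simp)
 then obtain N2 where N2: "\<And>n. n \<ge> N2 ==> norm (g n) \<le> 1 / (8 * real q) * norm (sqrt (real n))"
  unfolding eventually_sequentially by blast
 \<comment> \<open>The summand \<open>a0\<close> gives n = \<open>9 * K + a0\<close> at most
   \<open>16 * K\<close>. The summand \<open>4 * q * q\<close> makes sqrt K / q at least 2, so that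
   rounding down to \<open>sroot\<close> costs at most one half.\<close>
 define K1 where "K1 = K0 + N1 + N2 + a0 + 4 * q * q + 1"
 \<comment> \<open>Defined through the computation, since it takes a code as argument; determinism
   then gives the right value for every formula with that code.\<close>
 define val where "val = (%j :: bits \<times> bits. SOME v. \<exists>t. computes_in P {} (fst j) v t)"
 have val: "val j = max_sat F" if j: "fst j = cnf_code n F" "cnf_on n F" for j n F
 proof -
  obtain t where t: "computes_in P {} (fst j) (max_sat F) t" using solver[OF j(2)] j(1) by auto
  then have "\<exists>v t. computes_in P {} (fst j) v t" by blast
  then have "\<exists>t. computes_in P {} (fst j) (val j) t" unfolding val_def by (rule someI_ex)
  then show ?thesis using t exec_det unfolding computes_in_def by blast
 qed
 \<comment> \<open>The circuit for \<open>witlang tk\<close> at length \<open>n\<close>, with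
   \<open>w\<close> hard-wired, computes the table found by \<open>greedy\<close>.\<close>
 have circ: "\<exists>D. struct (2 ^ sroot q (length w)) (sL tk (length w)) D \<and> sat (sL tk (length w)) (stage tk w) (deval D)"
  if w: "length w \<ge> K1" and W: "\<exists>W. sat (sL tk (length w)) (stage tk w) W" for w
 proof -
  define K where "K = length w"
  define L where "L = sL tk K"
  define n where "n = K + L"
  have w1: "length w \<ge> 1" using w by (simp add: K1_def)
  have n: "n \<ge> N1" "n \<ge> N2" "n \<le> 16 * K" "L \<ge> 1" using w by (auto simp: n_def L_def sL K_def K1_def a0_def)
  obtain f Gs where C: "circuit_on n (SymAnd f Gs)" "real (circuit_size (SymAnd f Gs)) \<le> 2 powr g n"
   "\<forall>x. length x = n --> circuit_eval (SymAnd f Gs) x = (x \<in> witlang tk)"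
   using N1[OF n(1)] unfolding has_sym_and_circuit_def by (metis sym_and.exhaust)
  have "g n \<le> real (sroot q K)"
  proof -
   have "sqrt (real n) \<le> sqrt (16 * real K)" using n(3) by (intro real_sqrt_le_mono) linarith
   also have "\<dots> = 4 * sqrt (real K)" by (simp add: real_sqrt_mult)
   finally have s4: "sqrt (real n) \<le> 4 * sqrt (real K)" .
   have "g n \<le> 1 / (8 * real q) * sqrt (real n)" using N2[OF n(2)] by simp
   also have "\<dots> \<le> 1 / (8 * real q) * (4 * sqrt (real K))" using s4 by (intro mult_left_mono) auto
   also have "\<dots> = sqrt (real K) / real q / 2" by simp
   finally have g1: "g n \<le> sqrt (real K) / real q / 2" .
   have "(2 * real q)\<^sup>2 \<le> real K"
   proof -
    have "4 * q * q \<le> K" using w by (simp add: K1_def K_def)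
    then have "real (4 * q * q) \<le> real K" by (simp only: of_nat_le_iff)
    then show ?thesis by (simp add: power2_eq_square)
   qed
   then have "2 * real q \<le> sqrt (real K)" by (rule real_le_rsqrt)
   then have "2 \<le> sqrt (real K) / real q" using q by (simp add: field_simps)
   moreover define r where "r = sqrt (real K) / real q"
   ultimately show ?thesis using g1 sroot_bounds(2)[OF q, of K] unfolding r_def[symmetric] by linarith
  qed
  then have "2 powr g n \<le> 2 ^ sroot q K" by (simp add: powr_realpow[symmetric])
  moreover have "real (length Gs) + 1 \<le> 2 powr g n" using C(2) by simp
  ultimately have "real (length Gs) \<le> 2 ^ sroot q K" by linarith
  then have lG: "length Gs \<le> 2 ^ sroot q K" by (metis of_nat_le_iff of_nat_numeral of_nat_power)
  obtain D where D: "struct (2 ^ sroot q K) L D" "\<And>x. length x = L ==> deval D x = circuit_eval (SymAnd f Gs) (w @ x)"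
   using circuit_struct[of w L f Gs, OF _ n(4) lG] C(1) by (auto simp: n_def K_def)
  obtain W where W: "sat L (stage tk w) W" using W by (auto simp: L_def K_def)
  have fl: "length (fst l) = L" if "fam \<in> set (stage tk w)" "l \<in> set fam" for fam l
   using stage_families(2)[OF w1 that] by (simp add: L_def K_def)
  have "\<exists>v. wok tk w v"
  proof (rule sat_wok[OF W])
   show "L = sL tk (length w)" by (simp add: L_def K_def)
  qed (rule fl)
  then obtain v where "wok tk w v" by blast
  from greedy_wok[OF this] have s: "sat L (stage tk w) (lk (greedy tk w (2 ^ L)))" unfolding wok_iff by (simp add: L_def K_def)
  have dl: "deval D x = lk (greedy tk w (2 ^ L)) x" if x: "length x = L" for x
  proof -
   have "deval D x \<longleftrightarrow> w @ x \<in> witlang tk" using D(2)[OF x] C(3) x by (simp add: n_def K_def)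
   also have "\<dots> \<longleftrightarrow> lk (greedy tk w (2 ^ L)) x"
    using wsplit_append[of x tk w] x unfolding witlang_iff by (simp add: L_def K_def)
   finally show ?thesis .
  qed
  have "sat L (stage tk w) (deval D)" unfolding sat_def fam_ok_def
  proof (intro ballI)
   fix fam y assume f: "fam \<in> set (stage tk w)" and y: "y \<in> rows L"
   then obtain l where l: "l \<in> set fam" "lk (greedy tk w (2 ^ L)) (inst (fst l) y) = snd l" using s unfolding sat_def fam_ok_def by blast
   have "length (inst (fst l) y) = L" using fl[OF f l(1)] y length_inst[of "fst l" y] by (simp add: rows_def)
   then show "\<exists>l\<in>set fam. deval D (inst (fst l) y) = snd l" using dl l by auto
  qed
  then show ?thesis using D(1) unfolding L_def K_def by blast
 qed
 have run: "(\<exists>W. sat (sL tk (length w)) (stage tk w) W) \<longleftrightarrow>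
   (\<exists>x. length x \<ge> n \<and> ((\<exists>j\<in>set (vjobs U tk w (take n x)). nb (val j) = snd j) = vdiag U tk w))"
  if w: "length w \<ge> K1" and U: "U = replicate (2 ^ vx tk w) Lf" and n: "n = vcount U tk w" for w U n
 proof -
  define K where "K = length w"
  define x0 where "x0 = vx tk w"
  define e where "e = (U, x0, tk, w)"
  \<comment> \<open>Size of the data available to the verifier, dominated by the list
    \<open>U\<close>; up to factors linear in K it is the number of gates.\<close>
  define Z where "Z = es e + 1"
  \<comment> \<open>The exponential part of a call with at most \<open>K + 1\<close> variables and
    at most \<open>Z ^ a\<close> clauses.\<close>
  define R where "R = 2 powr (real (K + 1) * (1 - c / (real a * log 2 (real Z))))"
  define B where "B = nat \<lfloor>real ((Z ^ a) ^ k0 + k0) * R\<rfloor>"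
  have eU: "es (replicate m Lf) = 2 * m + 1" for m by (induction m) (auto simp: es_def)
  have Z2: "2 \<le> Z" using es_pos[of e] by (simp add: Z_def)
  have l1: "1 \<le> log 2 (real Z)" using Z2 by (simp add: le_log_iff)
  have al: "1 \<le> real a * log 2 (real Z)"
   using mult_mono[of 1 "real a" 1 "log 2 (real Z)"] l1 \<open>1 \<le> a\<close> by simp
  have ex0: "0 \<le> 1 - c / (real a * log 2 (real Z))" using c al by (simp add: field_simps)
  have R1: "1 \<le> R" unfolding R_def using ex0 by (intro ge_one_powr_ge_zero) auto
  have Zb: "Z \<le> 2 ^ x0 * (20 * K + (4 * length tk + 20))"
  proof -
   have x2: "x0 \<le> 2 ^ x0" by (simp add: less_imp_le)
   have "Z = 2 * 2 ^ x0 + 2 * x0 + es tk + es w + 6"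
    by (simp add: Z_def e_def U eU x0_def[symmetric])
   then have "Z \<le> 2 * 2 ^ x0 + 2 * 2 ^ x0 + (4 * length tk + 4 * K + 10)"
    using x2 es_bits[of tk] es_bits[of w] unfolding K_def by linarith
   also have "\<dots> \<le> 2 * 2 ^ x0 + 2 * 2 ^ x0 + 2 ^ x0 * (4 * length tk + 4 * K + 10)" by simp
   also have "\<dots> = 2 ^ x0 * (4 * length tk + 4 * K + 14)" by (simp add: distrib_left)
   also have "\<dots> \<le> 2 ^ x0 * (20 * K + (4 * length tk + 20))" by (intro mult_le_mono2) simp
   finally show ?thesis .
  qed
  have xb: "real x0 \<le> sqrt (real (K + 1)) / real q"
   using sroot_bounds(1)[OF q, of "Suc (length w)"] by (simp add: x0_def vx_def tkq K_def)
  have grow: "real Z ^ A * R < 2 ^ K" unfolding R_def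
   by (rule K0[OF _ xb Z2 Zb]) (use w in \<open>simp add: K1_def K_def\<close>)
  have ae: "\<tau> e \<le> Z ^ a"
   using a2[of e] power_increasing[of a2 a Z] Z2 by (simp add: Z_def a_def)
  have halts: "\<exists>t y i q. ev {} V (enc (tk, w), x, []) (y, i, q) t \<and>
    (y \<noteq> Lf \<longleftrightarrow> ((\<exists>j\<in>set (vjobs U tk w (take n x)). nb (val j) = snd j) = vdiag U tk w)) \<and>
    3 * length tk + 3 * length w + t + 10 < 2 ^ K" if x: "length x \<ge> n" for x
  proof -
   define J where "J = vjobs U tk w (take n x)"
   have eJ: "es J \<le> Z ^ a"
   proof -
    have "es (take n x) \<le> 4 * n + 1" using es_bits[of "take n x"] x by simp
    then have "es (U, take n x, tk, w) + 1 \<le> 4 * vc e + es e + 10" by (simp add: vc_def e_def n)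
    then have "(es (U, take n x, tk, w) + 1) ^ kJ \<le> (4 * vc e + es e + 10) ^ kJ" by (intro power_mono) auto
    moreover have "es J \<le> (es (U, take n x, tk, w) + 1) ^ kJ" using kJ[of "(U, take n x, tk, w)"] by (simp add: J_def)
    moreover have "(es e + 1) ^ a1 \<le> Z ^ a" unfolding Z_def by (rule power_increasing) (auto simp: a_def)
    ultimately show ?thesis using a1[of e] by linarith
   qed
   have jb: "val j \<le> length (fst j) \<and> (\<exists>t\<le>B. computes_in P {} (fst j) (val j) t)" if j: "j \<in> set J" for j
   proof -
    have "length (take n x) = vcount U tk w" using x n by simp
    from vjobs_cnf[OF this] j obtain m F where F: "fst j = cnf_code m F" "cnf_on m F" "2 \<le> length F" "m \<le> K + 1"
     unfolding J_def K_def by (metis Suc_eq_plus1)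
    have v: "val j = max_sat F" by (rule val[OF F(1,2)])
    have cl: "length (fst j) \<le> Z ^ a"
    proof -
     have "length (fst j) \<le> es j" using length_le_es[of "fst j"] by (cases j) simp
     then show ?thesis using es_mem[OF j] eJ by linarith
    qed
    have Fl: "length F \<le> Z ^ a" using length_cnf_code[of F m] cl F(1) by simp
    obtain t where t: "computes_in P {} (fst j) (val j) t"
     "real t \<le> real (length (fst j) ^ k0 + k0) * 2 powr (real m - c0 * (real m / log 2 (real (length F))))"
     using solver[OF F(2)] unfolding v F(1) by blast
    have F2: "2 \<le> real (length F)" using F(3) by linarith
    then have "log 2 2 \<le> log 2 (real (length F))" by (intro log_mono) auto
    then have lF: "1 \<le> log 2 (real (length F))" by simp
    have "real (length F) \<le> real Z ^ a" using Fl by (metis of_nat_le_iff of_nat_power)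
    then have "log 2 (real (length F)) \<le> log 2 (real Z ^ a)" using F2 by (intro log_mono) auto
    then have lZ: "log 2 (real (length F)) \<le> real a * log 2 (real Z)" using Z2 by (simp add: log_nat_power)
    have "c / (real a * log 2 (real Z)) \<le> c0 / log 2 (real (length F))"
     using c lZ lF by (intro frac_le) auto
    then have "real m * (1 - c0 / log 2 (real (length F))) \<le> real m * (1 - c / (real a * log 2 (real Z)))"
     by (intro mult_left_mono) auto
    also have "\<dots> \<le> real (K + 1) * (1 - c / (real a * log 2 (real Z)))"
     using F(4) ex0 by (intro mult_right_mono) auto
    finally have "real m - c0 * (real m / log 2 (real (length F))) \<le> real (K + 1) * (1 - c / (real a * log 2 (real Z)))"
     by (simp add: algebra_simps)
    then have p: "2 powr (real m - c0 * (real m / log 2 (real (length F)))) \<le> R" unfolding R_def by simp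
    have "length (fst j) ^ k0 + k0 \<le> (Z ^ a) ^ k0 + k0" using cl by (simp add: power_mono)
    then have "real (length (fst j) ^ k0 + k0) \<le> real ((Z ^ a) ^ k0 + k0)" by (simp only: of_nat_le_iff)
    then have "real (length (fst j) ^ k0 + k0) * 2 powr (real m - c0 * (real m / log 2 (real (length F)))) \<le> real ((Z ^ a) ^ k0 + k0) * R"
     using p by (intro mult_mono) auto
    then have "real t \<le> real ((Z ^ a) ^ k0 + k0) * R" using t(2) by linarith
    then have "t \<le> B" unfolding B_def by (simp add: le_nat_floor)
    moreover have "val j \<le> length (fst j)" using max_sat_le[of F] length_cnf_code[of F m] v F(1) by simp
    ultimately show ?thesis using t(1) by blast
   qed
   obtain t i where t: "t \<le> \<tau> e * (B + 1)"
    "ev {} V (enc (tk, w), x, []) (enc ((\<exists>j\<in>set J. nb (val j) = snd j) = vdiag U tk w), i, []) t"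
    using ver[THEN spec, THEN spec, THEN spec, THEN spec, THEN spec, THEN spec, THEN spec, THEN spec,
      THEN mp, THEN mp, THEN mp, THEN mp, THEN mp, of U tk w n J x val B] U n J_def x jb
    unfolding e_def x0_def by blast
   have "real (3 * length tk + 3 * length w + t + 10) < 2 ^ K"
   proof -
    have tz: "t \<le> Z ^ a * (B + 1)" using t(1) ae mult_le_mono1[OF ae, of "B + 1"] by linarith
    have Bb: "real B \<le> real ((Z ^ a) ^ k0 + k0) * R" unfolding B_def using R1 by simp
    have s1: "3 * length tk + 3 * length w + 10 \<le> Z ^ 5"
    proof -
     have "3 * length tk + 3 * length w + 10 \<le> 13 * Z" using length_le_es[of tk] length_le_es[of w] by (simp add: Z_def e_def)
     also have "\<dots> \<le> 2 ^ 4 * Z" by simp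
     also have "\<dots> \<le> Z ^ 4 * Z" using Z2 by (intro mult_le_mono1 power_mono) auto
     finally show ?thesis by (simp add: eval_nat_numeral)
    qed
    have s2: "Z ^ 5 + Z ^ a * ((Z ^ a) ^ k0 + k0 + 1) \<le> Z ^ A"
    proof -
     have two: "2 * Z ^ i \<le> Z ^ (i + 1)" for i using mult_le_mono1[OF Z2, of "Z ^ i"] by simp
     have inc: "Z ^ i \<le> Z ^ j" if "i \<le> j" for i j using that Z2 by (intro power_increasing) auto
     have "k0 + 1 \<le> 2 ^ (k0 + 1)" by (rule less_imp_le[OF less_exp])
     also have "\<dots> \<le> Z ^ (k0 + 1)" using Z2 by (intro power_mono) auto
     also have "\<dots> \<le> Z ^ (a * k0 + k0 + 1)" by (rule inc) simp
     finally have 1: "k0 + 1 \<le> Z ^ (a * k0 + k0 + 1)" .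
     have "(Z ^ a) ^ k0 \<le> Z ^ (a * k0 + k0 + 1)" unfolding power_mult[symmetric] by (rule inc) simp
     then have "(Z ^ a) ^ k0 + k0 + 1 \<le> 2 * Z ^ (a * k0 + k0 + 1)" using 1 by linarith
     also have "\<dots> \<le> Z ^ (a * k0 + k0 + 2)" using two[of "a * k0 + k0 + 1"] by simp
     finally have "Z ^ a * ((Z ^ a) ^ k0 + k0 + 1) \<le> Z ^ a * Z ^ (a * k0 + k0 + 2)" by (rule mult_le_mono2)
     also have "\<dots> = Z ^ (a + (a * k0 + k0 + 2))" by (simp only: power_add)
     also have "\<dots> \<le> Z ^ (a + a * k0 + k0 + 9)" by (rule inc) simp
     finally have 2: "Z ^ a * ((Z ^ a) ^ k0 + k0 + 1) \<le> Z ^ (a + a * k0 + k0 + 9)" .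
     have "Z ^ 5 \<le> Z ^ (a + a * k0 + k0 + 9)" by (rule inc) simp
     then have "Z ^ 5 + Z ^ a * ((Z ^ a) ^ k0 + k0 + 1) \<le> 2 * Z ^ (a + a * k0 + k0 + 9)" using 2 by linarith
     also have "\<dots> \<le> Z ^ (a + a * k0 + k0 + 9 + 1)" by (rule two)
     also have "a + a * k0 + k0 + 9 + 1 = A" by (simp add: A_def)
     finally show ?thesis .
    qed
    have "real t \<le> real (Z ^ a) * (real B + 1)" using tz by (metis of_nat_1 of_nat_add of_nat_le_iff of_nat_mult)
    also have "\<dots> \<le> real (Z ^ a) * (real ((Z ^ a) ^ k0 + k0) * R + R)" using Bb R1 by (intro mult_left_mono) auto
    also have "\<dots> = real (Z ^ a * ((Z ^ a) ^ k0 + k0 + 1)) * R" by (simp add: algebra_simps)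
    finally have t': "real t \<le> real (Z ^ a * ((Z ^ a) ^ k0 + k0 + 1)) * R" .
    have "real (3 * length tk + 3 * length w + 10) \<le> real (Z ^ 5)" using s1 by (simp only: of_nat_le_iff)
    also have "\<dots> \<le> real (Z ^ 5) * R" using mult_left_mono[OF R1, of "real (Z ^ 5)"] by simp
    finally have "real (3 * length tk + 3 * length w + 10) \<le> real (Z ^ 5) * R" .
    then have "real (3 * length tk + 3 * length w + 10) + real t \<le> real (Z ^ 5 + Z ^ a * ((Z ^ a) ^ k0 + k0 + 1)) * R"
     using t' unfolding of_nat_add[of "Z ^ 5"] distrib_right by linarith
    also have "\<dots> \<le> real (Z ^ A) * R"
    proof (rule mult_right_mono)
     show "real (Z ^ 5 + Z ^ a * ((Z ^ a) ^ k0 + k0 + 1)) \<le> real (Z ^ A)" using s2 by (simp only: of_nat_le_iff)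
     show "0 \<le> R" using R1 by simp
    qed
    also have "\<dots> < 2 ^ K" using grow by simp
    finally show ?thesis by simp
   qed
   also have "2 ^ K = real (2 ^ K)" by simp
   finally have lt: "3 * length tk + 3 * length w + t + 10 < 2 ^ K" by (simp only: of_nat_less_iff)
   have eb: "enc b \<noteq> Lf \<longleftrightarrow> b" for b :: bool by simp
   show ?thesis by (intro exI) (rule conjI[OF t(2)[unfolded J_def] conjI[OF eb lt]])
  qed
  have st: "stage tk w = stage_csp K (sn tk K) (map icode_of (fcode 0 V)) tk w"
   unfolding stage_def K_def by (simp add: tk_def)
  have "K \<ge> 1" using w by (simp add: K1_def K_def)
  moreover have "4 * K + 3 * length tk + 3 * length w + flen V + 40 \<le> sn tk K" by (simp add: sn_def K_def tk_def)
  ultimately have "(\<exists>W. sat (K + sn tk K) (stage_csp K (sn tk K) (map icode_of (fcode 0 V)) tk w) W) \<longleftrightarrow>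
    (\<exists>x. length x \<ge> n \<and> ((\<exists>j\<in>set (vjobs U tk w (take n x)). nb (val j) = snd j) = vdiag U tk w))"
   by (rule stage_csp_correct[OF V(1)]) (rule halts)
  then show ?thesis unfolding st[symmetric] by (simp add: sL_def K_def)
 qed
 show False by (rule diagonal[OF circ run val])
qed

end
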